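(* Let $W$ be a finite irreducible Coxeter group of coincidental type, with a fixed Coxeter element $c$ and Coxeter number $h$. Then (1) $\mathsf{Pop}_T^{h-1}(w)=e$ for all $w\in W$; (2) $\max_{w\in W}|O_{\mathsf{Pop}_T}(w)|=h$; and (3) the only forward orbit of $\mathsf{Pop}_T$ of size $h$ is $O_{\mathsf{Pop}_T}(c^{-1})$. Here $\mathsf{Pop}_T=\mathsf{Pop}_T(\cdot,c)$.
   Context: A finite irreducible Coxeter group is coincidental if it is of type $A_n$, type $B_n$, type $H_3$, or dihedral type $I_2(m)$. $W$ has set of simple reflections $S$, set of reflections $T=\{wsw^{-1}: s\in S,\ w\in W\}$, and Coxeter number $h$ (its largest fundamental degree). $\ell_T(w)$ is the minimum number of reflections whose product is $w$; the absolute order is $v\le_T w$ iff $\ell_T(wv^{-1})=\ell_T(w)-\ell_T(v)$. A Coxeter element is a regular element of $W$ (one with an eigenvector lying on no reflecting hyperplane) of order $h$. $\mathrm{NC}(W,c)$ is the interval $[e,c]$ in absolute order, a lattice with join $\bigvee$. The noncrossing projection is $\pi_T(w,c)=\bigvee_{t\in T,\ t\le_T w} t$ (join in $\mathrm{NC}(W,c)$, empty join $=e$), and $\mathsf{Pop}_T(w,c)=w\,\pi_T(w,c)^{-1}$. The forward orbit of $x$ under $f$ is $O_f(x)=\{x,f(x),f^2(x),\ldots\}$; its size is its cardinality. *)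

theory Defs
  imports "HOL-Analysis.Analysis" "HOL-Algebra.Algebra"
begin

section \<open>Coxeter systems\<close>

text \<open>The rank is the cardinality of the finite index type \<open>'n\<close>;
  the entry \<open>0\<close> of a Coxeter matrix stands for \<open>\<infinity>\<close>.\<close>

definition coxeter_matrix :: "('n::finite \<Rightarrow> 'n \<Rightarrow> nat) \<Rightarrow> bool" where
  "coxeter_matrix m \<longleftrightarrow>
     (\<forall>i. m i i = 1) \<and> (\<forall>i j. m i j = m j i) \<and> (\<forall>i j. i \<noteq> j \<longrightarrow> m i j \<noteq> 1)"

text \<open>The congruence on words generated by the relators \<open>(i j)^(m i j)\<close>. Inverse letters
  are not needed, since \<open>m i i = 1\<close> makes each letter its own inverse; an entry
  \<open>m i j = 0\<close> contributes the empty relator.\<close>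

inductive coxeter_equiv :: "('n::finite \<Rightarrow> 'n \<Rightarrow> nat) \<Rightarrow> 'n list \<Rightarrow> 'n list \<Rightarrow> bool"
  for m where
  relator: "coxeter_equiv m (u @ concat (replicate (m i j) [i, j]) @ v) (u @ v)"
| refl: "coxeter_equiv m u u"
| sym: "coxeter_equiv m u v \<Longrightarrow> coxeter_equiv m v u"
| trans: "coxeter_equiv m u v \<Longrightarrow> coxeter_equiv m v w \<Longrightarrow> coxeter_equiv m u w"

definition list_mult :: "('g, 'b) monoid_scheme \<Rightarrow> 'g list \<Rightarrow> 'g" where
  "list_mult W xs = foldr (\<lambda>x y. x \<otimes>\<^bsub>W\<^esub> y) xs \<one>\<^bsub>W\<^esub>"

text \<open>The pair \<open>(W, S)\<close> with \<open>S = range s\<close> is a Coxeter system with Coxeter matrix \<open>m\<close>: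
  \<open>W\<close> is presented by the generators \<open>s i\<close> and the relations \<open>(s i s j)^(m i j) = e\<close>.\<close>

definition coxeter_system ::
  "('g, 'b) monoid_scheme \<Rightarrow> ('n::finite \<Rightarrow> 'g) \<Rightarrow> ('n \<Rightarrow> 'n \<Rightarrow> nat) \<Rightarrow> bool" where
  "coxeter_system W s m \<longleftrightarrow>
     group W \<and> coxeter_matrix m \<and> range s \<subseteq> carrier W \<and>
     generate W (range s) = carrier W \<and>
     (\<forall>u v. list_mult W (map s u) = list_mult W (map s v) \<longleftrightarrow> coxeter_equiv m u v)"

definition irreducible_coxeter_matrix :: "('n::finite \<Rightarrow> 'n \<Rightarrow> nat) \<Rightarrow> bool" where
  "irreducible_coxeter_matrix m \<longleftrightarrow>
     \<not> (\<exists>J. J \<noteq> {} \<and> J \<noteq> UNIV \<and> (\<forall>i\<in>J. \<forall>j\<in>-J. m i j = 2))"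

text \<open>The Coxeter diagram is a path \<open>0 - 1 - \<dots> - (n - 1)\<close> whose first edge has label \<open>k\<close>
  and whose other edges have label 3.\<close>

definition linear_type :: "nat \<Rightarrow> ('n::finite \<Rightarrow> 'n \<Rightarrow> nat) \<Rightarrow> bool" where
  "linear_type k m \<longleftrightarrow>
     (\<exists>f. bij_betw f UNIV {0..<CARD('n)} \<and>
        (\<forall>i j. m i j =
           (if f i = f j then 1
            else if {f i, f j} = {0, 1} then k
            else if f i = Suc (f j) \<or> f j = Suc (f i) then 3
            else 2)))"

definition type_A :: "('n::finite \<Rightarrow> 'n \<Rightarrow> nat) \<Rightarrow> bool" where
  "type_A m \<longleftrightarrow> linear_type 3 m"

definition type_B :: "('n::finite \<Rightarrow> 'n \<Rightarrow> nat) \<Rightarrow> bool" where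
  "type_B m \<longleftrightarrow> CARD('n) \<ge> 2 \<and> linear_type 4 m"

definition type_H3 :: "('n::finite \<Rightarrow> 'n \<Rightarrow> nat) \<Rightarrow> bool" where
  "type_H3 m \<longleftrightarrow> CARD('n) = 3 \<and> linear_type 5 m"

definition type_I2 :: "nat \<Rightarrow> ('n::finite \<Rightarrow> 'n \<Rightarrow> nat) \<Rightarrow> bool" where
  "type_I2 k m \<longleftrightarrow> CARD('n) = 2 \<and> linear_type k m"

definition coincidental_type :: "('n::finite \<Rightarrow> 'n \<Rightarrow> nat) \<Rightarrow> bool" where
  "coincidental_type m \<longleftrightarrow>
     type_A m \<or> type_B m \<or> type_H3 m \<or> (\<exists>k\<ge>3. type_I2 k m)"


section \<open>The geometric representation\<close>

text \<open>With \<open>B(e\<^sub>i, e\<^sub>j) = - cos (\<pi> / m i j)\<close>, the generator \<open>s i\<close> acts on \<open>\<real>\<^sup>n\<close> by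
  \<open>v \<mapsto> v - 2 B(e\<^sub>i, v) e\<^sub>i\<close>. Since \<open>pi / 0 = 0\<close>, the value for \<open>m i j = \<infinity>\<close> is
  the usual \<open>-1\<close>.\<close>

definition simple_refl_matrix :: "('n::finite \<Rightarrow> 'n \<Rightarrow> nat) \<Rightarrow> 'n \<Rightarrow> real^'n^'n" where
  "simple_refl_matrix m i =
     (\<chi> k l. (if k = l then 1 else 0) - (if k = i then 2 * (- cos (pi / real (m i l))) else 0))"

definition geom_rep ::
  "('g, 'b) monoid_scheme \<Rightarrow> ('n::finite \<Rightarrow> 'g) \<Rightarrow> ('n \<Rightarrow> 'n \<Rightarrow> nat) \<Rightarrow> 'g \<Rightarrow> real^'n^'n" where
  "geom_rep W s m w =
     (THE A. \<exists>u. list_mult W (map s u) = w \<and>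
                 A = foldr (**) (map (simple_refl_matrix m) u) (mat 1))"

definition complex_action ::
  "('g, 'b) monoid_scheme \<Rightarrow> ('n::finite \<Rightarrow> 'g) \<Rightarrow> ('n \<Rightarrow> 'n \<Rightarrow> nat) \<Rightarrow> 'g
     \<Rightarrow> complex^'n \<Rightarrow> complex^'n" where
  "complex_action W s m w z = map_matrix complex_of_real (geom_rep W s m w) *v z"


section \<open>Fundamental degrees and the Coxeter number\<close>

text \<open>As \<open>\<real>\<close> is infinite, polynomials on \<open>\<real>\<^sup>n\<close> are identified with polynomial functions.\<close>

definition invariant_polynomial ::
  "('g, 'b) monoid_scheme \<Rightarrow> ('n::finite \<Rightarrow> 'g) \<Rightarrow> ('n \<Rightarrow> 'n \<Rightarrow> nat) \<Rightarrow> (real^'n \<Rightarrow> real) \<Rightarrow> bool"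
  where
  "invariant_polynomial W s m p \<longleftrightarrow>
     real_polynomial_function p \<and> (\<forall>w\<in>carrier W. \<forall>x. p (geom_rep W s m w *v x) = p x)"

text \<open>The degrees of \<open>n\<close> algebraically independent homogeneous generators of the algebra of
  invariant polynomials. By Chevalley's theorem such generators exist for finite \<open>W\<close>; their
  degrees do not depend on the choice, up to order.\<close>

definition fundamental_degrees ::
  "('g, 'b) monoid_scheme \<Rightarrow> ('n::finite \<Rightarrow> 'g) \<Rightarrow> ('n \<Rightarrow> 'n \<Rightarrow> nat) \<Rightarrow> ('n \<Rightarrow> nat) \<Rightarrow> bool" where
  "fundamental_degrees W s m d \<longleftrightarrow>
     (\<exists>p :: 'n \<Rightarrow> real^'n \<Rightarrow> real.
        (\<forall>i. invariant_polynomial W s m (p i)) \<and>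
        (\<forall>i a x. p i (a *\<^sub>R x) = a ^ d i * p i x) \<and>
        (\<forall>q. invariant_polynomial W s m q \<longrightarrow>
           (\<exists>P :: real^'n \<Rightarrow> real. real_polynomial_function P \<and> (\<forall>x. q x = P (\<chi> i. p i x)))) \<and>
        (\<forall>P :: real^'n \<Rightarrow> real. real_polynomial_function P \<and> (\<forall>x. P (\<chi> i. p i x) = 0)
           \<longrightarrow> (\<forall>y. P y = 0)))"

definition is_coxeter_number ::
  "('g, 'b) monoid_scheme \<Rightarrow> ('n::finite \<Rightarrow> 'g) \<Rightarrow> ('n \<Rightarrow> 'n \<Rightarrow> nat) \<Rightarrow> nat \<Rightarrow> bool" where
  "is_coxeter_number W s m h \<longleftrightarrow> (\<exists>d. fundamental_degrees W s m d \<and> h = Max (range d))"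


section \<open>Reflections, absolute order and noncrossing partitions\<close>

definition reflections :: "('g, 'b) monoid_scheme \<Rightarrow> ('n::finite \<Rightarrow> 'g) \<Rightarrow> 'g set" where
  "reflections W s = {w \<otimes>\<^bsub>W\<^esub> s i \<otimes>\<^bsub>W\<^esub> inv\<^bsub>W\<^esub> w | w i. w \<in> carrier W}"

definition abs_length :: "('g, 'b) monoid_scheme \<Rightarrow> ('n::finite \<Rightarrow> 'g) \<Rightarrow> 'g \<Rightarrow> nat" where
  "abs_length W s w =
     (LEAST k. \<exists>ts. length ts = k \<and> set ts \<subseteq> reflections W s \<and> list_mult W ts = w)"

definition abs_le :: "('g, 'b) monoid_scheme \<Rightarrow> ('n::finite \<Rightarrow> 'g) \<Rightarrow> 'g \<Rightarrow> 'g \<Rightarrow> bool" where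
  "abs_le W s v w \<longleftrightarrow>
     int (abs_length W s (w \<otimes>\<^bsub>W\<^esub> inv\<^bsub>W\<^esub> v)) = int (abs_length W s w) - int (abs_length W s v)"

definition NC :: "('g, 'b) monoid_scheme \<Rightarrow> ('n::finite \<Rightarrow> 'g) \<Rightarrow> 'g \<Rightarrow> 'g gorder" where
  "NC W s c =
     \<lparr>carrier = {u \<in> carrier W. abs_le W s \<one>\<^bsub>W\<^esub> u \<and> abs_le W s u c}, eq = (=), le = abs_le W s\<rparr>"

text \<open>The reflecting hyperplane of a reflection \<open>t\<close> in the complexified representation is the
  fixed space of \<open>t\<close>.\<close>

definition regular_element ::
  "('g, 'b) monoid_scheme \<Rightarrow> ('n::finite \<Rightarrow> 'g) \<Rightarrow> ('n \<Rightarrow> 'n \<Rightarrow> nat) \<Rightarrow> 'g \<Rightarrow> bool" where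
  "regular_element W s m w \<longleftrightarrow> w \<in> carrier W \<and>
     (\<exists>\<zeta> z. z \<noteq> 0 \<and> complex_action W s m w z = \<zeta> *s z \<and>
            (\<forall>t\<in>reflections W s. complex_action W s m t z \<noteq> z))"

definition coxeter_element ::
  "('g, 'b) monoid_scheme \<Rightarrow> ('n::finite \<Rightarrow> 'g) \<Rightarrow> ('n \<Rightarrow> 'n \<Rightarrow> nat) \<Rightarrow> nat \<Rightarrow> 'g \<Rightarrow> bool" where
  "coxeter_element W s m h c \<longleftrightarrow>
     regular_element W s m c \<and> group.ord W c = h"


section \<open>The operator Pop\<close>

definition nc_proj :: "('g, 'b) monoid_scheme \<Rightarrow> ('n::finite \<Rightarrow> 'g) \<Rightarrow> 'g \<Rightarrow> 'g \<Rightarrow> 'g" where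
  "nc_proj W s c w = \<Squnion>\<^bsub>NC W s c\<^esub> {t \<in> reflections W s. abs_le W s t w}"

definition Pop :: "('g, 'b) monoid_scheme \<Rightarrow> ('n::finite \<Rightarrow> 'g) \<Rightarrow> 'g \<Rightarrow> 'g \<Rightarrow> 'g" where
  "Pop W s c w = w \<otimes>\<^bsub>W\<^esub> inv\<^bsub>W\<^esub> (nc_proj W s c w)"

definition forward_orbit :: "('a \<Rightarrow> 'a) \<Rightarrow> 'a \<Rightarrow> 'a set" where
  "forward_orbit f x = {(f ^^ k) x | k. True}"

end

theory Submission
  imports Defs "HOL-Combinatorics.Orbits" "HOL-Library.Real_Mod"
begin

text \<open>A homogeneous invariant of degree less than \<open>K\<close>, restricted to a suitable ellipse in a Coxeter
  plane, is a trigonometric polynomial of degree less than \<open>K\<close> that is invariant under rotation by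
  \<open>2 \<pi> / K\<close>, hence constant. If all fundamental degrees were less than \<open>K\<close>, the ellipse would
  therefore lie in a single orbit, which is finite. This bounds \<open>h\<close> from below.

  In types \<open>A\<close> and \<open>B\<close> the group acts faithfully on \<open>N\<close> points with \<open>N \<le> h\<close>, in type \<open>B\<close> by the
  permutations that commute with a fixed point free involution. A regular eigenvector of \<open>c\<close> takes
  pairwise different values at these points, so \<open>c\<close> permutes them in one cycle, \<open>N = h\<close>, and one
  may take \<open>c x = x + 1\<close> modulo \<open>N\<close>. Then \<open>[e, c]\<close> consists of the permutations with increasing,
  pairwise noncrossing cycles, and the noncrossing projection of \<open>w\<close> has as cycles the classes of the
  noncrossing closure of the cycle partition of \<open>w\<close>. The permutation \<open>Pop w\<close> takes the value \<open>w x\<close> at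
  the successor of \<open>x\<close> in its class. This successor lies on the way from \<open>x\<close> to \<open>w x\<close>, so the cyclic
  distance from a point to its image shrinks in every step; it is less than \<open>N\<close> at the
  start, and a point that needs \<open>N - 1\<close> steps forces \<open>w\<close> to be the inverse of \<open>c\<close>.

  In the dihedral groups \<open>Pop\<close> multiplies nontrivial rotations by the inverse of \<open>c\<close> and kills
  reflections. Type \<open>H\<^sub>3\<close> is a computation in \<open>A\<^sub>5 \<times> \<int>/2\<close>.\<close>

section \<open>Permutations with increasing noncrossing cycles\<close>

text \<open>One count underlies the noncrossing picture. The maximum of a cycle is a weak descent,
  so a permutation has at least as many weak descents as cycles, with equality exactly if its cycles
  increase. The weak descents of \<open>u\<close> and of \<open>shift N \<circ> pinv u\<close> add
  up to \<open>N + 1\<close>; hence the cycle numbers add up to at most that, and in type A equality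
  is what lying below \<open>c\<close> means. In type B the absolute length counts pairs of
  antipodal cycles and ignores self-antipodal ones, so lying below \<open>c\<close> yields equality
  only once some self-antipodal cycle is known to occur in one of the two factors. This is where a
  sign argument enters. A Coxeter element is here any regular element of order \<open>h\<close>, and
  such elements can form several conjugacy classes, as the generators of the rotation group of
  \<open>I_2(m)\<close> do. No standard \<open>c\<close> can be fixed beforehand, so each model is
  adjusted to the given one. The lower bound for \<open>h\<close> that comes from the degrees is met
  by an upper bound for the order of \<open>c\<close>, read off a faithful model.\<close>

abbreviation pinv :: "('a \<Rightarrow> 'a) \<Rightarrow> 'a \<Rightarrow> 'a" where "pinv f \<equiv> inv_into UNIV f"

lemma orbit_subset_closed:
  assumes "x \<in> S" "\<And>z. z \<in> S \<Longrightarrow> f z \<in> S"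
  shows "orbit f x \<subseteq> S"
proof
  fix y assume "y \<in> orbit f x"
  then show "y \<in> S" by induction (use assms in auto)
qed

section \<open>Cycles, their maxima and weak descents\<close>

definition cycle_tops :: "nat \<Rightarrow> (nat \<Rightarrow> nat) \<Rightarrow> nat set" where
  "cycle_tops N u = {x. x < N \<and> (\<forall>y\<in>orbit u x. y \<le> x)}"

definition cyc :: "nat \<Rightarrow> (nat \<Rightarrow> nat) \<Rightarrow> nat" where
  "cyc N u = card (cycle_tops N u)"

definition weak_desc :: "nat \<Rightarrow> (nat \<Rightarrow> nat) \<Rightarrow> nat set" where
  "weak_desc N u = {x. x < N \<and> u x \<le> x}"

text \<open>A cycle without a weak descent besides its maximum runs upwards once and then drops to
  its minimum.\<close>

definition increasing_cycles :: "nat \<Rightarrow> (nat \<Rightarrow> nat) \<Rightarrow> bool" where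
  "increasing_cycles N u \<longleftrightarrow> weak_desc N u \<subseteq> cycle_tops N u"

definition noncrossing :: "nat \<Rightarrow> (nat \<Rightarrow> nat \<Rightarrow> bool) \<Rightarrow> bool" where
  "noncrossing N R \<longleftrightarrow>
     (\<forall>a b c d. a < b \<and> b < c \<and> c < d \<and> d < N \<and> R a c \<and> R b d \<longrightarrow> R a b)"

definition same_cycle :: "(nat \<Rightarrow> nat) \<Rightarrow> nat \<Rightarrow> nat \<Rightarrow> bool" where
  "same_cycle u x y \<longleftrightarrow> y \<in> orbit u x"

lemma cycle_tops_subset: "cycle_tops N u \<subseteq> weak_desc N u"
  by (auto simp: cycle_tops_def weak_desc_def orbit.base)

lemma finite_weak_desc [simp]: "finite (weak_desc N u)"
  by (rule finite_subset[of _ "{..<N}"]) (auto simp: weak_desc_def)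

lemma cyc_le: "cyc N u \<le> card (weak_desc N u)"
  unfolding cyc_def by (intro card_mono cycle_tops_subset) simp

lemma increasing_iff: "increasing_cycles N u \<longleftrightarrow> cyc N u = card (weak_desc N u)"
proof
  assume "increasing_cycles N u"
  then have "cycle_tops N u = weak_desc N u"
    using cycle_tops_subset[of N u] by (auto simp: increasing_cycles_def)
  then show "cyc N u = card (weak_desc N u)" by (simp add: cyc_def)
next
  assume "cyc N u = card (weak_desc N u)"
  then have "cycle_tops N u = weak_desc N u"
    using card_subset_eq[OF finite_weak_desc cycle_tops_subset] by (simp add: cyc_def)
  then show "increasing_cycles N u" by (simp add: increasing_cycles_def)
qed

lemma perm_orbit:
  assumes "u permutes {..<N::nat}"
  shows self_in_orbit: "x \<in> orbit u x"
    and orbit_sym: "y \<in> orbit u x \<Longrightarrow> x \<in> orbit u y"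
    and orbit_lt: "y \<in> orbit u x \<Longrightarrow> y < N \<longleftrightarrow> x < N"
    and orbit_finite: "finite (orbit u x)"
    and orbit_eq: "y \<in> orbit u x \<Longrightarrow> orbit u y = orbit u x"
proof -
  have p: "permutation u" using assms by (auto simp: permutation_permutes)
  show s: "x \<in> orbit u x" for x by (rule permutation_self_in_orbit[OF p])
  show sym: "y \<in> orbit u x \<Longrightarrow> x \<in> orbit u y" for x y using orbit_swap[OF s] .
  show "y \<in> orbit u x \<Longrightarrow> y < N \<longleftrightarrow> x < N"
  proof (induction rule: orbit.induct)
    case base
    then show ?case using permutes_in_image[OF assms] by simp
  next
    case (step y)
    then show ?case using permutes_in_image[OF assms, of y] by simp
  qed
  show "finite (orbit u x)" by (intro finite_orbit s)
  show "y \<in> orbit u x \<Longrightarrow> orbit u y = orbit u x"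
    using sym orbit_trans by (metis subsetI subset_antisym)
qed

lemma cycle_top_unique:
  assumes "u permutes {..<N}" "x \<in> cycle_tops N u" "y \<in> cycle_tops N u" "y \<in> orbit u x"
  shows "x = y"
  using assms orbit_sym[OF assms(1)] by (fastforce simp: cycle_tops_def)

lemma orbit_pred:
  assumes "u permutes {..<N::nat}" "y \<in> orbit u x"
  obtains p where "p \<in> orbit u x" "u p = y"
proof
  show 1: "u (pinv u y) = y" using permutes_inverses[OF assms(1)] by simp
  have "y \<in> orbit u (pinv u y)" using orbit.base[of u "pinv u y"] unfolding 1 .
  then show "pinv u y \<in> orbit u x"
    using orbit_sym[OF assms(1)] orbit_eq[OF assms(1,2)] by blast
qed

text \<open>The preimage of the minimum of a cycle is a weak descent, hence the top; so the top is
  followed by the minimum.\<close>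

lemma increasing_min:
  assumes "u permutes {..<N}" "increasing_cycles N u" "x \<in> cycle_tops N u" "y \<in> orbit u x"
  shows "u x \<le> y"
proof -
  let ?m = "Min (orbit u x)"
  have m: "?m \<in> orbit u x"
    using orbit_finite[OF assms(1)] assms(4) by (intro Min_in) auto
  obtain p where p: "p \<in> orbit u x" "u p = ?m" using orbit_pred[OF assms(1) m] by blast
  then have "u p \<le> p" using orbit_finite[OF assms(1)] by simp
  moreover have "p < N" using p assms(3) orbit_lt[OF assms(1)] by (auto simp: cycle_tops_def)
  ultimately have "p \<in> cycle_tops N u"
    using assms(2) by (auto simp: increasing_cycles_def weak_desc_def)
  then have "p = x" using cycle_top_unique[OF assms(1) assms(3)] p by blast
  then show ?thesis using p assms(4) orbit_finite[OF assms(1)] by simp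
qed

text \<open>Strong induction on \<open>x\<close>. If the step from \<open>x\<close> to
  \<open>u x\<close> skipped a point of the cycle, the least point \<open>m\<close> of the cycle
  above \<open>x\<close> would have its preimage \<open>p\<close> below \<open>x\<close>, and the
  claim at \<open>p\<close> would give \<open>u p \<le> x\<close>, although
  \<open>u p = m\<close>.\<close>

lemma increasing_next:
  assumes "u permutes {..<N}" "increasing_cycles N u" "x < N" "y \<in> orbit u x" "x < y"
  shows "x < u x \<and> u x \<le> y"
  using assms(3-)
proof (induction x arbitrary: y rule: less_induct)
  case (less x)
  have asc: "z < u z" if "z < N" "z \<notin> cycle_tops N u" for z
    using assms(2) that by (auto simp: increasing_cycles_def weak_desc_def)
  have "x \<notin> cycle_tops N u" using less.prems by (force simp: cycle_tops_def)
  then have 1: "x < u x" using asc less.prems by blast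
  have "\<not> y < u x"
  proof
    assume y: "y < u x"
    let ?S = "{z \<in> orbit u x. x < z}"
    have fin: "finite ?S" using orbit_finite[OF assms(1)] by auto
    define m where "m = Min ?S"
    have mS: "m \<in> ?S" unfolding m_def using fin less.prems by (intro Min_in) auto
    have mle: "m \<le> y" unfolding m_def using fin less.prems by (intro Min_le) auto
    obtain p where p: "p \<in> orbit u x" "u p = m" using orbit_pred[OF assms(1), of m x] mS by blast
    have pN: "p < N" using p less.prems orbit_lt[OF assms(1)] by blast
    have px: "x \<in> orbit u p" using orbit_sym[OF assms(1) p(1)] .
    have "p \<notin> cycle_tops N u" using increasing_min[OF assms(1,2) _ px] p mS by force
    then have "p < m" using asc[OF pN] p by simp
    then have "\<not> x < p" using p Min_le[OF fin, of p] by (auto simp: m_def)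
    moreover have "p \<noteq> x" using p mle y by auto
    ultimately have "p < x" by simp
    then have "u p \<le> x" using less.IH[OF _ pN px] by blast
    then show False using p mS by simp
  qed
  then show ?case using 1 by simp
qed

text \<open>Write a point as \<open>u y\<close>. In its \<open>q\<close>-cycle, \<open>q y\<close>
  is the next larger point after \<open>y\<close>, or the least one if \<open>y\<close> is a top; so
  \<open>q y \<le> u y\<close> holds exactly if \<open>y < u y\<close> or \<open>y\<close> is a top.
  The weak descents of the quotient thus count the strict ascents of \<open>u\<close> and the cycles
  of \<open>q\<close>, and the strict ascents of \<open>u\<close> are what its weak descents leave
  of the \<open>N\<close> points.\<close>

lemma weak_desc_count:
  assumes u: "u permutes {..<N}" and q: "q permutes {..<N}" "increasing_cycles N q"
    and sub: "\<And>x. x < N \<Longrightarrow> u x \<in> orbit q x"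
  shows "card (weak_desc N u) + card (weak_desc N (q \<circ> pinv u)) = N + cyc N q"
proof -
  have bij: "bij_betw u {..<N} {..<N}" using permutes_imp_bij[OF u] .
  have inj: "inj u" using permutes_inj[OF u] .
  have "weak_desc N (q \<circ> pinv u) = u ` {y. y < N \<and> q y \<le> u y}" (is "?L = ?R")
  proof
    show "?L \<subseteq> ?R"
    proof
      fix x assume "x \<in> ?L"
      then have x: "x < N" "q (pinv u x) \<le> x" by (auto simp: weak_desc_def)
      have 1: "u (pinv u x) = x" using permutes_inverses(1)[OF u] .
      then have "pinv u x < N" using x(1) permutes_in_image[OF u, of "pinv u x"] by simp
      then show "x \<in> ?R" using x(2) 1 by (intro image_eqI[of _ _ "pinv u x"]) simp_all
    qed
    show "?R \<subseteq> ?L"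
    proof
      fix x assume "x \<in> ?R"
      then obtain y where y: "y < N" "q y \<le> u y" "x = u y" by blast
      then show "x \<in> ?L"
        using permutes_in_image[OF u, of y] permutes_inverses(2)[OF u, of y] by (simp add: weak_desc_def)
    qed
  qed
  moreover have "{y. y < N \<and> q y \<le> u y} = {y. y < N \<and> y < u y} \<union> cycle_tops N q" (is "?A = ?B")
  proof -
    have "q y \<le> u y \<longleftrightarrow> y < u y \<or> y \<in> cycle_tops N q" if y: "y < N" for y
    proof (cases "y \<in> cycle_tops N q")
      case True
      then show ?thesis using increasing_min[OF q True sub[OF y]] by blast
    next
      case False
      then have "y < q y" using q(2) y by (auto simp: increasing_cycles_def weak_desc_def)
      then show ?thesis using increasing_next[OF q y sub[OF y]] False by auto
    qed
    moreover have "cycle_tops N q \<subseteq> {..<N}" by (auto simp: cycle_tops_def)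
    ultimately show ?thesis by auto
  qed
  moreover have "{y. y < N \<and> y < u y} \<inter> cycle_tops N q = {}"
    using sub by (fastforce simp: cycle_tops_def)
  ultimately have "card (weak_desc N (q \<circ> pinv u)) = card {y. y < N \<and> y < u y} + cyc N q"
    using inj by (simp add: card_image inj_on_subset cyc_def)
      (subst card_Un_disjoint, auto simp: cycle_tops_def)
  moreover have "card (weak_desc N u) + card {y. y < N \<and> y < u y} = N"
  proof -
    have "weak_desc N u \<union> {y. y < N \<and> y < u y} = {..<N}" by (auto simp: weak_desc_def)
    moreover have "weak_desc N u \<inter> {y. y < N \<and> y < u y} = {}" by (auto simp: weak_desc_def)
    ultimately show ?thesis
      using card_Un_disjoint[of "weak_desc N u" "{y. y < N \<and> y < u y}"] by simp
  qed
  ultimately show ?thesis by linarith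
qed

text \<open>A weak descent \<open>x\<close> of the quotient has to be the largest point of its
  cycle. With \<open>y = pinv u x\<close>, the points of the \<open>q\<close>-cycle between
  \<open>q y\<close> and \<open>x\<close> are closed under the quotient: as \<open>u\<close> is
  noncrossing, the \<open>u\<close>-preimage of such a point cannot leave the range in which
  \<open>q\<close> leads back into the interval.\<close>

lemma increasing_quotient:
  assumes u: "u permutes {..<N}" "increasing_cycles N u" "noncrossing N (same_cycle u)"
    and q: "q permutes {..<N}" "increasing_cycles N q"
    and sub: "\<And>x. x < N \<Longrightarrow> orbit u x \<subseteq> orbit q x"
  shows "increasing_cycles N (q \<circ> pinv u)"
  unfolding increasing_cycles_def
proof
  let ?v = "q \<circ> pinv u"
  fix x assume "x \<in> weak_desc N ?v"
  then have xN: "x < N" and vx: "q (pinv u x) \<le> x" by (auto simp: weak_desc_def)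
  define y where "y = pinv u x"
  have uy: "u y = x" using permutes_inverses[OF u(1)] by (simp add: y_def)
  have yN: "y < N" using uy xN permutes_in_image[OF u(1), of y] by auto
  have xy: "x \<in> orbit u y" using uy by (metis orbit.base)
  have yx: "y \<in> orbit u x" using orbit_sym[OF u(1) xy] .
  have nc: "b \<in> orbit u a"
    if "a < b" "b < c" "c < d" "d < N" "c \<in> orbit u a" "d \<in> orbit u b" for a b c d
    using u(3) that unfolding noncrossing_def same_cycle_def by blast
  have uprev: "pinv u z \<in> orbit u z" for z
    using orbit_sym[OF u(1), of z "pinv u z"] orbit.base[of u "pinv u z"] permutes_inverses[OF u(1)] by simp
  have vorb: "?v z \<in> orbit q x" if "z \<in> orbit q x" for z
  proof -
    have "z < N" using that orbit_lt[OF q(1)] xN by blast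
    then have "pinv u z \<in> orbit q z" using uprev sub by blast
    then have "pinv u z \<in> orbit q x" using that orbit_eq[OF q(1)] by metis
    then show ?thesis by (simp add: orbit.step)
  qed
  have yq: "y \<in> orbit q x" using yx sub xN by blast
  have lt: "z < N" if "z \<in> orbit q x" for z using that orbit_lt[OF q(1)] xN by blast
  have "orbit ?v x \<subseteq> {z \<in> orbit q x. q y \<le> z \<and> z \<le> x}"
  proof (rule orbit_subset_closed)
    show "x \<in> {z \<in> orbit q x. q y \<le> z \<and> z \<le> x}"
      using vx self_in_orbit[OF q(1)] by (simp add: y_def)
  next
    fix z assume z: "z \<in> {z \<in> orbit q x. q y \<le> z \<and> z \<le> x}"
    then have zq: "z \<in> orbit q x" and zN: "z < N" using lt by auto
    show "?v z \<in> {z \<in> orbit q x. q y \<le> z \<and> z \<le> x}"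
    proof (cases "z = x")
      case True
      then show ?thesis using vorb[OF zq] vx by (simp add: y_def)
    next
      case False
      then have zx: "z < x" using z by simp
      define p where "p = pinv u z"
      have pz: "p \<in> orbit u z" and zp: "z \<in> orbit u p"
        using uprev orbit_sym[OF u(1)] by (auto simp: p_def)
      have pN: "p < N" using pz zN orbit_lt[OF u(1)] by blast
      have pq: "p \<in> orbit q x" using pz zq sub[OF zN] orbit_eq[OF q(1) zq] by blast
      have up: "u p = z" using permutes_inverses[OF u(1)] by (simp add: p_def)
      have px: "p \<noteq> x" "p \<noteq> y" 
      proof -
        show "p \<noteq> y" using up uy zx by auto
        show "p \<noteq> x"
        proof
          assume "p = x"
          then have "z \<in> orbit u y" using zp orbit_eq[OF u(1) xy] by simp
          show False
          proof (cases "y < x")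
            case True
            have "y < q y" using increasing_next[OF q yN _ True] yq xN
              by (metis orbit_sym[OF q(1)] )
            then have "y < z" using z by simp
            then show False using increasing_next[OF u(1,2) yN \<open>z \<in> orbit u y\<close>] uy zx by simp
          next
            case False
            then have "y \<in> cycle_tops N u" using u(2) yN uy by (auto simp: increasing_cycles_def weak_desc_def)
            then show False using increasing_min[OF u(1,2) _ \<open>z \<in> orbit u y\<close>] uy zx by simp
          qed
        qed
      qed
      \<comment> \<open>If \<open>y\<close> is a \<open>q\<close>-top, \<open>q\<close> sends it to
        the minimum and only \<open>p < x\<close> needs an argument. Otherwise \<open>z\<close> lies
        strictly between \<open>y\<close> and \<open>x\<close>, in another \<open>u\<close>-cycle,
        and a preimage \<open>p\<close> outside would give a chord from \<open>p\<close> to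
        \<open>z\<close> crossing the one from \<open>y\<close> to \<open>x\<close>.\<close>
      have main: "p < x \<and> q y \<le> q p"
      proof (cases "y \<in> cycle_tops N q")
        case ytop: True
        have "y \<in> cycle_tops N u" using ytop sub[OF yN] by (auto simp: cycle_tops_def)
        have ple: "p \<le> y" using ytop pq orbit_eq[OF q(1) yq] by (auto simp: cycle_tops_def)
        have "\<not> x < p"
        proof
          assume xp: "x < p"
          have "x \<in> orbit u z" using nc[OF zx xp _ yN pz yx] ple px by simp
          then have "z \<in> orbit u y" using orbit_sym[OF u(1)] orbit_eq[OF u(1) xy] by blast
          then show False using increasing_min[OF u(1,2) \<open>y \<in> cycle_tops N u\<close>] uy zx by force
        qed
        moreover have "q y \<le> q p"
          using increasing_min[OF q ytop] pq orbit_eq[OF q(1) yq] by (simp add: orbit.step)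
        ultimately show ?thesis using px by simp
      next
        case False
        then have yqy: "y < q y" using q(2) yN by (auto simp: increasing_cycles_def weak_desc_def)
        then have yz: "y < z" and yltx: "y < x" using z zx by auto
        have nzy: "z \<notin> orbit u y" using increasing_next[OF u(1,2) yN _ yz] uy zx by auto
        have "\<not> p < y"
        proof
          assume "p < y"
          then have "y \<in> orbit u p" using nc[OF _ yz zx xN zp xy] by blast
          then show False using nzy zp orbit_eq[OF u(1)] by metis
        qed
        moreover have "\<not> x < p"
        proof
          assume "x < p"
          then have "z \<in> orbit u y" using nc[OF yz zx _ pN xy pz] by blast
          then show False using nzy by simp
        qed
        ultimately have pr: "y < p" "p < x" using px by auto
        have qyx: "orbit q y = orbit q x" using orbit_eq[OF q(1) yq] .
        have "q y \<le> p" using increasing_next[OF q yN, of p] pq pr qyx by simp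
        moreover have "p < q p" using increasing_next[OF q pN, of x] pr 
          by (metis orbit_sym[OF q(1)] pq)
        ultimately show ?thesis using pr by simp
      qed
      have "q p \<le> x" using increasing_next[OF q pN, of x] main
        by (metis orbit_sym[OF q(1)] pq)
      then show ?thesis using main vorb[OF zq] by (simp add: p_def)
    qed
  qed
  then show "x \<in> cycle_tops N ?v" using xN by (auto simp: cycle_tops_def)
qed

text \<open>Both \<open>u\<close> and the quotient have increasing cycles, so the weak descents in
  the count are the cycle tops.\<close>

lemma cyc_quotient:
  assumes u: "u permutes {..<N}" "increasing_cycles N u" "noncrossing N (same_cycle u)"
    and q: "q permutes {..<N}" "increasing_cycles N q"
    and sub: "\<And>x. x < N \<Longrightarrow> orbit u x \<subseteq> orbit q x"
  shows "cyc N u + cyc N (q \<circ> pinv u) = N + cyc N q"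
  using weak_desc_count[OF u(1) q] increasing_quotient[OF assms] u(2) sub orbit.base[of u]
  by (metis increasing_iff subsetD)

section \<open>The rotation by one step and equality in the genus bound\<close>

definition shift :: "nat \<Rightarrow> nat \<Rightarrow> nat" where
  "shift N x = (if x < N then (x + 1) mod N else x)"

lemma shift_simps: "Suc x < N \<Longrightarrow> shift N x = Suc x" "shift (Suc x) x = 0" "x \<ge> N \<Longrightarrow> shift N x = x"
  by (auto simp: shift_def)

lemma shift_cases: "x < N \<Longrightarrow> Suc x < N \<and> shift N x = Suc x \<or> Suc x = N \<and> shift N x = 0"
  by (cases "Suc x = N") (auto simp: shift_def)

lemma shift_permutes: "shift N permutes {..<N}"
proof (rule bij_imp_permutes)
  have "inj_on (shift N) {..<N}"
  proof (rule inj_onI)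
    fix x y assume "x \<in> {..<N}" "y \<in> {..<N}" "shift N x = shift N y"
    then show "x = y" using shift_cases[of x N] shift_cases[of y N] by auto
  qed
  moreover have "shift N ` {..<N} \<subseteq> {..<N}" by (auto simp: shift_def)
  ultimately show "bij_betw (shift N) {..<N} {..<N}"
    by (simp add: bij_betw_def endo_inj_surj)
qed (auto simp: shift_def)

lemma shift_funpow: "x < N \<Longrightarrow> (shift N ^^ k) x = (x + k) mod N"
proof (induction k)
  case (Suc k)
  then have "(x + k) mod N < N" by simp
  then show ?case using Suc by (simp add: shift_def mod_Suc_eq)
qed simp

lemma orbit_shift: "x < N \<Longrightarrow> orbit (shift N) x = {..<N}"
proof
  assume x: "x < N"
  show "orbit (shift N) x \<subseteq> {..<N}" using orbit_lt[OF shift_permutes] x by auto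
  show "{..<N} \<subseteq> orbit (shift N) x"
  proof
    fix y assume "y \<in> {..<N}"
    then have y: "y < N" by simp
    have "(shift N ^^ (y + N - x)) x = y" using x y by (simp add: shift_funpow)
    moreover have "0 < y + N - x" using x by simp
    ultimately show "y \<in> orbit (shift N) x" unfolding orbit_altdef mem_Collect_eq by metis
  qed
qed

lemma shift_increasing: "increasing_cycles N (shift N)"
proof -
  have "x \<in> cycle_tops N (shift N)" if "x \<in> weak_desc N (shift N)" for x
  proof -
    have x: "x < N" "shift N x \<le> x" using that by (auto simp: weak_desc_def)
    then have "Suc x = N" using shift_cases[of x N] by auto
    then show ?thesis using x by (auto simp: cycle_tops_def orbit_shift)
  qed
  then show ?thesis by (auto simp: increasing_cycles_def)
qed

lemma cyc_shift: "N > 0 \<Longrightarrow> cyc N (shift N) = 1"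
proof -
  assume "N > 0"
  then have "cycle_tops N (shift N) = {N - 1}"
  proof -
    have "x \<in> cycle_tops N (shift N) \<longleftrightarrow> x = N - 1" for x
    proof
      assume "x \<in> cycle_tops N (shift N)"
      then have x: "x < N" "\<forall>y<N. y \<le> x" by (auto simp: cycle_tops_def orbit_shift)
      then have "N - 1 \<le> x" using \<open>N > 0\<close> x(2)[rule_format, of "N - 1"] by simp
      then show "x = N - 1" using x(1) by linarith
    next
      assume "x = N - 1"
      then show "x \<in> cycle_tops N (shift N)" using \<open>N > 0\<close> by (auto simp: cycle_tops_def orbit_shift)
    qed
    then show ?thesis by blast
  qed
  then show ?thesis by (simp add: cyc_def)
qed

text \<open>Put \<open>v = shift N \<circ> pinv u\<close>. It sends \<open>u z\<close> back to
  \<open>z + 1\<close>, so \<open>u z\<close> is the top of its \<open>v\<close>-cycle. This cycle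
  jumps over \<open>b\<close> at its last point \<open>e\<close> not beyond \<open>b\<close>; the
  \<open>u\<close>-preimage \<open>x\<close> of \<open>e\<close> is then at least \<open>b\<close>,
  so it is a weak descent and the top of a \<open>u\<close>-cycle inside the gap. That cycle
  contains \<open>b\<close> or has a shorter gap around \<open>b\<close>.\<close>

lemma increasing_gap:
  assumes u: "u permutes {..<N}" "increasing_cycles N u"
    and v: "increasing_cycles N (shift N \<circ> pinv u)"
    and z: "z < u z" "u z < N" "z < b" "b < u z"
  shows "orbit u b \<subseteq> {z<..<u z}"
  using z
proof (induction "u z - z" arbitrary: z rule: less_induct)
  case less
  let ?v = "shift N \<circ> pinv u"
  let ?y = "u z"
  have vp: "?v permutes {..<N}" using permutes_compose[OF permutes_inv[OF u(1)] shift_permutes] .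
  have vy: "?v ?y = Suc z"
    using permutes_inverses(2)[OF u(1)] less.prems by (simp add: shift_simps)
  have ytop: "?y \<in> cycle_tops N ?v"
  proof -
    have "?y \<in> weak_desc N ?v"
      using less.prems vy unfolding weak_desc_def by simp
    then show ?thesis using v by (auto simp: increasing_cycles_def)
  qed
  define S where "S = {e \<in> orbit ?v ?y. e \<le> b}"
  have fin: "finite S" unfolding S_def using orbit_finite[OF vp] by auto
  have "Suc z \<in> S" using less.prems vy orbit.base[of ?v ?y] by (simp add: S_def)
  define e where "e = Max S"
  have eS: "e \<in> S" unfolding e_def using fin \<open>Suc z \<in> S\<close> by (intro Max_in) auto
  have ez: "Suc z \<le> e" unfolding e_def using fin \<open>Suc z \<in> S\<close> by (rule Max_ge)
  have eN: "e < N" using eS less.prems by (simp add: S_def)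
  have ve_orb: "?v e \<in> orbit ?v ?y" using eS orbit.step[of e ?v ?y] by (simp add: S_def)
  have "e \<notin> cycle_tops N ?v"
    using cycle_top_unique[OF vp ytop, of e] eS less.prems by (auto simp: S_def)
  then have "\<not> ?v e \<le> e" using v eN by (auto simp: increasing_cycles_def weak_desc_def)
  then have ve: "b < ?v e"
    using Max_ge[OF fin, of "?v e"] ve_orb by (fastforce simp: S_def e_def)
  define x where "x = pinv u e"
  have ux: "u x = e" using permutes_inverses(1)[OF u(1)] by (simp add: x_def)
  have xN: "x < N" using permutes_in_image[OF u(1), of x] ux eN by simp
  have shx: "shift N x = ?v e" by (simp add: x_def)
  then have bx: "b \<le> x" using ve shift_cases[OF xN] by auto
  have "?v e \<le> ?y" using ytop ve_orb by (auto simp: cycle_tops_def)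
  then have xy: "x < ?y" using shx ve shift_cases[OF xN] by auto
  have "u x \<le> x" using ux eS bx by (simp add: S_def)
  then have xtop: "x \<in> cycle_tops N u" using u(2) xN by (auto simp: increasing_cycles_def weak_desc_def)
  have xmin: "z < t" "t < ?y" if "t \<in> orbit u x" for t
  proof -
    show "z < t" using increasing_min[OF u xtop that] ux ez by simp
    show "t < ?y" using xtop that xy by (auto simp: cycle_tops_def)
  qed
  show ?case
  proof (cases "b \<in> orbit u x")
    case True
    then show ?thesis using orbit_eq[OF u(1) True] xmin by auto
  next
    case False
    define S' where "S' = {t \<in> orbit u x. t \<le> b}"
    have fin': "finite S'" unfolding S'_def using orbit_finite[OF u(1)] by auto
    have "e \<in> S'" using ux eS orbit.base[of u x] by (simp add: S_def S'_def)
    define z2 where "z2 = Max S'"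
    have z2S: "z2 \<in> S'" unfolding z2_def using fin' \<open>e \<in> S'\<close> by (intro Max_in) auto
    then have z2: "z2 \<in> orbit u x" "z2 < b" using False by (auto simp: S'_def order.order_iff_strict)
    have z2N: "z2 < N" using z2 bx xN by simp
    have up: "z2 < u z2" using increasing_next[OF u z2N, of x] z2 bx orbit_sym[OF u(1)] by simp
    have u2: "u z2 \<in> orbit u x" using z2(1) by (rule orbit.step)
    have "\<not> u z2 \<le> b" using Max_ge[OF fin', of "u z2", folded z2_def] u2 up by (auto simp: S'_def)
    then have "b < u z2" by simp
    have "orbit u b \<subseteq> {z2<..<u z2}"
      using less.hyps[OF _ up _ z2(2) \<open>b < u z2\<close>] xmin[OF u2] xmin[OF z2(1)] less.prems by simp
    then show ?thesis using xmin[OF u2] xmin[OF z2(1)] by auto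
  qed
qed

text \<open>The last point of the cycle of \<open>a\<close> that is not beyond \<open>b\<close>
  opens a gap around \<open>b\<close>. The cycle of \<open>b\<close> is confined to this gap, while
  \<open>d\<close> lies beyond it.\<close>

lemma noncrossing_if_increasing:
  assumes u: "u permutes {..<N}" "increasing_cycles N u"
    and v: "increasing_cycles N (shift N \<circ> pinv u)"
  shows "noncrossing N (same_cycle u)"
  unfolding noncrossing_def same_cycle_def
proof (intro allI impI)
  fix a b c d
  assume A: "a < b \<and> b < c \<and> c < d \<and> d < N \<and> c \<in> orbit u a \<and> d \<in> orbit u b"
  show "b \<in> orbit u a"
  proof (rule ccontr)
    assume nb: "b \<notin> orbit u a"
    define S where "S = {t \<in> orbit u a. t \<le> b}"
    have fin: "finite S" unfolding S_def using orbit_finite[OF u(1)] by auto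
    have "a \<in> S" using A self_in_orbit[OF u(1)] by (simp add: S_def)
    define z where "z = Max S"
    have zS: "z \<in> S" unfolding z_def using fin \<open>a \<in> S\<close> by (intro Max_in) auto
    then have z: "z \<in> orbit u a" "z < b" using nb by (auto simp: S_def order.order_iff_strict)
    have c: "c \<in> orbit u z" using A z(1) orbit_eq[OF u(1)] by blast
    have up: "z < u z" "u z \<le> c" using increasing_next[OF u _ c] z A by auto
    have "u z \<in> orbit u a" using z(1) by (rule orbit.step)
    then have "\<not> u z \<le> b" using Max_ge[OF fin, of "u z", folded z_def] up by (auto simp: S_def)
    then have "orbit u b \<subseteq> {z<..<u z}"
      using increasing_gap[OF u v up(1) _ z(2)] up A by simp
    then show False using A up by force
  qed
qed

lemma weak_desc_count_shift:
  assumes u: "u permutes {..<N}"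
  shows "card (weak_desc N u) + card (weak_desc N (shift N \<circ> pinv u)) = N + cyc N (shift N)"
proof (rule weak_desc_count[OF u shift_permutes shift_increasing])
  show "u x \<in> orbit (shift N) x" if "x < N" for x
    using that permutes_in_image[OF u, of x] by (simp add: orbit_shift)
qed

text \<open>The weak descents of the two factors number exactly \<open>N + 1\<close>, so equality
  leaves neither factor a weak descent that is not a cycle top.\<close>

lemma noncrossing_iff_cyc:
  assumes u: "u permutes {..<N}" and N: "N > 0"
    and eq: "cyc N u + cyc N (shift N \<circ> pinv u) = N + 1"
  shows "increasing_cycles N u" "noncrossing N (same_cycle u)"
proof -
  note weak_desc_count_shift[OF u]
  then have *: "increasing_cycles N u \<and> increasing_cycles N (shift N \<circ> pinv u)"
    using eq cyc_le[of N u] cyc_le[of N "shift N \<circ> pinv u"] cyc_shift[OF N]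
    unfolding increasing_iff by linarith
  then show "increasing_cycles N u" "noncrossing N (same_cycle u)"
    using noncrossing_if_increasing[OF u] by auto
qed

lemma cyc_sum_le:
  assumes u: "u permutes {..<N}" and N: "N > 0"
  shows "cyc N u + cyc N (shift N \<circ> pinv u) \<le> N + 1"
proof -
  note weak_desc_count_shift[OF u]
  then show ?thesis
    using cyc_le[of N u] cyc_le[of N "shift N \<circ> pinv u"] cyc_shift[OF N] by linarith
qed

section \<open>Clockwise distance\<close>

definition cdist :: "nat \<Rightarrow> nat \<Rightarrow> nat \<Rightarrow> nat" where
  "cdist N x y = (y + N - x) mod N"

lemma cdist_eq: "x < N \<Longrightarrow> y < N \<Longrightarrow> cdist N x y = (if x \<le> y then y - x else y + N - x)"
proof (cases "x \<le> y")
  case True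
  assume N: "x < N" "y < N"
  have "y + N - x = (y - x) + N" using True by simp
  then have "(y + N - x) mod N = (y - x) mod N" by simp
  moreover have "y - x < N" using N by simp
  ultimately show ?thesis using True by (simp add: cdist_def)
qed (simp add: cdist_def)

text \<open>Measured clockwise, the drop from the top to the minimum is no exception: every point is
  followed by the nearest other point of its cycle. In this form increasing cycles are compatible
  with rotations.\<close>

lemma increasing_cyclic_next:
  assumes u: "u permutes {..<N}" "increasing_cycles N u" and "x < N" "y \<in> orbit u x" "y \<noteq> x"
  shows "u x \<noteq> x" "cdist N x (u x) \<le> cdist N x y"
proof -
  have yN: "y < N" using orbit_lt[OF u(1) assms(4)] assms(3) by simp
  have uN: "u x < N" using assms(3) permutes_in_image[OF u(1), of x] by simp
  have "u x \<noteq> x \<and> cdist N x (u x) \<le> cdist N x y"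
  proof (cases "x \<in> cycle_tops N u")
    case True
    then have "y < x" using assms by (auto simp: cycle_tops_def order.order_iff_strict)
    moreover have "u x \<le> y" using increasing_min[OF u True] assms by blast
    ultimately show ?thesis using assms yN uN by (simp add: cdist_eq)
  next
    case False
    then have x: "x < u x" using u(2) assms by (auto simp: increasing_cycles_def weak_desc_def)
    show ?thesis
    proof (cases "x < y")
      case True
      then show ?thesis using increasing_next[OF u assms(3,4)] assms(3) yN uN by (auto simp: cdist_eq)
    next
      case False
      then show ?thesis using x assms yN uN by (simp add: cdist_eq)
    qed
  qed
  then show "u x \<noteq> x" "cdist N x (u x) \<le> cdist N x y" by auto
qed

section \<open>Noncrossing equivalence relations and the noncrossing closure\<close>

definition equiv_below :: "nat \<Rightarrow> (nat \<Rightarrow> nat \<Rightarrow> bool) \<Rightarrow> bool" where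
  "equiv_below N R \<longleftrightarrow> (\<forall>x<N. R x x) \<and> (\<forall>x y. R x y \<longrightarrow> x < N \<and> y < N \<and> R y x)
     \<and> (\<forall>x y z. R x y \<longrightarrow> R y z \<longrightarrow> R x z)"

lemma equiv_belowD:
  assumes "equiv_below N R"
  shows "x < N \<Longrightarrow> R x x" "R x y \<Longrightarrow> x < N" "R x y \<Longrightarrow> y < N" "R x y \<Longrightarrow> R y x"
    "R x y \<Longrightarrow> R y z \<Longrightarrow> R x z"
  using assms unfolding equiv_below_def by blast+

lemma equiv_below_same_cycle:
  assumes "u permutes {..<N}"
  shows "equiv_below N (\<lambda>x y. x < N \<and> same_cycle u x y)"
  unfolding equiv_below_def same_cycle_def
  using self_in_orbit[OF assms] orbit_lt[OF assms] orbit_sym[OF assms] by (auto intro: orbit_trans)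

text \<open>Send each point to the next larger member of its class, and the largest member to the
  least one.\<close>

lemma ex_increasing_perm:
  assumes R: "equiv_below N R"
  obtains u where "u permutes {..<N}" "increasing_cycles N u" "\<And>x. x < N \<Longrightarrow> orbit u x = {y. R x y}"
proof -
  note RD = equiv_belowD[OF R]
  define u where "u x = (if N \<le> x then x else if \<exists>y. R x y \<and> x < y then (LEAST y. R x y \<and> x < y)
      else (LEAST y. R x y))" for x
  have up: "R x (u x) \<and> x < u x \<and> u x \<le> y" if "x < N" "R x y" "x < y" for x y
  proof -
    have "u x = (LEAST y. R x y \<and> x < y)" using that by (auto simp: u_def)
    then show ?thesis using that LeastI[of "\<lambda>y. R x y \<and> x < y" y] Least_le[of "\<lambda>y. R x y \<and> x < y" y] by simp
  qed
  have down: "R x (u x) \<and> u x \<le> z" if "x < N" "\<not> (\<exists>y. R x y \<and> x < y)" "R x z" for x z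
  proof -
    have "u x = (LEAST y. R x y)" using that by (auto simp: u_def)
    then show ?thesis using that LeastI[of "R x" z] Least_le[of "R x" z] by simp
  qed
  have Ru: "R x (u x)" if "x < N" for x
    using up[OF that] down[OF that, of x] RD(1)[OF that] by blast
  have reach: "y = x \<or> y \<in> orbit u x" if "R x y" "x \<le> y" for x y
    using that
  proof (induction "y - x" arbitrary: x rule: less_induct)
    case less
    show ?case
    proof (cases "x = y")
      case False
      then have xy: "x < y" using less.prems by simp
      have xN: "x < N" using RD less.prems by blast
      note * = up[OF xN less.prems(1) xy]
      have "R (u x) y" using * less.prems RD by blast
      then have "y = u x \<or> y \<in> orbit u (u x)" using less.hyps[of "u x"] * by linarith
      then show ?thesis using orbit_trans[of y u "u x" x] orbit.base[of u x] by auto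
    qed simp
  qed
  have sub: "{y. R x y} \<subseteq> orbit u x" if x: "x < N" for x
  proof
    fix y assume "y \<in> {y. R x y}"
    then have y: "R x y" by simp
    let ?M = "Max {y. R x y}"
    have fin: "finite {y. R x y}" by (rule finite_subset[of _ "{..<N}"]) (auto dest: RD)
    have M: "R x ?M" using Max_in[OF fin] y by auto
    have MN: "?M < N" using RD M by blast
    have xM: "x \<le> ?M" using Max_ge[OF fin] RD(1)[OF x] by simp
    have ntop: "\<not> (\<exists>y. R ?M y \<and> ?M < y)"
    proof
      assume "\<exists>y. R ?M y \<and> ?M < y"
      then obtain y' where y': "R ?M y'" "?M < y'" by blast
      then have "R x y'" using RD(5)[OF M] by blast
      then show False using Max_ge[OF fin, of y'] y' by simp
    qed
    have Ry: "R ?M y" using M y RD by blast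
    have "u ?M \<le> y" using down[OF MN ntop Ry] by simp
    moreover have "R (u ?M) y" using Ru[OF MN] Ry RD by blast
    ultimately have "y = u ?M \<or> y \<in> orbit u (u ?M)" using reach by blast
    then have yM: "y \<in> orbit u ?M"
      using orbit_trans[of y u "u ?M" ?M] orbit.base[of u ?M] by blast
    have "?M = x \<or> ?M \<in> orbit u x" using reach[OF M xM] .
    then show "y \<in> orbit u x" using orbit_trans[OF yM, of x] yM by auto
  qed
  have orb: "orbit u x = {y. R x y}" if x: "x < N" for x
  proof
    show "orbit u x \<subseteq> {y. R x y}"
    proof (rule orbit_subset_closed)
      show "x \<in> {y. R x y}" using RD(1)[OF x] by simp
      show "u z \<in> {y. R x y}" if "z \<in> {y. R x y}" for z
        using that RD(5)[OF _ Ru[OF RD(3)]] by blast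
    qed
  qed (rule sub[OF x])
  have img: "{..<N} \<subseteq> u ` {..<N}"
  proof
    fix y assume "y \<in> {..<N}"
    then have y: "y < N" by simp
    then have "y \<in> orbit u y" using orb RD(1) by simp
    then obtain p where "p = y \<or> p \<in> orbit u y" and p: "y = u p" by (cases rule: orbit.cases) auto
    then have "p < N" using y orb[OF y] RD(3) by auto
    then show "y \<in> u ` {..<N}" using p by blast
  qed
  moreover have "u ` {..<N} \<subseteq> {..<N}" using Ru RD by blast
  ultimately have "bij_betw u {..<N} {..<N}"
    unfolding bij_betw_def using finite_surj_inj[of "{..<N}" u] by auto
  then have perm: "u permutes {..<N}" by (rule bij_imp_permutes) (simp add: u_def)
  have "increasing_cycles N u"
    unfolding increasing_cycles_def
  proof
    fix x assume "x \<in> weak_desc N u"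
    then have x: "x < N" "u x \<le> x" by (auto simp: weak_desc_def)
    then have "y \<le> x" if "R x y" for y using up[OF x(1) that] by force
    then show "x \<in> cycle_tops N u" using x orb by (auto simp: cycle_tops_def)
  qed
  then show thesis using that perm orb by blast
qed

definition nc_coarsening :: "nat \<Rightarrow> (nat \<Rightarrow> nat) \<Rightarrow> (nat \<Rightarrow> nat \<Rightarrow> bool) \<Rightarrow> bool" where
  "nc_coarsening N w R \<longleftrightarrow> equiv_below N R \<and> noncrossing N R \<and> (\<forall>x<N. R x (w x))"

definition nc_closure :: "nat \<Rightarrow> (nat \<Rightarrow> nat) \<Rightarrow> nat \<Rightarrow> nat \<Rightarrow> bool" where
  "nc_closure N w x y \<longleftrightarrow> x < N \<and> y < N \<and> (\<forall>R. nc_coarsening N w R \<longrightarrow> R x y)"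

lemma nc_closureI: "x < N \<Longrightarrow> y < N \<Longrightarrow> (\<And>R. nc_coarsening N w R \<Longrightarrow> R x y) \<Longrightarrow> nc_closure N w x y"
  unfolding nc_closure_def by (intro conjI allI impI)

lemma nc_closureD:
  assumes "nc_closure N w x y"
  shows "x < N" "y < N" "nc_coarsening N w R \<Longrightarrow> R x y"
proof -
  have *: "x < N \<and> y < N \<and> (\<forall>R. nc_coarsening N w R \<longrightarrow> R x y)"
    using assms unfolding nc_closure_def .
  show "x < N" using * by (rule conjunct1)
  show "y < N" using * by (elim conjE)
  show "R x y" if "nc_coarsening N w R" using * that by (elim conjE) (drule spec, erule mp)
qed

lemma nc_closure_coarsening:
  assumes w: "w permutes {..<N}"
  shows "nc_coarsening N w (nc_closure N w)"
  unfolding nc_coarsening_def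
proof (intro conjI)
  have E: "equiv_below N R" "noncrossing N R" if "nc_coarsening N w R" for R
    using that by (simp_all add: nc_coarsening_def)
  show "equiv_below N (nc_closure N w)"
    unfolding equiv_below_def
  proof (intro conjI allI impI)
    show "nc_closure N w x x" if "x < N" for x
      by (rule nc_closureI[OF that that]) (rule equiv_belowD(1)[OF E(1) that])
  next
    fix x y assume A: "nc_closure N w x y"
    then show "x < N" "y < N" by (rule nc_closureD)+
    then show "nc_closure N w y x"
      by (intro nc_closureI) (auto intro: equiv_belowD(4)[OF E(1)] nc_closureD(3)[OF A])
  next
    fix x y z assume A: "nc_closure N w x y" "nc_closure N w y z"
    show "nc_closure N w x z"
    proof (rule nc_closureI)
      show "x < N" "z < N" using A nc_closureD by blast+
      show "R x z" if "nc_coarsening N w R" for R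
        using equiv_belowD(5)[OF E(1)[OF that]] nc_closureD(3)[OF _ that] A by blast
    qed
  qed
  show "noncrossing N (nc_closure N w)"
    unfolding noncrossing_def
  proof (intro allI impI)
    fix a b c d
    assume A: "a < b \<and> b < c \<and> c < d \<and> d < N \<and> nc_closure N w a c \<and> nc_closure N w b d"
    show "nc_closure N w a b"
    proof (rule nc_closureI)
      show "a < N" "b < N" using A by auto
      fix R assume R: "nc_coarsening N w R"
      have "R a c" "R b d" using A nc_closureD(3)[OF _ R] by blast+
      then show "R a b" using A E(2)[OF R] unfolding noncrossing_def by blast
    qed
  qed
  show "\<forall>x<N. nc_closure N w x (w x)"
  proof (intro allI impI nc_closureI)
    fix x assume x: "x < N"
    then show "w x < N" using permutes_in_image[OF w, of x] by simp
    show "R x (w x)" if "nc_coarsening N w R" for R using that x by (simp add: nc_coarsening_def)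
  qed
qed

lemma nc_closure:
  assumes w: "w permutes {..<N}"
  shows equiv_nc_closure: "equiv_below N (nc_closure N w)"
    and noncrossing_nc_closure: "noncrossing N (nc_closure N w)"
    and nc_closure_base: "x < N \<Longrightarrow> nc_closure N w x (w x)"
  using nc_closure_coarsening[OF w] by (auto simp: nc_coarsening_def)

lemma nc_closure_least:
  assumes "equiv_below N R" "noncrossing N R" "\<And>x. x < N \<Longrightarrow> R x (w x)" "nc_closure N w x y"
  shows "R x y"
proof (rule nc_closureD(3)[OF assms(4)])
  show "nc_coarsening N w R" unfolding nc_coarsening_def using assms(1-3) by (intro conjI allI impI)
qed

text \<open>Splitting a point off its class keeps a partition noncrossing. For a fixed point the
  split partition is still coarser than the cycles of \<open>w\<close>, so the least one already has
  the point alone.\<close>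

lemma nc_closure_fixpoint:
  assumes w: "w permutes {..<N}" "w x = x" and "nc_closure N w x y"
  shows "y = x"
proof -
  let ?R = "\<lambda>a b. nc_closure N w a b \<and> (a = x \<longleftrightarrow> b = x)"
  note E = equiv_nc_closure[OF w(1)]
  have "equiv_below N ?R"
    unfolding equiv_below_def
  proof (intro conjI allI impI)
    show "nc_closure N w a a" if "a < N" for a using equiv_belowD(1)[OF E that] .
  next
    fix a b assume "nc_closure N w a b \<and> (a = x) = (b = x)"
    then have ab: "nc_closure N w a b" "(a = x) = (b = x)" by simp_all
    show "a < N" using equiv_belowD(2)[OF E ab(1)] .
    show "b < N" using equiv_belowD(3)[OF E ab(1)] .
    show "nc_closure N w b a" using equiv_belowD(4)[OF E ab(1)] .
    show "(b = x) = (a = x)" using ab(2) by simp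
  next
    fix a b c
    assume "nc_closure N w a b \<and> (a = x) = (b = x)" "nc_closure N w b c \<and> (b = x) = (c = x)"
    then have abc: "nc_closure N w a b" "nc_closure N w b c" "(a = x) = (c = x)" by simp_all
    show "nc_closure N w a c" using equiv_belowD(5)[OF E abc(1,2)] .
    show "(a = x) = (c = x)" by (rule abc(3))
  qed simp
  moreover have "noncrossing N ?R"
    unfolding noncrossing_def
  proof (intro allI impI)
    fix a b c d
    assume A: "a < b \<and> b < c \<and> c < d \<and> d < N \<and> ?R a c \<and> ?R b d"
    then have "nc_closure N w a b"
      using noncrossing_nc_closure[OF w(1)] unfolding noncrossing_def by blast
    moreover have "a \<noteq> x" "b \<noteq> x" using A by auto
    ultimately show "?R a b" by simp
  qed
  moreover have "?R a (w a)" if "a < N" for a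
  proof -
    have "w a = x \<longleftrightarrow> a = x" using inj_eq[OF permutes_inj[OF w(1)], of a x] w(2) by simp
    then show ?thesis using nc_closure_base[OF w(1) that] by simp
  qed
  ultimately have "?R x y" by (intro nc_closure_least[OF _ _ _ assms(3), of ?R])
  then show ?thesis by simp
qed

text \<open>The condition reads four points in linear order. A rotation disturbs this order only if
  the last point wraps round to 0, and then the same two chords are read from another starting
  point.\<close>

lemma equiv_noncrossing_shift:
  assumes "equiv_below N R" "noncrossing N R"
  shows "equiv_below N (\<lambda>x y. R (shift N x) (shift N y)) \<and> noncrossing N (\<lambda>x y. R (shift N x) (shift N y))"
proof
  note RD = equiv_belowD[OF assms(1)]
  have s: "shift N x < N \<longleftrightarrow> x < N" for x using permutes_in_image[OF shift_permutes] by auto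
  show "equiv_below N (\<lambda>x y. R (shift N x) (shift N y))"
    unfolding equiv_below_def
  proof (intro conjI allI impI)
    show "R (shift N x) (shift N x)" if "x < N" for x using that by (intro RD(1)) (simp add: s)
  next
    fix x y assume R: "R (shift N x) (shift N y)"
    show "x < N" using RD(2)[OF R] by (simp add: s)
    show "y < N" using RD(3)[OF R] by (simp add: s)
    show "R (shift N y) (shift N x)" using RD(4)[OF R] .
  next
    fix x y z assume "R (shift N x) (shift N y)" "R (shift N y) (shift N z)"
    then show "R (shift N x) (shift N z)" by (rule RD(5))
  qed
  have nc: "R a b" if "a < b" "b < c" "c < d" "d < N" "R a c" "R b d" for a b c d
    using assms(2) that unfolding noncrossing_def by blast
  show "noncrossing N (\<lambda>x y. R (shift N x) (shift N y))"
    unfolding noncrossing_def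
  proof (intro allI impI)
    fix a b c d
    assume A: "a < b \<and> b < c \<and> c < d \<and> d < N \<and> R (shift N a) (shift N c) \<and> R (shift N b) (shift N d)"
    have sa: "shift N a = Suc a" "shift N b = Suc b" "shift N c = Suc c" using A by (auto simp: shift_simps)
    show "R (shift N a) (shift N b)"
    proof (cases "Suc d = N")
      case True
      then have "shift N d = 0" by (auto simp: shift_simps)
      then have "R (Suc b) 0" "R (Suc a) (Suc c)" using A sa by simp_all
      then have "R 0 (Suc b)" using RD(4) by blast
      then have "R 0 (Suc a)" using nc[of 0 "Suc a" "Suc b" "Suc c"] A \<open>R (Suc a) (Suc c)\<close> shift_cases[of c N] True by simp
      then show ?thesis using RD(5)[OF RD(4) \<open>R 0 (Suc b)\<close>] sa by simp
    next
      case False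
      then have "shift N d = Suc d" using A by (simp add: shift_simps)
      then show ?thesis using nc[of "Suc a" "Suc b" "Suc c" "Suc d"] A sa False by simp
    qed
  qed
qed

lemma equiv_noncrossing_shift_pow:
  assumes "equiv_below N R" "noncrossing N R"
  shows "equiv_below N (\<lambda>x y. R ((shift N ^^ k) x) ((shift N ^^ k) y))
    \<and> noncrossing N (\<lambda>x y. R ((shift N ^^ k) x) ((shift N ^^ k) y))"
proof (induction k)
  case (Suc k)
  then show ?case using equiv_noncrossing_shift[of N "\<lambda>x y. R ((shift N ^^ k) x) ((shift N ^^ k) y)"]
    by (simp add: funpow_swap1)
qed (use assms in simp)

lemma nc_closure_shift:
  assumes w: "w permutes {..<N}" and com: "\<And>x. x < N \<Longrightarrow> w ((shift N ^^ k) x) = (shift N ^^ k) (w x)"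
    and "nc_closure N w x y"
  shows "nc_closure N w ((shift N ^^ k) x) ((shift N ^^ k) y)"
proof -
  let ?R = "\<lambda>x y. nc_closure N w ((shift N ^^ k) x) ((shift N ^^ k) y)"
  have *: "equiv_below N ?R \<and> noncrossing N ?R"
    by (rule equiv_noncrossing_shift_pow[OF equiv_nc_closure[OF w] noncrossing_nc_closure[OF w]])
  have "?R z (w z)" if z: "z < N" for z
    using nc_closure_base[OF w, of "(shift N ^^ k) z"] com[OF z] z by (simp add: shift_funpow)
  then show ?thesis using * by (intro nc_closure_least[OF _ _ _ assms(3), of ?R]) simp_all
qed

section \<open>Permutations commuting with an involution\<close>

text \<open>Types A and B at once. Only the sign of \<open>md\<close> matters: a positive value
  means type B, with \<open>sg\<close> as negation on signed points; otherwise \<open>sg\<close> is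
  the identity and commuting with it is no restriction.\<close>

locale sym_perms =
  fixes N :: nat and sg :: "nat \<Rightarrow> nat" and md :: int
  assumes N_pos: "N > 0"
    and sg_perm: "sg permutes {..<N}"
    and sg_sg [simp]: "sg (sg x) = x"
    and sg_even: "\<not> 0 < md \<Longrightarrow> sg x = x"
    and sg_odd: "0 < md \<Longrightarrow> x < N \<Longrightarrow> sg x \<noteq> x"
begin

abbreviation odd_mode :: bool where "odd_mode \<equiv> 0 < md"

definition G :: "(nat \<Rightarrow> nat) set" where
  "G = {w. w permutes {..<N} \<and> (\<forall>x. w (sg x) = sg (w x))}"

text \<open>The transposition of \<open>a\<close> and \<open>b\<close> together with its mirror
  image under \<open>sg\<close>; the two coincide if \<open>b = sg a\<close>. These are the
  reflections of the group.\<close>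

definition tr :: "nat \<Rightarrow> nat \<Rightarrow> nat \<Rightarrow> nat" where
  "tr a b x = (if x = a then b else if x = b then a else if x = sg a then sg b
     else if x = sg b then sg a else x)"

definition TR :: "(nat \<Rightarrow> nat) set" where
  "TR = {tr a b | a b. a < N \<and> b < N \<and> a \<noteq> b}"

text \<open>Functions with values in \<open>\<int>/3\<close>, represented by \<open>{0, 1, 2}\<close>, replace the reflection
  representation: they make dimensions computable by counting.\<close>

definition Fun :: "(nat \<Rightarrow> int) set" where
  "Fun = {f. (\<forall>x. x \<ge> N \<longrightarrow> f x = 0) \<and> (\<forall>x<N. f x \<in> {0..<3})
     \<and> (\<forall>x<N. f (sg x) = (if odd_mode then (- f x) mod 3 else f x))}"

definition Fx :: "(nat \<Rightarrow> nat) \<Rightarrow> (nat \<Rightarrow> int) set" where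
  "Fx w = {f \<in> Fun. \<forall>x<N. f (w x) = f x}"

lemma sg_lt: "sg x < N \<longleftrightarrow> x < N"
  using permutes_in_image[OF sg_perm, of x] by simp

lemma sg_eq_iff: "sg x = sg y \<longleftrightarrow> x = y"
  by (metis sg_sg)

lemma G_perm: "w \<in> G \<Longrightarrow> w permutes {..<N}"
  and G_comm: "w \<in> G \<Longrightarrow> w (sg x) = sg (w x)"
  and G_lt: "w \<in> G \<Longrightarrow> w x < N \<longleftrightarrow> x < N"
  using permutes_in_image[of w "{..<N}" x] by (auto simp: G_def)

lemma id_G: "id \<in> G"
  by (simp add: G_def permutes_id)

lemma comp_G: "u \<in> G \<Longrightarrow> v \<in> G \<Longrightarrow> u \<circ> v \<in> G"
  by (auto simp: G_def intro: permutes_compose)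

lemma pinv_G: "u \<in> G \<Longrightarrow> pinv u \<in> G"
proof -
  assume u: "u \<in> G"
  have "pinv u (sg x) = sg (pinv u x)" for x
  proof -
    have "u (sg (pinv u x)) = sg x" using G_comm[OF u] permutes_inverses(1)[OF G_perm[OF u]] by simp
    then show ?thesis using permutes_inverses(2)[OF G_perm[OF u], of "sg (pinv u x)"] by simp
  qed
  then show ?thesis using permutes_inv[OF G_perm[OF u]] by (simp add: G_def)
qed

lemma tr_invol: 
  assumes "a < N" "b < N"
  shows "tr a b (tr a b x) = x"
proof (cases odd_mode)
  case False
  then show ?thesis by (auto simp: tr_def sg_even)
next
  case True
  have "sg a = b \<longleftrightarrow> a = sg b" by (metis sg_sg)
  then show ?thesis using sg_odd[OF True assms(1)] sg_odd[OF True assms(2)] by (auto simp: tr_def sg_eq_iff)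
qed

lemma tr_simps: "tr a b a = b" "tr a b b = a"
  by (auto simp: tr_def)

lemma tr_sg:
  assumes "a < N" "b < N"
  shows "tr a b (sg x) = sg (tr a b x)"
proof (cases odd_mode)
  case False
  then show ?thesis by (auto simp: tr_def sg_even)
next
  case True
  have *: "sg y = z \<longleftrightarrow> y = sg z" for y z by (metis sg_sg)
  show ?thesis using sg_odd[OF True assms(1)] sg_odd[OF True assms(2)] by (auto simp: tr_def * sg_eq_iff)
qed

lemma tr_G: "a < N \<Longrightarrow> b < N \<Longrightarrow> tr a b \<in> G"
proof -
  assume ab: "a < N" "b < N"
  have lt: "tr a b x < N" if "x < N" for x using ab that by (auto simp: tr_def sg_lt)
  have "bij_betw (tr a b) {..<N} {..<N}"
    by (rule bij_betw_byWitness[of _ "tr a b"]) (use tr_invol[OF ab] lt in auto)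
  then have "tr a b permutes {..<N}"
    by (rule bij_imp_permutes) (use ab sg_lt in \<open>auto simp: tr_def\<close>)
  then show ?thesis by (simp add: G_def tr_sg[OF ab])
qed

lemma TR_G: "TR \<subseteq> G"
  by (auto simp: TR_def tr_G)

lemma conj_tr: "w \<in> G \<Longrightarrow> w \<circ> tr a b \<circ> pinv w = tr (w a) (w b)"
proof
  fix x
  assume w: "w \<in> G"
  define y where "y = pinv w x"
  have x: "x = w y" using permutes_inverses(1)[OF G_perm[OF w]] by (simp add: y_def)
  have inj: "w p = w q \<longleftrightarrow> p = q" for p q using inj_eq[OF permutes_inj[OF G_perm[OF w]]] .
  show "(w \<circ> tr a b \<circ> pinv w) x = tr (w a) (w b) x"
  proof -
    have e: "w y = sg (w p) \<longleftrightarrow> y = sg p" for p unfolding G_comm[OF w, symmetric] by (rule inj)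
    show ?thesis
      unfolding comp_def y_def[symmetric] x tr_def by (simp only: inj e if_distrib[of w] G_comm[OF w] permutes_inverses(2)[OF G_perm[OF w]])
  qed
qed

section \<open>Counting invariant functions\<close>

lemma finite_Fun: "finite Fun"
proof -
  have "Fun \<subseteq> {f. \<forall>x. (x \<in> {..<N} \<longrightarrow> f x \<in> {0..<3}) \<and> (x \<notin> {..<N} \<longrightarrow> f x = 0)}"
    by (auto simp: Fun_def)
  then show ?thesis by (rule finite_subset) (intro finite_set_of_finite_funs; simp)
qed

lemma finite_Fx [simp]: "finite (Fx w)"
  by (rule finite_subset[OF _ finite_Fun]) (auto simp: Fx_def)

lemma zero_Fx: "(\<lambda>x. 0) \<in> Fx w"
  by (simp add: Fx_def Fun_def)

lemma Fx_id: "Fx id = Fun"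
  by (auto simp: Fx_def)

definition add3 :: "(nat \<Rightarrow> int) \<Rightarrow> (nat \<Rightarrow> int) \<Rightarrow> nat \<Rightarrow> int" where
  "add3 f g x = (f x + g x) mod 3"

lemma FunI:
  assumes "\<And>x. x \<ge> N \<Longrightarrow> f x = 0" "\<And>x. x < N \<Longrightarrow> f x \<in> {0..<3}"
    "\<And>x. x < N \<Longrightarrow> f (sg x) = (if odd_mode then (- f x) mod 3 else f x)"
  shows "f \<in> Fun"
  unfolding Fun_def using assms by (intro CollectI conjI allI impI)

lemma FunD:
  assumes "f \<in> Fun"
  shows "x \<ge> N \<Longrightarrow> f x = 0" "x < N \<Longrightarrow> f x \<in> {0..<3}"
    "x < N \<Longrightarrow> f (sg x) = (if odd_mode then (- f x) mod 3 else f x)"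
  using assms unfolding Fun_def by blast+

lemma FxI: "f \<in> Fun \<Longrightarrow> (\<And>x. x < N \<Longrightarrow> f (w x) = f x) \<Longrightarrow> f \<in> Fx w"
  unfolding Fx_def by (intro CollectI conjI allI impI)

lemma FxD: "f \<in> Fx w \<Longrightarrow> f \<in> Fun" "f \<in> Fx w \<Longrightarrow> x < N \<Longrightarrow> f (w x) = f x"
  unfolding Fx_def by blast+

lemma neg_add3: "((- p) mod 3 + (- q) mod 3) mod 3 = (- ((p + q) mod 3)) mod (3::int)"
proof -
  have "((- p) mod 3 + (- q) mod 3) mod 3 = (- p + - q) mod 3" by (rule mod_add_eq)
  also have "- p + - q = - (p + q)" by simp
  also have "(- (p + q)) mod 3 = (- ((p + q) mod 3)) mod 3" by (rule mod_minus_eq[symmetric])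
  finally show ?thesis .
qed

lemma add3_Fx:
  assumes "f \<in> Fx w" "g \<in> Fx w"
  shows "add3 f g \<in> Fx w"
proof (rule FxI)
  note fD = FunD[OF FxD(1)[OF assms(1)]] and gD = FunD[OF FxD(1)[OF assms(2)]]
  show "add3 f g \<in> Fun"
  proof (rule FunI)
    show "add3 f g x = 0" if "x \<ge> N" for x unfolding add3_def fD(1)[OF that] gD(1)[OF that] by simp
    show "add3 f g x \<in> {0..<3}" for x by (simp add: add3_def)
    show "add3 f g (sg x) = (if odd_mode then (- add3 f g x) mod 3 else add3 f g x)" if "x < N" for x
      unfolding add3_def fD(3)[OF that] gD(3)[OF that]
      by (cases odd_mode) (simp_all only: if_True if_False neg_add3)
  qed
  show "add3 f g (w x) = add3 f g x" if "x < N" for x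
    unfolding add3_def FxD(2)[OF assms(1) that] FxD(2)[OF assms(2) that] ..
qed

lemma Fx_range: "f \<in> Fx w \<Longrightarrow> f x \<in> {0..<3}"
proof (cases "x < N")
  case True
  assume "f \<in> Fx w"
  then show ?thesis using FunD(2)[OF FxD(1) True] by blast
next
  case False
  assume "f \<in> Fx w"
  then have "f x = 0" using FunD(1)[OF FxD(1)] False by simp
  then show ?thesis by simp
qed

lemma diff_add3: "((p + q) mod 3 - (p' + q') mod 3) mod 3 = ((p - p') mod 3 + (q - q') mod 3) mod (3::int)"
proof -
  have "((p + q) mod 3 - (p' + q') mod 3) mod 3 = ((p + q) - (p' + q')) mod 3" by (rule mod_diff_eq)
  also have "(p + q) - (p' + q') = (p - p') + (q - q')" by simp
  finally show ?thesis by (simp only: mod_add_eq)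
qed

text \<open>Adding a fixed invariant function is injective and shifts the difference of the values
  at \<open>a\<close> and \<open>b\<close> by a constant.\<close>

lemma card_translate:
  assumes f0: "f0 \<in> Fx w" and r: "(f0 a - f0 b) mod 3 = r"
  shows "card {f \<in> Fx w. (f a - f b) mod 3 = s} \<le> card {f \<in> Fx w. (f a - f b) mod 3 = (r + s) mod 3}"
proof (rule card_inj_on_le[where f = "add3 f0"])
  show "inj_on (add3 f0) {f \<in> Fx w. (f a - f b) mod 3 = s}"
  proof (rule inj_onI)
    fix f g assume fg: "f \<in> {f \<in> Fx w. (f a - f b) mod 3 = s}" "g \<in> {f \<in> Fx w. (f a - f b) mod 3 = s}"
      and eq: "add3 f0 f = add3 f0 g"
    show "f = g"
    proof
      fix x
      have "(f0 x + f x) mod 3 = (f0 x + g x) mod 3" using fun_cong[OF eq, of x] by (simp add: add3_def)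
      then have "3 dvd (f0 x + f x) - (f0 x + g x)" by (simp only: mod_eq_dvd_iff)
      then have "3 dvd f x - g x" by simp
      moreover have "0 \<le> f x" "f x < 3" "0 \<le> g x" "g x < 3"
      proof -
        have "f \<in> Fx w" "g \<in> Fx w" using fg by (simp_all only: mem_Collect_eq)
        from Fx_range[OF this(1), of x] Fx_range[OF this(2), of x]
        show "0 \<le> f x" "f x < 3" "0 \<le> g x" "g x < 3" by simp_all
      qed
      ultimately show "f x = g x" by presburger
    qed
  qed
  show "add3 f0 ` {f \<in> Fx w. (f a - f b) mod 3 = s} \<subseteq> {f \<in> Fx w. (f a - f b) mod 3 = (r + s) mod 3}"
  proof (rule image_subsetI)
    fix f assume f: "f \<in> {f \<in> Fx w. (f a - f b) mod 3 = s}"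
    have "(add3 f0 f a - add3 f0 f b) mod 3 = (r + s) mod 3"
      unfolding add3_def diff_add3 using f r by (simp only: mem_Collect_eq)
    then show "add3 f0 f \<in> {f \<in> Fx w. (f a - f b) mod 3 = (r + s) mod 3}"
      using add3_Fx[OF f0] f by simp
  qed
  show "finite {f \<in> Fx w. (f a - f b) mod 3 = (r + s) mod 3}" by (rule finite_subset[OF _ finite_Fx[of w]]) auto
qed

text \<open>The fixed space of \<open>w\<close> cut with the reflecting hyperplane of
  \<open>tr a b\<close>.\<close>

definition Hp :: "(nat \<Rightarrow> nat) \<Rightarrow> nat \<Rightarrow> nat \<Rightarrow> (nat \<Rightarrow> int) set" where
  "Hp w a b = {f \<in> Fx w. f a = f b}"

lemma Hp_eq: "Hp w a b = {f \<in> Fx w. (f a - f b) mod 3 = 0}"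
proof -
  have "(f a - f b) mod 3 = 0 \<longleftrightarrow> f a = f b" if "f \<in> Fx w" for f
  proof -
    have "0 \<le> f a" "f a < 3" "0 \<le> f b" "f b < 3"
      using Fx_range[OF that, of a] Fx_range[OF that, of b] by simp_all
    then show ?thesis by presburger
  qed
  then show ?thesis
    unfolding Hp_def by (intro Collect_cong conj_cong[OF HOL.refl]) (simp only:)
qed

lemma card_Fx_split:
  "card (Fx w) = card (Hp w a b) + card {f \<in> Fx w. (f a - f b) mod 3 = 1}
     + card {f \<in> Fx w. (f a - f b) mod 3 = 2}"
proof -
  let ?C = "\<lambda>r. {f \<in> Fx w. (f a - f b) mod 3 = r}"
  have fin: "finite (?C r)" for r by (rule finite_subset[OF _ finite_Fx[of w]]) auto
  have "Fx w = (?C 0 \<union> ?C 1) \<union> ?C 2"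
  proof -
    have "r mod 3 = 0 \<or> r mod 3 = 1 \<or> r mod 3 = 2" for r :: int by presburger
    then show ?thesis by blast
  qed
  moreover have "card ((?C 0 \<union> ?C 1) \<union> ?C 2) = card (?C 0) + card (?C 1) + card (?C 2)"
    by (subst card_Un_disjoint; (subst card_Un_disjoint)?) (auto simp: fin)
  ultimately show ?thesis unfolding Hp_eq by presburger
qed

text \<open>Adding twice a member of a fibre of \<open>f a - f b\<close> carries this fibre into the
  zero fibre, so neither of the two nonzero fibres is larger than \<open>Hp w a b\<close>.\<close>

lemma card_Fx_le: "card (Fx w) \<le> 3 * card (Hp w a b)"
proof -
  let ?C = "\<lambda>r. {f \<in> Fx w. (f a - f b) mod 3 = r}"
  have "card (?C r) \<le> card (?C 0)" if "r = 1 \<or> r = 2" for r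
  proof (cases "?C r = {}")
    case False
    then obtain f where f: "f \<in> Fx w" "(f a - f b) mod 3 = r" by auto
    have "(add3 f f a - add3 f f b) mod 3 = (2 * r) mod 3"
      unfolding add3_def diff_add3 f(2) by (simp only: mult_2)
    then have "card (?C r) \<le> card (?C (((2 * r) mod 3 + r) mod 3))"
      by (rule card_translate[OF add3_Fx[OF f(1) f(1)]])
    moreover have "((2 * r) mod 3 + r) mod 3 = 0" using that by auto
    ultimately show ?thesis by simp
  qed (use card.empty in \<open>metis le0\<close>)
  from this[of 1] this[of 2] show ?thesis unfolding card_Fx_split[of w a b] Hp_eq by simp
qed

text \<open>Translation by a separating function, and by twice it, carries the zero fibre into each
  of the two others.\<close>

lemma card_Fx_eq:
  assumes "f \<in> Fx w" "f a \<noteq> f b"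
  shows "card (Fx w) = 3 * card (Hp w a b)"
proof -
  let ?C = "\<lambda>r. {f \<in> Fx w. (f a - f b) mod 3 = r}"
  define r where "r = (f a - f b) mod 3"
  have "f \<notin> Hp w a b" using assms by (simp add: Hp_def)
  moreover have "f \<in> Hp w a b" if "r = 0"
    unfolding Hp_eq using assms(1) that by (intro CollectI conjI) (simp_all only: r_def)
  ultimately have "r \<noteq> 0" by blast
  then have r: "r = 1 \<or> r = 2" unfolding r_def by presburger
  have "(add3 f f a - add3 f f b) mod 3 = (2 * r) mod 3"
    unfolding add3_def diff_add3 r_def by (simp only: mult_2)
  then have 1: "card (?C 0) \<le> card (?C (((2 * r) mod 3 + 0) mod 3))"
    by (rule card_translate[OF add3_Fx[OF assms(1) assms(1)]])
  have 2: "card (?C 0) \<le> card (?C ((r + 0) mod 3))"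
    by (rule card_translate[OF assms(1)]) (simp only: r_def)
  have "card (?C 0) \<le> card (?C 1) \<and> card (?C 0) \<le> card (?C 2)"
    using r
  proof
    assume r: "r = 1"
    then have e: "((2 * r) mod 3 + 0) mod 3 = 2" "(r + 0) mod 3 = 1" by simp_all
    show ?thesis using 1 2 unfolding e by blast
  next
    assume r: "r = 2"
    then have e: "((2 * r) mod 3 + 0) mod 3 = 1" "(r + 0) mod 3 = 2" by simp_all
    show ?thesis using 1 2 unfolding e by blast
  qed
  then show ?thesis
    using card_Fx_le[of w a b] unfolding card_Fx_split[of w a b] Hp_eq by linarith
qed

lemma tr_fix:
  assumes "f \<in> Fun" "f a = f b" "a < N" "b < N"
  shows "f (tr a b x) = f x"
  using assms by (auto simp: tr_def Fun_def)

text \<open>Functions that agree at \<open>a\<close> and \<open>b\<close> are invariant under the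
  reflection and cannot tell \<open>w\<close> from \<open>w \<circ> tr a b\<close>.\<close>

lemma Hp_comp_tr:
  assumes "a < N" "b < N"
  shows "Hp (w \<circ> tr a b) a b = Hp w a b"
proof -
  have t: "tr a b x < N \<longleftrightarrow> x < N" for x using G_lt[OF tr_G[OF assms]] .
  have "(\<forall>x<N. f (w (tr a b x)) = f x) \<longleftrightarrow> (\<forall>x<N. f (w x) = f x)" if "f \<in> Fun" "f a = f b" for f
  proof -
    note tf = tr_fix[OF that assms]
    have "f (w x) = f x" if *: "\<forall>x<N. f (w (tr a b x)) = f x" and x: "x < N" for x
      using *[rule_format, of "tr a b x"] x t[of x] by (simp add: tr_invol[OF assms] tf)
    moreover have "f (w (tr a b x)) = f x" if *: "\<forall>x<N. f (w x) = f x" and x: "x < N" for x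
      using *[rule_format, of "tr a b x"] x t[of x] by (simp add: tf)
    ultimately show ?thesis by blast
  qed
  then show ?thesis unfolding Hp_def Fx_def by auto
qed

lemma card_Fx_tr_le:
  assumes "a < N" "b < N"
  shows "card (Fx w) \<le> 3 * card (Fx (w \<circ> tr a b))"
proof -
  have "card (Hp w a b) \<le> card (Fx (w \<circ> tr a b))"
    unfolding Hp_comp_tr[OF assms, of w, symmetric] by (rule card_mono) (auto simp: Hp_def)
  then show ?thesis using card_Fx_le[of w a b] by simp
qed

text \<open>The indicator of \<open>p\<close>, made odd under \<open>sg\<close>: 2 stands for -1
  modulo 3. If \<open>sg p = p\<close>, the second test never fires.\<close>

definition point_fun :: "nat \<Rightarrow> nat \<Rightarrow> int" where
  "point_fun p x = (if x = p then 1 else if x = sg p then 2 else 0)"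

lemma point_fun_Fx:
  assumes w: "w \<in> G" "w p = p" and p: "p < N"
  shows "point_fun p \<in> Fx w"
proof -
  have "sg p = p \<or> odd_mode" using sg_even by blast
  moreover have "w (sg p) = sg p" using G_comm[OF w(1)] w(2) by simp
  moreover have inj: "w x = w y \<longleftrightarrow> x = y" for x y using inj_eq[OF permutes_inj[OF G_perm[OF w(1)]]] .
  ultimately have "w x = p \<longleftrightarrow> x = p" "w x = sg p \<longleftrightarrow> x = sg p" for x
    using w(2) by metis+
  moreover have "point_fun p \<in> Fun"
  proof -
    have *: "sg y = z \<longleftrightarrow> y = sg z" for y z by (metis sg_sg)
    have "p < N" "sg p < N" using p by (simp_all add: sg_lt)
    then show ?thesis
      using sg_odd[of p] by (auto simp: Fun_def point_fun_def * sg_even)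
  qed
  ultimately show ?thesis by (simp add: Fx_def point_fun_def)
qed

text \<open>The product with the reflection through \<open>y\<close> and \<open>w y\<close> fixes
  \<open>w y\<close>, so the indicator of \<open>w y\<close> becomes invariant. It separates
  \<open>y\<close> from \<open>w y\<close>, whereas the functions invariant under \<open>w\<close>
  are exactly those on the hyperplane.\<close>

lemma card_Fx_step:
  assumes w: "w \<in> G" and y: "w y \<noteq> y"
  shows "card (Fx (w \<circ> tr y (w y))) = 3 * card (Fx w)"
proof -
  let ?t = "tr y (w y)"
  have yN: "y < N" using y permutes_not_in[OF G_perm[OF w], of y] by fastforce
  then have wN: "w y < N" using G_lt[OF w] by simp
  have fixed: "(w \<circ> ?t) (w y) = w y" by (simp add: tr_simps)
  have "point_fun (w y) \<in> Fx (w \<circ> ?t)"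
    using point_fun_Fx[OF comp_G[OF w tr_G[OF yN wN]] fixed wN] .
  moreover have "point_fun (w y) y \<noteq> point_fun (w y) (w y)" using y by (auto simp: point_fun_def)
  ultimately have "card (Fx (w \<circ> ?t)) = 3 * card (Hp (w \<circ> ?t) y (w y))" by (rule card_Fx_eq)
  moreover have "Hp w y (w y) = Fx w" using yN by (auto simp: Hp_def Fx_def)
  ultimately show ?thesis by (simp add: Hp_comp_tr[OF yN wN])
qed

text \<open>Each reflection that creates a fixed point triples the number of invariant functions, so
  splitting off such reflections reaches the identity after as many steps as the codimension of the
  fixed space. With the lower bound in the next lemma this is Carter's formula for the absolute
  length.\<close>

lemma ex_tr_word:
  assumes "w \<in> G"
  shows "\<exists>ts. set ts \<subseteq> TR \<and> foldr (\<circ>) ts id = w \<and> card (Fx w) * 3 ^ length ts = card Fun"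
  using assms
proof (induction "card Fun - card (Fx w)" arbitrary: w rule: less_induct)
  case less
  show ?case
  proof (cases "\<exists>y. w y \<noteq> y")
    case False
    then have "w = id" by auto
    then show ?thesis by (intro exI[of _ "[]"]) (simp add: Fx_id)
  next
    case True
    then obtain y where y: "w y \<noteq> y" by blast
    let ?t = "tr y (w y)"
    have yN: "y < N" using y permutes_not_in[OF G_perm[OF less.prems], of y] by fastforce
    then have wN: "w y < N" using G_lt[OF less.prems] by simp
    have wt: "w \<circ> ?t \<in> G" using comp_G[OF less.prems tr_G[OF yN wN]] .
    have c: "card (Fx (w \<circ> ?t)) = 3 * card (Fx w)" using card_Fx_step[OF less.prems y] .
    have pos: "card (Fx w) > 0" using zero_Fx[of w] card_gt_0_iff[of "Fx w"] by auto
    have le: "card (Fx (w \<circ> ?t)) \<le> card Fun" by (rule card_mono[OF finite_Fun]) (auto simp: Fx_def)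
    obtain ts where ts: "set ts \<subseteq> TR" "foldr (\<circ>) ts id = w \<circ> ?t"
      "card (Fx (w \<circ> ?t)) * 3 ^ length ts = card Fun"
    proof -
      have "card Fun - card (Fx (w \<circ> ?t)) < card Fun - card (Fx w)" using c pos le by simp
      then show thesis using less.hyps[OF _ wt] that by blast
    qed
    have "foldr (\<circ>) (ts @ [?t]) id = w"
    proof -
      have *: "foldr (\<circ>) ts f = foldr (\<circ>) ts id \<circ> f" for f :: "nat \<Rightarrow> nat"
        by (induction ts) (auto simp: comp_assoc)
      show ?thesis using *[of ?t] ts(2) tr_invol[OF yN wN] by (auto simp: fun_eq_iff)
    qed
    moreover have "?t \<in> TR" unfolding TR_def using yN wN y[symmetric] by blast
    ultimately show ?thesis using ts c by (intro exI[of _ "ts @ [?t]"]) simp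
  qed
qed

lemma tr_word_lower:
  assumes "set ts \<subseteq> TR"
  shows "card Fun \<le> 3 ^ length ts * card (Fx (foldr (\<circ>) ts id))"
  using assms
proof (induction ts rule: rev_induct)
  case Nil
  then show ?case using Fx_id by (simp add: id_def)
next
  case (snoc t ts)
  have *: "foldr (\<circ>) ts f = foldr (\<circ>) ts id \<circ> f" for f :: "nat \<Rightarrow> nat"
    by (induction ts) (auto simp: comp_assoc)
  obtain a b where t: "t = tr a b" "a < N" "b < N" using snoc.prems by (auto simp: TR_def)
  have "card (Fx (foldr (\<circ>) ts id)) \<le> 3 * card (Fx (foldr (\<circ>) (ts @ [t]) id))"
    using card_Fx_tr_le[OF t(2,3), of "foldr (\<circ>) ts id"] *[of t] t(1) by simp
  note step = this
  have IH: "card Fun \<le> 3 ^ length ts * card (Fx (foldr (\<circ>) ts id))" using snoc.IH snoc.prems by (simp only: set_append Un_subset_iff)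
  have "3 ^ length ts * card (Fx (foldr (\<circ>) ts id))
      \<le> 3 ^ length ts * (3 * card (Fx (foldr (\<circ>) (ts @ [t]) id)))"
    using step by (intro mult_le_mono2)
  then have "card Fun \<le> 3 ^ length ts * (3 * card (Fx (foldr (\<circ>) (ts @ [t]) id)))" using IH by (rule order_trans[rotated])
  then show ?case by (simp only: length_append_singleton power_Suc2 mult.assoc)
qed

end

text \<open>The modulus is odd, so that only 0 equals its own negative and odd functions vanish on
  self-antipodal cycles.\<close>

lemma neg3:
  assumes "0 \<le> p" "p < (3::int)"
  shows "(- ((- p) mod 3)) mod 3 = p" "p = (- p) mod 3 \<Longrightarrow> p = 0"
proof -
  have "p = 0 \<or> p = 1 \<or> p = 2" using assms by linarith
  then show "(- ((- p) mod 3)) mod 3 = p" "p = (- p) mod 3 \<Longrightarrow> p = 0" by auto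
qed

lemma card_trichotomy:
  assumes "finite A"
  shows "card A = card {x \<in> A. f x < x} + card {x \<in> A. x < f x} + card {x \<in> A. f x = (x::nat)}"
proof -
  let ?L = "{x \<in> A. f x < x}" and ?M = "{x \<in> A. x < f x}" and ?E = "{x \<in> A. f x = x}"
  have "card A = card ((?L \<union> ?M) \<union> ?E)" by (rule arg_cong[where f = card]) auto
  also have "\<dots> = card (?L \<union> ?M) + card ?E"
  proof (rule card_Un_disjoint)
    show "(?L \<union> ?M) \<inter> ?E = {}" by (rule equals0I, elim IntE UnE CollectE conjE) simp_all
  qed (use assms in simp_all)
  also have "card (?L \<union> ?M) = card ?L + card ?M"
  proof (rule card_Un_disjoint)
    show "?L \<inter> ?M = {}" by (rule equals0I, elim IntE UnE CollectE conjE) simp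
  qed (use assms in simp_all)
  finally show ?thesis .
qed

context sym_perms begin

section \<open>The fixed dimension in terms of cycles\<close>

definition cycle_top :: "(nat \<Rightarrow> nat) \<Rightarrow> nat \<Rightarrow> nat" where
  "cycle_top w x = Max (orbit w x)"

text \<open>The cycles on which an invariant function can be prescribed freely. In type B this is
  one cycle of each antipodal pair, the one with the larger top; a self-antipodal cycle fails the
  strict inequality and is left out, as odd functions vanish there.\<close>

definition Rep :: "(nat \<Rightarrow> nat) \<Rightarrow> nat set" where
  "Rep w = {x \<in> cycle_tops N w. odd_mode \<longrightarrow> cycle_top w (sg x) < x}"

definition d :: "(nat \<Rightarrow> nat) \<Rightarrow> nat" where
  "d w = card (Rep w)"

definition balanced :: "(nat \<Rightarrow> nat) \<Rightarrow> nat \<Rightarrow> bool" where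
  "balanced w x \<longleftrightarrow> odd_mode \<and> sg x \<in> orbit w x"

definition bal :: "(nat \<Rightarrow> nat) \<Rightarrow> nat" where
  "bal w = card {x \<in> cycle_tops N w. balanced w x}"

context
  fixes w assumes w: "w \<in> G"
begin

lemma top_in: "cycle_top w x \<in> orbit w x"
  unfolding cycle_top_def using orbit_finite[OF G_perm[OF w]] self_in_orbit[OF G_perm[OF w], of x]
  by (intro Max_in) auto

lemma top_ge: "y \<in> orbit w x \<Longrightarrow> y \<le> cycle_top w x"
  unfolding cycle_top_def using orbit_finite[OF G_perm[OF w]] by (rule Max_ge)

lemma top_eq: "y \<in> orbit w x \<Longrightarrow> cycle_top w y = cycle_top w x"
  unfolding cycle_top_def using orbit_eq[OF G_perm[OF w]] by simp

lemma orbit_sg: "y \<in> orbit w x \<Longrightarrow> sg y \<in> orbit w (sg x)"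
proof (induction rule: orbit.induct)
  case base
  show ?case using G_comm[OF w, of x] orbit.base[of w "sg x"] by simp
next
  case (step y)
  then show ?case using G_comm[OF w, of y] orbit.step[of "sg y" w "sg x"] by simp
qed

lemma top_sg_top: "cycle_top w (sg (cycle_top w x)) = cycle_top w (sg x)"
  by (rule top_eq[OF orbit_sg[OF top_in]])

lemma top_lt: "cycle_top w x < N \<longleftrightarrow> x < N"
  using orbit_lt[OF G_perm[OF w] top_in] .

lemma top_cycle_tops: "x < N \<Longrightarrow> cycle_top w x \<in> cycle_tops N w"
  using top_lt[of x] top_ge orbit_eq[OF G_perm[OF w] top_in, of x]
  by (auto simp: cycle_tops_def)

lemma top_id: "x \<in> cycle_tops N w \<Longrightarrow> cycle_top w x = x"
  using top_in[of x] top_ge[OF self_in_orbit[OF G_perm[OF w]], of x] by (force simp: cycle_tops_def)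

lemma cycle_tops_iff: "x \<in> cycle_tops N w \<longleftrightarrow> x < N \<and> cycle_top w x = x"
  using top_id top_cycle_tops[of x] by (auto simp: cycle_tops_def)

lemma top_Rep: "x < N \<Longrightarrow> cycle_top w x \<in> Rep w \<longleftrightarrow> (odd_mode \<longrightarrow> cycle_top w (sg x) < cycle_top w x)"
  using top_cycle_tops by (simp add: Rep_def top_sg_top)

lemma balanced_top: "balanced w x \<longleftrightarrow> odd_mode \<and> cycle_top w (sg x) = cycle_top w x"
  unfolding balanced_def using top_eq[of "sg x" x] top_in[of "sg x"] top_in[of x]
    orbit_eq[OF G_perm[OF w]] self_in_orbit[OF G_perm[OF w]] by metis

lemma Fx_orbit: "f \<in> Fx w \<Longrightarrow> x < N \<Longrightarrow> y \<in> orbit w x \<Longrightarrow> f y = f x"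
proof -
  assume f: "f \<in> Fx w" and x: "x < N" and y: "y \<in> orbit w x"
  have "y \<in> {y. y < N \<and> f y = f x}"
  proof (rule subsetD[OF orbit_subset_closed y])
    show "x \<in> {y. y < N \<and> f y = f x}" using x by simp
    show "w z \<in> {y. y < N \<and> f y = f x}" if "z \<in> {y. y < N \<and> f y = f x}" for z
      using that f G_lt[OF w, of z] by (simp add: Fx_def)
  qed
  then show ?thesis by simp
qed

lemma Fx_values:
  assumes f: "f \<in> Fx w" and x: "x < N"
  shows "f x = (if cycle_top w x \<in> Rep w then f (cycle_top w x)
    else if cycle_top w (sg x) \<in> Rep w then (- f (cycle_top w (sg x))) mod 3 else 0)"
proof (cases "cycle_top w x \<in> Rep w")
  case True
  then show ?thesis using Fx_orbit[OF f x top_in] by simp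
next
  case False
  then have odd: odd_mode "\<not> cycle_top w (sg x) < cycle_top w x" using top_Rep[OF x] by auto
  have sx: "sg x < N" using x by (simp add: sg_lt)
  have fs: "f (sg x) = (- f x) mod 3" using f x odd by (simp add: Fx_def Fun_def)
  have r: "0 \<le> f x" "f x < 3" using Fx_range[OF f, of x] by auto
  have t: "f (cycle_top w (sg x)) = f (sg x)" "f (cycle_top w x) = f x" using Fx_orbit[OF f _ top_in] x sx by auto
  show ?thesis
  proof (cases "cycle_top w (sg x) = cycle_top w x")
    case True
    then have "f x = (- f x) mod 3" using t fs by simp
    then have "f x = 0" by (rule neg3(2)[OF r])
    then show ?thesis using False True by simp
  next
    case neq: False
    then have "cycle_top w x < cycle_top w (sg x)" using odd by simp
    then have "cycle_top w (sg x) \<in> Rep w" using top_Rep[OF sx] by simp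
    moreover have "f x = (- ((- f x) mod 3)) mod 3" using neg3(1)[OF r] by simp
    ultimately show ?thesis using False t fs by simp
  qed
qed

definition ext_fun :: "(nat \<Rightarrow> int) \<Rightarrow> nat \<Rightarrow> int" where
  "ext_fun g x = (if \<not> x < N then 0 else if cycle_top w x \<in> Rep w then g (cycle_top w x)
    else if cycle_top w (sg x) \<in> Rep w then (- g (cycle_top w (sg x))) mod 3 else 0)"

lemma Rep_sg: "x < N \<Longrightarrow> odd_mode \<Longrightarrow> cycle_top w x \<in> Rep w \<Longrightarrow> cycle_top w (sg x) \<notin> Rep w"
  using top_Rep[of x] top_Rep[of "sg x"] by (simp add: sg_lt)

lemma ext_fun_Fx:
  assumes g: "g \<in> Rep w \<rightarrow>\<^sub>E {0..<3}"
  shows "ext_fun g \<in> Fx w"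
proof -
  have gr: "0 \<le> g x \<and> g x < 3" if "x \<in> Rep w" for x using PiE_mem[OF g that] by simp
  have "ext_fun g (sg x) = (if odd_mode then (- ext_fun g x) mod 3 else ext_fun g x)" if x: "x < N" for x
  proof (cases odd_mode)
    case True
    have *: "g y = (- ((- g y) mod 3)) mod 3" if "y \<in> Rep w" for y using neg3(1) gr[OF that] by simp
    show ?thesis using x True Rep_sg[OF x True] *[of "cycle_top w (sg x)"]
      by (simp add: ext_fun_def sg_lt)
  qed (simp add: sg_even)
  moreover have "ext_fun g x \<in> {0..<3}" for x
    using gr by (simp add: ext_fun_def)
  ultimately have "ext_fun g \<in> Fun" by (simp add: Fun_def) (simp add: ext_fun_def)
  moreover have "ext_fun g (w x) = ext_fun g x" if "x < N" for x
  proof -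
    have "cycle_top w (w x) = cycle_top w x" by (rule top_eq[OF orbit.base])
    moreover have "cycle_top w (sg (w x)) = cycle_top w (sg x)"
      unfolding G_comm[OF w, symmetric] by (rule top_eq[OF orbit.base])
    ultimately show ?thesis using that G_lt[OF w, of x] by (simp add: ext_fun_def)
  qed
  ultimately show ?thesis by (simp add: Fx_def)
qed

text \<open>Restriction to \<open>Rep w\<close> is a bijection onto all functions to
  \<open>{0..<3}\<close>, with inverse \<open>ext_fun\<close>.\<close>

lemma card_Fx: "card (Fx w) = 3 ^ d w"
proof -
  have RN: "x < N \<and> cycle_top w x = x" if "x \<in> Rep w" for x
    using that cycle_tops_iff by (simp add: Rep_def)
  have "bij_betw (\<lambda>f. restrict f (Rep w)) (Fx w) (Rep w \<rightarrow>\<^sub>E {0..<3})"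
  proof (rule bij_betw_byWitness[of _ ext_fun])
    show "\<forall>f\<in>Fx w. ext_fun (restrict f (Rep w)) = f"
    proof
      fix f assume f: "f \<in> Fx w"
      show "ext_fun (restrict f (Rep w)) = f"
      proof
        fix x show "ext_fun (restrict f (Rep w)) x = f x"
        proof (cases "x < N")
          case True
          then show ?thesis using Fx_values[OF f True] by (simp add: ext_fun_def)
        next
          case False
          then show ?thesis using f by (simp add: ext_fun_def Fx_def Fun_def)
        qed
      qed
    qed
    show "\<forall>g\<in>Rep w \<rightarrow>\<^sub>E {0..<3}. restrict (ext_fun g) (Rep w) = g"
    proof
      fix g :: "nat \<Rightarrow> int" assume g: "g \<in> Rep w \<rightarrow>\<^sub>E {0..<3}"
      show "restrict (ext_fun g) (Rep w) = g"
      proof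
        fix x show "restrict (ext_fun g) (Rep w) x = g x"
        proof (cases "x \<in> Rep w")
          case True
          then show ?thesis using RN[OF True] by (simp add: ext_fun_def)
        next
          case False
          then show ?thesis using PiE_arb[OF g False] by simp
        qed
      qed
    qed
    show "(\<lambda>f. restrict f (Rep w)) ` Fx w \<subseteq> Rep w \<rightarrow>\<^sub>E {0..<3}"
      using Fx_range[of _ w] by (intro image_subsetI restrict_PiE_iff[THEN iffD2] ballI)
    show "ext_fun ` (Rep w \<rightarrow>\<^sub>E {0..<3}) \<subseteq> Fx w" using ext_fun_Fx by blast
  qed
  then have "card (Fx w) = card (Rep w \<rightarrow>\<^sub>E {0..<3::int})" by (rule bij_betw_same_card)
  moreover have "finite (Rep w)"
    by (rule finite_subset[of _ "{..<N}"]) (auto simp: Rep_def cycle_tops_def)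
  ultimately show ?thesis by (simp add: card_PiE d_def)
qed

text \<open>Passing to the top of the antipodal cycle exchanges \<open>Rep w\<close> with the tops
  that are smaller than their partner; the tops that are their own partner belong to the balanced
  cycles.\<close>

lemma cyc_d: "cyc N w = (if odd_mode then 2 * d w + bal w else d w)"
proof (cases odd_mode)
  case False
  then show ?thesis by (simp add: cyc_def d_def Rep_def)
next
  case True
  let ?B = "{x \<in> cycle_tops N w. balanced w x}"
  let ?M = "{x \<in> cycle_tops N w. x < cycle_top w (sg x)}"
  have fin: "finite (cycle_tops N w)" by (rule finite_subset[of _ "{..<N}"]) (auto simp: cycle_tops_def)
  have R: "Rep w = {x \<in> cycle_tops N w. cycle_top w (sg x) < x}" using True by (simp add: Rep_def)
  have B: "?B = {x \<in> cycle_tops N w. cycle_top w (sg x) = x}"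
    using True balanced_top top_id by auto
  have "bij_betw (\<lambda>x. cycle_top w (sg x)) (Rep w) ?M"
  proof (rule bij_betw_byWitness[of _ "\<lambda>x. cycle_top w (sg x)"])
    have *: "cycle_top w (sg (cycle_top w (sg x))) = x" if "x \<in> cycle_tops N w" for x
      using top_sg_top[of "sg x"] top_id[OF that] by simp
    have **: "cycle_top w (sg x) \<in> cycle_tops N w" if "x \<in> cycle_tops N w" for x
      using that cycle_tops_iff top_cycle_tops sg_lt by blast
    show "\<forall>x\<in>Rep w. cycle_top w (sg (cycle_top w (sg x))) = x" "\<forall>x\<in>?M. cycle_top w (sg (cycle_top w (sg x))) = x"
      using * R by auto
    show "(\<lambda>x. cycle_top w (sg x)) ` Rep w \<subseteq> ?M" "(\<lambda>x. cycle_top w (sg x)) ` ?M \<subseteq> Rep w"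
      using * ** R by auto
  qed
  then have "card (Rep w) = card ?M" by (rule bij_betw_same_card)
  moreover have "card (cycle_tops N w) = card (Rep w) + card ?M + card ?B"
    unfolding R B by (rule card_trichotomy[OF fin])
  ultimately have "cyc N w = 2 * card (Rep w) + card ?B" unfolding cyc_def by linarith
  then show ?thesis using True by (simp add: d_def bal_def)
qed

end

lemma Fx_conj:
  assumes g: "g \<in> G" and w: "w \<in> G"
  shows "d (g \<circ> w \<circ> pinv g) = d w"
proof -
  have gw: "g \<circ> w \<circ> pinv g \<in> G" using comp_G pinv_G g w by blast
  have inv: "g (pinv g x) = x" "pinv g (g x) = x" for x using permutes_inverses[OF G_perm[OF g]] by auto
  note gi = pinv_G[OF g]
  have "bij_betw (\<lambda>f. f \<circ> pinv g) (Fx w) (Fx (g \<circ> w \<circ> pinv g))"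
  proof (rule bij_betw_byWitness[of _ "\<lambda>f. f \<circ> g"])
    show "\<forall>f\<in>Fx w. (f \<circ> pinv g) \<circ> g = f" "\<forall>f\<in>Fx (g \<circ> w \<circ> pinv g). (f \<circ> g) \<circ> pinv g = f"
      using inv by (auto simp: fun_eq_iff)
    show "(\<lambda>f. f \<circ> pinv g) ` Fx w \<subseteq> Fx (g \<circ> w \<circ> pinv g)"
      using G_lt[OF gi] G_comm[OF gi] inv by (auto simp: Fx_def Fun_def not_less[symmetric])
    show "(\<lambda>f. f \<circ> g) ` Fx (g \<circ> w \<circ> pinv g) \<subseteq> Fx w"
    proof (rule image_subsetI)
      fix f assume f: "f \<in> Fx (g \<circ> w \<circ> pinv g)"
      have "(f \<circ> g) (w x) = (f \<circ> g) x" if "x < N" for x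
      proof -
        have "f ((g \<circ> w \<circ> pinv g) (g x)) = f (g x)" using f that G_lt[OF g, of x] by (simp add: Fx_def)
        then show ?thesis by (simp add: inv)
      qed
      moreover have "f \<circ> g \<in> Fun"
        using f G_lt[OF g] G_comm[OF g] by (auto simp: Fx_def Fun_def not_less[symmetric])
      ultimately show "f \<circ> g \<in> Fx w" by (simp add: Fx_def)
    qed
  qed
  then have "card (Fx w) = card (Fx (g \<circ> w \<circ> pinv g))" by (rule bij_betw_same_card)
  then show ?thesis using card_Fx[OF w] card_Fx[OF gw] by simp
qed

definition D :: nat where "D = d id"

lemma card_Fun: "card Fun = 3 ^ D"
  using card_Fx[OF id_G] by (simp add: Fx_id D_def)

lemma ex_tr_word_d:
  assumes "w \<in> G"
  obtains ts where "set ts \<subseteq> TR" "foldr (\<circ>) ts id = w" "length ts + d w = D"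
proof -
  obtain ts where ts: "set ts \<subseteq> TR" "foldr (\<circ>) ts id = w" "card (Fx w) * 3 ^ length ts = card Fun"
    using ex_tr_word[OF assms] by blast
  have "(3::nat) ^ (length ts + d w) = 3 ^ D"
    using ts(3) by (simp add: card_Fx[OF assms] card_Fun power_add mult.commute)
  then show thesis using ts that by simp
qed

lemma tr_word_lower_d:
  assumes "set ts \<subseteq> TR"
  shows "D \<le> length ts + d (foldr (\<circ>) ts id)"
proof -
  have "foldr (\<circ>) ts id \<in> G" using assms
    by (induction ts) (use TR_G id_G comp_G in auto)
  then have "(3::nat) ^ D \<le> 3 ^ (length ts + d (foldr (\<circ>) ts id))"
    using tr_word_lower[OF assms] by (simp add: card_Fun card_Fx power_add)
  then show ?thesis by simp
qed

text \<open>Concatenating shortest reflection words for \<open>u\<close> and \<open>v\<close> shows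
  that \<open>D - d\<close>, the absolute length, is subadditive.\<close>

lemma d_subadd:
  assumes "u \<in> G" "v \<in> G"
  shows "d u + d v \<le> D + d (u \<circ> v)"
proof -
  obtain ts where ts: "set ts \<subseteq> TR" "foldr (\<circ>) ts id = u" "length ts + d u = D"
    by (rule ex_tr_word_d[OF assms(1)])
  obtain rs where rs: "set rs \<subseteq> TR" "foldr (\<circ>) rs id = v" "length rs + d v = D"
    by (rule ex_tr_word_d[OF assms(2)])
  have *: "foldr (\<circ>) ts f = foldr (\<circ>) ts id \<circ> f" for f :: "nat \<Rightarrow> nat"
    by (induction ts) (auto simp: comp_assoc)
  have "foldr (\<circ>) (ts @ rs) id = u \<circ> v" using *[of v] ts rs by simp
  moreover have "D \<le> length (ts @ rs) + d (foldr (\<circ>) (ts @ rs) id)"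
    by (rule tr_word_lower_d) (use ts rs in auto)
  ultimately show ?thesis using ts rs by simp
qed

lemma d_step:
  assumes w: "w \<in> G" "w y \<noteq> y"
  shows "d (w \<circ> tr y (w y)) = d w + 1"
proof -
  have yN: "y < N" using w permutes_not_in[OF G_perm[OF w(1)], of y] by fastforce
  then have wN: "w y < N" using G_lt[OF w(1)] by simp
  have wt: "w \<circ> tr y (w y) \<in> G" using comp_G[OF w(1) tr_G[OF yN wN]] .
  have "(3::nat) ^ d (w \<circ> tr y (w y)) = 3 ^ (d w + 1)"
    using card_Fx_step[OF w] card_Fx[OF w(1)] card_Fx[OF wt] by (simp only: power_add power_one_right mult.commute)
  then show ?thesis by (simp only: power_inject_exp)
qed

text \<open>If the reflection enlarges the fixed space, all functions fixed by \<open>v\<close>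
  agree at \<open>a\<close> and \<open>b\<close>. A cycle that is not balanced carries a fixed
  function with value 1 on it and 2, that is -1, on its antipode; so two different cycles remain
  unseparated only if both are balanced.\<close>

lemma tr_below_same:
  assumes v: "v \<in> G" and ab: "a < N" "b < N" and d: "d (v \<circ> tr a b) = d v + 1"
  shows "b \<in> orbit v a \<or> balanced v a \<and> balanced v b"
proof -
  have all: "f a = f b" if f: "f \<in> Fx v" for f
  proof (rule ccontr)
    assume "f a \<noteq> f b"
    then have 1: "card (Fx v) = 3 * card (Hp v a b)" using card_Fx_eq[OF f] by blast
    have "card (Fx (v \<circ> tr a b)) \<le> 3 * card (Hp v a b)"
      using card_Fx_le[of "v \<circ> tr a b" a b] by (simp add: Hp_comp_tr[OF ab])
    then have "(3::nat) ^ (d v + 1) \<le> 3 ^ d v"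
      using 1 card_Fx[OF v] card_Fx[OF comp_G[OF v tr_G[OF ab]]] d by simp
    then show False by simp
  qed
  have key: "balanced v p" if neq: "\<forall>f\<in>Fx v. f p = f q" and pq: "p < N" "q < N" "q \<notin> orbit v p" for p q
  proof (rule ccontr)
    assume nb: "\<not> balanced v p"
    define g where "g x = (if x \<in> orbit v p then 1 else if x \<in> orbit v (sg p) then 2 else 0::int)" for x
    have orb: "x \<in> orbit v y \<longleftrightarrow> v x \<in> orbit v y" for x y
      using orbit.step[of x v y] orbit_eq[OF G_perm[OF v]] orbit.base[of v x] orbit_sym[OF G_perm[OF v]]
      by metis
    have sgo: "sg x \<in> orbit v (sg y) \<longleftrightarrow> x \<in> orbit v y" for x y
      using orbit_sg[OF v, of x y] orbit_sg[OF v, of "sg x" "sg y"] by auto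
    have lt: "x < N" if "x \<in> orbit v p \<or> x \<in> orbit v (sg p)" for x
      using that orbit_lt[OF G_perm[OF v]] pq sg_lt by blast
    have disj: "x \<notin> orbit v (sg p)" if "x \<in> orbit v p" odd_mode for x
    proof
      assume "x \<in> orbit v (sg p)"
      then have "sg p \<in> orbit v p" using that orbit_sym[OF G_perm[OF v]] orbit_trans by metis
      then show False using nb that by (simp add: balanced_def)
    qed
    have "g (sg x) = (if odd_mode then (- g x) mod 3 else g x)" for x
    proof (cases odd_mode)
      case True
      then show ?thesis using sgo[of x p] sgo[of x "sg p"] disj[of x] by (auto simp: g_def)
    qed (simp add: sg_even)
    then have "g \<in> Fun" using lt by (fastforce simp: Fun_def g_def)
    then have "g \<in> Fx v" using orb by (simp add: Fx_def g_def)
    then have "g p = g q" using neq by blast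
    then show False using pq(3) self_in_orbit[OF G_perm[OF v], of p] by (simp add: g_def split: if_splits)
  qed
  show ?thesis
  proof (cases "b \<in> orbit v a")
    case False
    then have "balanced v a" using key[of a b] all ab by blast
    moreover have "a \<notin> orbit v b" using False orbit_sym[OF G_perm[OF v]] by blast
    then have "balanced v b" using key[OF _ ab(2,1)] all[symmetric] by blast
    ultimately show ?thesis by simp
  qed simp
qed

end

lemma cyc_id: "cyc N id = N"
proof -
  have "orbit id x = {x}" for x :: nat by (simp add: orbit_eq_singleton_iff)
  then have "cycle_tops N id = {..<N}" by (auto simp: cycle_tops_def)
  then show ?thesis by (simp add: cyc_def)
qed

text \<open>With the identity in place of \<open>sg\<close>, the fixed dimension is the number of
  cycles.\<close>

lemma cyc_subadd:
  assumes "N > 0" "u permutes {..<N}" "v permutes {..<N}"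
  shows "cyc N u + cyc N v \<le> N + cyc N (u \<circ> v)"
proof -
  interpret A: sym_perms N "\<lambda>x. x" 0
    by unfold_locales (use assms permutes_id[of "{..<N}"] in \<open>simp_all add: id_def\<close>)
  have G: "w \<in> A.G" if "w permutes {..<N}" for w using that by (simp add: A.G_def)
  have d: "cyc N w = A.d w" if "w permutes {..<N}" for w using A.cyc_d[OF G[OF that]] by simp
  have "A.D = N" using d[OF permutes_id] by (simp add: A.D_def cyc_id)
  then show ?thesis
    using A.d_subadd[OF G[OF assms(2)] G[OF assms(3)]] d[OF assms(2)] d[OF assms(3)]
      d[OF permutes_compose[OF assms(3,2)]] by simp
qed

lemma cyc_conj:
  assumes "N > 0" "g permutes {..<N}" "w permutes {..<N}"
  shows "cyc N (g \<circ> w \<circ> pinv g) = cyc N w"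
proof -
  interpret A: sym_perms N "\<lambda>x. x" 0
    by unfold_locales (use assms permutes_id[of "{..<N}"] in \<open>simp_all add: id_def\<close>)
  have G: "w \<in> A.G" if "w permutes {..<N}" for w using that by (simp add: A.G_def)
  have gw: "g \<circ> w \<circ> pinv g \<in> A.G"
    using A.comp_G[OF A.comp_G[OF G[OF assms(2)] G[OF assms(3)]] A.pinv_G[OF G[OF assms(2)]]] .
  show ?thesis
    using A.Fx_conj[OF G[OF assms(2)] G[OF assms(3)]] A.cyc_d[OF G[OF assms(3)]] A.cyc_d[OF gw] by simp
qed

lemma cdist_unique:
  assumes "x < N" "e < N" "(x + e) mod N = y"
  shows "cdist N x y = e"
proof (cases "x + e < N")
  case True
  then show ?thesis using assms by (simp add: cdist_eq)
next
  case False
  then have "(x + e) mod N = (x + e - N) mod N" by (simp add: le_mod_geq)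
  also have "\<dots> = x + e - N" using assms by simp
  finally have y: "y = x + e - N" using assms(3) by simp
  then have "y < x" "y < N" using assms False by auto
  then show ?thesis using y assms False by (simp add: cdist_eq)
qed

lemma cdist_add: "x < N \<Longrightarrow> y < N \<Longrightarrow> (x + cdist N x y) mod N = y"
  by (simp add: cdist_eq)

lemma cdist_less: "x < N \<Longrightarrow> cdist N x y < N"
  by (simp add: cdist_def)

lemma cdist_zero: "x < N \<Longrightarrow> y < N \<Longrightarrow> cdist N x y = 0 \<longleftrightarrow> x = y"
  by (auto simp: cdist_eq split: if_splits)

lemma cdist_inj: "x < N \<Longrightarrow> y < N \<Longrightarrow> z < N \<Longrightarrow> cdist N x y = cdist N x z \<Longrightarrow> y = z"
  by (metis cdist_add)

lemma cdist_diff: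
  assumes "x < N" "y < N" "z < N" "cdist N x y \<le> cdist N x z"
  shows "cdist N y z = cdist N x z - cdist N x y"
proof (rule cdist_unique)
  have "(y + (cdist N x z - cdist N x y)) mod N = ((x + cdist N x y) mod N + (cdist N x z - cdist N x y)) mod N"
    unfolding cdist_add[OF assms(1,2)] ..
  also have "\<dots> = (x + cdist N x y + (cdist N x z - cdist N x y)) mod N" by (rule mod_add_left_eq)
  also have "x + cdist N x y + (cdist N x z - cdist N x y) = x + cdist N x z" using assms(4) by simp
  finally show "(y + (cdist N x z - cdist N x y)) mod N = z" using cdist_add[OF assms(1,3)] by simp
qed (use assms cdist_less[of x N z] in auto)

lemma cdist_shift:
  assumes "x < N" "y < N"
  shows "cdist N ((shift N ^^ k) x) ((shift N ^^ k) y) = cdist N x y"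
proof (rule cdist_unique)
  have "((x + k) mod N + cdist N x y) mod N = (x + k + cdist N x y) mod N" by (rule mod_add_left_eq)
  also have "x + k + cdist N x y = x + cdist N x y + k" by simp
  also have "(x + cdist N x y + k) mod N = ((x + cdist N x y) mod N + k) mod N"
    by (rule mod_add_left_eq[symmetric])
  finally show "((shift N ^^ k) x + cdist N x y) mod N = (shift N ^^ k) y"
    using assms by (simp add: shift_funpow cdist_add)
qed (use assms cdist_less in \<open>auto simp: shift_funpow\<close>)

text \<open>Both permutations send a point to the nearest clockwise member of the same
  class.\<close>

lemma increasing_unique:
  assumes u: "u permutes {..<N}" "increasing_cycles N u"
    and v: "v permutes {..<N}" "increasing_cycles N v"
    and eq: "\<And>x. x < N \<Longrightarrow> orbit u x = orbit v x"
  shows "u = v"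
proof
  fix x
  show "u x = v x"
  proof (cases "x < N")
    case False
    then show ?thesis using permutes_not_in[OF u(1)] permutes_not_in[OF v(1)] by simp
  next
    case True
    have uo: "u x \<in> orbit v x" and vo: "v x \<in> orbit u x"
      using eq[OF True] orbit.base[of u x] orbit.base[of v x] by auto
    have lt: "u x < N" "v x < N"
      using permutes_in_image[OF u(1), of x] permutes_in_image[OF v(1), of x] True by auto
    show ?thesis
    proof (cases "u x = x \<or> v x = x")
      case True2: True
      then show ?thesis
        using increasing_cyclic_next(1)[OF u True vo] increasing_cyclic_next(1)[OF v True uo] by metis
    next
      case False
      then have "cdist N x (u x) = cdist N x (v x)"
        using increasing_cyclic_next(2)[OF u True vo] increasing_cyclic_next(2)[OF v True uo] by simp
      then show ?thesis using cdist_inj[OF True lt] by simp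
    qed
  qed
qed

lemma noncrossing_restrict:
  assumes "noncrossing N (same_cycle u)"
  shows "noncrossing N (\<lambda>x y. x < N \<and> same_cycle u x y)"
  unfolding noncrossing_def
proof (intro allI impI)
  fix a b c d
  assume A: "a < b \<and> b < c \<and> c < d \<and> d < N \<and> (a < N \<and> same_cycle u a c) \<and> (b < N \<and> same_cycle u b d)"
  then have "same_cycle u a b" using assms unfolding noncrossing_def by blast
  then show "a < N \<and> same_cycle u a b" using A by simp
qed

section \<open>Points on a circle, the half turn, and permutations below the long cycle\<close>

locale cyclic_perms = sym_perms +
  assumes N_ge: "N \<ge> 2"
    and sg_shift: "0 < md \<Longrightarrow> even N \<and> sg = shift N ^^ (N div 2)"
begin

lemma sg_eq: "odd_mode \<Longrightarrow> x < N \<Longrightarrow> sg x = (if x < N div 2 then x + N div 2 else x - N div 2)"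
proof -
  assume o: odd_mode and x: "x < N"
  obtain n where n: "N = 2 * n" using sg_shift[OF o] by (auto elim: evenE)
  have "sg x = (x + n) mod N" using sg_shift[OF o] x n by (simp add: shift_funpow)
  then show ?thesis using x n by (auto simp: mod_if)
qed

lemma sg_pow: "\<exists>k. sg = shift N ^^ k"
  using sg_shift sg_even by (cases odd_mode) (auto intro: exI[of _ 0] simp: fun_eq_iff)

lemma shift_G: "shift N \<in> G"
proof -
  obtain k where "sg = shift N ^^ k" using sg_pow by blast
  then have "shift N (sg x) = sg (shift N x)" for x by (simp add: funpow_swap1)
  then show ?thesis using shift_permutes by (simp add: G_def)
qed

definition nc_perm :: "(nat \<Rightarrow> nat) \<Rightarrow> bool" where
  "nc_perm u \<longleftrightarrow> u \<in> G \<and> increasing_cycles N u \<and> noncrossing N (same_cycle u)"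

text \<open>Two diameters of a circle cross. Each of the two classes is first represented by a
  diameter whose smaller end lies in the first half of the circle.\<close>

lemma antipodes_related:
  assumes R: "equiv_below N R" "noncrossing N R" and o: odd_mode
    and a: "R a (sg a)" and b: "R b (sg b)"
  shows "R a b"
proof -
  note RD = equiv_belowD[OF R(1)]
  let ?n = "N div 2"
  have n: "N = 2 * ?n" using sg_shift[OF o] by auto
  have ex: "\<exists>p0. R p p0 \<and> p0 < ?n \<and> R p0 (p0 + ?n)" if p: "R p (sg p)" for p
  proof (cases "p < ?n")
    case True
    then show ?thesis using p RD(1,2) sg_eq[OF o RD(2)[OF p]] by auto
  next
    case False
    have pN: "p < N" using RD(2)[OF p] .
    have s: "sg p = p - ?n" "p - ?n < ?n" using sg_eq[OF o pN] False pN n by auto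
    have "R (p - ?n) p" using RD(4)[OF p] s by simp
    then have "R (p - ?n) (p - ?n + ?n)" using False by simp
    then show ?thesis using p s by auto
  qed
  obtain a0 where a0: "R a a0" "a0 < ?n" "R a0 (a0 + ?n)" using ex[OF a] by blast
  obtain b0 where b0: "R b b0" "b0 < ?n" "R b0 (b0 + ?n)" using ex[OF b] by blast
  have nc: "R p q" if "p < q" "q < ?n" "R p (p + ?n)" "R q (q + ?n)" for p q
  proof -
    have "p < q \<and> q < p + ?n \<and> p + ?n < q + ?n \<and> q + ?n < N \<and> R p (p + ?n) \<and> R q (q + ?n)"
      using that n by simp
    then show ?thesis using R(2) unfolding noncrossing_def by blast
  qed
  have "R a0 b0"
  proof -
    consider "a0 < b0" | "a0 = b0" | "b0 < a0" by linarith
    then show ?thesis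
    proof cases
      case 1 then show ?thesis using nc[OF 1] a0 b0 by simp
    next
      case 2 then show ?thesis using RD(1) a0(2) n by simp
    next
      case 3 then show ?thesis using RD(4)[OF nc[OF 3]] a0 b0 by simp
    qed
  qed
  then show ?thesis using RD(5)[OF a0(1)] RD(5)[OF _ RD(4)[OF b0(1)]] by blast
qed

lemma balanced_orbit:
  assumes u: "nc_perm u" and xy: "x < N" "y < N" "balanced u x" "balanced u y"
  shows "y \<in> orbit u x"
proof -
  have up: "u permutes {..<N}" using u G_perm by (simp add: nc_perm_def)
  let ?R = "\<lambda>x y. x < N \<and> same_cycle u x y"
  have "?R x y"
  proof (rule antipodes_related)
    show "equiv_below N ?R" by (rule equiv_below_same_cycle[OF up])
    show "noncrossing N ?R" using u by (intro noncrossing_restrict) (simp add: nc_perm_def)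
  qed (use xy in \<open>auto simp: balanced_def same_cycle_def sg_lt\<close>)
  then show ?thesis by (simp add: same_cycle_def)
qed

lemma bal_le_one:
  assumes u: "nc_perm u"
  shows "bal u \<le> 1"
proof -
  have up: "u permutes {..<N}" using u G_perm by (simp add: nc_perm_def)
  have "x = y" if "x \<in> cycle_tops N u" "balanced u x" "y \<in> cycle_tops N u" "balanced u y" for x y
    using cycle_top_unique[OF up that(1,3)] balanced_orbit[OF u _ _ that(2,4)] that
    by (simp add: cycle_tops_def)
  moreover have "finite {x \<in> cycle_tops N u. balanced u x}"
    by (rule finite_subset[of _ "{..<N}"]) (auto simp: cycle_tops_def)
  ultimately have "card {x \<in> cycle_tops N u. balanced u x} \<le> Suc 0"
    by (simp only: card_le_Suc0_iff_eq) blast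
  then show ?thesis by (simp add: bal_def)
qed

lemma bal_zero_iff:
  assumes u: "u \<in> G"
  shows "bal u = 0 \<longleftrightarrow> (\<forall>x<N. \<not> balanced u x)"
proof -
  have fin: "finite {x \<in> cycle_tops N u. balanced u x}"
    by (rule finite_subset[of _ "{..<N}"]) (auto simp: cycle_tops_def)
  have "balanced u (cycle_top u x)" if "balanced u x" for x
    using that by (simp add: balanced_top[OF u] top_sg_top[OF u] top_eq[OF u top_in[OF u]])
  then have "{x \<in> cycle_tops N u. balanced u x} = {} \<longleftrightarrow> (\<forall>x<N. \<not> balanced u x)"
    using top_cycle_tops[OF u] cycle_tops_iff[OF u] by blast
  then show ?thesis using fin by (simp add: bal_def)
qed

lemma D_eq: "N = (if odd_mode then 2 * D else D)"
proof -
  have "orbit id x = {x}" for x :: nat by (simp add: orbit_eq_singleton_iff)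
  then have "bal id = 0" using bal_zero_iff[OF id_G] sg_odd by (auto simp: balanced_def)
  then show ?thesis using cyc_d[OF id_G] unfolding cyc_id D_def by (simp only: add_0_right)
qed

text \<open>Without balanced cycles, comparing the top of a cycle with the top of its antipode never
  ends in a tie and so selects one cycle from each antipodal pair.\<close>

lemma odd_invariant_signs:
  assumes u: "u \<in> G" and o: odd_mode and b: "bal u = 0"
  obtains f :: "nat \<Rightarrow> int" where "\<And>x. f x * f x = 1" "\<And>x. x < N \<Longrightarrow> f (sg x) = - f x"
    "\<And>x. x < N \<Longrightarrow> f (u x) = f x"
proof
  define f :: "nat \<Rightarrow> int" where "f x = (if cycle_top u (sg x) < cycle_top u x then 1 else -1)" for x
  show "f x * f x = 1" for x by (simp add: f_def)
  show "f (sg x) = - f x" if "x < N" for x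
  proof -
    have "cycle_top u (sg x) \<noteq> cycle_top u x"
      using b bal_zero_iff[OF u] balanced_top[OF u] o that by blast
    then show ?thesis by (auto simp: f_def)
  qed
  show "f (u x) = f x" for x
  proof -
    have "cycle_top u (u x) = cycle_top u x" by (rule top_eq[OF u orbit.base])
    moreover have "cycle_top u (sg (u x)) = cycle_top u (sg x)"
      unfolding G_comm[OF u, symmetric] by (rule top_eq[OF u orbit.base])
    ultimately show ?thesis by (simp add: f_def)
  qed
qed

text \<open>Otherwise there would be odd sign functions \<open>f\<close>, \<open>g\<close> invariant under \<open>u\<close> and \<open>v\<close>.
  Comparing \<open>g\<close> with \<open>g \<circ> v \<circ> u\<close> through \<open>f\<close> gives an even number of sign changes, whereas
  a one step rotation changes the sign exactly once on a half circle.\<close>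

lemma bal_factors_pos:
  assumes u: "u \<in> G" and v: "v \<in> G" and o: odd_mode and c: "v \<circ> u = shift N"
  shows "bal u + bal v \<ge> 1"
proof (rule ccontr)
  assume "\<not> ?thesis"
  then have b: "bal u = 0" "bal v = 0" by auto
  obtain f :: "nat \<Rightarrow> int" where f: "\<And>x. f x * f x = 1" "\<And>x. x < N \<Longrightarrow> f (sg x) = - f x"
    "\<And>x. x < N \<Longrightarrow> f (u x) = f x" using odd_invariant_signs[OF u o b(1)] by blast
  obtain g :: "nat \<Rightarrow> int" where g: "\<And>x. g x * g x = 1" "\<And>x. x < N \<Longrightarrow> g (sg x) = - g x"
    "\<And>x. x < N \<Longrightarrow> g (v x) = g x" using odd_invariant_signs[OF v o b(2)] by blast
  define n where "n = N div 2"
  have n: "N = 2 * n" using sg_shift[OF o] by (auto simp: n_def)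
  have n0: "n > 0" using N_ge n by simp
  let ?h = "\<lambda>x. f x * g x"
  have sgn: "sg x = (if x < n then x + n else x - n)" if "x < N" for x
    using sg_eq[OF o that] by (simp add: n_def)
  have hmod: "?h (x mod n) = ?h x" if "x < N" for x
  proof (cases "x < n")
    case False
    then have "x mod n = x - n" using that n by (simp add: mod_if)
    then have "x mod n = sg x" using sgn[OF that] False by simp
    then show ?thesis using f(2)[OF that] g(2)[OF that] by simp
  qed simp
  \<comment> \<open>As \<open>u\<close> commutes with the half turn, it induces a permutation of the
    half circle.\<close>
  have inj: "inj_on (\<lambda>x. u x mod n) {..<n}"
  proof (rule inj_onI)
    fix x y assume xy: "x \<in> {..<n}" "y \<in> {..<n}" "u x mod n = u y mod n"
    have lt: "u x < N" "u y < N" using xy G_lt[OF u] n by auto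
    have "u x = u y \<or> u x = sg (u y)"
    proof (cases "u x < n \<longleftrightarrow> u y < n")
      case True
      then show ?thesis using xy(3) lt n by (cases "u x < n") (auto simp: mod_if split: if_splits)
    next
      case False
      then show ?thesis using xy(3) lt n sgn[OF lt(2)] by (auto simp: mod_if split: if_splits)
    qed
    then have "u x = u y \<or> u x = u (sg y)" using G_comm[OF u] by simp
    then have "x = y \<or> x = sg y" using inj_eq[OF permutes_inj[OF G_perm[OF u]]] by blast
    then show "x = y" using xy sgn[of y] n by auto
  qed
  have img: "(\<lambda>x. u x mod n) ` {..<n} = {..<n}"
    by (rule card_subset_eq) (use n0 card_image[OF inj] in auto)
  \<comment> \<open>Invariance of \<open>g\<close> under \<open>v\<close> gives
    \<open>g (shift N x) = g (u x)\<close>, and the inserted factor \<open>f x * f (u x)\<close> is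
    1. This rewrites the product in values of \<open>?h\<close>, which does not change under the
    half turn.\<close>
  have "(\<Prod>x<n. g x * g (shift N x)) = (\<Prod>x<n. ?h x * (?h (u x)))"
  proof (rule prod.cong)
    fix x assume "x \<in> {..<n}"
    then have x: "x < N" using n by simp
    have "g (shift N x) = g (u x)" using g(3)[of "u x"] G_lt[OF u] x c by (metis comp_apply)
    moreover have "?h x * ?h (u x) = (f x * f x) * (g x * g (u x))" using f(3)[OF x] by simp
    ultimately show "g x * g (shift N x) = ?h x * ?h (u x)" using f(1) by simp
  qed simp
  also have "\<dots> = (\<Prod>x<n. ?h x) * (\<Prod>x<n. ?h (u x))" by (simp add: prod.distrib)
  also have "(\<Prod>x<n. ?h (u x)) = (\<Prod>x<n. ?h (u x mod n))"
    by (rule prod.cong) (use hmod G_lt[OF u] n in auto)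
  also have "\<dots> = (\<Prod>x\<in>(\<lambda>x. u x mod n) ` {..<n}. ?h x)" by (simp add: prod.reindex[OF inj])
  also have "\<dots> = (\<Prod>x<n. ?h x)" by (simp add: img)
  also have "(\<Prod>x<n. ?h x) * (\<Prod>x<n. ?h x) = (\<Prod>x<n. ?h x * ?h x)" by (rule prod.distrib[symmetric])
  also have "\<dots> = 1"
  proof (rule prod.neutral, rule ballI)
    fix x
    have "?h x * ?h x = (f x * f x) * (g x * g x)" by simp
    then show "?h x * ?h x = 1" using f(1) g(1) by simp
  qed
  finally have 1: "(\<Prod>x<n. g x * g (shift N x)) = 1" .
  \<comment> \<open>Telescoping leaves the values at the two ends of a half circle, which are
    antipodal.\<close>
  have "(\<Prod>x<m. g x * g (shift N x)) = g 0 * g m" if "m \<le> n" for m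
    using that
  proof (induction m)
    case (Suc m)
    have "shift N m = Suc m" using Suc.prems n n0 by (intro shift_simps) simp
    then show ?case using Suc g(1)[of m] by (simp add: mult.assoc)
  qed (simp add: g(1))
  then have "(\<Prod>x<n. g x * g (shift N x)) = g 0 * g n" by simp
  also have "g n = - g 0" using g(2)[of 0] sgn[of 0] n n0 by simp
  finally show False using 1 g(1)[of 0] by simp
qed

text \<open>Lying below \<open>c\<close> is an equation between dimensions and has to become one
  between cycle numbers. In type B, doubling it accounts for all cycles except the balanced ones; at
  least one of these exists by \<open>bal_factors_pos\<close>, and the bound \<open>N + 1\<close>
  excludes a second.\<close>

lemma nc_permI:
  assumes u: "u \<in> G" and d: "d u + d (shift N \<circ> pinv u) = D + d (shift N)"
  shows "nc_perm u" "cyc N u + cyc N (shift N \<circ> pinv u) = N + 1"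
proof -
  let ?v = "shift N \<circ> pinv u"
  have v: "?v \<in> G" using comp_G[OF shift_G pinv_G[OF u]] .
  have le: "cyc N u + cyc N ?v \<le> N + 1" using cyc_sum_le[OF G_perm[OF u] N_pos] .
  have c1: "cyc N (shift N) = 1" using cyc_shift[OF N_pos] .
  have "cyc N u + cyc N ?v = N + 1"
  proof (cases odd_mode)
    case True
    have "?v \<circ> u = shift N" using permutes_inverses(2)[OF G_perm[OF u]] by (auto simp: fun_eq_iff)
    then have "bal u + bal ?v \<ge> 1" using bal_factors_pos[OF u v True] by simp
    moreover have "d (shift N) = 0" using cyc_d[OF shift_G] c1 True by simp
    ultimately show ?thesis using d le cyc_d[OF u] cyc_d[OF v] D_eq True by simp
  next
    case False
    then show ?thesis using d cyc_d[OF u] cyc_d[OF v] cyc_d[OF shift_G] D_eq c1 by simp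
  qed
  then show "cyc N u + cyc N ?v = N + 1" "nc_perm u"
    using noncrossing_iff_cyc[OF G_perm[OF u] N_pos] u by (auto simp: nc_perm_def)
qed

lemma nc_perm_shift: "nc_perm (shift N)"
  unfolding nc_perm_def noncrossing_def same_cycle_def
  using shift_G shift_increasing by (auto simp: orbit_shift)

lemma nc_perm_cyc:
  assumes "nc_perm u"
  shows "cyc N u + cyc N (shift N \<circ> pinv u) = N + 1"
proof -
  have u: "u permutes {..<N}" "increasing_cycles N u" "noncrossing N (same_cycle u)"
    using assms G_perm by (auto simp: nc_perm_def)
  show ?thesis
    using cyc_quotient[OF u shift_permutes shift_increasing] orbit_lt[OF u(1)] cyc_shift[OF N_pos]
    by (fastforce simp: orbit_shift)
qed

text \<open>Let \<open>x\<close> be the quotient and \<open>c\<close> the rotation. From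
  \<open>c x^(-1) = (c v^(-1)) (x u x^(-1))\<close> and subadditivity of cycle numbers,
  \<open>x\<close> and its complement reach \<open>N + 1\<close> cycles, so \<open>x\<close> is
  noncrossing. For the dimensions in type B the balanced cycles must match as well: if
  \<open>v\<close> has none, its refinements \<open>u\<close> and \<open>x\<close> have none; if
  \<open>v\<close> has one, the parity of the cycle equation leaves exactly one for \<open>u\<close>
  and \<open>x\<close> together.\<close>

lemma nc_perm_quotient:
  assumes u: "nc_perm u" and v: "nc_perm v" and sub: "\<And>x. x < N \<Longrightarrow> orbit u x \<subseteq> orbit v x"
  shows "nc_perm (v \<circ> pinv u)" "d u + d (v \<circ> pinv u) = D + d v"
proof -
  let ?x = "v \<circ> pinv u"
  have uG: "u \<in> G" and vG: "v \<in> G" using u v by (auto simp: nc_perm_def)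
  note up = G_perm[OF uG] and vp = G_perm[OF vG]
  have xG: "?x \<in> G" using comp_G[OF vG pinv_G[OF uG]] .
  note xp = G_perm[OF xG]
  have cx: "cyc N u + cyc N ?x = N + cyc N v"
    using cyc_quotient[OF up _ _ vp _ sub] u v by (auto simp: nc_perm_def)
  have cv: "cyc N v + cyc N (shift N \<circ> pinv v) = N + 1" by (rule nc_perm_cyc[OF v])
  have "shift N \<circ> pinv ?x = (shift N \<circ> pinv v) \<circ> (?x \<circ> u \<circ> pinv ?x)"
  proof
    fix y
    define z where "z = pinv ?x y"
    have "v (pinv u z) = y" using permutes_inverses(1)[OF xp, of y] by (simp add: z_def)
    then show "(shift N \<circ> pinv ?x) y = ((shift N \<circ> pinv v) \<circ> (?x \<circ> u \<circ> pinv ?x)) y"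
      using permutes_inverses(2)[OF vp] permutes_inverses[OF up] by (simp add: z_def[symmetric])
  qed
  then have "cyc N (shift N \<circ> pinv v) + cyc N u \<le> N + cyc N (shift N \<circ> pinv ?x)"
    using cyc_subadd[OF N_pos permutes_compose[OF permutes_inv[OF vp] shift_permutes],
        of "?x \<circ> u \<circ> pinv ?x"] cyc_conj[OF N_pos xp up]
      permutes_compose[OF permutes_inv[OF xp] permutes_compose[OF up xp]]
    by (simp add: comp_assoc)
  then have "cyc N ?x + cyc N (shift N \<circ> pinv ?x) = N + 1"
    using cyc_sum_le[OF xp N_pos] cx cv by linarith
  then show x: "nc_perm ?x" using noncrossing_iff_cyc[OF xp N_pos] xG by (simp add: nc_perm_def)
  show "d u + d ?x = D + d v"
  proof (cases odd_mode)
    case False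
    then show ?thesis using cx cyc_d[OF uG] cyc_d[OF vG] cyc_d[OF xG] D_eq by simp
  next
    case True
    have N: "N = 2 * D" using D_eq True by simp
    have eq: "2 * d u + bal u + (2 * d ?x + bal ?x) = 2 * D + (2 * d v + bal v)"
      using cx cyc_d[OF uG] cyc_d[OF vG] cyc_d[OF xG] True N by simp
    have "bal u + bal ?x = bal v"
    proof (cases "bal v = 0")
      case True
      have xsub: "orbit ?x y \<subseteq> orbit v y" if y: "y < N" for y
      proof (rule orbit_subset_closed)
        show "y \<in> orbit v y" by (rule self_in_orbit[OF vp])
        show "?x z \<in> orbit v y" if z: "z \<in> orbit v y" for z
        proof -
          have zN: "z < N" using orbit_lt[OF vp z] y by simp
          have "u (pinv u z) = z" using permutes_inverses(1)[OF up] .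
          then have "pinv u z \<in> orbit u z" using orbit_sym[OF up] orbit.base by metis
          then have "pinv u z \<in> orbit v z" using sub[OF zN] by blast
          then show ?thesis using orbit_trans[OF _ z] orbit.step by fastforce
        qed
      qed
      have nb: "\<not> balanced v y" if "y < N" for y using True bal_zero_iff[OF vG] that by blast
      have "\<not> balanced u y" if "y < N" for y using nb[OF that] sub[OF that] unfolding balanced_def by blast
      moreover have "\<not> balanced ?x y" if "y < N" for y
        using nb[OF that] xsub[OF that] unfolding balanced_def by blast
      ultimately have "bal u = 0" "bal ?x = 0" using bal_zero_iff[OF uG] bal_zero_iff[OF xG] by simp_all
      then show ?thesis using True by simp
    next
      case False
      then show ?thesis using bal_le_one[OF v] bal_le_one[OF u] bal_le_one[OF x] eq by presburger
    qed
    then show ?thesis using eq by simp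
  qed
qed

lemma tr_below_nc:
  assumes v: "nc_perm v" and ab: "a < N" "b < N" and d: "d (v \<circ> tr a b) = d v + 1"
  shows "b \<in> orbit v a"
  using tr_below_same[OF _ ab d] balanced_orbit[OF v ab] v by (auto simp: nc_perm_def)

lemma nc_closure_orbit:
  assumes w: "w permutes {..<N}" and x: "x < N" and y: "y \<in> orbit w x"
  shows "nc_closure N w x y"
proof -
  note E = equiv_belowD[OF equiv_nc_closure[OF w]]
  have "y \<in> {y. nc_closure N w x y}"
  proof (rule subsetD[OF orbit_subset_closed y])
    show "x \<in> {y. nc_closure N w x y}" using E(1)[OF x] by simp
    show "w z \<in> {y. nc_closure N w x y}" if "z \<in> {y. nc_closure N w x y}" for z
      using that E(5)[OF _ nc_closure_base[OF w E(3)]] by simp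
  qed
  then show ?thesis by simp
qed

text \<open>Different balanced cycles of \<open>w\<close> may occur here, but they contain crossing
  diameters and are merged by the closure.\<close>

lemma tr_below_closure:
  assumes w: "w \<in> G" and ab: "a < N" "b < N" and d: "d (w \<circ> tr a b) = d w + 1"
  shows "nc_closure N w a b"
  using tr_below_same[OF w ab d]
proof
  assume "b \<in> orbit w a"
  then show ?thesis by (rule nc_closure_orbit[OF G_perm[OF w] ab(1)])
next
  assume b: "balanced w a \<and> balanced w b"
  show ?thesis
  proof (rule antipodes_related[OF equiv_nc_closure[OF G_perm[OF w]] noncrossing_nc_closure[OF G_perm[OF w]]])
    show odd_mode using b by (simp add: balanced_def)
    show "nc_closure N w a (sg a)" "nc_closure N w b (sg b)"
      using b nc_closure_orbit[OF G_perm[OF w]] ab by (auto simp: balanced_def)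
  qed
qed

lemma orbit_tr:
  assumes "a < N" "b < N"
  shows "orbit (tr a b) x \<subseteq> {x, tr a b x}"
  by (rule orbit_subset_closed) (use tr_invol[OF assms] in auto)

text \<open>A chord and its image under the half turn are parallel, so the two 2-cycles of a
  reflection of type B do not cross.\<close>

lemma nc_perm_tr:
  assumes ab: "a < N" "b < N" "a \<noteq> b"
  shows "nc_perm (tr a b)"
proof -
  have "increasing_cycles N (tr a b)"
    unfolding increasing_cycles_def
  proof
    fix x assume "x \<in> weak_desc N (tr a b)"
    then show "x \<in> cycle_tops N (tr a b)"
      using orbit_tr[OF ab(1,2), of x] by (auto simp: weak_desc_def cycle_tops_def)
  qed
  moreover have "noncrossing N (same_cycle (tr a b))"
    unfolding noncrossing_def same_cycle_def
  proof (intro allI impI)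
    fix p q r s
    assume A: "p < q \<and> q < r \<and> r < s \<and> s < N \<and> r \<in> orbit (tr a b) p \<and> s \<in> orbit (tr a b) q"
    then have "r \<in> {p, tr a b p}" "s \<in> {q, tr a b q}" using orbit_tr[OF ab(1,2)] by blast+
    then have r: "r = tr a b p" and s: "s = tr a b q" using A by auto
    have neq: "tr a b p \<noteq> p" "tr a b q \<noteq> q" "p \<noteq> q" "tr a b p \<noteq> q" using A r s by auto
    have move: "y = a \<and> tr a b y = b \<or> y = b \<and> tr a b y = a \<or> y = sg a \<and> tr a b y = sg b
        \<or> y = sg b \<and> tr a b y = sg a" if "tr a b y \<noteq> y" for y
    proof -
      have "y = a \<or> y = b \<or> y = sg a \<or> y = sg b" using that unfolding tr_def by presburger
      moreover have "tr a b (sg a) = sg b" "tr a b (sg b) = sg a"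
        by (simp_all add: tr_sg[OF ab(1,2)] tr_simps)
      ultimately show ?thesis using tr_simps[of a b] by blast
    qed
    have "q = p \<or> q = tr a b p \<or> q = sg p \<or> q = sg (tr a b p)"
      using move[OF neq(1)] move[OF neq(2)] sg_sg[of a] sg_sg[of b] by metis
    then have "q = sg p \<or> q = sg (tr a b p)" using neq(3,4) by blast
    moreover have odd_mode using calculation neq(3,4) sg_even by metis
    ultimately have "odd_mode \<and> (q = sg p \<or> q = sg (tr a b p))" by blast
    then have o: odd_mode and q: "q = sg p \<or> q = sg r" using r by auto
    have lt: "p < N" "q < N" "r < N" using A by auto
    have sr: "s = sg r" if "q = sg p" using that s r tr_sg[OF ab(1,2)] by simp
    have sp: "s = sg p" if "q = sg r" using that s r tr_sg[OF ab(1,2)] tr_invol[OF ab(1,2)] by simp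
    have pq: "p < q" "q < r" "r < s" using A by simp_all
    have False
      using q
    proof
      assume 1: "q = sg p"
      have "p < N div 2" "q = p + N div 2" 
        using sg_eq[OF o lt(1)] pq(1) 1 by (cases "p < N div 2"; simp)+
      then have "sg r = r - N div 2" using sg_eq[OF o lt(3)] pq(2) by simp
      then show False using sr[OF 1] pq(3) by simp
    next
      assume 1: "q = sg r"
      have "r \<ge> N div 2" "q = r - N div 2"
        using sg_eq[OF o lt(3)] pq(2) 1 by (cases "r < N div 2"; simp)+
      moreover have "p < N div 2" "s = p + N div 2"
        using sg_eq[OF o lt(1)] pq sp[OF 1] by (cases "p < N div 2"; simp)+
      ultimately show False using pq(1,3) by linarith
    qed
    then show "q \<in> orbit (tr a b) p" ..
  qed
  ultimately show ?thesis using tr_G ab by (simp add: nc_perm_def)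
qed

section \<open>The permutation of the noncrossing closure\<close>

definition nc_join :: "(nat \<Rightarrow> nat) \<Rightarrow> nat \<Rightarrow> nat" where
  "nc_join w = (SOME u. u permutes {..<N} \<and> increasing_cycles N u \<and> (\<forall>x<N. orbit u x = {y. nc_closure N w x y}))"

context
  fixes w assumes w: "w \<in> G"
begin

lemma nc_join: "nc_join w permutes {..<N}" "increasing_cycles N (nc_join w)"
  and nc_join_orbit: "x < N \<Longrightarrow> orbit (nc_join w) x = {y. nc_closure N w x y}"
proof -
  have "\<exists>u. u permutes {..<N} \<and> increasing_cycles N u \<and> (\<forall>x<N. orbit u x = {y. nc_closure N w x y})"
    using ex_increasing_perm[OF equiv_nc_closure[OF G_perm[OF w]]] by metis
  then have "nc_join w permutes {..<N} \<and> increasing_cycles N (nc_join w) \<and> (\<forall>x<N. orbit (nc_join w) x = {y. nc_closure N w x y})"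
    unfolding nc_join_def by (rule someI_ex)
  then show "nc_join w permutes {..<N}" "increasing_cycles N (nc_join w)"
    "x < N \<Longrightarrow> orbit (nc_join w) x = {y. nc_closure N w x y}" by auto
qed

text \<open>The classes are stable under the rotation \<open>sg\<close>, and successors are nearest
  clockwise neighbours. Minimality at \<open>x\<close> and at \<open>sg x\<close> bounds each of the
  two distances by the other, so they agree.\<close>

lemma nc_join_comm: "nc_join w (sg x) = sg (nc_join w x)"
proof (cases "x < N")
  case False
  then show ?thesis using permutes_not_in[OF nc_join(1)] sg_lt by simp
next
  case x: True
  obtain k where k: "sg = shift N ^^ k" using sg_pow by blast
  have cl: "nc_closure N w (sg y) (sg z)" if "nc_closure N w y z" for y z
    using nc_closure_shift[OF G_perm[OF w] _ that, of k] G_comm[OF w] k by simp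
  have sx: "sg x < N" using x sg_lt by simp
  have ux: "nc_closure N w x (nc_join w x)" "nc_closure N w (sg x) (nc_join w (sg x))"
    using nc_join_orbit[OF x] nc_join_orbit[OF sx] orbit.base[of "nc_join w"] by auto
  have 1: "sg (nc_join w x) \<in> orbit (nc_join w) (sg x)" using nc_join_orbit[OF sx] cl[OF ux(1)] by simp
  have 2: "sg (nc_join w (sg x)) \<in> orbit (nc_join w) x" using nc_join_orbit[OF x] cl[OF ux(2)] by simp
  have lt: "nc_join w x < N" "nc_join w (sg x) < N" using nc_closureD(2) ux by blast+
  show ?thesis
  proof (cases "nc_join w x = x \<or> nc_join w (sg x) = sg x")
    case True
    then show ?thesis
      using increasing_cyclic_next(1)[OF nc_join sx 1] increasing_cyclic_next(1)[OF nc_join x 2] by (metis sg_sg)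
  next
    case False
    then have "sg (nc_join w x) \<noteq> sg x" "sg (nc_join w (sg x)) \<noteq> x" by (metis sg_sg)+
    then have "cdist N (sg x) (nc_join w (sg x)) \<le> cdist N (sg x) (sg (nc_join w x))"
      "cdist N x (nc_join w x) \<le> cdist N x (sg (nc_join w (sg x)))"
      using increasing_cyclic_next(2)[OF nc_join sx 1] increasing_cyclic_next(2)[OF nc_join x 2] by auto
    moreover have "cdist N (sg x) (sg (nc_join w x)) = cdist N x (nc_join w x)"
      unfolding k using cdist_shift[OF x lt(1)] .
    moreover have "cdist N (sg (sg x)) (sg (nc_join w (sg x))) = cdist N (sg x) (nc_join w (sg x))"
      using cdist_shift[OF sx lt(2), of k] unfolding k .
    ultimately have "cdist N (sg x) (nc_join w (sg x)) = cdist N (sg x) (sg (nc_join w x))" by simp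
    then show ?thesis using cdist_inj[OF sx lt(2)] lt(1) sg_lt by simp
  qed
qed

lemma nc_perm_nc_join: "nc_perm (nc_join w)"
proof -
  have "noncrossing N (same_cycle (nc_join w))"
    unfolding noncrossing_def same_cycle_def
  proof (intro allI impI)
    fix a b c d
    assume A: "a < b \<and> b < c \<and> c < d \<and> d < N \<and> c \<in> orbit (nc_join w) a \<and> d \<in> orbit (nc_join w) b"
    then have "nc_closure N w a c" "nc_closure N w b d" using nc_join_orbit by auto
    then have "nc_closure N w a b"
      using A noncrossing_nc_closure[OF G_perm[OF w]] unfolding noncrossing_def by blast
    then show "b \<in> orbit (nc_join w) a" using nc_join_orbit A by simp
  qed
  then show ?thesis using nc_join nc_join_comm by (simp add: nc_perm_def G_def)
qed

lemma orbit_nc_join: "x < N \<Longrightarrow> orbit w x \<subseteq> orbit (nc_join w) x"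
  using nc_join_orbit nc_closure_orbit[OF G_perm[OF w]] by blast

lemma nc_join_fix: "w x = x \<Longrightarrow> nc_join w x = x"
proof (cases "x < N")
  case True
  assume "w x = x"
  then have "nc_closure N w x y \<Longrightarrow> y = x" for y by (rule nc_closure_fixpoint[OF G_perm[OF w]])
  then show ?thesis using nc_join_orbit[OF True] orbit.base[of "nc_join w" x] by simp
qed (use permutes_not_in[OF nc_join(1)] in simp)

lemma nc_join_least:
  assumes v: "nc_perm v" and sub: "\<And>y. y < N \<Longrightarrow> w y \<in> orbit v y" and x: "x < N"
  shows "orbit (nc_join w) x \<subseteq> orbit v x"
proof
  have vp: "v permutes {..<N}" using v G_perm by (simp add: nc_perm_def)
  let ?R = "\<lambda>x y. x < N \<and> same_cycle v x y"
  fix y assume "y \<in> orbit (nc_join w) x"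
  then have "nc_closure N w x y" using nc_join_orbit[OF x] by simp
  then have "?R x y"
  proof (rule nc_closure_least[rotated 3])
    show "equiv_below N ?R" by (rule equiv_below_same_cycle[OF vp])
    show "noncrossing N ?R" using v by (intro noncrossing_restrict) (simp add: nc_perm_def)
    show "z < N \<and> same_cycle v z (w z)" if "z < N" for z using that sub by (simp add: same_cycle_def)
  qed
  then show "y \<in> orbit v x" by (simp add: same_cycle_def)
qed

end

end

section \<open>Iterating Pop on permutations\<close>

context cyclic_perms begin

definition pop :: "(nat \<Rightarrow> nat) \<Rightarrow> nat \<Rightarrow> nat" where
  "pop w = w \<circ> pinv (nc_join w)"

lemma nc_join_G: "w \<in> G \<Longrightarrow> nc_join w \<in> G"
  using nc_perm_nc_join by (simp add: nc_perm_def)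

lemma pop_G: "w \<in> G \<Longrightarrow> pop w \<in> G"
  unfolding pop_def by (intro comp_G pinv_G nc_join_G)

lemma pop_funpow_G: "w \<in> G \<Longrightarrow> (pop ^^ k) w \<in> G"
  by (induction k) (auto intro: pop_G)

lemma pop_nc_join: "w \<in> G \<Longrightarrow> pop w (nc_join w x) = w x"
  using permutes_inverses(2)[OF G_perm[OF nc_join_G]] by (simp add: pop_def)

lemma nc_join_surj: "w \<in> G \<Longrightarrow> y < N \<Longrightarrow> \<exists>x<N. nc_join w x = y"
  using permutes_inverses(1)[OF G_perm[OF nc_join_G], of w y] G_lt[OF nc_join_G, of w "pinv (nc_join w) y"]
  by (intro exI[of _ "pinv (nc_join w) y"]) simp

lemma nc_join_step:
  assumes w: "w \<in> G" and x: "x < N" and neq: "w x \<noteq> x"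
  shows "cdist N x (nc_join w x) \<ge> 1"
    and "cdist N x (w x) = cdist N x (nc_join w x) + cdist N (nc_join w x) (w x)"
proof -
  have wx: "w x \<in> orbit (nc_join w) x" using orbit_nc_join[OF w x] orbit.base[of w x] by blast
  note n = increasing_cyclic_next[OF nc_join[OF w] x wx neq]
  have lt: "w x < N" "nc_join w x < N" using G_lt[OF w] G_lt[OF nc_join_G[OF w]] x by auto
  show "cdist N x (nc_join w x) \<ge> 1" using cdist_zero[OF x lt(2)] n(1) by (simp add: Suc_le_eq)
  show "cdist N x (w x) = cdist N x (nc_join w x) + cdist N (nc_join w x) (w x)"
    using cdist_diff[OF x lt(2,1) n(2)] n(2) by simp
qed

text \<open>A clockwise distance is at most \<open>N - 1\<close>, which starts the induction. The
  new image of \<open>y\<close> is the old image of its \<open>nc_join\<close>-preimage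
  \<open>x\<close>, and moving from \<open>x\<close> to \<open>y\<close> has shortened the way by at
  least one.\<close>

lemma pop_distance:
  assumes w: "w \<in> G" and y: "y < N"
  shows "cdist N y ((pop ^^ k) w y) + k \<le> N - 1 \<or> (pop ^^ k) w y = y"
  using y
proof (induction k arbitrary: y)
  case 0
  then show ?case using cdist_less[OF 0, of "w y"] by simp linarith
next
  case (Suc k)
  let ?v = "(pop ^^ k) w"
  have v: "?v \<in> G" by (rule pop_funpow_G[OF w])
  obtain x where x: "x < N" "nc_join ?v x = y" using nc_join_surj[OF v Suc.prems] by blast
  have py: "(pop ^^ Suc k) w y = ?v x" using pop_nc_join[OF v, of x] x by simp
  show ?case
  proof (cases "?v x = x")
    case True
    then show ?thesis using nc_join_fix[OF v True] x py by simp
  next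
    case False
    then show ?thesis using nc_join_step[OF v x(1) False] Suc.IH[OF x(1)] x(2) unfolding py by simp
  qed
qed

lemma pop_power_id:
  assumes w: "w \<in> G"
  shows "(pop ^^ (N - 1)) w = id"
proof
  fix y
  let ?v = "(pop ^^ (N - 1)) w"
  have v: "?v \<in> G" by (rule pop_funpow_G[OF w])
  show "?v y = id y"
  proof (cases "y < N")
    case True
    then have "?v y < N" using G_lt[OF v] by simp
    moreover have "cdist N y (?v y) = 0 \<or> ?v y = y" using pop_distance[OF w True, of "N - 1"] by linarith
    ultimately show ?thesis using cdist_zero[OF True] by auto
  next
    case False
    then show ?thesis using permutes_not_in[OF G_perm[OF v]] by simp
  qed
qed

text \<open>Both \<open>z\<close> and \<open>pop w z\<close> are related to the
  \<open>nc_join\<close>-preimage of \<open>z\<close>.\<close>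

lemma pop_closure_mono:
  assumes w: "w \<in> G" and xy: "nc_closure N (pop w) x y"
  shows "nc_closure N w x y"
proof (rule nc_closure_least[OF equiv_nc_closure noncrossing_nc_closure _ xy])
  show "w permutes {..<N}" "w permutes {..<N}" using G_perm[OF w] by auto
  note E = equiv_belowD[OF equiv_nc_closure[OF G_perm[OF w]]]
  fix z assume z: "z < N"
  obtain p where p: "p < N" "nc_join w p = z" using nc_join_surj[OF w z] by blast
  have "nc_closure N w p z" using nc_join_orbit[OF w p(1)] orbit.base[of "nc_join w" p] p by auto
  moreover have "nc_closure N w p (w p)" by (rule nc_closure_base[OF G_perm[OF w] p(1)])
  ultimately have "nc_closure N w z (w p)" using E(5)[OF E(4)] by blast
  then show "nc_closure N w z (pop w z)" using pop_nc_join[OF w, of p] p by simp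
qed

lemma pop_closure_mono_pow:
  assumes w: "w \<in> G" and "j \<le> l" "nc_closure N ((pop ^^ l) w) x y"
  shows "nc_closure N ((pop ^^ j) w) x y"
  using assms(2,3)
proof (induction l rule: dec_induct)
  case (step l)
  then show ?case using pop_closure_mono[OF pop_funpow_G[OF w, of l]] by simp
qed

text \<open>Here a value is followed instead of a point: the point currently sent to
  \<open>w i\<close> moves clockwise towards \<open>w i\<close> by at least one place per step,
  until it reaches \<open>w i\<close> and stays.\<close>

lemma pop_arrival:
  assumes w: "w \<in> G" and i: "i < N"
  shows "\<exists>x<N. (pop ^^ k) w x = w i \<and> (cdist N x (w i) + k \<le> cdist N i (w i) \<or> x = w i)"
proof (induction k)
  case 0
  then show ?case using i by auto
next
  case (Suc k)
  let ?v = "(pop ^^ k) w"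
  have v: "?v \<in> G" by (rule pop_funpow_G[OF w])
  obtain x where x: "x < N" "?v x = w i" "cdist N x (w i) + k \<le> cdist N i (w i) \<or> x = w i"
    using Suc by blast
  have pv: "(pop ^^ Suc k) w (nc_join ?v x) = w i" using pop_nc_join[OF v, of x] x by simp
  have lt: "nc_join ?v x < N" using G_lt[OF nc_join_G[OF v]] x by simp
  show ?case
  proof (cases "?v x = x")
    case True
    then show ?thesis using nc_join_fix[OF v True] x pv lt by (intro exI[of _ x]) simp
  next
    case False
    then have "cdist N (nc_join ?v x) (w i) + Suc k \<le> cdist N i (w i)"
      using nc_join_step[OF v x(1) False] x by auto
    then show ?thesis using pv lt by blast
  qed
qed

text \<open>A value \<open>z\<close> whose preimage is still underway after \<open>N - 2\<close>
  steps has been approached at the slowest pace from the farthest start. Its trajectory keeps the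
  points \<open>p l\<close> in the class of \<open>z\<close> up to time \<open>l\<close>, so none of
  them is fixed up to then. Hence the value \<open>p l\<close> cannot have started so near that it
  arrives within \<open>l\<close> steps, which leaves only the inverse rotation.\<close>

lemma pop_slow_unique:
  assumes w: "w \<in> G" and slow: "(pop ^^ (N - 2)) w \<noteq> id"
  shows "w = pinv (shift N)"
proof -
  let ?w = "\<lambda>j. (pop ^^ j) w"
  have wG: "?w j \<in> G" for j by (rule pop_funpow_G[OF w])
  note wp = G_perm[OF wG]
  obtain q where q: "?w (N - 2) q \<noteq> q" using slow by (auto simp: fun_eq_iff)
  have qN: "q < N" using q permutes_not_in[OF wp, of q] by fastforce
  define z where "z = ?w (N - 2) q"
  have zN: "z < N" using G_lt[OF wG] qN by (simp add: z_def)
  \<comment> \<open>The points in clockwise order from the one right after \<open>z\<close>; thus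
    \<open>p l\<close> is at distance \<open>N - 1 - l\<close> from \<open>z\<close>, and
    \<open>p (N - 1) = z\<close>.\<close>
  define p where "p l = (z + l + 1) mod N" for l
  have pN: "p l < N" for l using N_pos by (simp add: p_def)
  have pz: "cdist N (p l) z = N - 1 - l" if "l < N" for l
  proof (rule cdist_unique[OF pN])
    have "(p l + (N - 1 - l)) mod N = (z + l + 1 + (N - 1 - l)) mod N" by (simp add: p_def mod_add_left_eq)
    also have "z + l + 1 + (N - 1 - l) = z + N" using that by simp
    finally show "(p l + (N - 1 - l)) mod N = z" using zN by simp
  qed (use that in auto)
  have p_last: "p (N - 1) = z" using zN N_pos by (simp add: p_def)
  have pinj: "p l = p l' \<Longrightarrow> l < N \<Longrightarrow> l' < N \<Longrightarrow> l = l'" for l l'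
    using pz[of l] pz[of l'] by simp
  have psurj: "\<exists>l<N. p l = x" if "x < N" for x
  proof (intro exI conjI)
    show "N - 1 - cdist N x z < N" using N_pos by simp
    have "cdist N (p (N - 1 - cdist N x z)) z = cdist N x z" 
      using pz[of "N - 1 - cdist N x z"] cdist_less[OF that, of z] by simp
    moreover have "cdist N a z = cdist N b z \<Longrightarrow> a < N \<Longrightarrow> b < N \<Longrightarrow> a = b" for a b
      using zN by (auto simp: cdist_eq split: if_splits)
    ultimately show "p (N - 1 - cdist N x z) = x" using that pN by blast
  qed
  \<comment> \<open>Backwards in time from \<open>N - 2\<close>: the preimage of the current point
    under the join lies at least one place further back, and \<open>pop_distance\<close> allows no
    more than one.\<close>
  have track: "?w j (p j) = z" if "j \<le> N - 2" for j
    using that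
  proof (induction j rule: inc_induct)
    case base
    have "cdist N q z + (N - 2) \<le> N - 1" using pop_distance[OF w qN, of "N - 2"] q by (simp add: z_def)
    moreover have "cdist N q z \<noteq> 0" using cdist_zero[OF qN zN] q by (simp add: z_def)
    ultimately have "cdist N q z = 1" using N_ge by simp
    moreover have "cdist N (p (N - 2)) z = 1" using pz[of "N - 2"] N_ge by simp
    ultimately have "q = p (N - 2)" using qN pN[of "N - 2"] zN by (auto simp: cdist_eq split: if_splits)
    then show ?case by (simp add: z_def)
  next
    case (step j)
    obtain x where x: "x < N" "nc_join (?w j) x = p (Suc j)" using nc_join_surj[OF wG pN] by blast
    have wx: "?w j x = z" using pop_nc_join[OF wG[of j], of x] x step.IH by simp
    have neq: "?w j x \<noteq> x"
    proof
      assume "?w j x = x"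
      then have "p (Suc j) = z" using nc_join_fix[OF wG] x wx by metis
      moreover have "Suc j < N" "Suc j \<noteq> N - 1" "N - 1 < N" using step.hyps N_ge by linarith+
      ultimately show False using pinj[of "Suc j" "N - 1"] p_last by simp
    qed
    have "cdist N x z + j \<le> N - 1" using pop_distance[OF w x(1), of j] neq wx by simp
    moreover have "cdist N x z \<ge> 1 + cdist N (p (Suc j)) z"
      using nc_join_step[OF wG x(1) neq] wx x(2) by simp
    ultimately have "cdist N x z = cdist N (p j) z" using pz[of "Suc j"] pz[of j] step.hyps N_ge by simp
    then have "x = p j" using x(1) pN[of j] zN by (auto simp: cdist_eq split: if_splits)
    then show ?case using wx by simp
  qed
  have cl: "nc_closure N (?w j) (p l) z" if "j \<le> l" "l \<le> N - 2" for j l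
    using pop_closure_mono_pow[OF w that(1)] nc_closure_base[OF wp pN, of l] track[OF that(2)] by metis
  have nofix: "?w j (p l) \<noteq> p l" if "j \<le> l" "l \<le> N - 2" for j l
  proof
    assume "?w j (p l) = p l"
    then have "z = p l" using nc_closure_fixpoint[OF wp _ cl[OF that]] by simp
    moreover have "l < N" "l \<noteq> N - 1" "N - 1 < N" using that N_ge by linarith+
    ultimately show False using pinj[of l "N - 1"] p_last by simp
  qed
  define a where "a l = (SOME k. k < N \<and> w (p k) = p l)" for l
  have a: "a l < N \<and> w (p (a l)) = p l" for l
    unfolding a_def
  proof (rule someI_ex)
    have "w (pinv w (p l)) = p l" using permutes_inverses(1)[OF G_perm[OF w]] .
    moreover have "pinv w (p l) < N" using G_lt[OF pinv_G[OF w]] pN by simp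
    ultimately show "\<exists>k<N. w (p k) = p l" using psurj by metis
  qed
  have ainj: "a l = a l' \<Longrightarrow> l < N \<Longrightarrow> l' < N \<Longrightarrow> l = l'" for l l' using a pinj by metis
  \<comment> \<open>If \<open>a l \<le> l\<close>, the value \<open>p l\<close> starts at distance
    \<open>l - a l\<close>, has arrived after \<open>l\<close> steps, and \<open>p l\<close> would
    be fixed.\<close>
  have agt: "a l > l" if l: "l \<le> N - 2" for l
  proof (rule ccontr)
    assume "\<not> a l > l"
    then have al: "a l \<le> l" by simp
    have "cdist N (p (a l)) (p l) = l - a l"
    proof (rule cdist_unique[OF pN])
      have "(p (a l) + (l - a l)) mod N = (z + a l + 1 + (l - a l)) mod N" by (simp add: p_def mod_add_left_eq)
      then show "(p (a l) + (l - a l)) mod N = p l" using al by (simp add: p_def)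
    qed (use l N_ge in auto)
    moreover obtain x where "x < N" "?w l x = p l" "cdist N x (p l) + l \<le> cdist N (p (a l)) (p l) \<or> x = p l"
      using pop_arrival[OF w pN, of l "a l"] a[of l] by auto
    moreover have "x \<noteq> p l" using nofix[of l l] l \<open>?w l x = p l\<close> by auto
    ultimately have "cdist N x (p l) = 0" by simp
    then have "x = p l" using cdist_zero[OF \<open>x < N\<close> pN] by simp
    then show False using \<open>x \<noteq> p l\<close> by simp
  qed
  \<comment> \<open>Downward induction: an index larger than \<open>l + 1\<close> is already the
    value of \<open>a\<close> at its predecessor, so injectivity leaves only
    \<open>l + 1\<close>.\<close>
  have asuc: "a l = Suc l" if "l \<le> N - 2" for l
    using that
  proof (induction "N - 2 - l" arbitrary: l rule: less_induct)
    case less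
    have "\<not> a l > Suc l"
    proof
      assume gt: "a l > Suc l"
      then have "a l - 1 \<le> N - 2" using a[of l] by linarith
      moreover have "N - 2 - (a l - 1) < N - 2 - l" using gt less.prems a[of l] by linarith
      ultimately have "a (a l - 1) = a l" using less.hyps[of "a l - 1"] gt by simp
      moreover have "a l - 1 < N" "l < N" using a[of l] less.prems N_ge by linarith+
      ultimately have "a l - 1 = l" by (rule ainj)
      then show False using gt by simp
    qed
    then show ?case using agt[OF less.prems] by simp
  qed
  have shp: "shift N (p l) = p (Suc l)" for l
    using pN[of l] by (simp add: shift_def p_def mod_Suc_eq)
  have "w (shift N x) = x" if x: "x < N" for x
  proof -
    obtain l where l: "l < N" "p l = x" using psurj[OF x] by blast
    show ?thesis
    proof (cases "l = N - 1")
      case True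
      then have "x = z" using l p_last by simp
      moreover have "p (Suc l) = p 0"
      proof -
        have "z + Suc l + 1 = (z + 0 + 1) + N" using True N_pos by simp
        then show ?thesis unfolding p_def by (simp only: mod_add_self2)
      qed
      ultimately show ?thesis using track[of 0] shp[of l] l by simp
    next
      case False
      then have "l \<le> N - 2" using l(1) by linarith
      then have "w (p (Suc l)) = p l" using asuc[of l] a[of l] by simp
      then show ?thesis using shp[of l] l(2) by simp
    qed
  qed
  then have "w (shift N x) = x" for x
    using permutes_not_in[OF G_perm[OF w], of x] by (cases "x < N") (auto simp: shift_def)
  then have "w y = pinv (shift N) y" for y
    using permutes_inverses(1)[OF shift_permutes, of N y] by metis
  then show ?thesis by blast
qed

text \<open>The chord from 0 to \<open>j\<close> crosses the chord from 1 to \<open>j + 1\<close>,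
  so the closure joins 0 and 1. In the extreme cases \<open>j = 1\<close> and
  \<open>j = N - 1\<close> a chord joins these neighbours directly. Rotation symmetry then joins all
  points.\<close>

lemma nc_join_shift_pow:
  assumes j: "1 \<le> j" "j < N"
  shows "nc_join (shift N ^^ j) = shift N"
proof -
  let ?w = "shift N ^^ j"
  have w: "?w \<in> G"
  proof (induction j)
    case 0
    show ?case by (simp only: funpow.simps(1) id_G)
  next
    case (Suc j)
    show ?case using comp_G[OF shift_G Suc] by (simp only: funpow.simps(2))
  qed
  note wp = G_perm[OF w]
  note E = equiv_belowD[OF equiv_nc_closure[OF wp]]
  have wx: "?w x = (x + j) mod N" if "x < N" for x using shift_funpow[OF that] .
  have c01: "nc_closure N ?w 0 1"
  proof -
    have b0: "nc_closure N ?w 0 j" using nc_closure_base[OF wp N_pos] wx[OF N_pos] j by simp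
    have b1: "nc_closure N ?w 1 ((1 + j) mod N)" using nc_closure_base[OF wp, of 1] wx[of 1] N_ge by simp
    consider "j = 1" | "1 < j" "j + 1 < N" | "j + 1 = N" using j by linarith
    then show ?thesis
    proof cases
      case 1 then show ?thesis using b0 by simp
    next
      case 2
      then have "nc_closure N ?w 1 (j + 1)" using b1 by simp
      then have "(0::nat) < 1 \<and> 1 < j \<and> j < j + 1 \<and> j + 1 < N \<and> nc_closure N ?w 0 j \<and> nc_closure N ?w 1 (j + 1)"
        using 2 b0 by simp
      then show ?thesis using noncrossing_nc_closure[OF wp] unfolding noncrossing_def by blast
    next
      case 3
      then show ?thesis using E(4)[OF b1] by simp
    qed
  qed
  have csuc: "nc_closure N ?w x (Suc x)" if "Suc x < N" for x
  proof -
    have com: "?w ((shift N ^^ x) y) = (shift N ^^ x) (?w y)" if "y < N" for y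
      using that by (simp add: funpow_add[symmetric, THEN fun_cong, simplified] add.commute)
    show ?thesis using nc_closure_shift[OF wp com c01] that N_ge by (simp add: shift_funpow)
  qed
  have c0: "nc_closure N ?w 0 x" if "x < N" for x
    using that
  proof (induction x)
    case (Suc x)
    then show ?case using E(5)[OF _ csuc[of x]] by simp
  qed (use E(1) in simp)
  have call: "nc_closure N ?w x y" if "x < N" "y < N" for x y
    using E(5)[OF E(4)[OF c0[OF that(1)]] c0[OF that(2)]] .
  show ?thesis
  proof (rule increasing_unique[OF nc_join[OF w] shift_permutes shift_increasing])
    fix x assume x: "x < N"
    show "orbit (nc_join ?w) x = orbit (shift N) x"
      using nc_join_orbit[OF w x] orbit_shift[OF x] call[OF x] nc_closureD(2) by auto
  qed
qed

lemma pinv_shift: "pinv (shift N) = shift N ^^ (N - 1)"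
proof
  fix y
  have "shift N ((shift N ^^ (N - 1)) y) = y"
  proof (cases "y < N")
    case True
    have "shift N ((shift N ^^ (N - 1)) y) = (shift N ^^ N) y"
      using N_pos by (metis Suc_diff_1 comp_apply funpow.simps(2))
    then show ?thesis using True by (simp add: shift_funpow)
  next
    case False
    have "(shift N ^^ k) y = y" for k using False by (induction k) (auto simp: shift_def)
    then show ?thesis using False by (simp add: shift_def)
  qed
  then show "pinv (shift N) y = (shift N ^^ (N - 1)) y"
    using permutes_inverses(2)[OF shift_permutes] by metis
qed

lemma pop_shift_pow:
  assumes j: "1 \<le> j" "j < N"
  shows "pop (shift N ^^ j) = shift N ^^ (j - 1)"
proof
  fix y
  have "shift N ^^ j = shift N ^^ (j - 1) \<circ> shift N"
    using j by (metis Suc_diff_1 funpow_Suc_right less_le_trans zero_less_one)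
  then have "(shift N ^^ j) (pinv (shift N) y) = (shift N ^^ (j - 1)) (shift N (pinv (shift N) y))"
    by (simp only: comp_apply)
  then show "pop (shift N ^^ j) y = (shift N ^^ (j - 1)) y"
    by (simp add: pop_def nc_join_shift_pow[OF j] permutes_inverses(1)[OF shift_permutes, of N y])
qed

text \<open>Each step lowers the exponent of a rotation by one, and the inverse of the generator is
  the rotation with exponent \<open>N - 1\<close>.\<close>

lemma pop_inverse_slow: "(pop ^^ (N - 2)) (pinv (shift N)) \<noteq> id"
proof -
  have "(pop ^^ k) (shift N ^^ (N - 1)) = shift N ^^ (N - 1 - k)" if "k \<le> N - 2" for k
    using that
  proof (induction k)
    case (Suc k)
    then show ?case using pop_shift_pow[of "N - 1 - k"] N_ge by simp
  qed simp
  then have "(pop ^^ (N - 2)) (pinv (shift N)) = shift N ^^ (N - 1 - (N - 2))"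
    unfolding pinv_shift by simp
  moreover have "N - 1 - (N - 2) = 1" using N_ge by simp
  moreover have "shift N 0 \<noteq> 0" using N_ge by (simp add: shift_def)
  ultimately show ?thesis by (auto simp: fun_eq_iff)
qed

end

section \<open>Reflection groups and the absolute order\<close>

locale refl_group = group W for W :: "('g, 'b) monoid_scheme" (structure) +
  fixes s :: "'n::finite \<Rightarrow> 'g"
  assumes s_range: "range s \<subseteq> carrier W"
    and s_generate: "generate W (range s) = carrier W"
    and s_invol: "s i \<otimes> s i = \<one>"
begin

lemma s_closed [simp]: "s i \<in> carrier W"
  using s_range by blast

lemma inv_s: "inv (s i) = s i"
  using inv_equality[OF s_invol] by simp

abbreviation T :: "'g set" where "T \<equiv> reflections W s"

abbreviation lm :: "'g list \<Rightarrow> 'g" where "lm \<equiv> list_mult W"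

lemma lm_simps [simp]: "lm [] = \<one>" "lm (x # xs) = x \<otimes> lm xs"
  by (simp_all add: list_mult_def)

lemma lm_closed: "set xs \<subseteq> carrier W \<Longrightarrow> lm xs \<in> carrier W"
  by (induction xs) auto

lemma lm_append: "set xs \<subseteq> carrier W \<Longrightarrow> set ys \<subseteq> carrier W \<Longrightarrow> lm (xs @ ys) = lm xs \<otimes> lm ys"
  by (induction xs) (auto simp: m_assoc lm_closed)

lemma word_closed [simp]: "lm (map s u) \<in> carrier W"
  by (rule lm_closed) auto

lemma word_append: "lm (map s (u @ v)) = lm (map s u) \<otimes> lm (map s v)"
  unfolding map_append by (rule lm_append) auto

lemma word_inv: "inv (lm (map s u)) = lm (map s (rev u))"
proof (induction u)
  case (Cons i u)
  have "lm (map s (rev (i # u))) = lm (map s (rev u)) \<otimes> s i"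
    using word_append[of "rev u" "[i]"] by simp
  then show ?case using Cons by (simp add: inv_mult_group inv_s)
qed simp

lemma ex_word:
  assumes "w \<in> carrier W"
  obtains u where "lm (map s u) = w"
proof -
  have "w \<in> generate W (range s)" using assms s_generate by simp
  then have "\<exists>u. lm (map s u) = w"
  proof (induction rule: generate.induct)
    case one
    show ?case by (intro exI[of _ "[]"]) simp
  next
    case (incl x)
    then obtain i where "x = s i" by blast
    then show ?case by (intro exI[of _ "[i]"]) simp
  next
    case (inv x)
    then obtain i where "x = s i" by blast
    then show ?case by (intro exI[of _ "[i]"]) (simp add: inv_s)
  next
    case (eng x y)
    then obtain u v where "lm (map s u) = x" "lm (map s v) = y" by blast
    then show ?case by (intro exI[of _ "u @ v"]) (simp only: word_append)
  qed
  then show thesis using that by blast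
qed

lemma cancel:
  assumes "x \<in> carrier W" "v \<in> carrier W"
  shows "inv v \<otimes> (v \<otimes> x) = x" "v \<otimes> (inv v \<otimes> x) = x" "s i \<otimes> (s i \<otimes> x) = x"
  using assms s_invol[of i] by (simp_all add: m_assoc[symmetric])

lemma T_closed: "t \<in> T \<Longrightarrow> t \<in> carrier W"
  by (auto simp: reflections_def)

lemma s_T: "s i \<in> T"
  unfolding reflections_def by (intro CollectI exI[of _ \<one>] exI[of _ i]) simp

lemma T_conj:
  assumes "t \<in> T" "w \<in> carrier W"
  shows "w \<otimes> t \<otimes> inv w \<in> T"
proof -
  obtain v i where t: "t = v \<otimes> s i \<otimes> inv v" "v \<in> carrier W" using assms(1) by (auto simp: reflections_def)
  have "w \<otimes> t \<otimes> inv w = (w \<otimes> v) \<otimes> s i \<otimes> inv (w \<otimes> v)"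
    using t assms(2) by (simp add: m_assoc inv_mult_group)
  then show ?thesis unfolding reflections_def using assms(2) t(2) by blast
qed

lemma T_invol: "t \<in> T \<Longrightarrow> t \<otimes> t = \<one>"
proof -
  assume "t \<in> T"
  then obtain v i where t: "t = v \<otimes> s i \<otimes> inv v" "v \<in> carrier W" by (auto simp: reflections_def)
  have "t \<otimes> t = v \<otimes> (s i \<otimes> (inv v \<otimes> (v \<otimes> (s i \<otimes> inv v))))"
    unfolding t(1) using t(2) by (simp add: m_assoc)
  also have "\<dots> = \<one>" using t(2) by (simp only: cancel inv_closed s_closed m_closed r_inv)
  finally show ?thesis .
qed

lemma inv_T: "t \<in> T \<Longrightarrow> inv t = t"
  using inv_equality[OF T_invol] T_closed by blast

lemma ex_T_word:
  assumes "w \<in> carrier W"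
  shows "\<exists>ts. set ts \<subseteq> T \<and> lm ts = w"
proof -
  obtain u where "lm (map s u) = w" using ex_word[OF assms] .
  then show ?thesis using s_T by (intro exI[of _ "map s u"]) auto
qed

lemma abs_length_le: "set ts \<subseteq> T \<Longrightarrow> lm ts = w \<Longrightarrow> abs_length W s w \<le> length ts"
  unfolding abs_length_def by (rule Least_le) blast

lemma abs_length_ex:
  assumes "w \<in> carrier W"
  obtains ts where "length ts = abs_length W s w" "set ts \<subseteq> T" "lm ts = w"
proof -
  have "\<exists>k ts. length ts = k \<and> set ts \<subseteq> T \<and> lm ts = w" using ex_T_word[OF assms] by blast
  then have "\<exists>ts. length ts = abs_length W s w \<and> set ts \<subseteq> T \<and> lm ts = w"
    unfolding abs_length_def by (rule LeastI_ex)
  then show thesis using that by blast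
qed

lemma abs_length_one: "abs_length W s \<one> = 0"
  using abs_length_le[of "[]" \<one>] by simp

lemma abs_length_zero: "w \<in> carrier W \<Longrightarrow> abs_length W s w = 0 \<longleftrightarrow> w = \<one>"
proof
  assume w: "w \<in> carrier W" "abs_length W s w = 0"
  obtain ts where "length ts = abs_length W s w" "lm ts = w" using abs_length_ex[OF w(1)] .
  then show "w = \<one>" using w(2) by simp
qed (simp add: abs_length_one)

lemma abs_le_antisym:
  assumes "u \<in> carrier W" "v \<in> carrier W" "abs_le W s u v" "abs_le W s v u"
  shows "u = v"
proof -
  have "abs_length W s (v \<otimes> inv u) = 0" using assms(3,4) unfolding abs_le_def by linarith
  then have "v \<otimes> inv u = \<one>" using abs_length_zero assms by simp
  then show ?thesis using assms(1,2) by (metis inv_inv inv_equality inv_closed)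
qed

lemma abs_le_refl: "w \<in> carrier W \<Longrightarrow> abs_le W s w w"
  by (simp add: abs_le_def abs_length_one)

lemma NC_carrier: "carrier (NC W s c) = {u \<in> carrier W. abs_le W s u c}"
  by (auto simp: NC_def abs_le_def abs_length_one)

text \<open>The lattice join is a chosen least upper bound. Antisymmetry of the absolute order makes
  it unique, so exhibiting one least upper bound is enough.\<close>

lemma nc_proj_eqI:
  assumes w: "w \<in> carrier W"
    and below: "\<And>t. t \<in> T \<Longrightarrow> abs_le W s t w \<Longrightarrow> abs_le W s t c"
    and u: "u \<in> carrier W" "abs_le W s u c" "\<And>t. t \<in> T \<Longrightarrow> abs_le W s t w \<Longrightarrow> abs_le W s t u"
    and least: "\<And>v. v \<in> carrier W \<Longrightarrow> abs_le W s v c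
      \<Longrightarrow> (\<And>t. t \<in> T \<Longrightarrow> abs_le W s t w \<Longrightarrow> abs_le W s t v) \<Longrightarrow> abs_le W s u v"
  shows "nc_proj W s c w = u"
proof -
  let ?L = "NC W s c"
  let ?A = "{t \<in> T. abs_le W s t w}"
  have le: "le ?L = abs_le W s" by (simp add: NC_def)
  have A: "?A \<subseteq> carrier ?L" unfolding NC_carrier using below T_closed by blast
  have U: "Upper ?L ?A = {v \<in> carrier ?L. \<forall>t\<in>?A. abs_le W s t v}"
    unfolding Upper_def le using A by blast
  have lu: "least ?L u (Upper ?L ?A)"
    unfolding least_def U le using u least unfolding NC_carrier by blast
  have "x = u" if "least ?L x (Upper ?L ?A)" for x
  proof -
    have "x \<in> carrier W" "abs_le W s x u" "abs_le W s u x"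
      using that lu unfolding least_def le U NC_carrier by blast+
    then show ?thesis using abs_le_antisym u(1) by blast
  qed
  then have "(SOME x. least ?L x (Upper ?L ?A)) = u" using lu by (intro some_equality)
  then show ?thesis unfolding nc_proj_def sup_def .
qed

end

section \<open>Sizes of forward orbits\<close>

lemma forward_orbit_until:
  assumes fix1: "f e = e" and K: "(f ^^ K) x = e" "\<And>j. j < K \<Longrightarrow> (f ^^ j) x \<noteq> e"
  shows "forward_orbit f x = (\<lambda>k. (f ^^ k) x) ` {..K}" "card (forward_orbit f x) = Suc K"
proof -
  have stay: "(f ^^ (K + k)) x = e" for k
    by (induction k) (simp_all add: K(1) fix1)
  show orb: "forward_orbit f x = (\<lambda>k. (f ^^ k) x) ` {..K}"
  proof
    show "forward_orbit f x \<subseteq> (\<lambda>k. (f ^^ k) x) ` {..K}"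
    proof
      fix y assume "y \<in> forward_orbit f x"
      then obtain k where k: "y = (f ^^ k) x" by (auto simp: forward_orbit_def)
      show "y \<in> (\<lambda>k. (f ^^ k) x) ` {..K}"
      proof (cases "k \<le> K")
        case False
        then have "y = (f ^^ K) x" using stay[of "k - K"] k K(1) by simp
        then show ?thesis by blast
      qed (use k in blast)
    qed
  qed (auto simp: forward_orbit_def)
  have "inj_on (\<lambda>k. (f ^^ k) x) {..K}"
  proof -
    have "False" if "i < j" "j \<le> K" "(f ^^ i) x = (f ^^ j) x" for i j
    proof -
      have "(f ^^ (K - j + i)) x = (f ^^ (K - j + j)) x" using that(3) by (simp only: funpow_add comp_apply)
      then have "(f ^^ (K - j + i)) x = e" using that(2) K(1) by simp
      moreover have "K - j + i < K" using that(1,2) by linarith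
      ultimately show False using K(2) by blast
    qed
    then show ?thesis by (intro inj_onI) (metis atMost_iff linorder_neqE_nat)
  qed
  then show "card (forward_orbit f x) = Suc K" unfolding orb by (simp add: card_image)
qed

text \<open>All three claims of the theorem follow once every element reaches \<open>e\<close>
  within \<open>h - 1\<close> steps and \<open>x\<close> alone has not reached it after
  \<open>h - 2\<close>.\<close>

lemma forward_orbit_max:
  assumes h: "h \<ge> 2" and fin: "finite A" and x: "x \<in> A" and fix1: "f e = e"
    and one: "\<And>w. w \<in> A \<Longrightarrow> (f ^^ (h - 1)) w = e"
    and two: "\<And>w. w \<in> A \<Longrightarrow> (f ^^ (h - 2)) w \<noteq> e \<Longrightarrow> w = x"
    and three: "(f ^^ (h - 2)) x \<noteq> e"
  shows "(\<forall>w\<in>A. (f ^^ (h - 1)) w = e) \<and> Max {card (forward_orbit f w) | w. w \<in> A} = h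
    \<and> {forward_orbit f w | w. w \<in> A \<and> card (forward_orbit f w) = h} = {forward_orbit f x}"
proof -
  have stay: "(f ^^ (j + k)) w = e" if "(f ^^ j) w = e" for j k w
    using that fix1 by (induction k) simp_all
  have hh: "h - 1 = Suc (h - 2)" "Suc (h - 1) = h" using h by simp_all
  have lt: "card (forward_orbit f w) < h" if w: "w \<in> A" "(f ^^ (h - 2)) w = e" for w
  proof -
    define K where "K = (LEAST k. (f ^^ k) w = e)"
    have K: "(f ^^ K) w = e" unfolding K_def using w(2) by (rule LeastI)
    have "K \<le> h - 2" unfolding K_def using w(2) by (rule Least_le)
    moreover have "card (forward_orbit f w) = Suc K"
      by (rule forward_orbit_until(2)[where f = f and e = e, OF fix1 K]) (unfold K_def, rule not_less_Least)
    ultimately show ?thesis using h by linarith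
  qed
  have eq: "card (forward_orbit f x) = h"
  proof -
    have "(f ^^ j) x \<noteq> e" if "j < h - 1" for j
    proof
      assume "(f ^^ j) x = e"
      then have "(f ^^ (j + (h - 2 - j))) x = e" by (rule stay)
      moreover have "j + (h - 2 - j) = h - 2" using that by linarith
      ultimately show False using three by simp
    qed
    from forward_orbit_until(2)[where f = f and e = e, OF fix1 one[OF x] this] show ?thesis using hh by simp
  qed
  have le: "card (forward_orbit f w) \<le> h" if "w \<in> A" for w
    using lt[OF that] two[OF that] eq by (cases "(f ^^ (h - 2)) w = e") auto
  have "Max {card (forward_orbit f w) | w. w \<in> A} = h"
  proof (rule Max_eqI)
    show "finite {card (forward_orbit f w) | w. w \<in> A}" using fin by simp
    show "h \<in> {card (forward_orbit f w) | w. w \<in> A}" using x eq[symmetric] by blast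
    show "y \<le> h" if "y \<in> {card (forward_orbit f w) | w. w \<in> A}" for y using that le by blast
  qed
  moreover have "w = x" if "w \<in> A" "card (forward_orbit f w) = h" for w
    using lt[OF that(1)] two[OF that(1)] that(2) by fastforce
  then have "{forward_orbit f w | w. w \<in> A \<and> card (forward_orbit f w) = h} = {forward_orbit f x}"
    using x eq by blast
  ultimately show ?thesis using one by blast
qed

section \<open>Groups with a permutation model in which the Coxeter element is the rotation\<close>

locale perm_model = refl_group W s + cyclic_perms N sg md
  for W :: "('g, 'b) monoid_scheme" (structure) and s :: "'n::finite \<Rightarrow> 'g" and N sg md +
  fixes rho :: "'g \<Rightarrow> nat \<Rightarrow> nat" and c :: 'g
  assumes rho_mult: "x \<in> carrier W \<Longrightarrow> y \<in> carrier W \<Longrightarrow> rho (x \<otimes> y) = rho x \<circ> rho y"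
    and rho_inj: "inj_on rho (carrier W)"
    and rho_G: "x \<in> carrier W \<Longrightarrow> rho x \<in> G"
    and rho_T: "rho ` T = TR"
    and c_closed: "c \<in> carrier W"
    and rho_c: "rho c = shift N"
begin

lemma rho_eq_iff: "x \<in> carrier W \<Longrightarrow> y \<in> carrier W \<Longrightarrow> rho x = rho y \<longleftrightarrow> x = y"
  using rho_inj by (simp add: inj_on_eq_iff)

lemma rho_one: "rho \<one> = id"
proof
  fix y
  have "rho \<one> (rho \<one> y) = rho \<one> y" using rho_mult[of \<one> \<one>] by (simp add: fun_eq_iff)
  then show "rho \<one> y = id y" using inj_eq[OF permutes_inj[OF G_perm[OF rho_G[OF one_closed]]]] by simp
qed

lemma rho_inv: "x \<in> carrier W \<Longrightarrow> rho (inv x) = pinv (rho x)"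
proof
  fix y
  assume x: "x \<in> carrier W"
  have "rho x \<circ> rho (inv x) = id" using rho_mult[of x "inv x"] x rho_one by simp
  then have "rho x (rho (inv x) y) = y" by (simp add: fun_eq_iff)
  then show "rho (inv x) y = pinv (rho x) y"
    using permutes_inverses(2)[OF G_perm[OF rho_G[OF x]], of "rho (inv x) y"] by simp
qed

lemma rho_lm: "set ts \<subseteq> carrier W \<Longrightarrow> rho (lm ts) = foldr (\<circ>) (map rho ts) id"
  by (induction ts) (simp_all add: rho_one rho_mult lm_closed)

lemma T_lift:
  assumes "set rs \<subseteq> TR"
  obtains ts where "set ts \<subseteq> T" "map rho ts = rs"
proof -
  have "\<exists>ts. set ts \<subseteq> T \<and> map rho ts = rs"
    using assms
  proof (induction rs)
    case (Cons r rs)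
    then obtain ts where ts: "set ts \<subseteq> T" "map rho ts = rs" by auto
    have "r \<in> rho ` T" using Cons.prems rho_T by simp
    then obtain t where "t \<in> T" "rho t = r" by blast
    then show ?case using ts by (intro exI[of _ "t # ts"]) simp
  qed simp
  then show thesis using that by blast
qed

text \<open>The elements of \<open>G\<close> are products of the \<open>tr a b\<close>, and each of
  these is the image of a reflection.\<close>

lemma rho_surj: "p \<in> G \<Longrightarrow> \<exists>x\<in>carrier W. rho x = p"
proof -
  assume p: "p \<in> G"
  obtain rs where rs: "set rs \<subseteq> TR" "foldr (\<circ>) rs id = p" by (rule ex_tr_word_d[OF p])
  obtain ts where ts: "set ts \<subseteq> T" "map rho ts = rs" by (rule T_lift[OF rs(1)])
  have tc: "set ts \<subseteq> carrier W" using ts(1) T_closed by blast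
  have "rho (lm ts) = p" using rho_lm[OF tc] ts(2) rs(2) by simp
  then show ?thesis using lm_closed[OF tc] by blast
qed

lemma abs_length_d: "w \<in> carrier W \<Longrightarrow> abs_length W s w + d (rho w) = D"
proof -
  assume w: "w \<in> carrier W"
  obtain rs where rs: "set rs \<subseteq> TR" "foldr (\<circ>) rs id = rho w" "length rs + d (rho w) = D"
    by (rule ex_tr_word_d[OF rho_G[OF w]])
  obtain ts where ts: "set ts \<subseteq> T" "map rho ts = rs" by (rule T_lift[OF rs(1)])
  have tc: "set ts \<subseteq> carrier W" using ts(1) T_closed by blast
  have "rho (lm ts) = rho w" using rho_lm[OF tc] ts(2) rs(2) by simp
  then have "lm ts = w" using rho_eq_iff lm_closed[OF tc] w by blast
  then have le: "abs_length W s w \<le> length ts" using abs_length_le ts(1) by blast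
  obtain us where us: "length us = abs_length W s w" "set us \<subseteq> T" "lm us = w"
    by (rule abs_length_ex[OF w])
  have uc: "set us \<subseteq> carrier W" using us(2) T_closed by blast
  have "set (map rho us) \<subseteq> TR" using us(2) rho_T by auto
  then have "D \<le> length us + d (rho w)"
    using tr_word_lower_d[of "map rho us"] rho_lm[OF uc] us(3) by simp
  moreover have "length ts = length rs" using ts(2) by auto
  ultimately show ?thesis using le rs(3) us(1) by linarith
qed

lemma abs_le_d:
  assumes "u \<in> carrier W" "v \<in> carrier W"
  shows "abs_le W s u v \<longleftrightarrow> d (rho u) + d (rho v \<circ> pinv (rho u)) = D + d (rho v)"
proof -
  have "rho (v \<otimes> inv u) = rho v \<circ> pinv (rho u)" using assms by (simp add: rho_mult rho_inv)
  then show ?thesis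
    using abs_length_d[of u] abs_length_d[of v] abs_length_d[of "v \<otimes> inv u"] assms
    unfolding abs_le_def by simp linarith
qed

lemma d_tr:
  assumes "a < N" "b < N" "a \<noteq> b"
  shows "d (tr a b) + 1 = D"
proof -
  have "d (tr a b \<circ> tr a (tr a b a)) = d (tr a b) + 1"
    by (rule d_step) (use assms tr_G in \<open>simp_all add: tr_simps\<close>)
  moreover have "tr a b \<circ> tr a (tr a b a) = id"
    using tr_invol[OF assms(1,2)] by (simp add: tr_simps fun_eq_iff)
  ultimately show ?thesis by (simp add: D_def)
qed

lemma abs_le_T:
  assumes t: "t \<in> T" "rho t = tr a b" and ab: "a < N" "b < N" "a \<noteq> b" and w: "w \<in> carrier W"
  shows "abs_le W s t w \<longleftrightarrow> d (rho w \<circ> tr a b) = d (rho w) + 1"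
proof -
  have "pinv (tr a b) = tr a b" using rho_inv[OF T_closed[OF t(1)]] inv_T[OF t(1)] t(2) by simp
  then show ?thesis using abs_le_d[OF T_closed[OF t(1)] w] t(2) d_tr[OF ab] by simp linarith
qed

lemma T_tr:
  assumes "t \<in> T"
  obtains a b where "rho t = tr a b" "a < N" "b < N" "a \<noteq> b"
proof -
  have "rho t \<in> TR" using assms rho_T by blast
  then show thesis using that by (auto simp: TR_def)
qed

lemma abs_le_c_nc_perm: "u \<in> carrier W \<Longrightarrow> abs_le W s u c \<Longrightarrow> nc_perm (rho u)"
  using abs_le_d[OF _ c_closed] nc_permI(1)[OF rho_G] by (simp add: rho_c)

lemma nc_perm_abs_le:
  assumes "u \<in> carrier W" "v \<in> carrier W" "nc_perm (rho u)" "nc_perm (rho v)"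
    "\<And>x. x < N \<Longrightarrow> orbit (rho u) x \<subseteq> orbit (rho v) x"
  shows "abs_le W s u v"
  using abs_le_d[OF assms(1,2)] nc_perm_quotient(2)[OF assms(3-5)] by simp

lemma nc_perm_abs_le_c: "u \<in> carrier W \<Longrightarrow> nc_perm (rho u) \<Longrightarrow> abs_le W s u c"
proof (rule nc_perm_abs_le[OF _ c_closed])
  assume u: "u \<in> carrier W" "nc_perm (rho u)"
  show "u \<in> carrier W" "nc_perm (rho u)" "nc_perm (rho c)" using u nc_perm_shift rho_c by simp_all
  show "orbit (rho u) x \<subseteq> orbit (rho c) x" if "x < N" for x
    using orbit_lt[OF G_perm[OF rho_G[OF u(1)]]] that by (auto simp: rho_c orbit_shift)
qed

text \<open>A reflection below \<open>w\<close> joins two points of one closure class and so lies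
  below the join. Conversely, an upper bound \<open>v\<close> in the interval lies above every
  reflection through \<open>y\<close> and \<open>w y\<close>; its cycles are therefore coarser than
  those of \<open>w\<close>, and being noncrossing also coarser than the closure.\<close>

lemma rho_nc_proj:
  assumes w: "w \<in> carrier W"
  shows "nc_proj W s c w \<in> carrier W" "rho (nc_proj W s c w) = nc_join (rho w)"
proof -
  note wG = rho_G[OF w]
  obtain u where u: "u \<in> carrier W" "rho u = nc_join (rho w)"
    using rho_surj[OF nc_join_G[OF wG]] by blast
  have nu: "nc_perm (rho u)" using nc_perm_nc_join[OF wG] u(2) by simp
  have le_u: "abs_le W s t v"
    if t: "t \<in> T" and v: "v \<in> carrier W" "nc_perm (rho v)"
      and ab: "rho t = tr a b" "a < N" "b < N" "a \<noteq> b" "b \<in> orbit (rho v) a" for t v a b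
  proof (rule nc_perm_abs_le[OF T_closed[OF t] v(1) _ v(2)])
    show "nc_perm (rho t)" using nc_perm_tr ab by simp
    have vp: "rho v permutes {..<N}" using G_perm[OF rho_G[OF v(1)]] .
    show "orbit (rho t) x \<subseteq> orbit (rho v) x" if x: "x < N" for x
    proof -
      have "tr a b x \<in> orbit (rho v) x"
      proof -
        have sgo: "sg b \<in> orbit (rho v) (sg a)" by (rule orbit_sg[OF rho_G[OF v(1)] ab(5)])
        have "a \<in> orbit (rho v) b" "sg a \<in> orbit (rho v) (sg b)"
          using orbit_sym[OF vp] ab(5) sgo by blast+
        then show ?thesis using ab(5) sgo self_in_orbit[OF vp, of x] by (simp add: tr_def)
      qed
      then show ?thesis using orbit_tr[OF ab(2,3), of x] self_in_orbit[OF vp, of x] ab(1) by auto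
    qed
  qed
  have eq: "nc_proj W s c w = u"
  proof (rule nc_proj_eqI[OF w])
    show "u \<in> carrier W" by (rule u(1))
    show "abs_le W s u c" by (rule nc_perm_abs_le_c[OF u(1) nu])
    show "abs_le W s t c" if t: "t \<in> T" for t
    proof -
      obtain a b where "rho t = tr a b" "a < N" "b < N" "a \<noteq> b" by (rule T_tr[OF t])
      then show ?thesis using nc_perm_abs_le_c[OF T_closed[OF t]] nc_perm_tr by simp
    qed
    show "abs_le W s t u" if t: "t \<in> T" "abs_le W s t w" for t
    proof -
      obtain a b where ab: "rho t = tr a b" "a < N" "b < N" "a \<noteq> b" by (rule T_tr[OF t(1)])
      have "nc_closure N (rho w) a b"
        using tr_below_closure[OF wG ab(2,3)] abs_le_T[OF t(1) ab w] t(2) by simp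
      then have "b \<in> orbit (rho u) a" using nc_join_orbit[OF wG ab(2)] u(2) by simp
      then show ?thesis using le_u[OF t(1) u(1) nu ab] by simp
    qed
    show "abs_le W s u v"
      if v: "v \<in> carrier W" "abs_le W s v c" and up: "\<And>t. t \<in> T \<Longrightarrow> abs_le W s t w \<Longrightarrow> abs_le W s t v" for v
    proof (rule nc_perm_abs_le[OF u(1) v(1) nu])
      show nv: "nc_perm (rho v)" by (rule abs_le_c_nc_perm[OF v])
      have vp: "rho v permutes {..<N}" using G_perm[OF rho_G[OF v(1)]] .
      have step: "rho w y \<in> orbit (rho v) y" if y: "y < N" for y
      proof (cases "rho w y = y")
        case True
        then show ?thesis using self_in_orbit[OF vp] by simp
      next
        case False
        have wy: "rho w y < N" using G_lt[OF wG] y by simp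
        have "tr y (rho w y) \<in> rho ` T" unfolding rho_T TR_def using y wy False[symmetric] by blast
        then obtain t where t: "t \<in> T" "rho t = tr y (rho w y)" by force
        have "abs_le W s t w"
          using abs_le_T[OF t y wy False[symmetric] w] d_step[OF wG False] by simp
        then have "d (rho v \<circ> tr y (rho w y)) = d (rho v) + 1"
          using abs_le_T[OF t y wy False[symmetric] v(1)] up[OF t(1)] by simp
        then show ?thesis by (rule tr_below_nc[OF nv y wy])
      qed
      show "orbit (rho u) x \<subseteq> orbit (rho v) x" if "x < N" for x
        unfolding u(2) by (rule nc_join_least[OF wG nv step that])
    qed
  qed
  show "nc_proj W s c w \<in> carrier W" "rho (nc_proj W s c w) = nc_join (rho w)"
    unfolding eq using u by simp_all
qed

lemma Pop_closed: "w \<in> carrier W \<Longrightarrow> Pop W s c w \<in> carrier W"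
  unfolding Pop_def using rho_nc_proj(1) by simp

lemma rho_Pop: "w \<in> carrier W \<Longrightarrow> rho (Pop W s c w) = pop (rho w)"
  unfolding Pop_def pop_def using rho_nc_proj[of w] by (simp add: rho_mult rho_inv)

lemma rho_Pop_funpow:
  "w \<in> carrier W \<Longrightarrow> (Pop W s c ^^ k) w \<in> carrier W \<and> rho ((Pop W s c ^^ k) w) = (pop ^^ k) (rho w)"
  by (induction k) (simp_all add: Pop_closed rho_Pop)

lemma Pop_funpow_one_iff: "w \<in> carrier W \<Longrightarrow> (Pop W s c ^^ k) w = \<one> \<longleftrightarrow> (pop ^^ k) (rho w) = id"
  using rho_Pop_funpow[of w k] rho_eq_iff[of "(Pop W s c ^^ k) w" \<one>] rho_one by simp

theorem Pop_conclusion: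
  assumes "finite (carrier W)"
  shows "(\<forall>w\<in>carrier W. (Pop W s c ^^ (N - 1)) w = \<one>)
    \<and> Max {card (forward_orbit (Pop W s c) w) | w. w \<in> carrier W} = N
    \<and> {forward_orbit (Pop W s c) w | w. w \<in> carrier W \<and> card (forward_orbit (Pop W s c) w) = N}
        = {forward_orbit (Pop W s c) (inv c)}"
proof (rule forward_orbit_max[OF N_ge assms])
  show "inv c \<in> carrier W" using c_closed by simp
  have "nc_join id = id"
    using nc_join_fix[OF id_G] by (simp add: fun_eq_iff)
  then have "pop id = id" by (simp add: pop_def)
  then show "Pop W s c \<one> = \<one>" using Pop_funpow_one_iff[of \<one> 1] by (simp add: rho_one)
  show "(Pop W s c ^^ (N - 1)) w = \<one>" if "w \<in> carrier W" for w
    using Pop_funpow_one_iff[OF that] pop_power_id[OF rho_G[OF that]] by simp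
  show "w = inv c" if w: "w \<in> carrier W" "(Pop W s c ^^ (N - 2)) w \<noteq> \<one>" for w
  proof -
    have "rho w = pinv (shift N)"
      using Pop_funpow_one_iff[OF w(1)] pop_slow_unique[OF rho_G[OF w(1)]] w(2) by simp
    then have "rho w = rho (inv c)" using rho_inv[OF c_closed] rho_c by simp
    then show ?thesis using rho_eq_iff w(1) c_closed by simp
  qed
  show "(Pop W s c ^^ (N - 2)) (inv c) \<noteq> \<one>"
    using Pop_funpow_one_iff[of "inv c"] c_closed pop_inverse_slow by (simp add: rho_inv rho_c)
qed

end

section \<open>A lower bound for the Coxeter number\<close>

definition plane_curve :: "'a::real_vector \<Rightarrow> 'a \<Rightarrow> real \<Rightarrow> 'a" where
  "plane_curve u v p = cos p *\<^sub>R u + sin p *\<^sub>R v"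

lemma sum_list_mult_product:
  fixes f :: "'a \<Rightarrow> 'c::comm_semiring_0"
  shows "(\<Sum>x\<leftarrow>xs. f x) * (\<Sum>y\<leftarrow>ys. g y) = (\<Sum>z\<leftarrow>List.product xs ys. f (fst z) * g (snd z))"
proof (induction xs)
  case (Cons x xs)
  have "f x * (\<Sum>y\<leftarrow>ys. g y) = (\<Sum>y\<leftarrow>ys. f x * g y)" by (simp add: sum_list_const_mult)
  then show ?case using Cons by (simp add: distrib_right o_def)
qed simp

text \<open>A triple \<open>(a, j, l)\<close> stands for \<open>a\<close> times the
  \<open>j\<close>-th power of \<open>r * cis p\<close> times the \<open>l\<close>-th power of its
  conjugate: degree \<open>j + l\<close> in the radius, frequency \<open>j - l\<close> in the
  angle.\<close>

definition trig_term :: "real \<Rightarrow> real \<Rightarrow> complex \<times> nat \<times> nat \<Rightarrow> complex" where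
  "trig_term r p z = fst z * of_real r ^ (fst (snd z) + snd (snd z)) *
     cis ((real (fst (snd z)) - real (snd (snd z))) * p)"

text \<open>A linear function contributes one term of frequency 1 and one of frequency -1, and
  products of terms are terms.\<close>

lemma polynomial_on_plane:
  fixes f :: "'a::real_normed_vector \<Rightarrow> real"
  assumes "real_polynomial_function f"
  shows "\<exists>L. \<forall>r p. complex_of_real (f (r *\<^sub>R plane_curve u v p)) = (\<Sum>z\<leftarrow>L. trig_term r p z)"
  using assms
proof (induction rule: real_polynomial_function.induct)
  case (linear f)
  interpret f: bounded_linear f by (rule linear)
  define a b where "a = complex_of_real (f u)" and "b = complex_of_real (f v)"
  have "complex_of_real (f (r *\<^sub>R plane_curve u v p))
    = (\<Sum>z\<leftarrow>[((a - \<i> * b) / 2, 1, 0), ((a + \<i> * b) / 2, 0, 1)]. trig_term r p z)" for r p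
  proof -
    have "complex_of_real (f (r *\<^sub>R plane_curve u v p)) = of_real r * (of_real (cos p) * a + of_real (sin p) * b)"
      by (simp add: plane_curve_def f.add f.scaleR a_def b_def)
    also have "\<dots> = (a - \<i> * b) / 2 * of_real r * cis p + (a + \<i> * b) / 2 * of_real r * cis (- p)"
    proof -
      have c: "cis p = of_real (cos p) + \<i> * of_real (sin p)" "cis (- p) = of_real (cos p) - \<i> * of_real (sin p)"
        by (simp_all add: complex_eq_iff)
      have i: "\<i> * (\<i> * z) = - z" for z :: complex by (simp add: mult.assoc[symmetric])
      show ?thesis unfolding c by (simp add: field_simps i)
    qed
    finally show ?thesis by (simp add: trig_term_def)
  qed
  then show ?case by blast
next
  case (const c)
  show ?case by (intro exI[of _ "[(of_real c, 0, 0)]"]) (simp add: trig_term_def)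
next
  case (add f g)
  then obtain L M where "\<And>r p. complex_of_real (f (r *\<^sub>R plane_curve u v p)) = (\<Sum>z\<leftarrow>L. trig_term r p z)"
    "\<And>r p. complex_of_real (g (r *\<^sub>R plane_curve u v p)) = (\<Sum>z\<leftarrow>M. trig_term r p z)" by blast
  then show ?case by (intro exI[of _ "L @ M"]) simp
next
  case (mult f g)
  then obtain L M where LM: "\<And>r p. complex_of_real (f (r *\<^sub>R plane_curve u v p)) = (\<Sum>z\<leftarrow>L. trig_term r p z)"
    "\<And>r p. complex_of_real (g (r *\<^sub>R plane_curve u v p)) = (\<Sum>z\<leftarrow>M. trig_term r p z)" by blast
  define pr :: "(complex \<times> nat \<times> nat) \<times> (complex \<times> nat \<times> nat) \<Rightarrow> complex \<times> nat \<times> nat" where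
    "pr z = (fst (fst z) * fst (snd z), fst (snd (fst z)) + fst (snd (snd z)),
      snd (snd (fst z)) + snd (snd (snd z)))" for z
  have pr: "trig_term r p (fst z) * trig_term r p (snd z) = trig_term r p (pr z)" for r p z
  proof -
    obtain a j l a' j' l' where z: "z = ((a, j, l), (a', j', l'))" by (metis prod.collapse)
    have "(real (j + j') - real (l + l')) * p = (real j - real l) * p + (real j' - real l') * p"
      by (simp add: algebra_simps)
    then have c: "cis ((real (j + j') - real (l + l')) * p)
      = cis ((real j - real l) * p) * cis ((real j' - real l') * p)" by (simp only: cis_mult)
    have e: "j + j' + (l + l') = (j + l) + (j' + l')" by simp
    show ?thesis unfolding z trig_term_def pr_def fst_conv snd_conv c e power_add by (simp only: mult_ac)
  qed
  have "complex_of_real (f (r *\<^sub>R plane_curve u v p) * g (r *\<^sub>R plane_curve u v p))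
    = (\<Sum>z\<leftarrow>map pr (List.product L M). trig_term r p z)" for r p
    by (simp add: LM sum_list_mult_product pr o_def)
  then show ?case by blast
qed

text \<open>Two complex polynomials in \<open>r\<close> that agree at all real arguments are equal.
  This isolates the part of a given degree in the radius.\<close>

lemma power_coeff_unique:
  fixes L :: "(complex \<times> nat) list"
  assumes "\<And>r::real. (\<Sum>z\<leftarrow>L. fst z * of_real r ^ snd z) = A * of_real r ^ d"
  shows "(\<Sum>z\<leftarrow>filter (\<lambda>z. snd z = d) L. fst z) = A"
proof -
  define P where "P = (\<Sum>z\<leftarrow>L. Polynomial.monom (fst z) (snd z))"
  have "poly P (of_real r) = poly (Polynomial.monom A d) (of_real r)" for r :: real
  proof -
    have "poly P x = (\<Sum>z\<leftarrow>L. fst z * x ^ snd z)" for x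
      unfolding P_def by (induction L) (simp_all add: poly_monom)
    then show ?thesis using assms[of r] by (simp add: poly_monom)
  qed
  then have "range complex_of_real \<subseteq> {x. poly (P - Polynomial.monom A d) x = 0}" by auto
  moreover have "infinite (range complex_of_real)"
    using infinite_UNIV_char_0 finite_imageD[of complex_of_real UNIV] by (auto simp: inj_of_real)
  ultimately have "P - Polynomial.monom A d = 0" using poly_roots_finite finite_subset by blast
  then have "Polynomial.coeff P d = A" by simp
  moreover have "Polynomial.coeff P d = (\<Sum>z\<leftarrow>filter (\<lambda>z. snd z = d) L. fst z)"
    unfolding P_def by (induction L) auto
  ultimately show ?thesis by simp
qed

lemma sum_cis_zero:
  assumes "h > 0" "k \<noteq> 0" "\<bar>k\<bar> < int h" and \<delta>: "real h * \<delta> = 2 * pi"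
  shows "(\<Sum>t<h. cis (real t * (of_int k * \<delta>))) = 0"
proof -
  let ?z = "cis (of_int k * \<delta>)"
  have "?z \<noteq> 1"
  proof
    assume "?z = 1"
    then obtain n where "of_int k * \<delta> = of_int n * (2 * pi)" by (auto simp: cis_eq_1_iff)
    then have "of_int k * (real h * \<delta>) = of_int n * (2 * pi) * real h"
      by (metis mult.assoc mult.commute)
    then have "of_int k * (2 * pi) = (of_int n * real h) * (2 * pi)" unfolding \<delta> by (simp only: mult_ac)
    then have "real_of_int k = of_int n * real h" by (simp only: mult_cancel_right) simp
    then have "real_of_int k = of_int (n * int h)" by simp
    then have "k = n * int h" by linarith
    then have "int h dvd k" by simp
    then show False using assms zdvd_imp_le[of "int h" "\<bar>k\<bar>"] by simp
  qed
  moreover have "?z ^ h = 1"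
  proof -
    have "?z ^ h = cis (real h * (of_int k * \<delta>))" by (rule Complex.DeMoivre)
    also have "real h * (of_int k * \<delta>) = 2 * pi * of_int k" using \<delta> by (metis mult.left_commute mult.commute)
    finally show ?thesis by simp
  qed
  moreover have "(\<Sum>t<h. cis (real t * (of_int k * \<delta>))) = (\<Sum>t<h. ?z ^ t)" by (simp only: Complex.DeMoivre)
  ultimately show ?thesis using geometric_sum[of ?z h] by simp
qed

text \<open>Homogeneity of degree \<open>d\<close> bounds all frequencies by \<open>d < h\<close> in
  absolute value. Averaging over the \<open>h\<close> shifts by multiples of \<open>\<delta>\<close>
  leaves \<open>f\<close> unchanged on the curve and kills every nonzero frequency below
  \<open>h\<close>.\<close>

lemma homogeneous_constant_on_plane:
  fixes f :: "'a::real_normed_vector \<Rightarrow> real"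
  assumes f: "real_polynomial_function f" and hom: "\<And>a x. f (a *\<^sub>R x) = a ^ d * f x"
    and h: "d < h" and \<delta>: "real h * \<delta> = 2 * pi" and per: "\<And>p. f (plane_curve u v (p + \<delta>)) = f (plane_curve u v p)"
  shows "f (plane_curve u v p) = f (plane_curve u v 0)"
proof -
  obtain L where L: "\<And>r p. complex_of_real (f (r *\<^sub>R plane_curve u v p)) = (\<Sum>z\<leftarrow>L. trig_term r p z)"
    using polynomial_on_plane[OF f] by blast
  define M where "M = filter (\<lambda>z. fst (snd z) + snd (snd z) = d) L"
  have F: "complex_of_real (f (plane_curve u v p))
      = (\<Sum>z\<leftarrow>M. fst z * cis (of_int (int (fst (snd z)) - int (snd (snd z))) * p))" for p
  proof -
    let ?L = "map (\<lambda>z. (fst z * cis ((real (fst (snd z)) - real (snd (snd z))) * p), fst (snd z) + snd (snd z))) L"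
    have "(\<Sum>z\<leftarrow>?L. fst z * of_real r ^ snd z) = complex_of_real (f (plane_curve u v p)) * of_real r ^ d" for r :: real
      using L[of r p] by (simp add: hom trig_term_def o_def mult.commute mult.left_commute)
    then have "(\<Sum>z\<leftarrow>filter (\<lambda>z. snd z = d) ?L. fst z) = complex_of_real (f (plane_curve u v p))"
      by (rule power_coeff_unique)
    then show ?thesis by (simp add: M_def filter_map o_def)
  qed
  have per': "f (plane_curve u v (p + real t * \<delta>)) = f (plane_curve u v p)" for p t
  proof (induction t)
    case (Suc t)
    have "p + real (Suc t) * \<delta> = (p + real t * \<delta>) + \<delta>"
      by (simp add: field_simps)
    then show ?case using per[of "p + real t * \<delta>"] Suc by (simp add: add.assoc)
  qed simp
  have "of_nat h * complex_of_real (f (plane_curve u v p))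
    = of_nat h * (\<Sum>z\<leftarrow>filter (\<lambda>z. fst (snd z) = snd (snd z)) M. fst z)" for p
  proof -
    have "of_nat h * complex_of_real (f (plane_curve u v p))
      = (\<Sum>t<h. complex_of_real (f (plane_curve u v (p + real t * \<delta>))))"
      by (simp add: per')
    also have "\<dots> = (\<Sum>t<h. (\<Sum>z\<leftarrow>M. fst z * cis (of_int (int (fst (snd z)) - int (snd (snd z))) * p) *
        cis (real t * (of_int (int (fst (snd z)) - int (snd (snd z))) * \<delta>))))"
    proof -
      have "cis (of_int k * (p + real t * \<delta>)) = cis (of_int k * p) * cis (real t * (of_int k * \<delta>))" for k t
        by (simp add: cis_mult algebra_simps)
      then show ?thesis unfolding F by (simp only: mult.assoc)
    qed
    also have "\<dots> = (\<Sum>z\<leftarrow>M. fst z * cis (of_int (int (fst (snd z)) - int (snd (snd z))) * p) *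
        (\<Sum>t<h. cis (real t * (of_int (int (fst (snd z)) - int (snd (snd z))) * \<delta>))))"
      by (induction M) (simp_all add: sum.distrib sum_distrib_left)
    also have "\<dots> = (\<Sum>z\<leftarrow>M. if fst (snd z) = snd (snd z) then of_nat h * fst z else 0)"
    proof (rule arg_cong[where f = sum_list], rule map_cong[OF HOL.refl])
      fix z assume "z \<in> set M"
      then have d: "fst (snd z) + snd (snd z) = d" by (simp add: M_def)
      let ?k = "int (fst (snd z)) - int (snd (snd z))"
      show "fst z * cis (of_int ?k * p) * (\<Sum>t<h. cis (real t * (of_int ?k * \<delta>)))
        = (if fst (snd z) = snd (snd z) then of_nat h * fst z else 0)"
      proof (cases "?k = 0")
        case True
        then show ?thesis by simp
      next
        case False
        have "\<bar>?k\<bar> < int h" using d h by linarith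
        then have "(\<Sum>t<h. cis (real t * (of_int ?k * \<delta>))) = 0"
          using sum_cis_zero[of h ?k, OF _ _ _ \<delta>] h False by simp
        then show ?thesis using False by simp
      qed
    qed
    also have "\<dots> = of_nat h * (\<Sum>z\<leftarrow>filter (\<lambda>z. fst (snd z) = snd (snd z)) M. fst z)"
      by (induction M) (simp_all add: algebra_simps)
    finally show ?thesis .
  qed
  from this[of p] this[of 0]
  have "of_nat h * complex_of_real (f (plane_curve u v p)) = of_nat h * complex_of_real (f (plane_curve u v 0))"
    by (simp only:)
  then show ?thesis using h by simp
qed

text \<open>A closed curve in the span of \<open>x\<close> and \<open>y\<close> on which a pair of reflections at angle \<open>\<theta>\<close>
  acts as a shift of the parameter by \<open>2 \<theta>\<close>; up to scale, \<open>x\<close> and \<open>y\<close> are unit roots.\<close>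

definition refl_curve :: "real \<Rightarrow> 'a::real_vector \<Rightarrow> 'a \<Rightarrow> real \<Rightarrow> 'a" where
  "refl_curve \<theta> x y p = sin p *\<^sub>R x + sin (p + \<theta>) *\<^sub>R y"

lemma refl_curve_plane: "refl_curve \<theta> x y p = plane_curve (sin \<theta> *\<^sub>R y) (x + cos \<theta> *\<^sub>R y) p"
  by (simp add: refl_curve_def plane_curve_def sin_add algebra_simps)

text \<open>The coefficients of \<open>x\<close> and \<open>y\<close> are consecutive values of a
  sine with step \<open>\<theta>\<close>. By the recursion \<open>sin (q + \<theta>) + sin (q -
  \<theta>) = 2 * cos \<theta> * sin q\<close>, each reflection replaces one of them by the next
  value.\<close>

lemma refl_curve_reflect:
  assumes f1: "linear f1" "f1 x = - x" "f1 y = y + (2 * cos \<theta>) *\<^sub>R x"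
    and f2: "linear f2" "f2 y = - y" "f2 x = x + (2 * cos \<theta>) *\<^sub>R y"
  shows "f1 (f2 (refl_curve \<theta> x y p)) = refl_curve \<theta> x y (p - 2 * \<theta>)"
proof -
  have A: "sin (p + \<theta>) = sin p * cos \<theta> + cos p * sin \<theta>" "sin (p - \<theta>) = sin p * cos \<theta> - cos p * sin \<theta>"
    by (simp_all add: sin_add sin_diff)
  have 1: "f2 (refl_curve \<theta> x y p) = sin p *\<^sub>R x + sin (p - \<theta>) *\<^sub>R y"
  proof -
    have "f2 (refl_curve \<theta> x y p) = sin p *\<^sub>R x + (2 * cos \<theta> * sin p - sin (p + \<theta>)) *\<^sub>R y"
      using f2 by (simp add: refl_curve_def linear_add linear_scale algebra_simps)
    also have "2 * cos \<theta> * sin p - sin (p + \<theta>) = sin (p - \<theta>)" using A by simp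
    finally show ?thesis .
  qed
  have "f1 (sin p *\<^sub>R x + sin (p - \<theta>) *\<^sub>R y) = (2 * cos \<theta> * sin (p - \<theta>) - sin p) *\<^sub>R x + sin (p - \<theta>) *\<^sub>R y"
    using f1 by (simp add: linear_add linear_scale algebra_simps)
  also have "2 * cos \<theta> * sin (p - \<theta>) - sin p = sin (p - 2 * \<theta>)"
    using sin_add[of "p - \<theta>" \<theta>] sin_diff[of "p - \<theta>" \<theta>] by (simp add: algebra_simps)
  finally show ?thesis unfolding 1 by (simp add: refl_curve_def)
qed

lemma refl_curve_period: "refl_curve \<theta> x y (p - 2 * pi) = refl_curve \<theta> x y p"
proof -
  have "sin (p - 2 * pi + \<theta>) = sin (p + \<theta>)" using sin_periodic[of "p - 2 * pi + \<theta>"] by (simp add: algebra_simps)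
  moreover have "sin (p - 2 * pi) = sin p" using sin_periodic[of "p - 2 * pi"] by simp
  ultimately show ?thesis by (simp add: refl_curve_def)
qed

section \<open>The universal property of the presentation\<close>

lemma coxeter_equiv_foldr:
  fixes mul :: "'c \<Rightarrow> 'c \<Rightarrow> 'c" and one :: 'c
  assumes "coxeter_equiv m u v"
    and assoc: "\<And>x y z. mul (mul x y) z = mul x (mul y z)" and one: "\<And>x. mul one x = x"
    and rel: "\<And>i j. foldr mul (concat (replicate (m i j) [\<phi> i, \<phi> j])) one = one"
  shows "foldr mul (map \<phi> u) one = foldr mul (map \<phi> v) one"
  using assms(1)
proof (induction rule: coxeter_equiv.induct)
  case (relator u i j v)
  have app: "foldr mul xs y = mul (foldr mul xs one) y" for xs y
    by (induction xs) (simp_all add: assoc one)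
  have "map \<phi> (concat (replicate (m i j) [i, j])) = concat (replicate (m i j) [\<phi> i, \<phi> j])"
    by (simp add: map_concat)
  then have "foldr mul (map \<phi> (concat (replicate (m i j) [i, j]))) y = y" for y
    using app[of "concat (replicate (m i j) [\<phi> i, \<phi> j])" y] rel one by simp
  then show ?case by simp
qed simp_all

lemma coxeter_system_refl_group:
  assumes "coxeter_system W s m"
  shows "refl_group W s"
proof -
  interpret group W using assms by (simp add: coxeter_system_def)
  have "s i \<otimes>\<^bsub>W\<^esub> s i = \<one>\<^bsub>W\<^esub>" for i
  proof -
    have "coxeter_equiv m ([] @ concat (replicate (m i i) [i, i]) @ []) ([] @ [])"
      by (rule coxeter_equiv.relator)
    moreover have "m i i = 1" using assms by (simp add: coxeter_system_def coxeter_matrix_def)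
    ultimately have "coxeter_equiv m [i, i] []" by simp
    then have "list_mult W (map s [i, i]) = list_mult W (map s [])"
      using assms unfolding coxeter_system_def by blast
    moreover have "s i \<in> carrier W" using assms unfolding coxeter_system_def by blast
    ultimately show ?thesis by (simp add: list_mult_def)
  qed
  then show ?thesis
    using assms unfolding coxeter_system_def by unfold_locales auto
qed

text \<open>The target is a bare associative operation, so that permutations, signs and the pairs
  used for \<open>H_3\<close> can all serve.\<close>

lemma coxeter_lift:
  fixes mul :: "'c \<Rightarrow> 'c \<Rightarrow> 'c" and one :: 'c
  assumes W: "coxeter_system W s m"
    and assoc: "\<And>x y z. mul (mul x y) z = mul x (mul y z)" and one: "\<And>x. mul one x = x"
    and rel: "\<And>i j. foldr mul (concat (replicate (m i j) [\<phi> i, \<phi> j])) one = one"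
  obtains \<psi> where "\<And>u. \<psi> (list_mult W (map s u)) = foldr mul (map \<phi> u) one"
    "\<And>x y. x \<in> carrier W \<Longrightarrow> y \<in> carrier W \<Longrightarrow> \<psi> (x \<otimes>\<^bsub>W\<^esub> y) = mul (\<psi> x) (\<psi> y)"
proof -
  interpret refl_group W s by (rule coxeter_system_refl_group[OF W])
  define \<psi> where "\<psi> w = foldr mul (map \<phi> (SOME u. list_mult W (map s u) = w)) one" for w
  have 1: "\<psi> (list_mult W (map s u)) = foldr mul (map \<phi> u) one" for u
  proof -
    let ?v = "SOME v. list_mult W (map s v) = list_mult W (map s u)"
    have "list_mult W (map s ?v) = list_mult W (map s u)"
      by (rule someI[of "\<lambda>v. list_mult W (map s v) = list_mult W (map s u)" u]) (rule HOL.refl)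
    then have "coxeter_equiv m ?v u" using W unfolding coxeter_system_def by blast
    then show ?thesis unfolding \<psi>_def by (rule coxeter_equiv_foldr[OF _ assoc one rel])
  qed
  have "\<psi> (x \<otimes>\<^bsub>W\<^esub> y) = mul (\<psi> x) (\<psi> y)" if xy: "x \<in> carrier W" "y \<in> carrier W" for x y
  proof -
    obtain u where u: "list_mult W (map s u) = x" by (rule ex_word[OF xy(1)])
    obtain v where v: "list_mult W (map s v) = y" by (rule ex_word[OF xy(2)])
    have app: "foldr mul xs z = mul (foldr mul xs one) z" for xs z
      by (induction xs) (simp_all add: assoc one)
    have "\<psi> (x \<otimes>\<^bsub>W\<^esub> y) = foldr mul (map \<phi> (u @ v)) one"
      unfolding u[symmetric] v[symmetric] word_append[symmetric] by (rule 1)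
    also have "\<dots> = mul (\<psi> x) (\<psi> y)" unfolding u[symmetric] v[symmetric] 1 by (simp add: app[symmetric])
    finally show ?thesis .
  qed
  then show thesis using that 1 by blast
qed

section \<open>The geometric representation in coordinates\<close>

definition bform :: "('n::finite \<Rightarrow> 'n \<Rightarrow> nat) \<Rightarrow> 'n \<Rightarrow> real^'n \<Rightarrow> real" where
  "bform m i x = (\<Sum>l\<in>UNIV. - cos (pi / real (m i l)) * x $ l)"

lemma simple_refl_apply:
  "simple_refl_matrix m i *v x = x - (2 * bform m i x) *\<^sub>R axis i 1"
proof (subst vec_eq_iff, rule allI)
  fix k
  have "(simple_refl_matrix m i *v x) $ k
    = (\<Sum>l\<in>UNIV. (if k = l then x $ l else 0) - (if k = i then 2 * (- cos (pi / real (m i l)) * x $ l) else 0))"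
    unfolding matrix_vector_mult_def simple_refl_matrix_def vec_lambda_beta
    by (rule sum.cong[OF HOL.refl]) (simp add: left_diff_distrib)
  also have "\<dots> = x $ k - (if k = i then 2 * bform m i x else 0)"
    by (simp add: sum_subtractf bform_def sum_distrib_left)
  also have "\<dots> = (x - (2 * bform m i x) *\<^sub>R axis i 1) $ k"
    by (simp add: axis_def)
  finally show "(simple_refl_matrix m i *v x) $ k = (x - (2 * bform m i x) *\<^sub>R axis i 1) $ k" .
qed

lemma bform_axis: "bform m i (axis l 1) = - cos (pi / real (m i l))"
proof -
  have "bform m i (axis l 1) = (\<Sum>k\<in>UNIV. if k = l then - cos (pi / real (m i k)) else 0)"
    unfolding bform_def by (rule sum.cong[OF HOL.refl]) (simp add: axis_def)
  then show ?thesis by simp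
qed

lemma bform_linear: "bform m i (x + y) = bform m i x + bform m i y"
  "bform m i (c *\<^sub>R x) = c * bform m i x" "bform m i (x - y) = bform m i x - bform m i y"
  by (simp_all add: bform_def algebra_simps sum.distrib sum_subtractf sum_negf sum_distrib_left)

definition mword :: "('n::finite \<Rightarrow> 'n \<Rightarrow> nat) \<Rightarrow> 'n list \<Rightarrow> real^'n^'n" where
  "mword m u = foldr (**) (map (simple_refl_matrix m) u) (mat 1)"

lemma mword_Cons_apply: "mword m (i # u) *v x = simple_refl_matrix m i *v (mword m u *v x)"
  by (simp add: mword_def matrix_vector_mul_assoc)

lemma mword_Nil: "mword m [] = mat 1"
  by (simp add: mword_def)

text \<open>A vector \<open>x\<close> splits as \<open>(x - y) + y\<close> with \<open>y\<close> in
  the span of the two simple roots and with the same pairings with them. Both reflections fix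
  \<open>x - y\<close>. On the span, their product moves the parameter of \<open>refl_curve\<close>
  by \<open>2 * \<theta>\<close>, so that \<open>m i j\<close> steps make a full period.\<close>

lemma simple_refl_relation:
  fixes m :: "'n::finite \<Rightarrow> 'n \<Rightarrow> nat"
  assumes m: "coxeter_matrix m" and pos: "m i j \<noteq> 0"
  shows "foldr (**) (concat (replicate (m i j) [simple_refl_matrix m i, simple_refl_matrix m j])) (mat 1) = mat 1"
proof -
  let ?Ri = "\<lambda>x. simple_refl_matrix m i *v x" and ?Rj = "\<lambda>x. simple_refl_matrix m j *v x"
  let ?ei = "axis i 1 :: real^'n" and ?ej = "axis j 1 :: real^'n"
  define n where "n = m i j"
  have mii: "m k k = 1" for k using m by (simp add: coxeter_matrix_def)
  have mji: "m j i = n" using m unfolding coxeter_matrix_def n_def by metis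
  have lin: "linear ?Ri" "linear ?Rj" by (rule matrix_vector_mul_linear)+
  have pow: "foldr (**) (concat (replicate k [simple_refl_matrix m i, simple_refl_matrix m j])) (mat 1) *v x
    = ((\<lambda>x. ?Ri (?Rj x)) ^^ k) x" for k x
    by (induction k) (simp_all add: matrix_vector_mul_assoc[symmetric] matrix_mul_assoc[symmetric])
  let ?L = "\<lambda>x. ?Ri (?Rj x)"
  have linL: "linear (?L ^^ k)" for k
  proof (induction k)
    case 0
    show ?case by (simp add: linear_id[unfolded id_def])
  next
    case (Suc k)
    then show ?case using linear_compose[OF Suc linear_compose[OF lin(2,1)]] by (simp add: o_def)
  qed
  have Ri: "?Ri ?ei = - ?ei" "?Rj ?ej = - ?ej"
    by (simp_all add: simple_refl_apply bform_axis mii scaleR_2)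
  have "(?L ^^ n) x = x" for x
  proof (cases "i = j")
    case True
    have inv: "?Ri (?Ri x) = x" for x
    proof -
      have "bform m i (?Ri x) = - bform m i x"
        by (simp add: simple_refl_apply bform_linear bform_axis mii)
      then show ?thesis unfolding simple_refl_apply[of m i "?Ri x"] by (simp add: simple_refl_apply)
    qed
    have "n = 1" using True mii by (simp add: n_def)
    then show ?thesis using inv True by simp
  next
    case False
    then have "n \<noteq> 1" using m by (simp add: coxeter_matrix_def n_def)
    then have n2: "n \<ge> 2" using pos by (simp add: n_def)
    define \<theta> where "\<theta> = pi / real n"
    have n\<theta>: "real n * \<theta> = pi" using n2 by (simp add: \<theta>_def)
    have "0 < \<theta>" "\<theta> < pi" using n2 by (simp_all add: \<theta>_def field_simps)
    then have sin: "sin \<theta> > 0" by (rule sin_gt_zero)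
    have Rij: "?Ri ?ej = ?ej + (2 * cos \<theta>) *\<^sub>R ?ei" "?Rj ?ei = ?ei + (2 * cos \<theta>) *\<^sub>R ?ej"
      by (simp_all add: simple_refl_apply bform_axis mji n_def[symmetric] \<theta>_def)
    have step: "?L (refl_curve \<theta> ?ei ?ej p) = refl_curve \<theta> ?ei ?ej (p - 2 * \<theta>)" for p
      by (rule refl_curve_reflect[OF lin(1) Ri(1) Rij(1) lin(2) Ri(2) Rij(2)])
    have "(?L ^^ k) (refl_curve \<theta> ?ei ?ej p) = refl_curve \<theta> ?ei ?ej (p - 2 * (real k * \<theta>))" for k p
      by (induction k) (simp_all add: step algebra_simps)
    then have per: "(?L ^^ n) (refl_curve \<theta> ?ei ?ej p) = refl_curve \<theta> ?ei ?ej p" for p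
      by (simp add: n\<theta> refl_curve_period)
    \<comment> \<open>At the parameters 0 and \<open>- \<theta>\<close> the curve passes through
      multiples of the two roots.\<close>
    have "(?L ^^ n) (sin \<theta> *\<^sub>R ?ej) = sin \<theta> *\<^sub>R ?ej" "(?L ^^ n) (- (sin \<theta> *\<^sub>R ?ei)) = - (sin \<theta> *\<^sub>R ?ei)"
      using per[of 0] per[of "- \<theta>"] by (simp_all add: refl_curve_def)
    then have fixe: "(?L ^^ n) ?ej = ?ej" "(?L ^^ n) ?ei = ?ei"
      using sin by (simp_all add: linear_scale[OF linL] linear_neg[OF linL])
    define P Q where "P = bform m i x" and "Q = bform m j x"
    \<comment> \<open>The solution of the linear system \<open>a - b * cos \<theta> = P\<close>,
      \<open>b - a * cos \<theta> = Q\<close>, whose determinant is the square of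
      \<open>sin \<theta>\<close>.\<close>
    define a b where "a = (P + Q * cos \<theta>) / (sin \<theta>)\<^sup>2" and "b = (Q + P * cos \<theta>) / (sin \<theta>)\<^sup>2"
    define y where "y = a *\<^sub>R ?ei + b *\<^sub>R ?ej"
    have sc: "(sin \<theta>)\<^sup>2 = 1 - (cos \<theta>)\<^sup>2" using sin_cos_squared_add[of \<theta>] by linarith
    have s0: "(sin \<theta>)\<^sup>2 \<noteq> 0" using sin by simp
    have ab0: "a * (sin \<theta>)\<^sup>2 = P + Q * cos \<theta>" "b * (sin \<theta>)\<^sup>2 = Q + P * cos \<theta>"
      using s0 by (simp_all add: a_def b_def)
    have "(a - b * cos \<theta>) * (sin \<theta>)\<^sup>2 = a * (sin \<theta>)\<^sup>2 - b * (sin \<theta>)\<^sup>2 * cos \<theta>"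
      "(b - a * cos \<theta>) * (sin \<theta>)\<^sup>2 = b * (sin \<theta>)\<^sup>2 - a * (sin \<theta>)\<^sup>2 * cos \<theta>"
      by (simp_all add: algebra_simps)
    then have "(a - b * cos \<theta>) * (sin \<theta>)\<^sup>2 = (P + Q * cos \<theta>) - (Q + P * cos \<theta>) * cos \<theta>"
      "(b - a * cos \<theta>) * (sin \<theta>)\<^sup>2 = (Q + P * cos \<theta>) - (P + Q * cos \<theta>) * cos \<theta>"
      by (simp_all only: ab0)
    moreover have "(P + Q * cos \<theta>) - (Q + P * cos \<theta>) * cos \<theta> = P * (sin \<theta>)\<^sup>2"
      "(Q + P * cos \<theta>) - (P + Q * cos \<theta>) * cos \<theta> = Q * (sin \<theta>)\<^sup>2"
      unfolding sc by (simp_all add: algebra_simps power2_eq_square)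
    ultimately have "(a - b * cos \<theta>) * (sin \<theta>)\<^sup>2 = P * (sin \<theta>)\<^sup>2" "(b - a * cos \<theta>) * (sin \<theta>)\<^sup>2 = Q * (sin \<theta>)\<^sup>2"
      by (simp_all only:)
    then have ab: "a - b * cos \<theta> = P" "b - a * cos \<theta> = Q" using s0 by simp_all
    have "bform m i y = P" "bform m j y = Q"
      using ab by (simp_all add: y_def bform_linear bform_axis mii mji n_def[symmetric] \<theta>_def)
    then have z: "?Ri (x - y) = x - y" "?Rj (x - y) = x - y"
      by (simp_all add: simple_refl_apply bform_linear P_def Q_def)
    have "(?L ^^ k) (x - y) = x - y" for k by (induction k) (simp_all add: z)
    moreover have "(?L ^^ n) y = y" unfolding y_def by (simp add: linear_add[OF linL] linear_scale[OF linL] fixe)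
    ultimately have "(?L ^^ n) ((x - y) + y) = (x - y) + y" by (simp only: linear_add[OF linL])
    then show ?thesis by simp
  qed
  then show ?thesis using pow[of n] unfolding n_def[symmetric] by (simp add: matrix_eq)
qed

text \<open>The definite description denotes something because words for the same element are
  congruent, and congruent words have the same matrix product.\<close>

lemma geom_rep_word:
  assumes W: "coxeter_system W s m" and pos: "\<And>i j. m i j \<noteq> 0"
  shows "geom_rep W s m (list_mult W (map s u)) = mword m u"
  unfolding geom_rep_def
proof (rule the_equality)
  have m: "coxeter_matrix m" using W by (simp add: coxeter_system_def)
  show "\<exists>v. list_mult W (map s v) = list_mult W (map s u) \<and>
      mword m u = foldr (**) (map (simple_refl_matrix m) v) (mat 1)"
    by (intro exI[of _ u]) (simp add: mword_def)
  fix A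
  assume "\<exists>v. list_mult W (map s v) = list_mult W (map s u) \<and>
      A = foldr (**) (map (simple_refl_matrix m) v) (mat 1)"
  then obtain v where v: "list_mult W (map s v) = list_mult W (map s u)"
    "A = foldr (**) (map (simple_refl_matrix m) v) (mat 1)" by blast
  then have "coxeter_equiv m v u" using W unfolding coxeter_system_def by blast
  then show "A = mword m u"
    unfolding v(2) mword_def
    by (rule coxeter_equiv_foldr) (simp_all add: matrix_mul_assoc simple_refl_relation[OF m pos])
qed

lemma geom_rep_mult:
  fixes m :: "'n::finite \<Rightarrow> 'n \<Rightarrow> nat"
  assumes W: "coxeter_system W s m" and pos: "\<And>i j. m i j \<noteq> 0"
    and xy: "x \<in> carrier W" "y \<in> carrier W"
  shows "geom_rep W s m (x \<otimes>\<^bsub>W\<^esub> y) = geom_rep W s m x ** geom_rep W s m y"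
proof -
  interpret refl_group W s by (rule coxeter_system_refl_group[OF W])
  obtain u where u: "list_mult W (map s u) = x" by (rule ex_word[OF xy(1)])
  obtain v where v: "list_mult W (map s v) = y" by (rule ex_word[OF xy(2)])
  have app: "foldr (**) xs A = foldr (**) xs (mat 1) ** A" for xs and A :: "real^'n^'n"
    by (induction xs) (simp_all add: matrix_mul_assoc)
  have "geom_rep W s m (x \<otimes>\<^bsub>W\<^esub> y) = mword m (u @ v)"
    unfolding u[symmetric] v[symmetric] word_append[symmetric] by (rule geom_rep_word[OF W pos])
  also have "\<dots> = mword m u ** mword m v"
    unfolding mword_def using app[of "map (simple_refl_matrix m) u" "foldr (**) (map (simple_refl_matrix m) v) (mat 1)"]
    by simp
  finally show ?thesis using geom_rep_word[OF W pos] u v by metis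
qed

text \<open>If all degrees were below \<open>k\<close>, every invariant would be constant on the
  curve \<open>g\<close>. For real \<open>t\<close>, the product over the group of the affine
  functions \<open>(w z)_i - t\<close> is an invariant polynomial in \<open>z\<close>. It vanishes
  at a point of the curve whose \<open>i\<close>-th coordinate is \<open>t\<close>, hence at
  \<open>g 0\<close>. So the \<open>i\<close>-th coordinates along the curve all occur in the finite
  orbit of \<open>g 0\<close>; but they are \<open>x $ i * sin r\<close>, because
  \<open>y $ i = 0\<close>, and fill an interval.\<close>

lemma coxeter_number_ge:
  fixes m :: "'n::finite \<Rightarrow> 'n \<Rightarrow> nat"
  assumes W: "coxeter_system W s m" and pos: "\<And>i j. m i j \<noteq> 0" and fin: "finite (carrier W)"
    and h: "is_coxeter_number W s m h"
    and k: "k \<ge> 2"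
    and f1: "mword m u1 *v x = - x" "mword m u1 *v y = y + (2 * cos (pi / real k)) *\<^sub>R x"
    and f2: "mword m u2 *v y = - y" "mword m u2 *v x = x + (2 * cos (pi / real k)) *\<^sub>R y"
    and i: "x $ i \<noteq> 0" "y $ i = 0"
  shows "h \<ge> k"
proof (rule ccontr)
  assume "\<not> h \<ge> k"
  then have hk: "h < k" by simp
  interpret refl_group W s by (rule coxeter_system_refl_group[OF W])
  obtain d where d: "fundamental_degrees W s m d" "h = Max (range d)" using h unfolding is_coxeter_number_def by blast
  obtain p where p0: "\<forall>i. invariant_polynomial W s m (p i)" "\<forall>i a x. p i (a *\<^sub>R x) = a ^ d i * p i x"
    "\<forall>q. invariant_polynomial W s m q \<longrightarrow> (\<exists>P::real^'n \<Rightarrow> real. real_polynomial_function P \<and> (\<forall>x. q x = P (\<chi> i. p i x)))"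
    using d(1)[unfolded fundamental_degrees_def] by (elim exE conjE) (rule that)
  have p: "invariant_polynomial W s m (p i)" "p i (a *\<^sub>R x) = a ^ d i * p i x" for i a x
    by (rule spec[OF p0(1)], rule spec[OF spec[OF spec[OF p0(2)]]])
  define \<theta> where "\<theta> = pi / real k"
  define g where "g = refl_curve \<theta> x y"
  have inv: "q (g (r - 2 * \<theta>)) = q (g r)" if q: "invariant_polynomial W s m q" for q r
  proof -
    let ?w1 = "lm (map s u1)" and ?w2 = "lm (map s u2)"
    have "g (r - 2 * \<theta>) = mword m u1 *v (mword m u2 *v g r)"
      unfolding g_def
      by (rule refl_curve_reflect[where ?f1.0 = "\<lambda>z. mword m u1 *v z" and ?f2.0 = "\<lambda>z. mword m u2 *v z", symmetric,
            OF matrix_vector_mul_linear f1[folded \<theta>_def] matrix_vector_mul_linear f2[folded \<theta>_def]])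
    also have "\<dots> = geom_rep W s m ?w1 *v (geom_rep W s m ?w2 *v g r)" by (simp only: geom_rep_word[OF W pos])
    finally have eq: "g (r - 2 * \<theta>) = geom_rep W s m ?w1 *v (geom_rep W s m ?w2 *v g r)" .
    have iv: "q (geom_rep W s m w *v z) = q z" if "w \<in> carrier W" for w z
      using bspec[OF conjunct2[OF q[unfolded invariant_polynomial_def]] that] by (rule spec)
    show ?thesis unfolding eq iv[OF word_closed] ..
  qed
  have dk: "d i < k" for i
  proof -
    have "d i \<le> Max (range d)" by (rule Max_ge) auto
    then show ?thesis using hk d(2) by simp
  qed
  have const: "p i (g r) = p i (g 0)" for i r
    unfolding g_def refl_curve_plane
  proof (rule homogeneous_constant_on_plane[OF _ p(2) dk])
    show "real_polynomial_function (p i)" using p(1) by (simp add: invariant_polynomial_def)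
    show "real k * (2 * \<theta>) = 2 * pi" using k by (simp add: \<theta>_def)
    show "p i (plane_curve (sin \<theta> *\<^sub>R y) (x + cos \<theta> *\<^sub>R y) (r + 2 * \<theta>))
      = p i (plane_curve (sin \<theta> *\<^sub>R y) (x + cos \<theta> *\<^sub>R y) r)" for r
      using inv[OF p(1), of i "r + 2 * \<theta>"] by (simp add: g_def refl_curve_plane)
  qed
  have constq: "q (g r) = q (g 0)" if q: "invariant_polynomial W s m q" for q r
  proof -
    obtain P :: "real^'n \<Rightarrow> real" where "\<forall>x. q x = P (\<chi> i. p i x)"
      using mp[OF spec[OF p0(3)] q] by (elim exE conjE) (rule that)
    then have P: "q x = P (\<chi> i. p i x)" for x by (rule spec)
    have "(\<chi> i. p i (g r)) = (\<chi> i. p i (g 0))"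
      by (subst vec_eq_iff, intro allI, unfold vec_lambda_beta, rule const)
    then show ?thesis unfolding P by (rule arg_cong)
  qed
  have vals: "x $ i * sin r \<in> (\<lambda>w. (geom_rep W s m w *v g 0) $ i) ` carrier W" for r
  proof -
    let ?t = "x $ i * sin r"
    let ?q = "\<lambda>z. \<Prod>w\<in>carrier W. ((geom_rep W s m w *v z) $ i - ?t)"
    have "invariant_polynomial W s m ?q"
      unfolding invariant_polynomial_def
    proof (intro conjI ballI allI)
      have "bounded_linear (\<lambda>z. (A *v z) $ i)" for A :: "real^'n^'n"
        using bounded_linear_compose[OF bounded_linear_vec_nth matrix_vector_mul_bounded_linear] .
      then have lin: "real_polynomial_function (\<lambda>z. (A *v z) $ i)" for A :: "real^'n^'n"
        by (rule real_polynomial_function.intros(1))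
      have "real_polynomial_function (\<lambda>z. (geom_rep W s m w *v z) $ i - ?t)" for w
        by (rule real_polynomial_function_diff[OF lin real_polynomial_function.intros(2)])
      then show "real_polynomial_function ?q" by (intro real_polynomial_function_prod fin)
    next
      fix v z assume v: "v \<in> carrier W"
      have "?q (geom_rep W s m v *v z) = (\<Prod>w\<in>carrier W. (geom_rep W s m (w \<otimes>\<^bsub>W\<^esub> v) *v z) $ i - ?t)"
        by (rule prod.cong[OF HOL.refl]) (simp add: matrix_vector_mul_assoc geom_rep_mult[OF W pos] v)
      also have "\<dots> = ?q z"
      proof (rule prod.reindex_bij_witness[of _ "\<lambda>w. w \<otimes>\<^bsub>W\<^esub> inv\<^bsub>W\<^esub> v" "\<lambda>w. w \<otimes>\<^bsub>W\<^esub> v"])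
      qed (use v in \<open>simp_all add: m_assoc\<close>)
      finally show "?q (geom_rep W s m v *v z) = ?q z" .
    qed
    from constq[OF this, of r] have eq: "?q (g r) = ?q (g 0)" .
    have "geom_rep W s m \<one>\<^bsub>W\<^esub> = mat 1" using geom_rep_word[OF W pos, of "[]"] by (simp add: mword_Nil)
    then have "(geom_rep W s m \<one>\<^bsub>W\<^esub> *v g r) $ i - ?t = 0" using i(2) by (simp add: g_def refl_curve_def)
    then have "?q (g r) = 0" using fin by (intro prod_zero) blast+
    then obtain w where "w \<in> carrier W" "(geom_rep W s m w *v g 0) $ i - ?t = 0"
      unfolding eq using fin by auto
    then show ?thesis by force
  qed
  have "(*) (x $ i) ` {0..1} \<subseteq> (\<lambda>w. (geom_rep W s m w *v g 0) $ i) ` carrier W"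
  proof
    fix t assume "t \<in> (*) (x $ i) ` {0..1}"
    then obtain r where "r \<in> {0..1}" and r1: "t = x $ i * r" by blast
    then have r: "t = x $ i * r" "0 \<le> r" "r \<le> 1" by simp_all
    then have "sin (arcsin r) = r" by (intro sin_arcsin) auto
    then show "t \<in> (\<lambda>w. (geom_rep W s m w *v g 0) $ i) ` carrier W" using vals[of "arcsin r"] r by simp
  qed
  then have "finite ((*) (x $ i) ` {0..1})" using fin finite_subset by blast
  moreover have "inj_on ((*) (x $ i)) {0..1}" using i(1) by (auto simp: inj_on_def)
  ultimately have "finite {0..1::real}" using finite_imageD by blast
  then show False using infinite_Icc[of "0::real" 1] by simp
qed

text \<open>Simple roots with \<open>m i j = 2\<close> are orthogonal, so the corrections subtracted
  by the reflections do not affect one another.\<close>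

lemma mword_commuting:
  assumes "distinct u" "\<And>i j. i \<in> set u \<Longrightarrow> j \<in> set u \<Longrightarrow> i \<noteq> j \<Longrightarrow> m i j = 2"
  shows "mword m u *v z = z - (\<Sum>i\<in>set u. (2 * bform m i z) *\<^sub>R axis i 1)"
  using assms
proof (induction u)
  case Nil
  then show ?case by (simp add: mword_Nil)
next
  case (Cons i u)
  let ?z = "z - (\<Sum>j\<in>set u. (2 * bform m j z) *\<^sub>R axis j 1)"
  have IH: "mword m u *v z = ?z" using Cons by simp
  have sum0: "bform m i (\<Sum>j\<in>A. c j *\<^sub>R axis j 1) = (\<Sum>j\<in>A. c j * bform m i (axis j 1))" if "finite A" for A c
    using that
  proof (induction A)
    case empty
    show ?case by (simp add: bform_def)
  qed (simp add: bform_linear)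
  have "bform m i (axis j 1) = 0" if "j \<in> set u" for j
  proof -
    have "m i j = 2" using Cons.prems that by auto
    then show ?thesis by (simp add: bform_axis)
  qed
  then have eq: "bform m i ?z = bform m i z" by (simp add: bform_linear sum0)
  have "mword m (i # u) *v z = ?z - (2 * bform m i z) *\<^sub>R axis i 1"
    by (simp only: mword_Cons_apply IH simple_refl_apply eq)
  then show ?case using Cons.prems(1) by (simp add: algebra_simps)
qed

section \<open>Coxeter groups with a linear diagram\<close>

locale linear_coxeter =
  fixes W :: "('g, 'b) monoid_scheme" (structure) and s :: "'n::finite \<Rightarrow> 'g"
    and m :: "'n \<Rightarrow> 'n \<Rightarrow> nat" and f :: "'n \<Rightarrow> nat" and k n :: nat
  assumes sys: "coxeter_system W s m" and k3: "k \<ge> 3"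
    and n_card: "n = CARD('n)" and f_bij: "bij_betw f UNIV {0..<n}"
    and m_eq: "m i j = (if f i = f j then 1 else if {f i, f j} = {0, 1} then k
       else if f i = Suc (f j) \<or> f j = Suc (f i) then 3 else 2)"
begin

sublocale refl_group W s by (rule coxeter_system_refl_group[OF sys])

lemma m_pos: "m i j \<noteq> 0"
  using k3 unfolding m_eq[of i j] by auto

definition idx :: "nat \<Rightarrow> 'n" where "idx = inv_into UNIV f"

lemma f_idx: "j < n \<Longrightarrow> f (idx j) = j"
  unfolding idx_def using f_bij by (intro f_inv_into_f) (auto simp: bij_betw_def)

lemma idx_f: "idx (f i) = i"
  unfolding idx_def using f_bij by (simp add: bij_betw_def)

lemma f_lt: "f i < n"
  using bij_betwE[OF f_bij] by auto

definition g :: "nat \<Rightarrow> 'g" where "g j = s (idx j)"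

lemma g_closed [simp]: "g j \<in> carrier W"
  by (simp add: g_def)

lemma relator: "lm (concat (replicate (m i j) [s i, s j])) = \<one>"
proof -
  have "coxeter_equiv m ([] @ concat (replicate (m i j) [i, j]) @ []) ([] @ [])"
    by (rule coxeter_equiv.relator)
  then have "coxeter_equiv m (concat (replicate (m i j) [i, j])) []" by simp
  then have "lm (map s (concat (replicate (m i j) [i, j]))) = lm (map s [])"
    using sys unfolding coxeter_system_def by blast
  then show ?thesis by (simp add: map_concat)
qed

lemma g_invol: "g j \<otimes> g j = \<one>"
  by (simp add: g_def s_invol)

lemma g_cancel: "x \<in> carrier W \<Longrightarrow> g j \<otimes> (g j \<otimes> x) = x"
  by (simp add: g_def cancel)

lemma g_order:
  assumes "i < n" "j < n" "l = m (idx i) (idx j)"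
  shows "lm (concat (replicate l [g i, g j])) = \<one>"
  unfolding assms(3) g_def by (rule relator)

lemma g_commute:
  assumes "i < n" "j < n" "i + 2 \<le> j \<or> j + 2 \<le> i"
  shows "g i \<otimes> g j = g j \<otimes> g i"
proof -
  have "{i, j} \<noteq> {0, 1}" using assms(3) by (auto simp: doubleton_eq_iff)
  then have "m (idx i) (idx j) = 2" using assms by (simp add: m_eq f_idx) linarith
  then have "lm (concat (replicate 2 [g i, g j])) = \<one>" using g_order[OF assms(1,2)] by simp
  then have 1: "g i \<otimes> (g j \<otimes> (g i \<otimes> g j)) = \<one>" by (simp add: numeral_2_eq_2)
  have "g i \<otimes> g j = g j \<otimes> (g i \<otimes> (g i \<otimes> (g j \<otimes> (g i \<otimes> g j))))" by (simp add: g_cancel)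
  then show ?thesis unfolding 1 by simp
qed

lemma g_braid:
  assumes "Suc j < n" "j > 0 \<or> k = 3"
  shows "g j \<otimes> (g (Suc j) \<otimes> g j) = g (Suc j) \<otimes> (g j \<otimes> g (Suc j))"
proof -
  have "m (idx j) (idx (Suc j)) = 3" using assms by (auto simp: m_eq f_idx doubleton_eq_iff)
  then have "lm (concat (replicate 3 [g j, g (Suc j)])) = \<one>" using g_order[of j "Suc j"] assms by simp
  then have 1: "g j \<otimes> (g (Suc j) \<otimes> (g j \<otimes> (g (Suc j) \<otimes> (g j \<otimes> g (Suc j))))) = \<one>"
    by (simp add: numeral_3_eq_3)
  have "g (Suc j) \<otimes> (g j \<otimes> g (Suc j)) = g j \<otimes> (g (Suc j) \<otimes> (g j \<otimes> (g j \<otimes> (g (Suc j) \<otimes> (g j \<otimes> (g (Suc j) \<otimes> (g j \<otimes> g (Suc j))))))))"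
    by (simp add: g_cancel)
  then show ?thesis unfolding 1 by simp
qed

lemma g_braid4:
  assumes "1 < n" "k = 4"
  shows "g 0 \<otimes> (g 1 \<otimes> (g 0 \<otimes> g 1)) = g 1 \<otimes> (g 0 \<otimes> (g 1 \<otimes> g 0))"
proof -
  have "m (idx 0) (idx 1) = 4" using assms by (simp add: m_eq f_idx)
  then have "lm (concat (replicate 4 [g 0, g 1])) = \<one>" using g_order[of 0 1] assms by simp
  moreover have "replicate 4 x = [x, x, x, x]" for x :: "'g list" by (simp add: eval_nat_numeral)
  ultimately have 1: "g 0 \<otimes> (g 1 \<otimes> (g 0 \<otimes> (g 1 \<otimes> (g 0 \<otimes> (g 1 \<otimes> (g 0 \<otimes> g 1)))))) = \<one>"
    by simp
  have "g 0 \<otimes> (g 1 \<otimes> (g 0 \<otimes> g 1)) = g 1 \<otimes> (g 0 \<otimes> (g 1 \<otimes> (g 0 \<otimes> (g 0 \<otimes> (g 1 \<otimes> (g 0 \<otimes> (g 1 \<otimes> (g 0 \<otimes> (g 1 \<otimes> (g 0 \<otimes> g 1))))))))))"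
    by (simp add: g_cancel)
  then show ?thesis unfolding 1 by simp
qed

text \<open>The edge between \<open>j\<close> and \<open>j + 1\<close> weighted by minus the value
  of the bilinear form on the two simple roots.\<close>

definition edge :: "nat \<Rightarrow> real" where
  "edge j = (if j = 0 then cos (pi / real k) else 1 / 2)"

lemma cos_m:
  "i \<noteq> l \<Longrightarrow> cos (pi / real (m i l)) =
    (if f l = Suc (f i) then edge (f i) else 0) + (if f i = Suc (f l) then edge (f l) else 0)"
proof -
  assume "i \<noteq> l"
  then have neq: "f i \<noteq> f l" using idx_f by metis
  consider "f l = Suc (f i)" | "f i = Suc (f l)" | "f l \<noteq> Suc (f i)" "f i \<noteq> Suc (f l)" by blast
  then show ?thesis
  proof cases
    case 1
    then show ?thesis by (cases "f i = 0") (auto simp: m_eq edge_def cos_60 doubleton_eq_iff)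
  next
    case 2
    then show ?thesis by (cases "f l = 0") (auto simp: m_eq edge_def cos_60 doubleton_eq_iff)
  next
    case 3
    then have "{f i, f l} \<noteq> {0, 1}" by (auto simp: doubleton_eq_iff)
    then have "m i l = 2" using 3 neq by (auto simp: m_eq)
    then show ?thesis using 3 by simp
  qed
qed

text \<open>The path is bipartite, and the commuting reflections at its even and at its odd vertices
  multiply to two involutions. An eigenvector of the weighted adjacency matrix for the eigenvalue
  \<open>cos (pi / K)\<close> splits into an even and an odd part; on their span the involutions act
  as reflections at angle \<open>pi / K\<close>. This span is the Coxeter plane.\<close>

theorem coxeter_number_ge_eigen:
  assumes fin: "finite (carrier W)" and h: "is_coxeter_number W s m h" and K: "K \<ge> 2"
    and a0: "a 0 \<noteq> 0"
    and eig: "\<And>j. j < n \<Longrightarrow> (if Suc j < n then edge j * a (Suc j) else 0)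
        + (if j > 0 then edge (j - 1) * a (j - 1) else 0) = cos (pi / real K) * a j"
  shows "h \<ge> K"
proof -
  define v :: "bool \<Rightarrow> real^'n" where "v b = (\<chi> i. if even (f i) = b then a (f i) else 0)" for b
  have ex: "\<exists>u. set u = {i. even (f i) = b} \<and> distinct u" for b
    using finite_distinct_list[of "{i. even (f i) = b}"] by simp
  define u where "u b = (SOME u. set u = {i. even (f i) = b} \<and> distinct u)" for b
  have u: "set (u b) = {i. even (f i) = b}" "distinct (u b)" for b
    using someI_ex[OF ex[of b]] by (simp_all add: u_def)
  have m2: "m i j = 2" if "even (f i) = even (f j)" "i \<noteq> j" for i j
  proof -
    have "f i \<noteq> f j" using that(2) idx_f by metis
    moreover have "f i \<noteq> Suc (f j)" "f j \<noteq> Suc (f i)" using that(1) by auto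
    moreover have "{f i, f j} \<noteq> {0, 1}"
    proof
      assume "{f i, f j} = {0, 1}"
      then have "f i = 0 \<and> f j = 1 \<or> f i = 1 \<and> f j = 0" by (simp only: doubleton_eq_iff)
      then show False using that(1) by auto
    qed
    ultimately show ?thesis by (simp add: m_eq)
  qed
  have same: "bform m i (v b) = a (f i)" if "even (f i) = b" for i b
  proof -
    have "bform m i (v b) = (\<Sum>l\<in>UNIV. if l = i then a (f i) else 0)"
      unfolding bform_def
    proof (rule sum.cong[OF HOL.refl])
      fix l
      show "- cos (pi / real (m i l)) * v b $ l = (if l = i then a (f i) else 0)"
      proof (cases "l = i")
        case True
        then show ?thesis using that by (simp add: v_def m_eq)
      next
        case False
        then show ?thesis using that m2[of i l] by (simp add: v_def)
      qed
    qed
    then show ?thesis by simp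
  qed
  have other: "bform m i (v (\<not> b)) = - cos (pi / real K) * a (f i)" if "even (f i) = b" for i b
  proof -
    have "bform m i (v (\<not> b)) = (\<Sum>l\<in>UNIV. - ((if f l = Suc (f i) then edge (f i) * a (f l) else 0)
        + (if f i = Suc (f l) then edge (f l) * a (f l) else 0)))"
      unfolding bform_def
    proof (rule sum.cong[OF HOL.refl])
      fix l
      show "- cos (pi / real (m i l)) * v (\<not> b) $ l = - ((if f l = Suc (f i) then edge (f i) * a (f l) else 0)
        + (if f i = Suc (f l) then edge (f l) * a (f l) else 0))"
      proof (cases "even (f l) = b")
        case True
        then have "f l \<noteq> Suc (f i)" "f i \<noteq> Suc (f l)" using that by auto
        then show ?thesis using True by (simp add: v_def)
      next
        case False
        then have "i \<noteq> l" using that by auto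
        have vl: "v (\<not> b) $ l = a (f l)" using False by (auto simp: v_def)
        show ?thesis unfolding cos_m[OF \<open>i \<noteq> l\<close>] vl by (simp add: algebra_simps)
      qed
    qed
    also have "\<dots> = (\<Sum>t\<in>{0..<n}. - ((if t = Suc (f i) then edge (f i) * a t else 0)
        + (if f i = Suc t then edge t * a t else 0)))"
      using sum.reindex_bij_betw[OF f_bij, of "\<lambda>t. - ((if t = Suc (f i) then edge (f i) * a t else 0)
        + (if f i = Suc t then edge t * a t else 0))"] by simp
    also have "\<dots> = - ((\<Sum>t\<in>{0..<n}. if t = Suc (f i) then edge (f i) * a t else 0)
        + (\<Sum>t\<in>{0..<n}. if f i = Suc t then edge t * a t else 0))"
      by (simp only: sum_negf sum.distrib)
    also have "(\<Sum>t\<in>{0..<n}. if t = Suc (f i) then edge (f i) * a t else 0)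
        = (if Suc (f i) < n then edge (f i) * a (Suc (f i)) else 0)"
      by (simp add: sum.delta)
    also have "(\<Sum>t\<in>{0..<n}. if f i = Suc t then edge t * a t else 0)
        = (if f i > 0 then edge (f i - 1) * a (f i - 1) else 0)"
    proof (cases "f i")
      case (Suc t)
      then have "(\<Sum>t\<in>{0..<n}. if f i = Suc t then edge t * a t else 0)
        = (\<Sum>t'\<in>{0..<n}. if t' = t then edge t' * a t' else 0)"
        by (intro sum.cong) auto
      also have "\<dots> = edge t * a t" using Suc f_lt[of i] by (simp add: sum.delta)
      finally show ?thesis using Suc by simp
    qed simp
    finally show ?thesis using eig[OF f_lt[of i]] by simp
  qed
  have expand: "(\<Sum>i\<in>{i. even (f i) = b}. (c * a (f i)) *\<^sub>R axis i 1) = c *\<^sub>R v b" for b c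
  proof (subst vec_eq_iff, rule allI)
    fix l
    have "(\<Sum>i\<in>{i. even (f i) = b}. (c * a (f i)) *\<^sub>R (axis i 1 :: real^'n)) $ l
      = (\<Sum>i\<in>{i. even (f i) = b}. if i = l then c * a (f i) else 0)"
      unfolding sum_component by (rule sum.cong[OF HOL.refl]) (simp add: axis_def)
    also have "\<dots> = (c *\<^sub>R v b) $ l" by (simp add: v_def sum.delta)
    finally show "(\<Sum>i\<in>{i. even (f i) = b}. (c * a (f i)) *\<^sub>R (axis i 1 :: real^'n)) $ l = (c *\<^sub>R v b) $ l" .
  qed
  have act: "mword m (u b) *v z = z - (\<Sum>i\<in>{i. even (f i) = b}. (2 * bform m i z) *\<^sub>R axis i 1)" for b z
    using mword_commuting[of "u b" m z] u[of b] m2 by simp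
  have A: "mword m (u b) *v v b = - v b" for b
  proof -
    have "(\<Sum>i\<in>{i. even (f i) = b}. (2 * bform m i (v b)) *\<^sub>R axis i 1)
      = (\<Sum>i\<in>{i. even (f i) = b}. (2 * a (f i)) *\<^sub>R (axis i 1 :: real^'n))"
      by (rule sum.cong[OF HOL.refl]) (simp add: same)
    then show ?thesis unfolding act using expand[of 2 b] by (simp add: scaleR_2)
  qed
  have B: "mword m (u b) *v v (\<not> b) = v (\<not> b) + (2 * cos (pi / real K)) *\<^sub>R v b" for b
  proof -
    have "(\<Sum>i\<in>{i. even (f i) = b}. (2 * bform m i (v (\<not> b))) *\<^sub>R axis i 1)
      = (\<Sum>i\<in>{i. even (f i) = b}. (- (2 * cos (pi / real K)) * a (f i)) *\<^sub>R (axis i 1 :: real^'n))"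
      by (rule sum.cong[OF HOL.refl]) (simp add: other)
    then show ?thesis unfolding act using expand[of "- (2 * cos (pi / real K))" b] by simp
  qed
  have n0: "0 < n" by (simp add: n_card)
  show ?thesis
  proof (rule coxeter_number_ge[OF sys m_pos fin h K])
    show "mword m (u True) *v v True = - v True" by (rule A)
    show "mword m (u True) *v v False = v False + (2 * cos (pi / real K)) *\<^sub>R v True" using B[of True] by simp
    show "mword m (u False) *v v False = - v False" by (rule A)
    show "mword m (u False) *v v True = v True + (2 * cos (pi / real K)) *\<^sub>R v False" using B[of False] by simp
    show "v True $ idx 0 \<noteq> 0" "v False $ idx 0 = 0" using a0 f_idx[OF n0] by (simp_all add: v_def)
  qed
qed

end

section \<open>Types \<open>A\<close> and \<open>B\<close>\<close>

context linear_coxeter begin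

definition gw :: "nat list \<Rightarrow> 'g" where "gw ks = lm (map g ks)"

lemma gw_simps [simp]: "gw [] = \<one>" "gw (i # ks) = g i \<otimes> gw ks"
  by (simp_all add: gw_def)

lemma gw_closed [simp]: "gw ks \<in> carrier W"
  unfolding gw_def by (rule lm_closed) auto

lemma gw_append: "gw (ks @ ls) = gw ks \<otimes> gw ls"
  unfolding gw_def map_append by (rule lm_append) auto

lemma gw_word: "gw ks = lm (map s (map idx ks))"
  by (simp add: gw_def g_def[abs_def] o_def)

text \<open>The standard parabolic subgroup generated by the first \<open>j\<close> simple
  reflections.\<close>

definition H :: "nat \<Rightarrow> 'g set" where "H j = {gw ks | ks. set ks \<subseteq> {..<j}}"

lemma H_closed: "v \<in> H j \<Longrightarrow> v \<in> carrier W"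
  by (auto simp: H_def)

lemma H_one: "\<one> \<in> H j"
  unfolding H_def by (intro CollectI exI[of _ "[]"]) simp

lemma H_gen: "i < j \<Longrightarrow> g i \<in> H j"
  unfolding H_def by (intro CollectI exI[of _ "[i]"]) simp

lemma H_mult: "v \<in> H j \<Longrightarrow> w \<in> H j \<Longrightarrow> v \<otimes> w \<in> H j"
proof -
  assume "v \<in> H j" "w \<in> H j"
  then obtain ks ls where "v = gw ks" "w = gw ls" "set ks \<subseteq> {..<j}" "set ls \<subseteq> {..<j}" by (auto simp: H_def)
  then show ?thesis unfolding H_def by (intro CollectI exI[of _ "ks @ ls"]) (simp add: gw_append)
qed

lemma H_full: "H n = carrier W"
proof
  show "carrier W \<subseteq> H n"
  proof
    fix w assume "w \<in> carrier W"
    then obtain u where u: "lm (map s u) = w" by (rule ex_word)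
    have "gw (map f u) = w" unfolding gw_word using u by (simp add: idx_f o_def)
    moreover have "set (map f u) \<subseteq> {..<n}" using f_lt by auto
    ultimately show "w \<in> H n" unfolding H_def by blast
  qed
qed (auto simp: H_closed)

text \<open>If right multiplication by the generators keeps \<open>R\<close> stable up to a left
  factor from \<open>H j\<close>, then reading a word from left to right never leaves
  \<open>H j\<close> times \<open>R\<close>. This bounds the cosets from above; a faithful model
  separates them later.\<close>

lemma H_decompose:
  assumes R: "\<one> \<in> R" "R \<subseteq> carrier W"
    and step: "\<And>r i. r \<in> R \<Longrightarrow> i \<le> j \<Longrightarrow> \<exists>v\<in>H j. \<exists>r'\<in>R. r \<otimes> g i = v \<otimes> r'"
    and w: "w \<in> H (Suc j)"
  shows "\<exists>v\<in>H j. \<exists>r\<in>R. w = v \<otimes> r"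
proof -
  obtain ks where ks: "w = gw ks" "set ks \<subseteq> {..<Suc j}" using w by (auto simp: H_def)
  have "\<exists>v\<in>H j. \<exists>r\<in>R. gw ks = v \<otimes> r"
    using ks(2)
  proof (induction ks rule: rev_induct)
    case Nil
    then show ?case using H_one R by (intro bexI[of _ \<one>]) auto
  next
    case (snoc i ks)
    then obtain v r where vr: "v \<in> H j" "r \<in> R" "gw ks = v \<otimes> r" by auto
    obtain v' r' where vr': "v' \<in> H j" "r' \<in> R" "r \<otimes> g i = v' \<otimes> r'"
      using step[OF vr(2), of i] snoc.prems by auto
    have c: "v \<in> carrier W" "r \<in> carrier W" "v' \<in> carrier W" "r' \<in> carrier W"
      using vr vr' R H_closed by auto
    have "gw (ks @ [i]) = v \<otimes> (r \<otimes> g i)" using c by (simp add: gw_append vr(3) m_assoc)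
    also have "\<dots> = (v \<otimes> v') \<otimes> r'" unfolding vr'(3) using c by (simp add: m_assoc)
    finally show ?case using H_mult[OF vr(1) vr'(1)] vr'(2) by blast
  qed
  then show ?thesis using ks(1) by simp
qed

lemma gw_commute:
  assumes "\<And>t. t \<in> set ks \<Longrightarrow> t < n \<and> (t + 2 \<le> i \<or> i + 2 \<le> t)" "i < n"
  shows "gw ks \<otimes> g i = g i \<otimes> gw ks"
  using assms(1)
proof (induction ks)
  case (Cons t ks)
  have "gw (t # ks) \<otimes> g i = g t \<otimes> (g i \<otimes> gw ks)" using Cons by (simp add: m_assoc)
  also have "\<dots> = (g i \<otimes> g t) \<otimes> gw ks"
    using g_commute[of t i] Cons.prems[of t] assms(2) by (simp add: m_assoc[symmetric])
  finally show ?case by (simp add: m_assoc)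
qed simp

text \<open>Coset representatives of \<open>H k\<close> in \<open>H (k + 1)\<close>: \<open>down j = g k \<dots> g j\<close>, and in type \<open>B\<close>
  also \<open>g k \<dots> g 0 \<dots> g j\<close>.\<close>

definition down :: "nat \<Rightarrow> nat \<Rightarrow> nat list" where "down l j = rev [j..<Suc l]"

lemma down_simps: "j \<le> l \<Longrightarrow> down l j = down l (Suc j) @ [j]" "down l (Suc l) = []"
  by (simp_all add: down_def upt_conv_Cons del: upt_Suc)

lemma down_split: "j < i \<Longrightarrow> i \<le> l \<Longrightarrow> down l j = down l (Suc i) @ [i, i - 1] @ rev [j..<i - 1]"
proof -
  assume ji: "j < i" "i \<le> l"
  have "[j..<Suc l] = [j..<i - 1] @ [i - 1..<Suc l]"
    using ji upt_add_eq_append[of j "i - 1" "Suc l - (i - 1)"] by (simp del: upt_Suc)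
  also have "[i - 1..<Suc l] = (i - 1) # i # [Suc i..<Suc l]" using ji by (simp add: upt_conv_Cons del: upt_Suc)
  finally show ?thesis by (simp add: down_def del: upt_Suc)
qed

lemma braid_cancel:
  assumes "x \<in> carrier W" "Suc j < n" "j > 0 \<or> k = 3"
  shows "g (Suc j) \<otimes> (g j \<otimes> (g (Suc j) \<otimes> x)) = g j \<otimes> (g (Suc j) \<otimes> (g j \<otimes> x))"
proof -
  have "(g (Suc j) \<otimes> (g j \<otimes> g (Suc j))) \<otimes> x = (g j \<otimes> (g (Suc j) \<otimes> g j)) \<otimes> x"
    using g_braid[OF assms(2,3)] by simp
  then show ?thesis using assms(1) by (simp add: m_assoc)
qed

text \<open>The letter \<open>g i\<close> commutes past the tail, turns into
  \<open>g (i - 1)\<close> at the pair \<open>g i\<close>, \<open>g (i - 1)\<close> by the braid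
  relation of length 3, and as such commutes past the head. The last assumption gives the edge
  between \<open>i - 1\<close> and \<open>i\<close> the label 3.\<close>

lemma down_step_above:
  assumes "j < i" "i \<le> l" "l < n" "i > 1 \<or> k = 3"
  shows "gw (down l j) \<otimes> g i = g (i - 1) \<otimes> gw (down l j)"
proof -
  obtain i' where i: "i = Suc i'" using assms(1) by (cases i) auto
  have ds: "down l j = down l (Suc i) @ [i, i'] @ rev [j..<i']" using down_split[OF assms(1,2)] i by simp
  have c1: "gw (rev [j..<i']) \<otimes> g i = g i \<otimes> gw (rev [j..<i'])"
    by (rule gw_commute) (use assms i in auto)
  have c2: "gw (down l (Suc i)) \<otimes> g i' = g i' \<otimes> gw (down l (Suc i))"
    by (rule gw_commute) (use assms i in \<open>auto simp: down_def\<close>)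
  have "gw (down l j) \<otimes> g i = gw (down l (Suc i)) \<otimes> (g i \<otimes> (g i' \<otimes> (gw (rev [j..<i']) \<otimes> g i)))"
    unfolding ds by (simp add: gw_append m_assoc)
  also have "\<dots> = gw (down l (Suc i)) \<otimes> (g i' \<otimes> (g i \<otimes> (g i' \<otimes> gw (rev [j..<i']))))"
    unfolding c1 using braid_cancel[of "gw (rev [j..<i'])" i'] assms i by simp
  also have "\<dots> = (gw (down l (Suc i)) \<otimes> g i') \<otimes> (g i \<otimes> (g i' \<otimes> gw (rev [j..<i'])))"
    by (simp add: m_assoc)
  also have "\<dots> = g i' \<otimes> gw (down l j)" unfolding c2 ds by (simp add: gw_append m_assoc)
  finally show ?thesis using i by simp
qed

lemma down_step_eq: "i \<le> l \<Longrightarrow> gw (down l i) \<otimes> g i = gw (down l (Suc i))"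
  unfolding down_simps(1)[of i l] by (simp add: gw_append m_assoc g_invol)

lemma down_step_below: "i \<le> l \<Longrightarrow> gw (down l (Suc i)) \<otimes> g i = gw (down l i)"
  unfolding down_simps(1)[of i l] by (simp add: gw_append)

lemma down_step_far: "Suc i < j \<Longrightarrow> j \<le> Suc l \<Longrightarrow> l < n \<Longrightarrow> gw (down l j) \<otimes> g i = g i \<otimes> gw (down l j)"
  by (rule gw_commute) (auto simp: down_def)

text \<open>Multiplying a chain that ends in \<open>g j\<close> by \<open>g i\<close> is a braid
  move for \<open>j < i\<close>, a cancellation for \<open>j = i\<close>, an extension for
  \<open>j = i + 1\<close>, and a commutation beyond.\<close>

lemma cosets_A:
  assumes "k = 3" "l < n" "w \<in> H (Suc l)"
  shows "\<exists>v\<in>H l. \<exists>j\<le>Suc l. w = v \<otimes> gw (down l j)"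
proof -
  let ?R = "{gw (down l j) | j. j \<le> Suc l}"
  have "\<exists>v\<in>H l. \<exists>r\<in>?R. w = v \<otimes> r"
  proof (rule H_decompose[OF _ _ _ assms(3)])
    have "gw (down l (Suc l)) = \<one>" by (simp add: down_simps)
    then show "\<one> \<in> ?R" by (intro CollectI exI[of _ "Suc l"]) simp
    show "?R \<subseteq> carrier W" by auto
    show "\<exists>v\<in>H l. \<exists>r'\<in>?R. r \<otimes> g i = v \<otimes> r'" if "r \<in> ?R" and i: "i \<le> l" for r i
    proof -
      obtain j where j: "r = gw (down l j)" "j \<le> Suc l" using \<open>r \<in> ?R\<close> by blast
      consider "j < i" | "j = i" | "j = Suc i" | "Suc i < j" by linarith
      then show ?thesis
      proof cases
        case 1
        have "g (i - 1) \<in> H l" using H_gen 1 i by simp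
        then show ?thesis using down_step_above[OF 1 i assms(2)] assms(1) j by auto
      next
        case 2
        then have "r \<otimes> g i = \<one> \<otimes> gw (down l (Suc i))" using down_step_eq[OF i] j by simp
        then show ?thesis using H_one i by blast
      next
        case 3
        then have "r \<otimes> g i = \<one> \<otimes> gw (down l i)" using down_step_below[OF i] j by simp
        then show ?thesis using H_one i by (metis (mono_tags, lifting) le_Suc_eq mem_Collect_eq)
      next
        case 4
        have "g i \<in> H l" using H_gen 4 j by simp
        then show ?thesis using down_step_far[OF 4 j(2) assms(2)] j by auto
      qed
    qed
  qed
  then show ?thesis by blast
qed

definition up :: "nat \<Rightarrow> nat list" where "up j = [1..<Suc j]"

lemma up_simps: "up 0 = []" "up (Suc j) = up j @ [Suc j]" "j > 0 \<Longrightarrow> up j = 1 # [2..<Suc j]"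
  by (simp_all add: up_def) (simp add: upt_conv_Cons numeral_2_eq_2 del: upt_Suc)

definition updown :: "nat \<Rightarrow> nat \<Rightarrow> nat list" where "updown l j = down l 0 @ up j"

text \<open>The mirror image of \<open>down_step_above\<close> for ascending chains.\<close>

lemma up_step:
  assumes "1 \<le> i" "i < j" "j < n"
  shows "gw (up j) \<otimes> g i = g (Suc i) \<otimes> gw (up j)"
proof -
  have "[1..<Suc j] = [1..<i] @ [i..<Suc j]" using assms upt_add_eq_append[of 1 i "Suc j - i"] by (simp del: upt_Suc)
  also have "[i..<Suc j] = i # Suc i # [Suc (Suc i)..<Suc j]" using assms by (simp add: upt_conv_Cons del: upt_Suc)
  finally have sp: "up j = [1..<i] @ [i, Suc i] @ [Suc (Suc i)..<Suc j]" by (simp only: up_def append_Cons append_Nil)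
  have c1: "gw [Suc (Suc i)..<Suc j] \<otimes> g i = g i \<otimes> gw [Suc (Suc i)..<Suc j]"
    by (rule gw_commute) (use assms in auto)
  have c2: "gw [1..<i] \<otimes> g (Suc i) = g (Suc i) \<otimes> gw [1..<i]"
    by (rule gw_commute) (use assms in auto)
  have "gw (up j) \<otimes> g i = gw [1..<i] \<otimes> (g i \<otimes> (g (Suc i) \<otimes> (gw [Suc (Suc i)..<Suc j] \<otimes> g i)))"
    unfolding sp by (simp add: gw_append m_assoc)
  also have "\<dots> = gw [1..<i] \<otimes> (g (Suc i) \<otimes> (g i \<otimes> (g (Suc i) \<otimes> gw [Suc (Suc i)..<Suc j])))"
    unfolding c1 using braid_cancel[of "gw [Suc (Suc i)..<Suc j]" i] assms by simp
  also have "\<dots> = (gw [1..<i] \<otimes> g (Suc i)) \<otimes> (g i \<otimes> (g (Suc i) \<otimes> gw [Suc (Suc i)..<Suc j]))"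
    by (simp add: m_assoc)
  also have "\<dots> = g (Suc i) \<otimes> gw (up j)" unfolding c2 sp by (simp add: gw_append m_assoc)
  finally show ?thesis .
qed

text \<open>Besides descending chains there are chains that turn at 0 and climb again. As
  \<open>updown l 0\<close> is \<open>down l 0\<close>, the first family starts with
  \<open>j = 1\<close>. The relation of length 4 is met only when a chain that has climbed is
  multiplied by \<open>g 0\<close>.\<close>

lemma cosets_B:
  assumes k: "k = 4" and l: "l < n" and w: "w \<in> H (Suc l)"
  shows "\<exists>v\<in>H l. (\<exists>j\<le>Suc l. j \<ge> 1 \<and> w = v \<otimes> gw (down l j)) \<or> (\<exists>j\<le>l. w = v \<otimes> gw (updown l j))"
proof -
  define R where "R = {gw (down l j) | j. 1 \<le> j \<and> j \<le> Suc l} \<union> {gw (updown l j) | j. j \<le> l}"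
  have RD: "gw (down l j) \<in> R" if "1 \<le> j" "j \<le> Suc l" for j using that unfolding R_def by blast
  have RE: "gw (updown l j) \<in> R" if "j \<le> l" for j using that unfolding R_def by blast
  have E0: "updown l 0 = down l 0" by (simp add: updown_def up_simps)
  have Eeq: "gw (updown l j) = gw (down l 0) \<otimes> gw (up j)" for j by (simp add: updown_def gw_append)
  have res: "\<exists>v\<in>H l. \<exists>r'\<in>R. r \<otimes> g i = v \<otimes> r'"
    if "r \<otimes> g i = v \<otimes> r'" "v \<in> H l" "r' \<in> R" for r r' v i using that by blast
  have "\<exists>v\<in>H l. \<exists>r\<in>R. w = v \<otimes> r"
  proof (rule H_decompose[OF _ _ _ w])
    have "gw (down l (Suc l)) = \<one>" by (simp add: down_simps)
    then show "\<one> \<in> R" using RD[of "Suc l"] by simp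
    show "R \<subseteq> carrier W" by (auto simp: R_def)
    show "\<exists>v\<in>H l. \<exists>r'\<in>R. r \<otimes> g i = v \<otimes> r'" if r: "r \<in> R" and i: "i \<le> l" for r i
    proof -
      have "r \<in> {gw (down l j) | j. 1 \<le> j \<and> j \<le> Suc l} \<or> r \<in> {gw (updown l j) | j. j \<le> l}"
        using r unfolding R_def by blast
      then show ?thesis
    proof
      assume "r \<in> {gw (down l j) | j. 1 \<le> j \<and> j \<le> Suc l}"
      then obtain j where j: "r = gw (down l j)" "1 \<le> j" "j \<le> Suc l" by blast
      consider "j < i" | "j = i" | "j = Suc i" "i > 0" | "j = Suc i" "i = 0" | "Suc i < j" by linarith
      then show ?thesis
      proof cases
        case 1
        have "g (i - 1) \<in> H l" using H_gen 1 i by simp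
        moreover have "r \<otimes> g i = g (i - 1) \<otimes> r" using down_step_above[OF 1 i l] 1 j by simp
        ultimately show ?thesis using res RD[OF j(2,3)] j(1) by blast
      next
        case 2
        then have "r \<otimes> g i = \<one> \<otimes> gw (down l (Suc i))" using down_step_eq[OF i] j by simp
        then show ?thesis by (rule res[OF _ H_one RD]) (use i j in simp_all)
      next
        case 3
        then have "r \<otimes> g i = \<one> \<otimes> gw (down l i)" using down_step_below[OF i] j by simp
        then show ?thesis by (rule res[OF _ H_one RD]) (use 3 i j in simp_all)
      next
        case 4
        then have "r \<otimes> g i = \<one> \<otimes> gw (updown l 0)" using down_step_below[OF i] j E0 by simp
        then show ?thesis by (rule res[OF _ H_one RE]) (use i j in simp_all)
      next
        case 5
        have "g i \<in> H l" using H_gen 5 j by simp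
        moreover have "r \<otimes> g i = g i \<otimes> r" using down_step_far[OF 5 j(3) l] j by simp
        ultimately show ?thesis using res RD[OF j(2,3)] j(1) by blast
      qed
    next
      assume "r \<in> {gw (updown l j) | j. j \<le> l}"
      then obtain j where j: "r = gw (updown l j)" "j \<le> l" by blast
      consider "i = j" "j = 0" | "i = j" "j > 0" | "i = Suc j" | "Suc j < i" | "1 \<le> i" "i < j" | "i = 0" "0 < j"
        by linarith
      then show ?thesis
      proof cases
        case 1
        then have "r \<otimes> g i = \<one> \<otimes> gw (down l (Suc 0))" using down_step_eq[of 0 l] j E0 by simp
        then show ?thesis by (rule res[OF _ H_one RD]) (use i j in simp_all)
      next
        case 2
        obtain j' where j': "j = Suc j'" using 2 by (cases j) auto
        have "gw (up j) \<otimes> g j = gw (up j')" unfolding j' up_simps(2) by (simp add: gw_append m_assoc g_invol)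
        then have "r \<otimes> g i = \<one> \<otimes> gw (updown l (j - 1))" using j 2 j' by (simp add: Eeq m_assoc)
        then show ?thesis by (rule res[OF _ H_one RE]) (use i j in simp_all)
      next
        case 3
        then have "r \<otimes> g i = \<one> \<otimes> gw (updown l i)" using j by (simp add: Eeq up_simps(2) gw_append m_assoc)
        then show ?thesis by (rule res[OF _ H_one RE]) (use i j in simp_all)
      next
        case 4
        have c: "gw (up j) \<otimes> g i = g i \<otimes> gw (up j)"
          by (rule gw_commute) (use 4 i l in \<open>auto simp: up_def\<close>)
        have "r \<otimes> g i = (gw (down l 0) \<otimes> g i) \<otimes> gw (up j)" unfolding j(1) Eeq using c by (simp add: m_assoc)
        also have "\<dots> = g (i - 1) \<otimes> r" using down_step_above[of 0 i l] 4 i l j(1) by (simp add: Eeq m_assoc)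
        finally show ?thesis by (rule res[OF _ H_gen r]) (use 4 i in simp)
      next
        case 5
        then have jn: "j < n" using j l by simp
        have "r \<otimes> g i = (gw (down l 0) \<otimes> g (Suc i)) \<otimes> gw (up j)"
          unfolding j(1) Eeq using up_step[OF 5 jn] by (simp add: m_assoc)
        also have "\<dots> = g i \<otimes> r" using down_step_above[of 0 "Suc i" l] 5 j l by (simp add: Eeq m_assoc)
        finally show ?thesis by (rule res[OF _ H_gen r]) (use 5 j in simp)
      next
        \<comment> \<open>The letter \<open>g 0\<close> commutes past the climb above 1, the word 1
          0 1 0 becomes 0 1 0 1, and its first letter commutes past the descent above 1.\<close>
        case 6
        have sp: "up j = 1 # [2..<Suc j]" using up_simps(3) 6 by simp
        have ds: "down l 0 = down l 2 @ [1, 0]"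
          using down_simps(1)[of 0 l] down_simps(1)[of 1 l] 6 j by (simp add: numeral_2_eq_2)
        have c1: "gw [2..<Suc j] \<otimes> g 0 = g 0 \<otimes> gw [2..<Suc j]"
          by (rule gw_commute) (use 6 j l in auto)
        have c2: "gw (down l 2) \<otimes> g 0 = g 0 \<otimes> gw (down l 2)"
          by (rule gw_commute) (use 6 j l in \<open>auto simp: down_def\<close>)
        have b4: "g 1 \<otimes> (g 0 \<otimes> (g 1 \<otimes> (g 0 \<otimes> x))) = g 0 \<otimes> (g 1 \<otimes> (g 0 \<otimes> (g 1 \<otimes> x)))" if "x \<in> carrier W" for x
        proof -
          have "(g 1 \<otimes> (g 0 \<otimes> (g 1 \<otimes> g 0))) \<otimes> x = (g 0 \<otimes> (g 1 \<otimes> (g 0 \<otimes> g 1))) \<otimes> x"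
            using g_braid4 k 6 j l by simp
          then show ?thesis using that by (simp add: m_assoc)
        qed
        have "r \<otimes> g i = gw (down l 2) \<otimes> (g 1 \<otimes> (g 0 \<otimes> (g 1 \<otimes> (gw [2..<Suc j] \<otimes> g 0))))"
          unfolding j(1) updown_def ds sp using 6 by (simp add: gw_append m_assoc del: upt_Suc)
        also have "\<dots> = gw (down l 2) \<otimes> (g 0 \<otimes> (g 1 \<otimes> (g 0 \<otimes> (g 1 \<otimes> gw [2..<Suc j]))))"
          unfolding c1 by (simp only: b4 gw_closed)
        also have "\<dots> = (gw (down l 2) \<otimes> g 0) \<otimes> (g 1 \<otimes> (g 0 \<otimes> (g 1 \<otimes> gw [2..<Suc j])))"
          by (simp add: m_assoc)
        also have "\<dots> = g 0 \<otimes> r" unfolding c2 j(1) updown_def ds sp by (simp add: gw_append m_assoc del: upt_Suc)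
        finally show ?thesis by (rule res[OF _ H_gen r]) (use 6 j in simp)
      qed
    qed
    qed
  qed
  then show ?thesis unfolding R_def by blast
qed

end

section \<open>Permutation models for types A and B\<close>

locale lin_perm = linear_coxeter W s m f k n + sym_perms N sg md
  for W :: "('g, 'b) monoid_scheme" (structure) and s :: "'n::finite \<Rightarrow> 'g" and m f k n N sg md +
  fixes b0 :: nat
  assumes mode: "k = 3 \<and> md = 0 \<and> N = Suc n \<and> b0 = 0
    \<or> k = 4 \<and> md = 1 \<and> n \<ge> 2 \<and> N = 2 * n \<and> Suc b0 = n \<and> (\<forall>x<N. sg x = N - 1 - x)"
begin

text \<open>In type A these are the adjacent transpositions of \<open>n + 1\<close> points. In type
  B the \<open>2 * n\<close> points are signed numbers in increasing order, \<open>sg\<close>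
  reverses the order, and \<open>b0 = n - 1\<close> is the last negative one: the first generator
  swaps the two middle points, the others are adjacent transpositions together with their mirror
  images.\<close>

definition p :: "nat \<Rightarrow> nat \<Rightarrow> nat" where "p j = tr (b0 + j) (b0 + Suc j)"

lemma b0_lt: "i \<le> n \<Longrightarrow> b0 + i < N"
  using mode by auto

text \<open>The exceptional value occurs because in type B the point \<open>b0\<close> is the mirror
  image of \<open>b0 + 1\<close>, which the generator with index 1 moves.\<close>

lemma p_at:
  assumes "i \<le> n" "j < n"
  shows "p j (b0 + i) = (if i = j then b0 + Suc j else if i = Suc j then b0 + j
    else if md = 1 \<and> i = 0 \<and> j = 1 then b0 - 1 else b0 + i)"
  using mode
proof
  assume A: "k = 3 \<and> md = 0 \<and> N = Suc n \<and> b0 = 0"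
  then have sgx: "sg x = x" for x using sg_even by simp
  have "b0 = 0" "md \<noteq> 1" using A by auto
  then show ?thesis unfolding p_def tr_def sgx by simp
next
  assume B: "k = 4 \<and> md = 1 \<and> n \<ge> 2 \<and> N = 2 * n \<and> Suc b0 = n \<and> (\<forall>x<N. sg x = N - 1 - x)"
  then have s1: "sg (b0 + j) = N - 1 - (b0 + j)" "sg (b0 + Suc j) = N - 1 - (b0 + Suc j)"
    using b0_lt[of j] b0_lt[of "Suc j"] assms by simp_all
  show ?thesis
  proof (cases "i = j \<or> i = Suc j")
    case True
    then show ?thesis unfolding p_def by (elim disjE) (simp_all add: tr_simps)
  next
    case False
    have N: "N = 2 * Suc b0" and b0: "b0 > 0" using B by auto
    have s1': "sg (b0 + j) = (if j = 0 then Suc b0 else Suc b0 - j)" "sg (b0 + Suc j) = b0 - j"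
      unfolding s1 N by simp_all
    have jb: "j \<le> b0" using B assms(2) by linarith
    have 2: "b0 + i \<noteq> sg (b0 + Suc j)" unfolding s1' using False jb b0 by linarith
    have 1: "b0 + i = sg (b0 + j) \<longleftrightarrow> i = 0 \<and> j = 1"
    proof (cases "j = 0")
      case True
      then show ?thesis unfolding s1' using False by simp
    next
      case F: False
      then have "sg (b0 + j) = Suc b0 - j" unfolding s1' by simp
      then show ?thesis using F jb by linarith
    qed
    have "b0 + Suc 1 < N" unfolding N using b0 by simp
    then have "sg (b0 + Suc 1) = N - 1 - (b0 + Suc 1)" using B by blast
    then have 3: "sg (b0 + Suc 1) = b0 - 1" unfolding N by simp
    show ?thesis
    proof (cases "i = 0 \<and> j = 1")
      case True
      then have "p j (b0 + i) = sg (b0 + Suc j)" using False 1 by (simp add: p_def tr_def)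
      then show ?thesis using True 3 B by simp
    next
      case F2: False
      then have "b0 + i \<noteq> sg (b0 + j)" using 1 by blast
      then have "p j (b0 + i) = b0 + i" using False 2 unfolding p_def tr_def by simp
      then show ?thesis using F2 False by auto
    qed
  qed
qed

lemma p_G: "j < n \<Longrightarrow> p j \<in> G"
  unfolding p_def using b0_lt[of j] b0_lt[of "Suc j"] by (intro tr_G) simp_all

lemma p_invol: "j < n \<Longrightarrow> p j (p j x) = x"
  unfolding p_def using b0_lt[of j] b0_lt[of "Suc j"] by (intro tr_invol) simp_all

lemma pinv_p: "j < n \<Longrightarrow> pinv (p j) = p j"
proof
  fix x assume j: "j < n"
  show "pinv (p j) x = p j x"
    using permutes_inverses(2)[OF G_perm[OF p_G[OF j]], of "p j x"] p_invol[OF j] by simp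
qed

lemma p_conj: "i < n \<Longrightarrow> p i (tr a b (p i x)) = tr (p i a) (p i b) x"
  using conj_tr[OF p_G, of i a b] pinv_p[of i] by (simp add: fun_eq_iff)

lemma tr_sym: "tr a b = tr b a" "tr (sg a) (sg b) = tr a b" if "a < N" "b < N"
proof -
  have *: "sg y = z \<longleftrightarrow> y = sg z" for y z by (metis sg_sg)
  show "tr a b = tr b a"
  proof (rule ext, goal_cases)
    case (1 x)
    show ?case using sg_odd[of a] sg_odd[of b] sg_even that unfolding tr_def by (smt (verit) sg_sg)
  qed
  show "tr (sg a) (sg b) = tr a b"
  proof (rule ext, goal_cases)
    case (1 x)
    show ?case using sg_odd[of a] sg_odd[of b] sg_even that unfolding tr_def by (smt (verit) sg_sg)
  qed
qed

lemma p_far: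
  assumes "i < n" "j < n" "i + 2 \<le> j \<or> j + 2 \<le> i"
  shows "p i (p j (p i x)) = p j x"
proof -
  have "p i (p j (p i x)) = tr (p i (b0 + j)) (p i (b0 + Suc j)) x"
    unfolding p_def[of j] by (rule p_conj[OF assms(1)])
  also have "p i (b0 + j) = b0 + j" using assms by (subst p_at) auto
  also have "p i (b0 + Suc j) = b0 + Suc j" using assms by (subst p_at) auto
  finally show ?thesis by (simp add: p_def)
qed

lemma p_braid:
  assumes "Suc j < n" "j > 0 \<or> k = 3"
  shows "p j (p (Suc j) (p j x)) = p (Suc j) (p j (p (Suc j) x))"
proof -
  have md: "md = 1 \<Longrightarrow> j > 0" using assms(2) mode by auto
  have "p j (p (Suc j) (p j x)) = tr (p j (b0 + Suc j)) (p j (b0 + Suc (Suc j))) x"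
    unfolding p_def[of "Suc j"] by (rule p_conj) (use assms in simp)
  also have "p j (b0 + Suc j) = b0 + j" using assms by (subst p_at) auto
  also have "p j (b0 + Suc (Suc j)) = b0 + Suc (Suc j)" using assms by (subst p_at) auto
  finally have 1: "p j (p (Suc j) (p j x)) = tr (b0 + j) (b0 + Suc (Suc j)) x" .
  have "p (Suc j) (p j (p (Suc j) x)) = tr (p (Suc j) (b0 + j)) (p (Suc j) (b0 + Suc j)) x"
    unfolding p_def[of j] by (rule p_conj) (use assms in simp)
  also have "p (Suc j) (b0 + j) = b0 + j" using assms md by (subst p_at) auto
  also have "p (Suc j) (b0 + Suc j) = b0 + Suc (Suc j)" using assms by (subst p_at) auto
  finally show ?thesis using 1 by simp
qed

text \<open>The right side is the reflection \<open>tr b0 (b0 + 2)\<close>. Conjugation by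
  \<open>p 1\<close> moves the two points to \<open>b0 - 1\<close> and \<open>b0 + 1\<close>, their
  mirror images in opposite order, so the reflection is unchanged.\<close>

lemma p_braid4:
  assumes "k = 4"
  shows "p 1 (p 0 (p 1 (p 0 (p 1 x)))) = p 0 (p 1 (p 0 x))"
proof -
  have B: "md = 1" "n \<ge> 2" "N = 2 * n" "Suc b0 = n" "\<And>x. x < N \<Longrightarrow> sg x = N - 1 - x" using mode assms by auto
  have "p 0 (p 1 (p 0 y)) = tr (p 0 (b0 + 1)) (p 0 (b0 + Suc 1)) y" for y
    unfolding p_def[of 1] by (rule p_conj) (use B in simp)
  moreover have "p 0 (b0 + 1) = b0" using B by (subst p_at) auto
  moreover have "p 0 (b0 + Suc 1) = b0 + Suc 1" using B by (subst p_at) auto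
  ultimately have 1: "p 0 (p 1 (p 0 y)) = tr b0 (b0 + Suc 1) y" for y by simp
  have "p 1 (p 0 (p 1 (p 0 (p 1 x)))) = tr (p 1 b0) (p 1 (b0 + Suc 1)) x"
    unfolding 1 by (rule p_conj) (use B in simp)
  also have "p 1 b0 = b0 - 1" using p_at[of 0 1] B by simp
  also have "p 1 (b0 + Suc 1) = b0 + 1" using B by (subst p_at) auto
  also have "tr (b0 - 1) (b0 + 1) = tr (sg (b0 + Suc 1)) (sg b0)"
    using B b0_lt[of "Suc 1"] b0_lt[of 0] by (intro arg_cong2[where f = tr]) simp_all
  also have "\<dots> = tr (b0 + Suc 1) b0" by (rule tr_sym(2)) (use B b0_lt[of "Suc 1"] b0_lt[of 0] in simp_all)
  also have "\<dots> = tr b0 (b0 + Suc 1)" by (rule tr_sym(1)) (use B b0_lt[of "Suc 1"] b0_lt[of 0] in simp_all)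
  finally show ?thesis using 1 by simp
qed

lemma p_relation: "foldr (\<circ>) (concat (replicate (m i j) [p (f i), p (f j)])) id = id"
proof -
  let ?P = "p (f i)" and ?Q = "p (f j)"
  note inv = p_invol[OF f_lt]
  consider "f i = f j" | "{f i, f j} = {0, 1}" "k = 4" "f i \<noteq> f j"
    | "f j = Suc (f i)" "f i > 0 \<or> k = 3" | "f i = Suc (f j)" "f j > 0 \<or> k = 3"
    | "f i + 2 \<le> f j \<or> f j + 2 \<le> f i"
  proof -
    have "k = 3 \<or> k = 4" using mode by auto
    moreover have "f i = 0 \<and> f j = 1 \<Longrightarrow> {f i, f j} = {0, 1}" "f i = 1 \<and> f j = 0 \<Longrightarrow> {f i, f j} = {0, 1}" by auto
    ultimately show ?thesis using that by (metis One_nat_def Suc_lessI add_2_eq_Suc' gr0I less_eq_Suc_le linorder_neqE_nat n_not_Suc_n)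
  qed
  then show ?thesis
  proof cases
    case 1
    then have "m i j = 1" by (simp add: m_eq)
    then show ?thesis using 1 inv by (auto simp: fun_eq_iff)
  next
    case 2
    then have "m i j = 4" by (simp add: m_eq)
    moreover have "replicate 4 x = [x, x, x, x]" for x :: "(nat \<Rightarrow> nat) list" by (simp add: eval_nat_numeral)
    moreover have "f i = 0 \<and> f j = 1 \<or> f i = 1 \<and> f j = 0" using 2(1) by (simp add: doubleton_eq_iff)
    moreover have n2: "0 < n" "1 < n" using mode 2 by auto
    ultimately show ?thesis
      using p_braid4[OF 2(2)] p_invol[OF n2(1)] p_invol[OF n2(2)] by (elim disjE conjE) (simp_all add: fun_eq_iff)
  next
    case 3
    then have "m i j = 3" by (auto simp: m_eq doubleton_eq_iff)
    moreover have "replicate 3 x = [x, x, x]" for x :: "(nat \<Rightarrow> nat) list" by (simp add: eval_nat_numeral)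
    moreover have br: "?P (?Q (?P x)) = ?Q (?P (?Q x))" for x using p_braid[of "f i"] 3 f_lt[of j] by simp
    ultimately show ?thesis using inv[of i] inv[of j] by (simp add: fun_eq_iff)
  next
    case 4
    then have "m i j = 3" by (auto simp: m_eq doubleton_eq_iff)
    moreover have "replicate 3 x = [x, x, x]" for x :: "(nat \<Rightarrow> nat) list" by (simp add: eval_nat_numeral)
    moreover have br: "?P (?Q (?P x)) = ?Q (?P (?Q x))" for x using p_braid[of "f j"] 4 f_lt[of i] by simp
    ultimately show ?thesis using inv[of i] inv[of j] by (simp add: fun_eq_iff)
  next
    case 5
    then have "{f i, f j} \<noteq> {0, 1}" "f i \<noteq> f j" "f i \<noteq> Suc (f j)" "f j \<noteq> Suc (f i)" by (auto simp: doubleton_eq_iff)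
    then have "m i j = 2" by (simp add: m_eq)
    moreover have "replicate 2 x = [x, x]" for x :: "(nat \<Rightarrow> nat) list" by (simp add: eval_nat_numeral)
    moreover have "?P (?Q (?P x)) = ?Q x" for x using p_far[OF f_lt f_lt 5] .
    ultimately show ?thesis using inv[of j] by (simp add: fun_eq_iff)
  qed
qed

definition psi :: "'g \<Rightarrow> nat \<Rightarrow> nat" where
  "psi = (SOME \<psi>. (\<forall>u. \<psi> (lm (map s u)) = foldr (\<circ>) (map (\<lambda>i. p (f i)) u) id)
    \<and> (\<forall>x\<in>carrier W. \<forall>y\<in>carrier W. \<psi> (x \<otimes> y) = \<psi> x \<circ> \<psi> y))"

lemma psi_word: "psi (lm (map s u)) = foldr (\<circ>) (map (\<lambda>i. p (f i)) u) id"
  and psi_mult: "x \<in> carrier W \<Longrightarrow> y \<in> carrier W \<Longrightarrow> psi (x \<otimes> y) = psi x \<circ> psi y"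
proof -
  have "\<exists>\<psi>. (\<forall>u. \<psi> (lm (map s u)) = foldr (\<circ>) (map (\<lambda>i. p (f i)) u) id)
    \<and> (\<forall>x\<in>carrier W. \<forall>y\<in>carrier W. \<psi> (x \<otimes> y) = \<psi> x \<circ> \<psi> y)"
  proof (rule coxeter_lift[OF sys, where mul = "(\<circ>)" and one = id and \<phi> = "\<lambda>i. p (f i)"])
    fix \<psi>
    assume "\<And>u. \<psi> (lm (map s u)) = foldr (\<circ>) (map (\<lambda>i. p (f i)) u) id"
      "\<And>x y. x \<in> carrier W \<Longrightarrow> y \<in> carrier W \<Longrightarrow> \<psi> (x \<otimes> y) = \<psi> x \<circ> \<psi> y"
    then show ?thesis by blast
  qed (simp_all add: p_relation comp_assoc)
  then have *: "(\<forall>u. psi (lm (map s u)) = foldr (\<circ>) (map (\<lambda>i. p (f i)) u) id)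
    \<and> (\<forall>x\<in>carrier W. \<forall>y\<in>carrier W. psi (x \<otimes> y) = psi x \<circ> psi y)"
    unfolding psi_def by (rule someI_ex)
  show "psi (lm (map s u)) = foldr (\<circ>) (map (\<lambda>i. p (f i)) u) id" using * by blast
  show "x \<in> carrier W \<Longrightarrow> y \<in> carrier W \<Longrightarrow> psi (x \<otimes> y) = psi x \<circ> psi y" using * by blast
qed

lemma psi_one: "psi \<one> = id"
  using psi_word[of "[]"] by simp

lemma psi_s: "psi (s i) = p (f i)"
  using psi_word[of "[i]"] by simp

lemma psi_g: "j < n \<Longrightarrow> psi (g j) = p j"
  using psi_s[of "idx j"] by (simp add: g_def f_idx)

lemma psi_G: "w \<in> carrier W \<Longrightarrow> psi w \<in> G"
proof -
  assume "w \<in> carrier W"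
  then obtain u where u: "lm (map s u) = w" by (rule ex_word)
  have G: "foldr (\<circ>) ts id \<in> G" if "set ts \<subseteq> G" for ts
    using that by (induction ts) (use id_G comp_G in auto)
  have "foldr (\<circ>) (map (\<lambda>i. p (f i)) u) id \<in> G"
    by (rule G) (use p_G[OF f_lt] in auto)
  then show ?thesis using psi_word[of u] u by simp
qed

lemma psi_inj_point: "w \<in> carrier W \<Longrightarrow> psi w x = psi w y \<longleftrightarrow> x = y"
  using inj_eq[OF permutes_inj[OF G_perm[OF psi_G]]] .

lemma psi_inv: "x \<in> carrier W \<Longrightarrow> psi (inv x) = pinv (psi x)"
proof
  fix y
  assume x: "x \<in> carrier W"
  have "psi x \<circ> psi (inv x) = id" using psi_mult[of x "inv x"] x psi_one by simp
  then have "psi x (psi (inv x) y) = y" by (simp add: fun_eq_iff)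
  then show "psi (inv x) y = pinv (psi x) y"
    using permutes_inverses(2)[OF G_perm[OF psi_G[OF x]], of "psi (inv x) y"] by simp
qed

lemma H_fix_top:
  assumes "w \<in> H l" "l < n"
  shows "psi w (b0 + Suc l) = b0 + Suc l"
proof -
  obtain ks where ks: "w = gw ks" "set ks \<subseteq> {..<l}" using assms(1) by (auto simp: H_def)
  have "psi (gw ks) (b0 + Suc l) = b0 + Suc l"
    using ks(2)
  proof (induction ks)
    case (Cons t ks)
    then have t: "t < l" "t < n" using assms(2) by auto
    have "p t (b0 + Suc l) = b0 + Suc l" using t assms(2) by (subst p_at) auto
    then show ?case using Cons t by (simp add: psi_mult psi_g)
  qed (simp add: psi_one)
  then show ?thesis using ks(1) by simp
qed

lemma H_top_moved:
  assumes "v \<in> H l" "l < n"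
  shows "psi (g l \<otimes> v) (b0 + Suc l) = b0 + l"
proof -
  have "p l (b0 + Suc l) = b0 + l" using assms(2) by (subst p_at) auto
  then show ?thesis using H_fix_top[OF assms] assms H_closed by (simp add: psi_mult psi_g)
qed

lemma psi_down_one:
  "l < n \<Longrightarrow> psi (gw (down l 1)) (b0 + 1) = b0 + Suc l"
proof (induction l)
  case 0
  then show ?case using down_simps(2)[of 0] by (simp add: psi_one)
next
  case (Suc l)
  have "down (Suc l) 1 = Suc l # down l 1" by (simp add: down_def)
  moreover have "p (Suc l) (b0 + Suc l) = b0 + Suc (Suc l)" using Suc.prems by (subst p_at) auto
  ultimately show ?case using Suc by (simp add: psi_mult psi_g)
qed

text \<open>The full chain is the conjugate of \<open>g 0\<close> by \<open>gw (down l 1)\<close>,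
  which sends \<open>b0 + 1\<close> to \<open>b0 + Suc l\<close>; and \<open>p 0\<close> moves
  \<open>b0 + 1\<close>.\<close>

lemma updown_full_moves:
  assumes "l < n" "l > 0"
  shows "psi (gw (updown l l)) (b0 + Suc l) \<noteq> b0 + Suc l"
proof
  let ?e = "gw (down l 1)"
  assume A: "psi (gw (updown l l)) (b0 + Suc l) = b0 + Suc l"
  have d0: "down l 0 = down l 1 @ [0]" using down_simps(1)[of 0 l] by simp
  have up: "gw (up l) = inv ?e"
  proof -
    have "map idx (up l) = rev (map idx (down l 1))" by (simp add: up_def down_def rev_map)
    then show ?thesis unfolding gw_word word_inv by (simp only:)
  qed
  have "psi ?e (psi (inv ?e) (b0 + Suc l)) = psi ?e (b0 + 1)"
    using psi_mult[of ?e "inv ?e"] psi_one psi_down_one[OF assms(1)] by (simp add: fun_eq_iff)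
  then have e: "psi (inv ?e) (b0 + Suc l) = b0 + 1" by (simp add: psi_inj_point)
  have p0: "p 0 (b0 + 1) = b0" using assms by (subst p_at) auto
  have "psi (gw (updown l l)) (b0 + Suc l) = psi ?e (p 0 (psi (inv ?e) (b0 + Suc l)))"
    using assms by (simp add: updown_def d0 gw_append up psi_mult psi_g)
  then have "psi ?e b0 = psi ?e (b0 + 1)" using A e p0 psi_down_one[OF assms(1)] by simp
  then have "b0 = b0 + 1" by (simp only: psi_inj_point gw_closed)
  then show False by simp
qed

text \<open>Induction along the chain of parabolic subgroups: \<open>H l\<close> fixes the point
  \<open>b0 + Suc l\<close>, and every coset representative except the trivial one moves it, so a
  kernel element of \<open>H (Suc l)\<close> lies in \<open>H l\<close>.\<close>

lemma psi_kernel_H: "l \<le> n \<Longrightarrow> w \<in> H l \<Longrightarrow> psi w = id \<Longrightarrow> w = \<one>"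
proof (induction l arbitrary: w)
  case 0
  then show ?case by (auto simp: H_def)
next
  case (Suc l)
  then have l: "l < n" by simp
  let ?x = "b0 + Suc l"
  have moved: "psi (gw r) ?x \<noteq> ?x" if "r = l # r'" "set r' \<subseteq> {..<l}" for r r'
  proof -
    have "gw r' \<in> H l" using that(2) unfolding H_def by blast
    then show ?thesis using H_top_moved[OF _ l] that(1) by simp
  qed
  have dl: "down l j = l # rev [j..<l]" if "j \<le> l" for j
    using that by (simp add: down_def)
  have dmoved: "psi (gw (down l j)) ?x \<noteq> ?x" if "j \<le> l" for j
    by (rule moved[OF dl[OF that]]) auto
  have fixr: "psi (gw r) ?x = ?x" if v: "v \<in> H l" "w = v \<otimes> gw r" for v r
  proof -
    have vc: "v \<in> carrier W" using H_closed v(1) by blast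
    have "psi v (psi (gw r) ?x) = psi v ?x"
      using Suc.prems(3) psi_mult[OF vc, of "gw r"] v(2) H_fix_top[OF v(1) l] by (simp add: fun_eq_iff)
    then show ?thesis using psi_inj_point[OF vc] by simp
  qed
  have "k = 3 \<or> k = 4" using mode by auto
  then have "w \<in> H l"
  proof
    assume k: "k = 3"
    obtain v j where vj: "v \<in> H l" "j \<le> Suc l" "w = v \<otimes> gw (down l j)"
      using cosets_A[OF k l Suc.prems(2)] by blast
    then have "j = Suc l" using dmoved[of j] fixr[OF vj(1,3)] by linarith
    then show ?thesis using vj H_closed by (simp add: down_simps)
  next
    assume k: "k = 4"
    obtain v where v: "v \<in> H l"
      "(\<exists>j\<le>Suc l. j \<ge> 1 \<and> w = v \<otimes> gw (down l j)) \<or> (\<exists>j\<le>l. w = v \<otimes> gw (updown l j))"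
      using cosets_B[OF k l Suc.prems(2)] by blast
    from v(2) show ?thesis
    proof
      assume "\<exists>j\<le>Suc l. j \<ge> 1 \<and> w = v \<otimes> gw (down l j)"
      then obtain j where j: "j \<le> Suc l" "w = v \<otimes> gw (down l j)" by blast
      then have "j = Suc l" using dmoved[of j] fixr[OF v(1) j(2)] by linarith
      then show ?thesis using j v H_closed by (simp add: down_simps)
    next
      assume "\<exists>j\<le>l. w = v \<otimes> gw (updown l j)"
      then obtain j where j: "j \<le> l" "w = v \<otimes> gw (updown l j)" by blast
      note fx = fixr[OF v(1) j(2)]
      have "psi (gw (updown l j)) ?x \<noteq> ?x"
      proof (cases "j < l")
        case True
        have "updown l j = l # (rev [0..<l] @ up j)" using dl[of 0] by (simp add: updown_def)
        then show ?thesis by (rule moved) (use True in \<open>auto simp: up_def\<close>)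
      next
        case False
        then have jl: "j = l" using j by simp
        show ?thesis
        proof (cases "l = 0")
          case True
          then show ?thesis using dmoved[of 0] jl by (simp add: updown_def up_simps)
        next
          case False
          then show ?thesis using updown_full_moves[OF l] jl by simp
        qed
      qed
      then show ?thesis using fx by simp
    qed
  qed
  then show ?case using Suc.IH Suc.prems l by simp
qed

lemma psi_inj: "inj_on psi (carrier W)"
proof (rule inj_onI)
  fix x y assume xy: "x \<in> carrier W" "y \<in> carrier W" "psi x = psi y"
  have "psi (x \<otimes> inv y) = psi y \<circ> psi (inv y)" using xy by (simp add: psi_mult)
  also have "\<dots> = psi (y \<otimes> inv y)" using xy psi_mult[of y "inv y"] by simp
  finally have "psi (x \<otimes> inv y) = psi (y \<otimes> inv y)" .
  then have "psi (x \<otimes> inv y) = id" using xy psi_one by simp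
  then have "x \<otimes> inv y = \<one>" using psi_kernel_H[of n] H_full xy by simp
  then show "x = y" using xy by (metis inv_equality inv_inv inv_closed)
qed

section \<open>Identifying the reflections in the permutation model\<close>

lemma psi_T_conj:
  assumes "q \<in> psi ` T" "tr a b \<in> psi ` T" "a < N" "b < N"
  shows "tr (q a) (q b) \<in> psi ` T"
proof -
  obtain t where t: "t \<in> T" "q = psi t" using assms(1) by blast
  obtain r where r: "r \<in> T" "tr a b = psi r" using assms(2) by blast
  have tc: "t \<in> carrier W" and rc: "r \<in> carrier W" using t r T_closed by auto
  have "psi (t \<otimes> r \<otimes> inv t) = tr (q a) (q b)"
    using conj_tr[OF psi_G[OF tc], of a b] tc rc t r by (simp add: psi_mult psi_inv comp_assoc)
  then show ?thesis using T_conj[OF r(1) tc] by (metis image_eqI)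
qed

lemma psi_T_adjacent: "Suc q < N \<Longrightarrow> tr q (Suc q) \<in> psi ` T"
proof -
  assume q: "Suc q < N"
  have gen: "tr (b0 + j) (b0 + Suc j) \<in> psi ` T" if "j < n" for j
    using psi_g[OF that] s_T[of "idx j"] unfolding p_def g_def by (metis image_eqI)
  from mode show ?thesis
  proof
    assume "k = 3 \<and> md = 0 \<and> N = Suc n \<and> b0 = 0"
    then show ?thesis using gen[of q] q by simp
  next
    assume B: "k = 4 \<and> md = 1 \<and> n \<ge> 2 \<and> N = 2 * n \<and> Suc b0 = n \<and> (\<forall>x<N. sg x = N - 1 - x)"
    show ?thesis
    proof (cases "q \<ge> b0")
      case True
      have "q - b0 < n" using q B by auto
      from gen[OF this] show ?thesis using True by simp
    next
      case False
      let ?r = "N - 2 - q"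
      have r: "?r \<ge> b0" "?r - b0 < n" "?r < N" "Suc ?r < N" using False B q by auto
      have "tr ?r (Suc ?r) \<in> psi ` T" using gen[OF r(2)] unfolding add_Suc_right le_add_diff_inverse[OF r(1)] .
      moreover have "sg ?r = Suc q" "sg (Suc ?r) = q" using B r q by auto
      then have "tr ?r (Suc ?r) = tr (Suc q) q" using tr_sym(2)[OF r(3,4)] by simp
      moreover have "tr (Suc q) q = tr q (Suc q)" using tr_sym(1)[of "Suc q" q] q by simp
      ultimately show ?thesis by simp
    qed
  qed
qed

text \<open>Conjugation by an adjacent transposition lengthens a pair at its upper end. In type B
  the shorter pair \<open>a\<close>, \<open>b - 1\<close> may be antipodal, which the induction does
  not cover; then the pair is lengthened at its lower end.\<close>

lemma psi_T_tr_less: "a < b \<Longrightarrow> b < N \<Longrightarrow> b \<noteq> sg a \<or> md = 0 \<Longrightarrow> tr a b \<in> psi ` T"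
proof (induction "b - a" arbitrary: a b rule: less_induct)
  case less
  have sgx: "sg x = N - 1 - x" if "md = 1" "x < N" for x using mode that by auto
  have sge: "sg x = x" if "md = 0" for x using sg_even that by simp
  have md01: "md = 0 \<or> md = 1" using mode by auto
  show ?case
  proof (cases "b = Suc a")
    case True
    then show ?thesis using psi_T_adjacent less.prems by simp
  next
    case False
    then have ab: "Suc a < b" "a < b - 1" using less.prems by auto
    show ?thesis
    proof (cases "md = 1 \<and> b - 1 = sg a")
      case True
      have aN: "a < N" "Suc a < N" using less.prems ab by auto
      have b: "b = N - a" using True sgx[of a] aN ab by linarith
      have "tr (Suc a) b \<in> psi ` T"
      proof (rule less.hyps)
        show "b \<noteq> sg (Suc a) \<or> md = 0" using sgx[of "Suc a"] True aN b by auto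
      qed (use ab less.prems in auto)
      moreover have ta: "tr a (Suc a) \<in> psi ` T" using psi_T_adjacent aN by simp
      ultimately have "tr (tr a (Suc a) (Suc a)) (tr a (Suc a) b) \<in> psi ` T"
        using psi_T_conj[OF ta] aN less.prems by simp
      moreover have "tr a (Suc a) b = b"
        using sgx[of a] sgx[of "Suc a"] True aN b ab by (auto simp: tr_def)
      ultimately show ?thesis by (simp add: tr_simps)
    next
      case F: False
      have bN: "b - 1 < N" "Suc (b - 1) = b" using less.prems ab by auto
      have "tr a (b - 1) \<in> psi ` T"
        by (rule less.hyps) (use ab less.prems F md01 in auto)
      moreover have tb: "tr (b - 1) b \<in> psi ` T" using psi_T_adjacent[of "b - 1"] bN less.prems by simp
      ultimately have *: "tr (tr (b - 1) b a) (tr (b - 1) b (b - 1)) \<in> psi ` T"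
        using psi_T_conj[OF tb] bN less.prems by simp
      have "tr (b - 1) b a = a"
      proof (cases "md = 1")
        case True
        have "a \<noteq> sg (b - 1)" using F True by (metis sg_sg)
        moreover have "a \<noteq> sg b" using less.prems(3) True by (metis sg_sg zero_neq_one)
        ultimately show ?thesis using ab less.prems by (simp add: tr_def)
      next
        case False
        then have "md = 0" using md01 by simp
        then show ?thesis using ab less.prems by (simp add: tr_def sge)
      qed
      then show ?thesis using * by (simp add: tr_simps)
    qed
  qed
qed

text \<open>The middle pair is an adjacent transposition; conjugation moves it outwards
  symmetrically.\<close>

lemma psi_T_antipodal: "md = 1 \<Longrightarrow> j < n \<Longrightarrow> tr (b0 - j) (sg (b0 - j)) \<in> psi ` T"
proof (induction j)
  case 0
  have "sg b0 = Suc b0" "Suc b0 < N" using mode 0 by auto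
  then show ?case using psi_T_adjacent[of b0] by simp
next
  case (Suc j)
  have B: "N = 2 * n" "Suc b0 = n" "\<And>x. x < N \<Longrightarrow> sg x = N - 1 - x" using mode Suc.prems by auto
  let ?a = "b0 - Suc j"
  have a: "Suc ?a = b0 - j" "?a < N" "Suc ?a < N" using Suc.prems B by auto
  have "tr (Suc ?a) (sg (Suc ?a)) \<in> psi ` T" using Suc a by simp
  moreover have ta: "tr ?a (Suc ?a) \<in> psi ` T" by (rule psi_T_adjacent[OF a(3)])
  ultimately have *: "tr (tr ?a (Suc ?a) (Suc ?a)) (tr ?a (Suc ?a) (sg (Suc ?a))) \<in> psi ` T"
    using psi_T_conj[OF ta] a sg_lt by simp
  have "tr ?a (Suc ?a) (sg (Suc ?a)) = sg ?a" using tr_sg[OF a(2,3), of "Suc ?a"] by (simp add: tr_simps)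
  then show ?case using * by (simp add: tr_simps)
qed

lemma psi_T: "psi ` T = TR"
proof
  show "psi ` T \<subseteq> TR"
  proof
    fix q assume "q \<in> psi ` T"
    then obtain w i where w: "w \<in> carrier W" "q = psi (w \<otimes> s i \<otimes> inv w)" by (auto simp: reflections_def)
    have "q = psi w \<circ> p (f i) \<circ> pinv (psi w)" using w by (simp add: psi_mult psi_inv psi_s comp_assoc)
    also have "\<dots> = tr (psi w (b0 + f i)) (psi w (b0 + Suc (f i)))"
      unfolding p_def by (rule conj_tr[OF psi_G[OF w(1)]])
    finally have q: "q = tr (psi w (b0 + f i)) (psi w (b0 + Suc (f i)))" .
    have "psi w (b0 + f i) < N" "psi w (b0 + Suc (f i)) < N"
      using G_lt[OF psi_G[OF w(1)]] b0_lt[of "f i"] b0_lt[of "Suc (f i)"] f_lt[of i] by simp_all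
    moreover have "psi w (b0 + f i) \<noteq> psi w (b0 + Suc (f i))" using psi_inj_point[OF w(1)] by simp
    ultimately show "q \<in> TR" unfolding TR_def q by blast
  qed
  show "TR \<subseteq> psi ` T"
  proof
    fix q assume "q \<in> TR"
    then obtain a b where ab: "q = tr a b" "a < N" "b < N" "a \<noteq> b" by (auto simp: TR_def)
    have less: "tr a b \<in> psi ` T" if "a < b" "b < N" for a b
    proof (cases "md = 1 \<and> b = sg a")
      case True
      have B: "N = 2 * n" "Suc b0 = n" "\<And>x. x < N \<Longrightarrow> sg x = N - 1 - x" using mode True by auto
      have "sg a = N - 1 - a" using B(3)[of a] that by simp
      then have "a \<le> b0" using that True B by linarith
      then have "b0 - a < n" "b0 - (b0 - a) = a" using B by auto
      then show ?thesis using psi_T_antipodal[of "b0 - a"] True by simp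
    next
      case False
      moreover have "md = 0 \<or> md = 1" using mode by auto
      ultimately show ?thesis using psi_T_tr_less[OF that] by blast
    qed
    show "q \<in> psi ` T"
    proof (cases "a < b")
      case True
      then show ?thesis using less ab by simp
    next
      case False
      then show ?thesis using less[of b a] ab tr_sym(1)[OF ab(2,3)] by simp
    qed
  qed
qed

end

section \<open>The complexified geometric representation as functions on the points\<close>

lemma map_matrix_mult_vec:
  fixes A B :: "real^'n::finite^'n"
  shows "map_matrix complex_of_real (A ** B) *v z
    = map_matrix complex_of_real A *v (map_matrix complex_of_real B *v z)"
proof -
  have "map_matrix complex_of_real (A ** B) = map_matrix complex_of_real A ** map_matrix complex_of_real B"
    by (simp add: vec_eq_iff map_matrix_def matrix_matrix_mult_def)
  then show ?thesis by (simp add: matrix_vector_mul_assoc)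
qed

lemma map_matrix_simple_refl:
  "(map_matrix complex_of_real (simple_refl_matrix m i) *v z) $ k
    = z $ k + (if k = i then \<Sum>l\<in>UNIV. complex_of_real (2 * cos (pi / real (m i l))) * z $ l else 0)"
proof -
  have "(map_matrix complex_of_real (simple_refl_matrix m i) *v z) $ k
    = (\<Sum>l\<in>UNIV. (if k = l then z $ l else 0)
        + (if k = i then complex_of_real (2 * cos (pi / real (m i l))) * z $ l else 0))"
    unfolding matrix_vector_mult_def simple_refl_matrix_def map_matrix_def vec_lambda_beta
    by (rule sum.cong[OF HOL.refl]) (simp add: algebra_simps)
  also have "\<dots> = z $ k + (if k = i then \<Sum>l\<in>UNIV. complex_of_real (2 * cos (pi / real (m i l))) * z $ l else 0)"
    by (simp add: sum.distrib)
  finally show ?thesis .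
qed

lemma map_matrix_one:
  fixes z :: "complex^'n::finite"
  shows "map_matrix complex_of_real (mat 1) *v z = z"
proof -
  have "map_matrix complex_of_real (mat 1 :: real^'n^'n) = mat 1"
    by (simp add: vec_eq_iff map_matrix_def mat_def)
  then show ?thesis by (simp only: matrix_vector_mul_lid)
qed

context linear_coxeter
begin

lemma n_pos: "n > 0"
  by (simp add: n_card)

lemma complex_action_mult:
  assumes "x \<in> carrier W" "y \<in> carrier W"
  shows "complex_action W s m (x \<otimes> y) z = complex_action W s m x (complex_action W s m y z)"
  unfolding complex_action_def geom_rep_mult[OF sys m_pos assms] by (rule map_matrix_mult_vec)

lemma complex_action_s:
  "complex_action W s m (s i) z $ q
    = z $ q + (if q = i then \<Sum>l\<in>UNIV. complex_of_real (2 * cos (pi / real (m i l))) * z $ l else 0)"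
proof -
  have "geom_rep W s m (s i) = simple_refl_matrix m i"
    using geom_rep_word[OF sys m_pos, of "[i]"] by (simp add: mword_def)
  then show ?thesis unfolding complex_action_def by (simp only: map_matrix_simple_refl)
qed

lemma complex_action_one: "complex_action W s m \<one> z = z"
proof -
  have "geom_rep W s m \<one> = mat 1"
    using geom_rep_word[OF sys m_pos, of "[]"] by (simp add: mword_def)
  then show ?thesis unfolding complex_action_def by (simp only: map_matrix_one)
qed

end

context lin_perm
begin

definition twisted :: bool where "twisted \<longleftrightarrow> md = 1"

lemma twisted_mode: "twisted \<Longrightarrow> n \<ge> 2" "twisted \<Longrightarrow> N = 2 * n" "twisted \<Longrightarrow> Suc b0 = n"
  "twisted \<Longrightarrow> x < N \<Longrightarrow> sg x = N - 1 - x"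
  unfolding twisted_def using mode by auto

lemma untwisted_sg: "\<not> twisted \<Longrightarrow> sg x = x"
  unfolding twisted_def by (rule sg_even) (use mode in auto)

definition ee :: "nat \<Rightarrow> nat \<Rightarrow> real" where
  "ee a x = (if x = a then 1 else 0) - (if twisted \<and> x = sg a then 1 else 0)"

text \<open>The simple roots as functions on the points; in type \<open>B\<close> the first one is half as
  long in the square as the functions \<open>ee a - ee b\<close>.\<close>

definition root :: "nat \<Rightarrow> nat \<Rightarrow> real" where
  "root j x = (if twisted \<and> j = 0 then 1 / sqrt 2 else 1) * (ee (b0 + j) x - ee (b0 + Suc j) x)"

text \<open>Maps the geometric representation, whose basis vectors are the simple roots, into the
  functions on the points.\<close>

definition coord :: "complex^'n \<Rightarrow> nat \<Rightarrow> complex" where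
  "coord z x = (\<Sum>i\<in>UNIV. complex_of_real (root (f i) x) * z $ i)"

lemma ee_p:
  assumes "j < n"
  shows "ee a (p j x) = ee (p j a) x"
proof -
  have 1: "p j x = a \<longleftrightarrow> x = p j a" for x a using p_invol[OF assms] by metis
  have "p j x = sg a \<longleftrightarrow> x = sg (p j a)" unfolding 1 G_comm[OF p_G[OF assms]] ..
  then show ?thesis unfolding ee_def 1 by simp
qed

lemma ee_sg: "twisted \<Longrightarrow> ee (sg a) x = - ee a x"
  by (simp add: ee_def)

lemma ee_sg_arg: "twisted \<Longrightarrow> ee a (sg x) = - ee a x"
proof -
  assume md: "twisted"
  have "sg x = a \<longleftrightarrow> x = sg a" "sg x = sg a \<longleftrightarrow> x = a" by (metis sg_sg)+
  then show ?thesis using md by (simp add: ee_def)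
qed

lemma sg_near: "twisted \<Longrightarrow> sg b0 = b0 + 1" "twisted \<Longrightarrow> sg (b0 + 1) = b0"
  "twisted \<Longrightarrow> sg (b0 - 1) = b0 + 2" "twisted \<Longrightarrow> sg (b0 + 2) = b0 - 1"
proof -
  assume "twisted"
  note B = twisted_mode[OF this]
  then show "sg b0 = b0 + 1" "sg (b0 + 1) = b0" "sg (b0 - 1) = b0 + 2" "sg (b0 + 2) = b0 - 1" by simp_all
qed

text \<open>The factor \<open>1 / sqrt 2\<close> in the first root of type B makes the coefficients
  between the first two roots equal in both directions, with the value
  \<open>sqrt 2 = 2 * cos (pi / 4)\<close> required by the geometric representation.\<close>

lemma root_p_formula:
  assumes "i < n" "l < n"
  shows "root l (p i x) = root l x + (if l = i then - 2 else if l = Suc i then 2 * edge i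
    else if i = Suc l then 2 * edge l else 0) * root i x"
proof -
  have md: "twisted \<and> k = 4 \<or> \<not> twisted \<and> k = 3" unfolding twisted_def using mode by auto
  have e: "2 * edge j = (if twisted \<and> j = 0 then sqrt 2 else 1)" for j
    using md by (auto simp: edge_def cos_45 cos_60)
  have q: "p i (b0 + l) = (if l = i then b0 + Suc i else if l = Suc i then b0 + i
      else if twisted \<and> l = 0 \<and> i = 1 then b0 - 1 else b0 + l)"
    "p i (b0 + Suc l) = (if l = i then b0 + i else if i = Suc l then b0 + Suc i else b0 + Suc l)"
    using assms by (subst p_at[folded twisted_def]; auto)+
  have r: "root l (p i x) = (if twisted \<and> l = 0 then 1 / sqrt 2 else 1) * (ee (p i (b0 + l)) x - ee (p i (b0 + Suc l)) x)"
    unfolding root_def ee_p[OF assms(1)] ..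
  have s2: "1 / sqrt 2 * sqrt 2 = 1" "sqrt 2 * (1 / sqrt 2) = 1" "1 / sqrt 2 * 2 = sqrt 2"
    by (simp_all add: field_simps)
  consider "l = i" | "l = Suc i" | "i = Suc l" "\<not> (twisted \<and> l = 0)" | "i = Suc l" "twisted" "l = 0"
    | "l \<noteq> i" "l \<noteq> Suc i" "i \<noteq> Suc l" by blast
  then show ?thesis
  proof cases
    case 1
    then show ?thesis unfolding r q by (simp add: root_def algebra_simps)
  next
    case 2
    have "ee (b0 + i) x - ee (b0 + Suc l) x = (ee (b0 + l) x - ee (b0 + Suc l) x) + (ee (b0 + i) x - ee (b0 + Suc i) x)"
      using 2 by simp
    then show ?thesis unfolding r q using 2 s2(2) by (simp add: root_def e)
  next
    case 3
    have "ee (b0 + l) x - ee (b0 + Suc i) x = (ee (b0 + l) x - ee (b0 + Suc l) x) + (ee (b0 + i) x - ee (b0 + Suc i) x)"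
      using 3 by simp
    moreover have "p i (b0 + l) = b0 + l" "p i (b0 + Suc l) = b0 + Suc i" using 3 q by auto
    moreover have "2 * edge l = 1" "(if twisted \<and> l = 0 then 1 / sqrt 2 else 1) = (1::real)"
      "(if twisted \<and> i = 0 then 1 / sqrt 2 else 1) = (1::real)" using 3 e[of l] by auto
    moreover from calculation have "root l (p i x) = ee (b0 + l) x - ee (b0 + Suc i) x"
      by (simp only: r mult_1)
    ultimately have "root l (p i x) = ee (b0 + l) x - ee (b0 + Suc i) x"
      "root l x = ee (b0 + l) x - ee (b0 + Suc l) x" "root i x = ee (b0 + Suc l) x - ee (b0 + Suc i) x"
      "2 * edge l = 1"
      by (simp only:, simp_all only: root_def mult_1)
    then show ?thesis using 3(1) by simp
  next
    case 4
    have 1: "ee (b0 - 1) x = - ee (b0 + 2) x" "ee b0 x = - ee (b0 + 1) x"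
      using ee_sg[OF 4(2), of "b0 + 2" x] ee_sg[OF 4(2), of "b0 + 1" x] sg_near[OF 4(2)] by simp_all
    have "p i (b0 + l) = b0 - 1" "p i (b0 + Suc l) = b0 + 2" using 4 q by auto
    then have r2: "root l (p i x) = 1 / sqrt 2 * (- 2 * ee (b0 + 2) x)" unfolding r using 4 1 by simp
    have rl: "root l x = 1 / sqrt 2 * (- 2 * ee (b0 + 1) x)" unfolding root_def using 4 1 by simp
    have ri: "root i x = ee (b0 + 1) x - ee (b0 + 2) x" unfolding root_def using 4(1,3) by simp
    have "2 * edge l = sqrt 2" using e[of l] 4 by simp
    moreover have "1 / sqrt 2 * (- 2 * ee (b0 + 2) x) = 1 / sqrt 2 * (- 2 * ee (b0 + 1) x) + 1 / sqrt 2 * 2 * (ee (b0 + 1) x - ee (b0 + 2) x)"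
      by (simp add: algebra_simps)
    ultimately show ?thesis unfolding r2 rl ri unfolding s2(3) using 4(1) by simp
  next
    case 5
    then show ?thesis unfolding r q by (simp add: root_def)
  qed
qed

lemma root_p: "root (f l) (p (f i) x) = root (f l) x + 2 * cos (pi / real (m i l)) * root (f i) x"
proof (cases "i = l")
  case True
  then show ?thesis using root_p_formula[OF f_lt f_lt, of i l x] by (simp add: m_eq)
next
  case False
  then have "f l \<noteq> f i" using idx_f by metis
  then have "(if f l = f i then - 2 else if f l = Suc (f i) then 2 * edge (f i)
    else if f i = Suc (f l) then 2 * edge (f l) else 0) = 2 * cos (pi / real (m i l))"
    unfolding cos_m[OF False] by auto
  then show ?thesis using root_p_formula[OF f_lt[of i] f_lt[of l], of x] by (simp only:)
qed

lemma coord_s: "coord (complex_action W s m (s i) z) (p (f i) x) = coord z x"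
proof -
  let ?b = "\<Sum>l\<in>UNIV. complex_of_real (2 * cos (pi / real (m i l))) * z $ l"
  have m1: "m i i = 1" by (simp add: m_eq)
  have act: "coord (complex_action W s m (s i) z) y = coord z y + complex_of_real (root (f i) y) * ?b" for y
  proof -
    have "coord (complex_action W s m (s i) z) y
      = (\<Sum>l\<in>UNIV. complex_of_real (root (f l) y) * z $ l + (if l = i then complex_of_real (root (f i) y) * ?b else 0))"
      unfolding coord_def complex_action_s by (rule sum.cong[OF HOL.refl]) (simp add: distrib_left)
    then show ?thesis by (simp add: sum.distrib coord_def)
  qed
  have arg: "coord z (p (f i) y) = coord z y + complex_of_real (root (f i) y) * ?b" for y
  proof -
    have "coord z (p (f i) y) = (\<Sum>l\<in>UNIV. complex_of_real (root (f l) y) * z $ l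
        + complex_of_real (root (f i) y) * (complex_of_real (2 * cos (pi / real (m i l))) * z $ l))"
      unfolding coord_def root_p by (rule sum.cong[OF HOL.refl]) (simp add: algebra_simps)
    then show ?thesis by (simp only: sum.distrib coord_def sum_distrib_left)
  qed
  show ?thesis using act[of "p (f i) x"] arg[of "p (f i) x"] p_invol[OF f_lt, of i x] by simp
qed

lemma coord_action:
  assumes "w \<in> carrier W"
  shows "coord (complex_action W s m w z) (psi w x) = coord z x"
proof -
  obtain u where u: "lm (map s u) = w" by (rule ex_word[OF assms])
  have "coord (complex_action W s m (lm (map s u)) z) (psi (lm (map s u)) x) = coord z x"
  proof (induction u)
    case Nil
    then show ?case by (simp add: complex_action_one psi_one)
  next
    case (Cons i u)
    then show ?case by (simp add: complex_action_mult psi_mult psi_s coord_s)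
  qed
  then show ?thesis using u by simp
qed

text \<open>Elimination from the far end: at the point \<open>b0 + Suc j\<close> the root with index
  \<open>j\<close> is nonzero and all roots with smaller index vanish.\<close>

lemma coord_inj:
  assumes "\<And>x. x < N \<Longrightarrow> coord z x = 0"
  shows "z = 0"
proof -
  have "z $ idx j = 0" if "j < n" for j
    using that
  proof (induction "n - j" arbitrary: j rule: less_induct)
    case less
    have j: "j < n" by (rule less.prems)
    let ?x = "b0 + Suc j"
    have x: "?x < N" using b0_lt[of "Suc j"] j by simp
    have low: "root l ?x = 0" if "l < j" for l
    proof -
      have "?x \<noteq> sg (b0 + l)" "?x \<noteq> sg (b0 + Suc l)" if "twisted"
        using twisted_mode[OF that] \<open>l < j\<close> j b0_lt[of l] b0_lt[of "Suc l"] by simp_all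
      then show ?thesis using \<open>l < j\<close> by (auto simp: root_def ee_def)
    qed
    have self: "root j ?x \<noteq> 0"
    proof (cases "twisted")
      case True
      have "?x \<noteq> sg (b0 + Suc j)" "?x = sg (b0 + j) \<longleftrightarrow> j = 0"
        using twisted_mode[OF True] j b0_lt[of j] b0_lt[of "Suc j"] by auto
      then show ?thesis by (auto simp: root_def ee_def)
    next
      case False
      then show ?thesis by (simp add: root_def ee_def)
    qed
    have zero: "complex_of_real (root (f i) ?x) * z $ i = 0" if "i \<noteq> idx j" for i
    proof -
      have "f i \<noteq> j" using that idx_f by metis
      then consider "f i < j" | "f i > j" by linarith
      then show ?thesis
      proof cases
        case 1
        then show ?thesis using low by simp
      next
        case 2
        then have "z $ idx (f i) = 0" using less.hyps[of "f i"] f_lt[of i] by simp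
        then show ?thesis by (simp add: idx_f)
      qed
    qed
    have "coord z ?x = complex_of_real (root (f (idx j)) ?x) * z $ idx j
      + (\<Sum>i\<in>UNIV - {idx j}. complex_of_real (root (f i) ?x) * z $ i)"
      unfolding coord_def by (rule sum.remove) simp_all
    also have "(\<Sum>i\<in>UNIV - {idx j}. complex_of_real (root (f i) ?x) * z $ i) = 0"
      by (rule sum.neutral) (use zero in blast)
    finally show ?case using assms[OF x] self by (simp add: f_idx[OF j])
  qed
  then have "z $ i = 0" for i using f_lt[of i] idx_f[of i] by metis
  then show ?thesis by (simp add: vec_eq_iff)
qed

lemma coord_diff: "coord (z - z') x = coord z x - coord z' x"
  by (simp add: coord_def algebra_simps sum_subtractf)

lemma coord_sg: "twisted \<Longrightarrow> coord z (sg x) = - coord z x"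
  by (simp add: coord_def root_def ee_sg_arg sum_negf[symmetric] algebra_simps)

text \<open>Equal values at \<open>a\<close> and \<open>b\<close> make the function of
  \<open>z\<close> invariant under \<open>tr a b\<close>, so the corresponding reflection fixes
  \<open>z\<close>.\<close>

lemma regular_coord_inj:
  assumes reg: "\<And>t. t \<in> T \<Longrightarrow> complex_action W s m t z \<noteq> z"
    and ab: "a < N" "b < N" "a \<noteq> b"
  shows "coord z a \<noteq> coord z b"
proof
  assume eq: "coord z a = coord z b"
  have "tr a b \<in> psi ` T" unfolding psi_T TR_def using ab by blast
  then obtain t where t: "t \<in> T" "psi t = tr a b" by force
  have "coord z (sg a) = coord z (sg b)"
    using eq coord_sg[of z a] coord_sg[of z b] untwisted_sg by (cases twisted) auto
  then have inv: "coord z (tr a b x) = coord z x" for x using eq by (simp add: tr_def)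
  have "coord (complex_action W s m t z) x = coord z x" for x
    using coord_action[OF T_closed[OF t(1)], of z "tr a b x"] inv[of x] tr_invol[OF ab(1,2), of x] t(2) by simp
  then have "complex_action W s m t z - z = 0" by (intro coord_inj) (simp add: coord_diff)
  then show False using reg[OF t(1)] by simp
qed

lemma psi_pow: "w \<in> carrier W \<Longrightarrow> psi (w [^] (j::nat)) = psi w ^^ j"
  by (induction j) (simp_all add: psi_one psi_mult funpow_Suc_right del: funpow.simps(2))

text \<open>Along an orbit of \<open>c\<close> the coordinate of an eigenvector changes by powers of
  the eigenvalue. A return of \<open>c^k\<close> at a point with nonzero coordinate forces the power
  to be 1; then \<open>c^k\<close> preserves every coordinate, and as these are pairwise different
  it fixes every point.\<close>

lemma regular_fix:
  assumes reg: "regular_element W s m c" and x: "x < N"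
  obtains x0 where "x0 < N" "\<And>k. (psi c ^^ k) x0 = x0 \<Longrightarrow> c [^] k = \<one>"
proof -
  have c: "c \<in> carrier W" using reg by (simp add: regular_element_def)
  obtain \<zeta> z where z: "complex_action W s m c z = \<zeta> *s z" "\<And>t. t \<in> T \<Longrightarrow> complex_action W s m t z \<noteq> z"
    using reg unfolding regular_element_def by blast
  have N: "0 < N" "1 < N" using mode n_pos by auto
  \<comment> \<open>At least one of two different coordinates is nonzero.\<close>
  have "coord z 0 \<noteq> coord z 1" by (rule regular_coord_inj) (use z(2) N in auto)
  then obtain x0 where x0: "x0 < N" "coord z x0 \<noteq> 0" using N by metis
  have step: "\<zeta> * coord z (psi c x) = coord z x" for x
    using coord_action[OF c, of z x] unfolding z(1) by (simp add: coord_def sum_distrib_left algebra_simps)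
  have pow: "\<zeta> ^ k * coord z ((psi c ^^ k) x) = coord z x" for k and x :: nat
  proof (induction k arbitrary: x)
    case (Suc k)
    have "\<zeta> ^ Suc k * coord z ((psi c ^^ Suc k) x) = \<zeta> ^ k * (\<zeta> * coord z (psi c ((psi c ^^ k) x)))" by simp
    then show ?case using Suc step by simp
  qed simp
  show thesis
  proof (rule that[OF x0(1)])
    fix k assume fx: "(psi c ^^ k) x0 = x0"
    then have "\<zeta> ^ k = 1" using pow[of k x0] x0(2) by simp
    then have same: "coord z ((psi c ^^ k) x) = coord z x" for x using pow[of k x] by simp
    have "psi (c [^] k) x = x" for x
    proof (cases "x < N")
      case True
      then have "(psi c ^^ k) x < N" using G_lt[OF psi_G[of "c [^] k"]] c by (simp add: psi_pow)
      then show ?thesis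
        using regular_coord_inj[OF z(2), of "(psi c ^^ k) x" x] same[of x] True by (auto simp: psi_pow c)
    next
      case False
      then show ?thesis using permutes_not_in[OF G_perm[OF psi_G[of "c [^] k"]]] c by simp
    qed
    then have "psi (c [^] k) = psi \<one>" by (simp add: psi_one fun_eq_iff)
    then show "c [^] k = \<one>" using inj_onD[OF psi_inj] c by simp
  qed
qed

text \<open>The eigenvector is a sine along the path in type A and a cosine in type B, where the
  first entry \<open>sqrt 2 / 2\<close> compensates the heavier first edge. The angle
  \<open>pi / N\<close> makes the wave vanish one step beyond the last vertex.\<close>

lemma coxeter_number_ge_N:
  assumes "finite (carrier W)" "is_coxeter_number W s m h"
  shows "h \<ge> N"
  using mode
proof
  assume A: "k = 3 \<and> md = 0 \<and> N = Suc n \<and> b0 = 0"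
  define \<theta> where "\<theta> = pi / real N"
  have e: "edge j = 1 / 2" for j using A unfolding edge_def using A by (simp add: cos_60)
  have full: "sin (real N * \<theta>) = 0" using N_pos by (simp add: \<theta>_def)
  show ?thesis
  proof (rule coxeter_number_ge_eigen[OF assms, where a = "\<lambda>j. sin (real (Suc j) * \<theta>)"])
    show "N \<ge> 2" using A n_pos by simp
    have "0 < \<theta>" "\<theta> < pi" using A n_pos by (simp_all add: \<theta>_def field_simps)
    then show "sin (real (Suc 0) * \<theta>) \<noteq> 0" using sin_gt_zero[of \<theta>] by simp
    fix j assume j: "j < n"
    have 1: "(if Suc j < n then edge j * sin (real (Suc (Suc j)) * \<theta>) else 0) = 1/2 * sin (real (Suc (Suc j)) * \<theta>)"
    proof (cases "Suc j < n")
      case False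
      then have "Suc (Suc j) = N" using j A by simp
      then show ?thesis using full False by simp
    qed (simp add: e)
    have 2: "(if j > 0 then edge (j - 1) * sin (real (Suc (j - 1)) * \<theta>) else 0) = 1/2 * sin (real j * \<theta>)"
      by (simp add: e)
    have "real (Suc (Suc j)) * \<theta> = real (Suc j) * \<theta> + \<theta>" "real j * \<theta> = real (Suc j) * \<theta> - \<theta>"
      by (simp_all add: algebra_simps)
    then show "(if Suc j < n then edge j * sin (real (Suc (Suc j)) * \<theta>) else 0)
      + (if j > 0 then edge (j - 1) * sin (real (Suc (j - 1)) * \<theta>) else 0) = cos (pi / real N) * sin (real (Suc j) * \<theta>)"
      unfolding 1 2 \<theta>_def[symmetric] by (simp only: sin_add sin_diff) (simp add: algebra_simps)
  qed
next
  assume B: "k = 4 \<and> md = 1 \<and> n \<ge> 2 \<and> N = 2 * n \<and> Suc b0 = n \<and> (\<forall>x<N. sg x = N - 1 - x)"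
  define \<theta> where "\<theta> = pi / real N"
  define a where "a j = (if j = 0 then sqrt 2 / 2 else cos (real j * \<theta>))" for j :: nat
  have e: "edge j = (if j = 0 then sqrt 2 / 2 else 1 / 2)" for j unfolding edge_def using B by (auto simp: cos_45 cos_60)
  have "real n * \<theta> = pi / 2" using B by (simp add: \<theta>_def)
  then have full: "cos (real n * \<theta>) = 0" by (simp only: cos_pi_half)
  show ?thesis
  proof (rule coxeter_number_ge_eigen[OF assms, where a = a])
    show "N \<ge> 2" using B by simp
    show "a 0 \<noteq> 0" by (simp add: a_def)
    fix j assume j: "j < n"
    have 1: "(if Suc j < n then edge j * a (Suc j) else 0) = edge j * cos (real (Suc j) * \<theta>)"
    proof (cases "Suc j < n")
      case False
      then have "Suc j = n" using j by simp
      then show ?thesis using full by simp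
    qed (simp add: a_def)
    have 2: "(if j > 0 then edge (j - 1) * a (j - 1) else 0) = (if j > 0 then 1/2 * cos (real (j - 1) * \<theta>) else 0)"
      by (cases "j = 1") (simp_all add: e a_def)
    consider "j = 0" | i where "j = Suc i" by (cases j) auto
    then have "edge j * cos (real (Suc j) * \<theta>) + (if j > 0 then 1/2 * cos (real (j - 1) * \<theta>) else 0) = cos \<theta> * a j"
    proof cases
      case 1
      then show ?thesis by (simp add: e a_def)
    next
      case 2
      have "real (Suc j) * \<theta> = real j * \<theta> + \<theta>" "real (j - 1) * \<theta> = real j * \<theta> - \<theta>"
        using 2 by (simp_all add: algebra_simps)
      then show ?thesis using 2 by (simp only: cos_add cos_diff) (simp add: e a_def algebra_simps)
    qed
    then show "(if Suc j < n then edge j * a (Suc j) else 0) + (if j > 0 then edge (j - 1) * a (j - 1) else 0)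
      = cos (pi / real N) * a j"
      unfolding 1 2 \<theta>_def[symmetric] .
  qed
qed

end

context lin_perm
begin

text \<open>Since no smaller power of \<open>c\<close> returns to \<open>x0\<close>, its orbit has
  \<open>h\<close> points, which gives \<open>h \<le> N\<close>. Numbering the points along this
  orbit turns \<open>c\<close> into the rotation, and the reflections and \<open>sg\<close> are
  transported by the same numbering.\<close>

theorem Pop_conclusion_linear:
  assumes fin: "finite (carrier W)" and h: "is_coxeter_number W s m h" and c: "coxeter_element W s m h c"
  shows "(\<forall>w\<in>carrier W. (Pop W s c ^^ (h - 1)) w = \<one>)
    \<and> Max {card (forward_orbit (Pop W s c) w) | w. w \<in> carrier W} = h
    \<and> {forward_orbit (Pop W s c) w | w. w \<in> carrier W \<and> card (forward_orbit (Pop W s c) w) = h}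
        = {forward_orbit (Pop W s c) (inv c)}"
proof -
  have reg: "regular_element W s m c" and ord: "ord c = h" using c by (simp_all add: coxeter_element_def)
  have cW: "c \<in> carrier W" using reg by (simp add: regular_element_def)
  define C where "C = psi c"
  have CG: "C \<in> G" unfolding C_def by (rule psi_G[OF cW])
  have Cpow: "C ^^ j = psi (c [^] j)" for j :: nat unfolding C_def by (rule psi_pow[OF cW, symmetric])
  have CpG: "C ^^ j \<in> G" for j unfolding Cpow using cW by (intro psi_G) simp
  have hN: "h \<ge> N" by (rule coxeter_number_ge_N[OF fin h])
  obtain x0 where x0: "x0 < N" and fx: "\<And>j. (C ^^ j) x0 = x0 \<Longrightarrow> c [^] j = \<one>"
    using regular_fix[OF reg N_pos] unfolding C_def by blast
  have Cinj: "(C ^^ j) x = (C ^^ j) y \<longleftrightarrow> x = y" for j x y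
    using inj_eq[OF permutes_inj[OF G_perm[OF CpG[of j]]]] .
  have no_fix: "(C ^^ j) x0 \<noteq> x0" if "0 < j" "j < h" for j
  proof
    assume "(C ^^ j) x0 = x0"
    then have "c [^] j = \<one>" by (rule fx)
    then have "h dvd j" using pow_eq_id[OF cW, of j] ord by simp
    then show False using that by (auto dest: dvd_imp_le)
  qed
  have inj: "inj_on (\<lambda>j. (C ^^ j) x0) {..<h}"
  proof -
    have "(C ^^ i) x0 \<noteq> (C ^^ j) x0" if "i < j" "j < h" for i j
    proof
      assume "(C ^^ i) x0 = (C ^^ j) x0"
      also have "(C ^^ j) x0 = (C ^^ i) ((C ^^ (j - i)) x0)"
        using that by (simp add: funpow_add[symmetric, THEN fun_cong, unfolded comp_apply])
      finally have "x0 = (C ^^ (j - i)) x0" unfolding Cinj .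
      moreover have "(C ^^ (j - i)) x0 \<noteq> x0" by (rule no_fix) (use that in auto)
      ultimately show False by simp
    qed
    then show ?thesis unfolding inj_on_def by (metis lessThan_iff linorder_neqE_nat)
  qed
  have sub: "(\<lambda>j. (C ^^ j) x0) ` {..<h} \<subseteq> {..<N}" using G_lt[OF CpG] x0 by auto
  then have "h \<le> N" using card_inj_on_le[OF inj sub] by simp
  then have hN: "h = N" using hN by simp
  \<comment> \<open>The numbering: position \<open>x\<close> on the circle is the point reached from
    \<open>x0\<close> after \<open>x\<close> steps of \<open>c\<close>.\<close>
  define e where "e x = (if x < N then (C ^^ x) x0 else x)" for x
  have ep: "e permutes {..<N}"
  proof (rule bij_imp_permutes)
    have "inj_on e {..<N}" using inj unfolding hN inj_on_def e_def by simp
    moreover have "e ` {..<N} \<subseteq> {..<N}" using sub unfolding hN e_def by auto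
    ultimately show "bij_betw e {..<N} {..<N}"
      unfolding bij_betw_def using endo_inj_surj[of "{..<N}" e] by simp
  qed (simp add: e_def)
  note ei = permutes_inverses[OF ep]
  have Cfull: "C ^^ N = id"
    unfolding Cpow hN[symmetric] ord[symmetric] using pow_ord_eq_1[OF cW] psi_one by simp
  have Ce: "C (e x) = e (shift N x)" for x
  proof (cases "x < N")
    case True
    then show ?thesis
    proof (cases "Suc x = N")
      case S: True
      have "C ((C ^^ x) x0) = (C ^^ Suc x) x0" by simp
      also have "\<dots> = x0" unfolding S Cfull by simp
      finally show ?thesis using True N_pos shift_cases[OF True] S by (simp add: e_def)
    next
      case False
      then show ?thesis using True shift_cases[OF True] by (simp add: e_def)
    qed
  next
    case False
    then show ?thesis using permutes_not_in[OF G_perm[OF CG]] by (simp add: e_def shift_simps)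
  qed
  define sg' where "sg' = pinv e \<circ> sg \<circ> e"
  define rho where "rho w = pinv e \<circ> psi w \<circ> e" for w
  have lt: "e x < N \<longleftrightarrow> x < N" "pinv e x < N \<longleftrightarrow> x < N" for x
    using permutes_in_image[OF ep, of x] permutes_in_image[OF permutes_inv[OF ep], of x] by simp_all
  have einj: "e x = e y \<longleftrightarrow> x = y" "pinv e x = pinv e y \<longleftrightarrow> x = y" for x y
    using inj_eq[OF permutes_inj[OF ep]] inj_eq[OF permutes_inj[OF permutes_inv[OF ep]]] by simp_all
  have pe: "pinv e x = y \<longleftrightarrow> x = e y" for x y using ei by metis
  have sym': "sym_perms N sg' md"
  proof
    show "N > 0" by (rule N_pos)
    show "sg' permutes {..<N}" unfolding sg'_def
      by (rule permutes_compose[OF ep permutes_compose[OF sg_perm permutes_inv[OF ep]], folded comp_assoc])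
    show "sg' (sg' x) = x" for x by (simp add: sg'_def ei)
    show "sg' x = x" if "\<not> 0 < md" for x using that by (simp add: sg'_def ei sg_even)
    show "sg' x \<noteq> x" if "0 < md" "x < N" for x
      using sg_odd[OF that(1), of "e x"] that(2) lt by (simp add: sg'_def pe)
  qed
  interpret Q: sym_perms N sg' md by (rule sym')
  have tr': "pinv e \<circ> tr a b \<circ> e = Q.tr (pinv e a) (pinv e b)" for a b
  proof
    fix x
    have e: "e x = a \<longleftrightarrow> x = pinv e a" for a using ei by metis
    have "sg' (pinv e y) = pinv e (sg y)" for y by (simp add: sg'_def ei)
    then show "(pinv e \<circ> tr a b \<circ> e) x = Q.tr (pinv e a) (pinv e b) x"
      unfolding tr_def Q.tr_def comp_apply by (simp add: e ei(2))
  qed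
  have rho_mult: "rho (x \<otimes> y) = rho x \<circ> rho y" if "x \<in> carrier W" "y \<in> carrier W" for x y
    using psi_mult[OF that] by (simp add: rho_def fun_eq_iff ei)
  have shift_rho: "rho c = shift N"
    using Ce by (simp add: rho_def fun_eq_iff C_def[symmetric] ei)
  have rho_G: "rho x \<in> Q.G" if "x \<in> carrier W" for x
  proof -
    have "rho x permutes {..<N}" unfolding rho_def
      by (rule permutes_compose[OF ep permutes_compose[OF G_perm[OF psi_G[OF that]] permutes_inv[OF ep]], folded comp_assoc])
    moreover have "rho x (sg' y) = sg' (rho x y)" for y
      using G_comm[OF psi_G[OF that]] by (simp add: rho_def sg'_def ei)
    ultimately show ?thesis by (simp add: Q.G_def)
  qed
  have "cyclic_perms N sg' md"
  proof (intro cyclic_perms.intro sym' cyclic_perms_axioms.intro)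
    show "N \<ge> 2" using mode n_pos by auto
    assume o: "0 < md"
    \<comment> \<open>A map commuting with the rotation is determined by its value at 0 and is
      itself a rotation, here by \<open>r\<close>. As an involution without fixed points it is the
      half turn.\<close>
    define r where "r = sg' 0"
    have r: "r < N" "r \<noteq> 0" using Q.sg_lt[of 0] Q.sg_odd[OF o N_pos] N_pos by (simp_all add: r_def)
    have comm: "(shift N ^^ j) (sg' y) = sg' ((shift N ^^ j) y)" for j y
    proof (induction j)
      case (Suc j)
      then show ?case using Q.G_comm[OF rho_G[OF cW]] unfolding shift_rho by simp
    qed simp
    have sg_shift: "sg' x = (r + x) mod N" if "x < N" for x
    proof -
      have "sg' x = sg' ((shift N ^^ x) 0)" using that N_pos by (simp add: shift_funpow)
      also have "\<dots> = (shift N ^^ x) r" using comm[of x 0] by (simp add: r_def)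
      finally show ?thesis using r(1) by (simp add: shift_funpow)
    qed
    have "(r + r) mod N = 0" using sg_shift[OF r(1)] Q.sg_sg[of 0] by (simp add: r_def)
    then have N2: "N = 2 * r" using r by (auto simp: mod_if split: if_splits)
    have "sg' x = (shift N ^^ (N div 2)) x" for x
    proof (cases "x < N")
      case True
      then show ?thesis using sg_shift[OF True] N2 by (simp add: shift_funpow add.commute)
    next
      case False
      then have "(shift N ^^ j) x = x" for j by (induction j) (simp_all add: shift_simps)
      then show ?thesis using False permutes_not_in[OF Q.sg_perm, of x] by simp
    qed
    then show "even N \<and> sg' = shift N ^^ (N div 2)" using N2 by auto
  qed
  then interpret perm_model W s N sg' md rho c
  proof (intro perm_model.intro perm_model_axioms.intro rho_mult rho_G cW shift_rho)
    show "refl_group W s" by unfold_locales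
    show "inj_on rho (carrier W)"
    proof (rule inj_onI)
      fix x y assume xy: "x \<in> carrier W" "y \<in> carrier W" "rho x = rho y"
      have "psi x = psi y"
      proof
        fix z
        have "rho x (pinv e z) = rho y (pinv e z)" using xy(3) by simp
        then show "psi x z = psi y z" by (simp add: rho_def ei einj)
      qed
      then show "x = y" using inj_onD[OF psi_inj] xy by blast
    qed
    have "rho ` T = (\<lambda>q. pinv e \<circ> q \<circ> e) ` psi ` T" by (auto simp: rho_def image_image)
    also have "\<dots> = {Q.tr (pinv e a) (pinv e b) | a b. a < N \<and> b < N \<and> a \<noteq> b}"
      unfolding psi_T TR_def image_Collect tr'[symmetric] by blast
    also have "\<dots> = Q.TR"
    proof (intro equalityI subsetI)
      fix q assume "q \<in> Q.TR"
      then obtain a b where ab: "q = Q.tr a b" "a < N" "b < N" "a \<noteq> b" by (auto simp: Q.TR_def)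
      then show "q \<in> {Q.tr (pinv e a) (pinv e b) | a b. a < N \<and> b < N \<and> a \<noteq> b}"
        by (intro CollectI exI[of _ "e a"] exI[of _ "e b"]) (simp add: ei lt einj)
    next
      fix q assume "q \<in> {Q.tr (pinv e a) (pinv e b) | a b. a < N \<and> b < N \<and> a \<noteq> b}"
      then obtain a b where ab: "q = Q.tr (pinv e a) (pinv e b)" "a < N" "b < N" "a \<noteq> b" by blast
      then show "q \<in> Q.TR" unfolding Q.TR_def
        by (intro CollectI exI[of _ "pinv e a"] exI[of _ "pinv e b"]) (simp add: lt einj)
    qed
    finally show "rho ` T = Q.TR" .
  qed
  show ?thesis unfolding hN by (rule Pop_conclusion[OF fin])
qed

end

section \<open>Parity and dihedral groups\<close>

text \<open>All relators have even length, so the parity of words descends to the group.\<close>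

lemma coxeter_parity:
  assumes W: "coxeter_system W s m"
  obtains par :: "'g \<Rightarrow> bool" where "\<And>i. par (s i)"
    "\<And>x y. x \<in> carrier W \<Longrightarrow> y \<in> carrier W \<Longrightarrow> par (x \<otimes>\<^bsub>W\<^esub> y) \<longleftrightarrow> par x \<noteq> par y"
proof (rule coxeter_lift[OF W, where mul = "(\<noteq>)" and one = False and \<phi> = "\<lambda>i. True"])
  show "foldr (\<noteq>) (concat (replicate (m i j) [True, True])) False = False" for i j
  proof -
    have "foldr (\<noteq>) (concat (replicate l [True, True])) False = False" for l
      by (induction l) simp_all
    then show ?thesis .
  qed
  fix par
  assume par: "\<And>u. par (list_mult W (map s u)) = foldr (\<noteq>) (map (\<lambda>i. True) u) False"
    "\<And>x y. x \<in> carrier W \<Longrightarrow> y \<in> carrier W \<Longrightarrow> par (x \<otimes>\<^bsub>W\<^esub> y) \<longleftrightarrow> par x \<noteq> par y"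
  interpret refl_group W s by (rule coxeter_system_refl_group[OF W])
  have "par (s i)" for i using par(1)[of "[i]"] by simp
  then show thesis using that par(2) by blast
qed auto

locale parity_group = refl_group W s for W :: "('g, 'b) monoid_scheme" (structure) and s :: "'n::finite \<Rightarrow> 'g" +
  fixes par :: "'g \<Rightarrow> bool"
  assumes par_s: "par (s i)"
    and par_mult: "x \<in> carrier W \<Longrightarrow> y \<in> carrier W \<Longrightarrow> par (x \<otimes> y) \<longleftrightarrow> par x \<noteq> par y"
begin

lemma par_one: "\<not> par \<one>"
  using par_mult[of \<one> \<one>] by simp

lemma par_inv: "x \<in> carrier W \<Longrightarrow> par (inv x) \<longleftrightarrow> par x"
  using par_mult[of x "inv x"] par_one by simp

lemma par_T: "t \<in> T \<Longrightarrow> par t"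
  by (auto simp: reflections_def par_mult par_inv par_s)

lemma par_lm: "set ts \<subseteq> T \<Longrightarrow> par (lm ts) \<longleftrightarrow> odd (length ts)"
proof (induction ts)
  case (Cons t ts)
  then have "t \<in> carrier W" "lm ts \<in> carrier W" using T_closed by (auto intro!: lm_closed)
  then show ?case using Cons par_T by (simp add: par_mult)
qed (simp add: par_one)

lemma par_abs_length: "w \<in> carrier W \<Longrightarrow> par w \<longleftrightarrow> odd (abs_length W s w)"
  using abs_length_ex par_lm by metis

lemma abs_length_T: "t \<in> T \<Longrightarrow> abs_length W s t = 1"
proof -
  assume t: "t \<in> T"
  have "abs_length W s t \<le> 1" using abs_length_le[of "[t]" t] t T_closed by simp
  moreover have "odd (abs_length W s t)" using par_abs_length[OF T_closed[OF t]] par_T[OF t] by simp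
  ultimately show ?thesis by (cases "abs_length W s t") auto
qed

lemma abs_length_two:
  assumes "t \<in> T" "r \<in> T" "t \<otimes> r \<noteq> \<one>"
  shows "abs_length W s (t \<otimes> r) = 2"
proof -
  have c: "t \<otimes> r \<in> carrier W" using assms T_closed by blast
  have "abs_length W s (t \<otimes> r) \<le> 2" using abs_length_le[of "[t, r]" "t \<otimes> r"] assms T_closed by simp
  moreover have "even (abs_length W s (t \<otimes> r))"
    using par_abs_length[OF c] par_mult[OF T_closed T_closed, OF assms(1,2)] par_T assms by simp
  moreover have "abs_length W s (t \<otimes> r) \<noteq> 0" using abs_length_zero[OF c] assms(3) by simp
  moreover have "l = 2" if "l \<le> 2" "even l" "l \<noteq> 0" for l :: nat
  proof -
    have "l = 0 \<or> l = 1 \<or> l = 2" using that(1) by linarith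
    then show ?thesis using that(2,3) by auto
  qed
  ultimately show ?thesis by blast
qed

lemma abs_le_T_T: "t \<in> T \<Longrightarrow> r \<in> T \<Longrightarrow> abs_le W s t r \<longleftrightarrow> t = r"
proof -
  assume tr: "t \<in> T" "r \<in> T"
  have c: "t \<in> carrier W" "r \<in> carrier W" using tr T_closed by auto
  have "abs_le W s t r \<longleftrightarrow> r \<otimes> inv t = \<one>"
    unfolding abs_le_def using tr abs_length_zero[of "r \<otimes> inv t"] c by (simp add: abs_length_T)
  then show ?thesis using c by (metis inv_equality inv_inv inv_closed r_inv)
qed

lemma abs_le_one: "u \<in> carrier W \<Longrightarrow> abs_le W s \<one> u"
  by (simp add: abs_le_def abs_length_one)

lemma abs_le_T_one: "t \<in> T \<Longrightarrow> \<not> abs_le W s t \<one>"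
  by (simp add: abs_le_def abs_length_one abs_length_T inv_T T_closed)

lemma nc_proj_T:
  assumes "t \<in> T" "abs_le W s t c"
  shows "nc_proj W s c t = t"
  by (rule nc_proj_eqI) (use assms T_closed abs_le_T_T abs_le_refl in auto)

lemma nc_proj_one: "nc_proj W s c \<one> = \<one>" if "c \<in> carrier W"
  by (rule nc_proj_eqI) (use abs_le_one that abs_le_T_one in auto)

lemma Pop_T: "t \<in> T \<Longrightarrow> abs_le W s t c \<Longrightarrow> Pop W s c t = \<one>"
  unfolding Pop_def using T_closed by (simp add: nc_proj_T)

lemma Pop_one: "c \<in> carrier W \<Longrightarrow> Pop W s c \<one> = \<one>"
  unfolding Pop_def by (simp add: nc_proj_one)

end

section \<open>Dihedral groups\<close>

context linear_coxeter
begin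

text \<open>The order of \<open>c\<close> is at least 3, so \<open>c\<close> is not a reflection but
  a power of \<open>R\<close>; as \<open>R [^] k\<close> is trivial, \<open>h = k\<close> and
  \<open>c\<close> generates all rotations. Every reflection lies below every nontrivial rotation,
  so the projection of a nontrivial rotation is \<open>c\<close>.\<close>

theorem Pop_conclusion_dihedral:
  assumes n2: "n = 2" and fin: "finite (carrier W)" and h: "is_coxeter_number W s m h"
    and c: "coxeter_element W s m h c"
  shows "(\<forall>w\<in>carrier W. (Pop W s c ^^ (h - 1)) w = \<one>)
    \<and> Max {card (forward_orbit (Pop W s c) w) | w. w \<in> carrier W} = h
    \<and> {forward_orbit (Pop W s c) w | w. w \<in> carrier W \<and> card (forward_orbit (Pop W s c) w) = h}
        = {forward_orbit (Pop W s c) (inv c)}"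
proof -
  obtain par where "\<And>i. par (s i)" "\<And>x y. x \<in> carrier W \<Longrightarrow> y \<in> carrier W \<Longrightarrow> par (x \<otimes> y) \<longleftrightarrow> par x \<noteq> par y"
    using coxeter_parity[OF sys] by blast
  then interpret parity_group W s par by unfold_locales
  have cW: "c \<in> carrier W" and ord: "ord c = h"
    using c by (simp_all add: coxeter_element_def regular_element_def)
  \<comment> \<open>On two vertices the constant vector is an eigenvector, with the weight of the
    edge as eigenvalue.\<close>
  have hk: "h \<ge> k"
    by (rule coxeter_number_ge_eigen[OF fin h, where a = "\<lambda>j. 1"]) (use k3 n2 in \<open>auto simp: edge_def\<close>)
  define R where "R = g 0 \<otimes> g 1"
  have RW: "R \<in> carrier W" by (simp add: R_def)
  have "m (idx 0) (idx 1) = k" using n2 by (simp add: m_eq f_idx)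
  then have "lm (concat (replicate k [g 0, g 1])) = \<one>" using g_order[of 0 1 k] n2 by simp
  moreover have "lm (concat (replicate j [g 0, g 1])) = R [^] j" for j
  proof (induction j)
    case (Suc j)
    have "R [^] Suc j = R \<otimes> R [^] j" using RW by (rule nat_pow_Suc2)
    then show ?case using Suc RW by (simp add: R_def m_assoc)
  qed simp
  ultimately have Rk: "R [^] k = \<one>" by simp
  have gR: "g 0 \<otimes> R = g 1" by (simp add: R_def g_cancel)
  have Rinv: "R [^] (k - 1) \<otimes> g 0 = g 1"
  proof -
    have "R [^] (k - 1) \<otimes> R = \<one>" using Rk k3 by (metis nat_pow_Suc Suc_diff_1 less_le_trans zero_less_numeral)
    then have "R [^] (k - 1) = inv R" using RW by (metis inv_equality inv_inv nat_pow_closed inv_closed)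
    moreover have "inv R = g 1 \<otimes> g 0" by (simp add: R_def inv_mult_group g_def inv_s)
    ultimately show ?thesis by (simp add: m_assoc g_invol)
  qed
  have g0R: "g 0 \<otimes> inv R = R \<otimes> g 0"
    by (simp add: R_def inv_mult_group g_def inv_s m_assoc)
  have form: "(\<exists>j::nat. w = R [^] j) \<or> (\<exists>j::nat. w = R [^] j \<otimes> g 0)" if "w \<in> carrier W" for w
  proof -
    have "w \<in> H 2" using that H_full unfolding n2 by simp
    then obtain ks where ks: "w = gw ks" "set ks \<subseteq> {..<2}" unfolding H_def by blast
    have "(\<exists>j::nat. gw ks = R [^] j) \<or> (\<exists>j::nat. gw ks = R [^] j \<otimes> g 0)" using ks(2)
    proof (induction ks rule: rev_induct)
      case Nil
      show ?case by (intro disjI1 exI[of _ "0::nat"]) simp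
    next
      case (snoc i ks)
      have "i < 2" using snoc.prems by simp
      then have i: "i = 0 \<or> i = 1" by linarith
      have IH: "(\<exists>j::nat. gw ks = R [^] j) \<or> (\<exists>j::nat. gw ks = R [^] j \<otimes> g 0)"
        by (rule snoc.IH) (use snoc.prems in simp)
      have eq: "gw (ks @ [i]) = gw ks \<otimes> g i" by (simp add: gw_append)
      have e1: "R [^] j \<otimes> g 1 = R [^] (j + (k - 1)) \<otimes> g 0" for j :: nat
        using RW by (simp add: nat_pow_mult[symmetric] m_assoc Rinv[unfolded One_nat_def])
      have e2: "R [^] j \<otimes> g 0 \<otimes> g 0 = R [^] j" for j :: nat using RW by (simp add: m_assoc g_invol)
      have e3: "R [^] j \<otimes> g 0 \<otimes> g 1 = R [^] Suc j" for j :: nat using RW by (simp add: m_assoc R_def)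
      let ?P = "(\<exists>j::nat. gw ks \<otimes> g i = R [^] j) \<or> (\<exists>j::nat. gw ks \<otimes> g i = R [^] j \<otimes> g 0)"
      show ?case using i IH unfolding eq
      proof (elim disjE exE)
        fix j :: nat assume "i = 0" "gw ks = R [^] j"
        then have "gw ks \<otimes> g i = R [^] j \<otimes> g 0" by simp
        then show ?P by blast
      next
        fix j :: nat assume "i = 1" "gw ks = R [^] j"
        then have "gw ks \<otimes> g i = R [^] (j + (k - 1)) \<otimes> g 0" using e1[of j] by simp
        then show ?P by blast
      next
        fix j :: nat assume "i = 0" "gw ks = R [^] j \<otimes> g 0"
        then have "gw ks \<otimes> g i = R [^] j" using e2[of j] by simp
        then show ?P by blast
      next
        fix j :: nat assume "i = 1" "gw ks = R [^] j \<otimes> g 0"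
        then have "gw ks \<otimes> g i = R [^] Suc j" using e3[of j] by simp
        then show ?P by blast
      qed
    qed
    then show ?thesis using ks(1) by simp
  qed
  have refl: "R [^] j \<otimes> g 0 \<in> T" for j :: nat
  proof (induction j rule: less_induct)
    case (less j)
    consider "j = 0" | "j = 1" | i where "j = Suc (Suc i)" by (metis One_nat_def not0_implies_Suc)
    then show ?case
    proof cases
      case 1
      then show ?thesis using s_T by (simp add: g_def)
    next
      case 2
      have "g 0 \<otimes> g 1 \<otimes> inv (g 0) \<in> T" by (rule T_conj) (simp_all add: g_def s_T)
      then show ?thesis using 2 by (simp add: R_def g_def inv_s)
    next
      case 3
      have "R \<otimes> (R [^] i \<otimes> g 0) \<otimes> inv R \<in> T" by (rule T_conj[OF less RW]) (use 3 in simp)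
      also have "R \<otimes> (R [^] i \<otimes> g 0) \<otimes> inv R = R \<otimes> R [^] i \<otimes> R \<otimes> g 0"
        using RW by (simp add: m_assoc g0R)
      also have "R \<otimes> R [^] i \<otimes> R = R [^] j" using RW nat_pow_Suc2[OF RW, of i] 3 by simp
      finally show ?thesis .
    qed
  qed
  have par_R: "\<not> par (R [^] j)" for j :: nat
    using RW by (induction j) (simp_all add: par_one par_mult, simp add: R_def par_mult g_def par_s)
  have odd_T: "w \<in> T" if "w \<in> carrier W" "par w" for w
    using form[OF that(1)] that(2) par_R refl by blast
  have even_R: "\<exists>j::nat. w = R [^] j" if "w \<in> carrier W" "\<not> par w" for w
    using form[OF that(1)] that(2) par_T[OF refl] by blast
  have two: "abs_length W s w = 2" if w: "w \<in> carrier W" "\<not> par w" "w \<noteq> \<one>" for w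
  proof -
    have "w \<otimes> g 0 \<in> T" by (rule odd_T) (use w in \<open>simp_all add: par_mult g_def par_s\<close>)
    moreover have "w \<otimes> g 0 \<otimes> g 0 = w" using w(1) by (simp add: m_assoc g_invol)
    ultimately show ?thesis using abs_length_two[of "w \<otimes> g 0" "g 0"] w(3) s_T by (simp add: g_def)
  qed
  have le_two: "abs_le W s t w" if "t \<in> T" "w \<in> carrier W" "\<not> par w" "w \<noteq> \<one>" for t w
  proof -
    have "w \<otimes> inv t \<in> T" by (rule odd_T) (use that T_closed par_T in \<open>simp_all add: par_mult par_inv\<close>)
    then show ?thesis unfolding abs_le_def using two[OF that(2-4)] that(1) by (simp add: abs_length_T)
  qed
  have c_even: "\<not> par c"
  proof
    assume "par c"
    then have "c [^] (2::nat) = \<one>" using T_invol[OF odd_T] cW by (simp add: numeral_2_eq_2)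
    then have "h dvd 2" using pow_eq_id[OF cW, of 2] ord by simp
    then show False using hk k3 by (auto dest: dvd_imp_le)
  qed
  obtain r :: nat where "c = R [^] r" using even_R[OF cW c_even] by blast
  then have "c [^] k = \<one>" using RW Rk by (metis nat_pow_pow nat_pow_one mult.commute)
  then have "h dvd k" using pow_eq_id[OF cW, of k] ord by simp
  then have hk: "h = k" using hk k3 by (auto dest: dvd_imp_le)
  have c1: "c \<noteq> \<one>" using ord hk k3 by auto
  have g01: "g 0 \<noteq> g 1"
  proof
    assume "g 0 = g 1"
    then have "R = \<one>" by (simp add: R_def g_invol)
    then show False using \<open>c = R [^] r\<close> c1 by simp
  qed
  have cinj: "inj_on (\<lambda>i. c [^] i) {..<h}"
  proof -
    have "c [^] i \<noteq> c [^] j" if "i < j" "j < h" for i j :: nat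
    proof
      assume eq: "c [^] i = c [^] j"
      have "c [^] j = c [^] i \<otimes> c [^] (j - i)" using cW that by (simp add: nat_pow_mult)
      then have "c [^] (j - i) = \<one>" using eq cW by (metis l_cancel_one' nat_pow_closed)
      then have "h dvd (j - i)" using pow_eq_id[OF cW] ord by simp
      then show False using that by (auto dest: dvd_imp_le)
    qed
    then show ?thesis unfolding inj_on_def by (metis lessThan_iff linorder_neqE_nat)
  qed
  have powers: "\<exists>i<h. w = c [^] i" if w: "w \<in> carrier W" "\<not> par w" for w
  proof -
    let ?E = "(\<lambda>i. R [^] i) ` {..<k}" and ?C = "(\<lambda>i. c [^] i) ` {..<h}"
    have red: "\<exists>j<k. v = R [^] j" if "v \<in> carrier W" "\<not> par v" for v
    proof -
      have "\<exists>j::nat. v = R [^] j" by (rule even_R[OF that])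
      then obtain j :: nat where "v = R [^] j" by blast
      also have "R [^] j = R [^] (k * (j div k) + j mod k)" by simp
      also have "\<dots> = R [^] (j mod k)"
        unfolding nat_pow_mult[OF RW, symmetric] nat_pow_pow[OF RW, symmetric] Rk using RW by simp
      finally show ?thesis using k3 by (intro exI[of _ "j mod k"]) simp
    qed
    have pc: "\<not> par (c [^] i)" for i :: nat
      using cW c_even by (induction i) (simp_all add: par_one par_mult)
    have "?C \<subseteq> ?E" using red[OF _ pc] cW by auto
    moreover have "card ?C = k" using card_image[OF cinj] hk by simp
    moreover have "card ?E \<le> k" using card_image_le[of "{..<k}"] by simp
    ultimately have "?C = ?E" by (intro card_seteq) auto
    moreover have "w \<in> ?E" using red[OF w] by blast
    ultimately show ?thesis by auto
  qed
  have Pop_even: "Pop W s c w = w \<otimes> inv c" if w: "w \<in> carrier W" "\<not> par w" "w \<noteq> \<one>" for w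
  proof -
    have "nc_proj W s c w = c"
    proof (rule nc_proj_eqI[OF w(1)])
      show "abs_le W s t c" "abs_le W s t c" if "t \<in> T" for t
        using le_two[OF that cW c_even c1] by simp_all
      show "c \<in> carrier W" "abs_le W s c c" using cW abs_le_refl by simp_all
      fix v assume v: "v \<in> carrier W" "abs_le W s v c" and up: "\<And>t. t \<in> T \<Longrightarrow> abs_le W s t w \<Longrightarrow> abs_le W s t v"
      have up: "abs_le W s t v" if "t \<in> T" for t using up[OF that le_two[OF that w]] .
      have gT: "g 0 \<in> T" "g 1 \<in> T" by (simp_all add: g_def s_T)
      \<comment> \<open>An upper bound of two different reflections is neither trivial nor a
        reflection; it has length 2 like \<open>c\<close>, and below \<open>c\<close> this forces
        equality.\<close>
      have "v \<noteq> \<one>" using up[OF gT(1)] abs_le_T_one[OF gT(1)] by blast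
      moreover have "v \<notin> T" using up[OF gT(1)] up[OF gT(2)] abs_le_T_T gT g01 by blast
      ultimately have "abs_length W s v = 2" using two odd_T v(1) by blast
      then have "abs_length W s (c \<otimes> inv v) = 0" using v(2) two[OF cW c_even c1] unfolding abs_le_def by simp
      then have "c \<otimes> inv v = \<one>" using abs_length_zero cW v(1) by simp
      then have "v = c" using cW v(1) by (metis inv_equality inv_inv inv_closed)
      then show "abs_le W s c v" using abs_le_refl[OF cW] by simp
    qed
    then show ?thesis by (simp add: Pop_def)
  qed
  have Pop_pow: "Pop W s c (c [^] Suc i) = c [^] i" if "Suc i < h" for i
  proof -
    have "c [^] Suc i \<noteq> c [^] (0::nat)" using inj_onD[OF cinj, of "Suc i" 0] that by auto
    moreover have "\<not> par (c [^] j)" for j :: nat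
      using cW c_even by (induction j) (simp_all add: par_one par_mult)
    ultimately have "Pop W s c (c [^] Suc i) = c [^] Suc i \<otimes> inv c" using cW c_even
      by (intro Pop_even) (simp_all add: par_mult)
    then show ?thesis using cW by (simp add: m_assoc)
  qed
  have chain: "(Pop W s c ^^ j) (c [^] i) = c [^] (i - j)" if "i < h" for i j
  proof (induction j)
    case (Suc j)
    then show ?case
    proof (cases "i \<le> j")
      case True
      then show ?thesis using Suc Pop_one[OF cW] by simp
    next
      case False
      then have "i - j = Suc (i - Suc j)" by simp
      then show ?thesis using Suc Pop_pow[of "i - Suc j"] that by simp
    qed
  qed simp
  have stay: "(Pop W s c ^^ j) \<one> = \<one>" for j using Pop_one[OF cW] by (induction j) simp_all
  have odd_case: "(Pop W s c ^^ j) w = \<one>" if "w \<in> carrier W" "par w" "j > 0" for w j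
  proof -
    have "Pop W s c w = \<one>" by (rule Pop_T) (use odd_T that le_two[OF _ cW c_even c1] in auto)
    then show ?thesis using stay[of "j - 1"] that(3) by (cases j) (simp_all add: funpow_Suc_right del: funpow.simps(2))
  qed
  have inv_c: "inv c = c [^] (h - 1)"
  proof -
    have "c [^] (h - 1) \<otimes> c = \<one>"
      using pow_ord_eq_1[OF cW] ord hk k3 by (metis nat_pow_Suc Suc_diff_1 less_le_trans zero_less_numeral)
    then show ?thesis using cW by (metis inv_equality inv_inv inv_closed nat_pow_closed)
  qed
  show ?thesis
  proof (rule forward_orbit_max)
    show "h \<ge> 2" using hk k3 by simp
    show "inv c \<in> carrier W" using cW by simp
    show "Pop W s c \<one> = \<one>" by (rule Pop_one[OF cW])
    show "(Pop W s c ^^ (h - 1)) w = \<one>" if w: "w \<in> carrier W" for w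
    proof (cases "par w")
      case True
      then show ?thesis using odd_case w hk k3 by simp
    next
      case False
      then obtain i where "i < h" "w = c [^] i" using powers w by blast
      then show ?thesis using chain[of i "h - 1"] by simp
    qed
    show "w = inv c" if w: "w \<in> carrier W" "(Pop W s c ^^ (h - 2)) w \<noteq> \<one>" for w
    proof -
      have "\<not> par w" using odd_case[OF w(1), of "h - 2"] w(2) hk k3 by auto
      then obtain i where i: "i < h" "w = c [^] i" using powers w(1) by blast
      have "\<not> i \<le> h - 2" using chain[OF i(1), of "h - 2"] i(2) w(2) by auto
      then have "i = h - 1" using i(1) by simp
      then show ?thesis using i(2) inv_c by simp
    qed
    have "h - 1 < h" "h - 1 - (h - 2) = 1" using hk k3 by auto
    then show "(Pop W s c ^^ (h - 2)) (inv c) \<noteq> \<one>"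
      unfolding inv_c using chain[of "h - 1" "h - 2"] c1 cW by simp
  qed (rule fin)
qed

end

section \<open>Type \<open>H\<^sub>3\<close>\<close>

datatype pt = P0 | P1 | P2 | P3 | P4

datatype perm5 = Pm pt pt pt pt pt

fun ap :: "perm5 \<Rightarrow> pt \<Rightarrow> pt" where
  "ap (Pm a b c d e) P0 = a"
| "ap (Pm a b c d e) P1 = b"
| "ap (Pm a b c d e) P2 = c"
| "ap (Pm a b c d e) P3 = d"
| "ap (Pm a b c d e) P4 = e"

fun mul :: "perm5 \<Rightarrow> perm5 \<Rightarrow> perm5" where
  "mul p (Pm a b c d e) = Pm (ap p a) (ap p b) (ap p c) (ap p d) (ap p e)"

abbreviation id5 :: perm5 where "id5 \<equiv> Pm P0 P1 P2 P3 P4"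

fun preimage :: "perm5 \<Rightarrow> pt \<Rightarrow> pt" where
  "preimage (Pm a b c d e) x = (if a = x then P0 else if b = x then P1 else if c = x then P2
     else if d = x then P3 else P4)"

definition inv5 :: "perm5 \<Rightarrow> perm5" where
  "inv5 p = Pm (preimage p P0) (preimage p P1) (preimage p P2) (preimage p P3) (preimage p P4)"

lemma ap_mul: "ap (mul p q) x = ap p (ap q x)"
  by (cases q; cases x) simp_all

lemma mul_assoc: "mul (mul p q) r = mul p (mul q r)"
  by (cases r) (simp add: ap_mul)

lemma mul_id: "mul id5 p = p" "mul p id5 = p"
proof -
  have "ap id5 x = x" for x by (cases x) simp_all
  then show "mul id5 p = p" by (cases p) simp
  show "mul p id5 = p" by (cases p) simp
qed

type_synonym h3 = "perm5 \<times> bool"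

fun mulP :: "h3 \<Rightarrow> h3 \<Rightarrow> h3" where
  "mulP (p, a) (q, b) = (mul p q, if a then \<not> b else b)"

abbreviation oneP :: h3 where "oneP \<equiv> (id5, False)"

lemma mulP_assoc: "mulP (mulP x y) z = mulP x (mulP y z)"
proof -
  obtain p a q b r c where "x = (p, a)" "y = (q, b)" "z = (r, c)" by (cases x, cases y, cases z) auto
  then show ?thesis by (simp add: mul_assoc del: mul.simps)
qed

lemma mulP_one: "mulP oneP x = x" "mulP x oneP = x"
proof -
  obtain p b where "x = (p, b)" by (cases x) auto
  then show "mulP oneP x = x" "mulP x oneP = x" by (simp_all add: mul_id del: mul.simps)
qed

text \<open>The double transpositions (1 2)(3 4), (0 1)(2 3) and (1 4)(2 3); products of consecutive
  ones have orders 5 and 3, and the first and the third commute.\<close>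

definition gen :: "nat \<Rightarrow> perm5" where
  "gen j = (if j = 0 then Pm P0 P2 P1 P4 P3 else if j = 1 then Pm P1 P0 P3 P2 P4 else Pm P0 P4 P3 P2 P1)"

definition word_image :: "nat list \<Rightarrow> h3" where
  "word_image ks = foldr (\<lambda>j. mulP (gen j, True)) ks oneP"

text \<open>This and the next two lists represent the right cosets along the chain of parabolic
  subgroups of orders 1, 2, 10 and 120.\<close>

definition reps0 :: "nat list list" where "reps0 = [[], [0]]"

definition reps1 :: "nat list list" where
  "reps1 = [[], [1], [1, 0], [1, 0, 1], [1, 0, 1, 0]]"

definition reps2 :: "nat list list" where
  "reps2 = [[], [2], [2, 1], [2, 1, 0], [2, 1, 0, 1], [2, 1, 0, 1, 0], [2, 1, 0, 1, 2],
     [2, 1, 0, 1, 0, 2], [2, 1, 0, 1, 0, 2, 1], [2, 1, 0, 1, 0, 2, 1, 0],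
     [2, 1, 0, 1, 0, 2, 1, 0, 1], [2, 1, 0, 1, 0, 2, 1, 0, 1, 2]]"

definition all_words :: "nat list list" where
  "all_words = concat (map (\<lambda>a. concat (map (\<lambda>b. map (\<lambda>c. a @ b @ c) reps2) reps1)) reps0)"

definition elements :: "h3 list" where "elements = map word_image all_words"

definition rotations :: "perm5 list" where
  "rotations = map fst (filter (\<lambda>q. \<not> snd q) elements)"

definition invol :: "perm5 \<Rightarrow> bool" where "invol p \<longleftrightarrow> p \<noteq> id5 \<and> mul p p = id5"

definition involutions :: "perm5 list" where "involutions = filter invol rotations"

abbreviation cox5 :: perm5 where "cox5 \<equiv> Pm P1 P2 P3 P4 P0"

text \<open>The nontrivial rotations below \<open>c\<close>: removing a reflection from
  \<open>c\<close> leaves an element of length 2.\<close>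

definition nc_rotations :: "perm5 list" where
  "nc_rotations = map (\<lambda>t. mul t cox5) involutions"

definition below :: "perm5 \<Rightarrow> perm5 list" where
  "below p = filter (\<lambda>t. invol (mul p t)) involutions"

text \<open>The candidates, among the rotations below \<open>c\<close>, for the join of the
  reflections below \<open>p\<close>. The evaluation below finds at most one; if there is none, the
  join is \<open>c\<close>.\<close>

definition joins :: "perm5 \<Rightarrow> perm5 list" where
  "joins p = filter (\<lambda>u. list_all (\<lambda>t. invol (mul u t)) (below p)) nc_rotations"

text \<open>A reflection is its own projection, any other odd element projects to \<open>c\<close>,
  the unit to itself, and a nontrivial rotation to the only entry of \<open>joins\<close> or else to
  \<open>c\<close>.\<close>

definition pop5 :: "h3 \<Rightarrow> h3" where
  "pop5 q = (if snd q then (if invol (fst q) then oneP else (mul (fst q) (inv5 cox5), False))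
     else if fst q = id5 then oneP
     else case joins (fst q) of [] \<Rightarrow> (mul (fst q) (inv5 cox5), True)
       | u # us \<Rightarrow> (mul (fst q) (inv5 u), False))"

text \<open>The lists are tabulated once so that the evaluations below do not recompute them.\<close>

lemma rotations_code [code]: "rotations =
    [Pm P0 P1 P2 P3 P4, Pm P4 P0 P2 P3 P1, Pm P2 P4 P1 P0 P3, Pm P2 P0 P3 P4 P1,
     Pm P0 P4 P2 P1 P3, Pm P4 P3 P2 P1 P0, Pm P1 P4 P2 P3 P0, Pm P4 P3 P1 P0 P2,
     Pm P3 P0 P4 P2 P1, Pm P3 P2 P1 P0 P4, Pm P1 P3 P4 P2 P0, Pm P4 P1 P0 P3 P2,
     Pm P1 P3 P0 P4 P2, Pm P2 P1 P0 P4 P3, Pm P0 P2 P3 P1 P4, Pm P0 P1 P4 P2 P3,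
     Pm P1 P2 P0 P3 P4, Pm P2 P4 P0 P3 P1, Pm P3 P2 P0 P4 P1, Pm P2 P4 P3 P1 P0,
     Pm P4 P1 P2 P0 P3, Pm P4 P0 P3 P1 P2, Pm P3 P4 P2 P0 P1, Pm P2 P3 P1 P4 P0,
     Pm P3 P4 P1 P2 P0, Pm P0 P3 P1 P2 P4, Pm P1 P0 P4 P3 P2, Pm P1 P3 P2 P0 P4,
     Pm P3 P0 P1 P4 P2, Pm P0 P2 P1 P4 P3, Pm P0 P3 P4 P1 P2, Pm P3 P1 P0 P2 P4,
     Pm P1 P2 P3 P4 P0, Pm P1 P4 P0 P2 P3, Pm P0 P1 P3 P4 P2, Pm P3 P0 P2 P1 P4,
     Pm P2 P0 P4 P1 P3, Pm P3 P2 P4 P1 P0, Pm P4 P3 P0 P2 P1, Pm P4 P2 P1 P3 P0,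
     Pm P2 P3 P4 P0 P1, Pm P3 P1 P4 P0 P2, Pm P2 P1 P3 P0 P4, Pm P1 P0 P2 P4 P3,
     Pm P0 P4 P1 P3 P2, Pm P0 P3 P2 P4 P1, Pm P2 P0 P1 P3 P4, Pm P1 P2 P4 P0 P3,
     Pm P4 P2 P3 P0 P1, Pm P1 P4 P3 P0 P2, Pm P3 P1 P2 P4 P0, Pm P3 P4 P0 P1 P2,
     Pm P4 P1 P3 P2 P0, Pm P1 P0 P3 P2 P4, Pm P4 P0 P1 P2 P3, Pm P0 P2 P4 P3 P1,
     Pm P2 P3 P0 P1 P4, Pm P2 P1 P4 P3 P0, Pm P4 P2 P0 P1 P3, Pm P0 P4 P3 P2 P1]"
  by code_simp

lemma involutions_code [code]: "involutions =
    [Pm P4 P3 P2 P1 P0, Pm P3 P2 P1 P0 P4, Pm P2 P1 P0 P4 P3, Pm P2 P4 P0 P3 P1,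
     Pm P3 P4 P2 P0 P1, Pm P1 P0 P4 P3 P2, Pm P0 P2 P1 P4 P3, Pm P0 P3 P4 P1 P2,
     Pm P4 P2 P1 P3 P0, Pm P3 P1 P4 P0 P2, Pm P1 P0 P2 P4 P3, Pm P4 P1 P3 P2 P0,
     Pm P1 P0 P3 P2 P4, Pm P2 P3 P0 P1 P4, Pm P0 P4 P3 P2 P1]"
  by code_simp

lemma nc_rotations_code [code]: "nc_rotations =
    [Pm P3 P2 P1 P0 P4, Pm P2 P1 P0 P4 P3, Pm P1 P0 P4 P3 P2, Pm P4 P0 P3 P1 P2,
     Pm P4 P2 P0 P1 P3, Pm P0 P4 P3 P2 P1, Pm P2 P1 P4 P3 P0, Pm P3 P4 P1 P2 P0,
     Pm P2 P1 P3 P0 P4, Pm P1 P4 P0 P2 P3, Pm P0 P2 P4 P3 P1, Pm P1 P3 P2 P0 P4,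
     Pm P0 P3 P2 P4 P1, Pm P3 P0 P1 P4 P2, Pm P4 P3 P2 P1 P0]"
  by code_simp

text \<open>Lists the points along the cycle of \<open>p\<close>, so that for a 5-cycle it
  conjugates \<open>cox5\<close> to \<open>p\<close>. It may be an odd permutation, because the
  5-cycles form two classes in \<open>A_5\<close>; conjugation is then an outer automorphism, and
  \<open>good_relabel\<close> checks that the generators stay among the rotations.\<close>

definition relabel :: "perm5 \<Rightarrow> perm5" where
  "relabel p = Pm P0 (ap p P0) (ap p (ap p P0)) (ap p (ap p (ap p P0))) (ap p (ap p (ap p (ap p P0))))"

definition good_relabel :: "perm5 \<Rightarrow> perm5 \<Rightarrow> bool" where
  "good_relabel p e \<longleftrightarrow> mul e (inv5 e) = id5 \<and> mul (inv5 e) e = id5 \<and> mul (inv5 e) (mul p e) = cox5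
     \<and> list_all (\<lambda>j. mul (inv5 e) (mul (gen j) e) \<in> set rotations) [0, 1, 2]"

definition refl_words :: "(nat list \<times> nat) list" where
  "refl_words = [([], 0), ([], 1), ([], 2), ([0], 1), ([1], 0), ([1], 2), ([0, 1], 0), ([0, 1], 2), ([2, 1], 0), ([0, 2, 1], 0), ([1, 0, 1], 2), ([0, 1, 0, 1], 2), ([1, 0, 2, 1], 0), ([0, 1, 0, 2, 1], 0), ([1, 0, 1, 0, 2, 1], 0)]"

abbreviation pop8 :: "h3 \<Rightarrow> h3" where
  "pop8 q \<equiv> pop5 (pop5 (pop5 (pop5 (pop5 (pop5 (pop5 (pop5 q)))))))"

text \<open>Separates the images of the 120 words and thereby makes the model faithful.\<close>

lemma distinct_elements: "distinct elements"
  by code_simp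

definition sublist_of :: "'a list \<Rightarrow> 'a list \<Rightarrow> bool" where
  "sublist_of xs ys \<longleftrightarrow> list_all (\<lambda>x. x \<in> set ys) xs"

lemma check_odd_elements:
  "sublist_of rotations (map fst (filter snd elements)) \<and> sublist_of (map fst (filter snd elements)) rotations"
  by code_simp

text \<open>The order of every element divides 6, 5 or 10. An order of at least 10 leaves only the
  last alternative.\<close>

lemma check_relabel:
  "list_all (\<lambda>q. foldr mulP [q, q, q, q, q, q] oneP = oneP \<or> foldr mulP [q, q, q, q, q] oneP = oneP
     \<or> foldr mulP [q, q, q, q, q, q, q, q, q, q] oneP = oneP \<and> snd q \<and> good_relabel (fst q) (relabel (fst q))) elements"
  by code_simp

lemma check_refl_words:
  "list_all (\<lambda>q. snd q \<and> invol (fst q) \<longrightarrow> q \<in> set (map (\<lambda>(u, i). word_image (u @ i # rev u)) refl_words)) elements"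
  by code_simp

text \<open>For a nontrivial rotation the clauses serve in turn to show that it is a product of two
  reflections, that some reflection is not below it, that at least two are, and that a join other
  than \<open>c\<close> is unique.\<close>

lemma check_rotations:
  "list_all (\<lambda>p. mul p (inv5 p) = id5 \<and> (p = id5 \<or> list_ex (\<lambda>t. invol (mul p t)) involutions
     \<and> list_ex (\<lambda>t. \<not> invol (mul p t)) involutions
     \<and> (case below p of t # r # ts \<Rightarrow> t \<noteq> r | _ \<Rightarrow> False)
     \<and> (case joins p of [] \<Rightarrow> True | u # us \<Rightarrow> us = []))) rotations"
  by code_simp

lemma check_nc_rotations: "list_all (\<lambda>u. u \<noteq> id5) nc_rotations"
  by code_simp

text \<open>Eight is \<open>h - 2\<close> for \<open>h = 10\<close>.\<close>

lemma check_pop: "list_all (\<lambda>q. q = (inv5 cox5, True) \<or> pop8 q = oneP) elements"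
  by code_simp

lemma check_pop_cox: "pop8 (inv5 cox5, True) \<noteq> oneP \<and> pop5 (pop8 (inv5 cox5, True)) = oneP"
  by code_simp

section \<open>Rewriting certificates for the coset representatives\<close>

definition h3_rules :: "(nat list \<times> nat list) list" where
  "h3_rules = [([0, 0], []), ([1, 1], []), ([2, 2], []), ([0, 2], [2, 0]), ([2, 0], [0, 2]),
     ([1, 2, 1], [2, 1, 2]), ([2, 1, 2], [1, 2, 1]),
     ([0, 1, 0, 1, 0], [1, 0, 1, 0, 1]), ([1, 0, 1, 0, 1], [0, 1, 0, 1, 0])]"

text \<open>The position determines the rewriting, as the first matching rule is applied. Braid and
  commutation rules occur in both directions, so a list of positions certifies an equation between
  words.\<close>

definition rewrite_at :: "nat \<Rightarrow> nat list \<Rightarrow> nat list" where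
  "rewrite_at q w = (case find (\<lambda>(x, y). take (length x) (drop q w) = x) h3_rules of
     None \<Rightarrow> w | Some (x, y) \<Rightarrow> take q w @ y @ drop (q + length x) w)"

definition coset_step :: "nat \<Rightarrow> nat list list \<Rightarrow> nat list \<Rightarrow> nat \<Rightarrow> nat list \<Rightarrow> bool" where
  "coset_step j R r i ps \<longleftrightarrow> (let w = fold rewrite_at ps (r @ [i])
     in w \<in> set R \<or> (w \<noteq> [] \<and> hd w < j \<and> tl w \<in> set R))"

definition coset_table :: "nat \<Rightarrow> nat list list \<Rightarrow> nat list list list \<Rightarrow> bool" where
  "coset_table j R tab \<longleftrightarrow> [] \<in> set R \<and> length tab = length R
     \<and> list_all (\<lambda>(r, row). length row = Suc j
          \<and> list_all (\<lambda>(i, ps). coset_step j R r i ps) (zip [0..<Suc j] row)) (zip R tab)"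

text \<open>The tables list, for each representative and each generator, the positions at which
  defining relations are applied.\<close>

lemma coset_table0: "coset_table 0 reps0 [[[]], [[0]]]"
  by code_simp

lemma coset_table1: "coset_table 1 reps1
    [[[], []], [[], [0]], [[1], []], [[], [2]], [[3], [0]]]"
  by code_simp

lemma coset_table2: "coset_table 2 reps2
    [[[], [], []], [[0], [], [0]], [[], [1], [0]], [[2], [], [2, 0]], [[], [3], []], [[4], [1,
    0], []], [[4], [3, 2, 0], [4]], [[4, 5], [], [5]], [[], [6], [5, 1, 0]], [[7], [], [7, 5, 1,
    0]], [[4, 5, 3, 2, 0, 5], [8], []], [[4, 9, 5, 3, 2, 0, 5], [8, 7, 5, 1, 0], [9]]]"
  by code_simp

lemma coset_tableD:
  assumes "coset_table j R tab" "r \<in> set R" "i \<le> j"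
  shows "\<exists>ps. coset_step j R r i ps"
proof -
  obtain q where q: "q < length R" "R ! q = r" using assms(2) by (auto simp: in_set_conv_nth)
  have len: "length tab = length R" using assms(1) by (simp add: coset_table_def)
  have "(r, tab ! q) \<in> set (zip R tab)" using q len by (auto simp: in_set_zip)
  then have row: "length (tab ! q) = Suc j"
    "list_all (\<lambda>(i, ps). coset_step j R r i ps) (zip [0..<Suc j] (tab ! q))"
    using assms(1) unfolding coset_table_def list_all_iff by auto
  have "(i, tab ! q ! i) \<in> set (zip [0..<Suc j] (tab ! q))"
    unfolding in_set_zip using row(1) assms(3) by (intro exI[of _ i]) (simp del: upt_Suc)
  then show ?thesis using row(2) unfolding list_all_iff by auto
qed

locale h3_coxeter = linear_coxeter W s m f 5 3
  for W :: "('g, 'b) monoid_scheme" (structure) and s :: "'n::finite \<Rightarrow> 'g" and m f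
begin

lemma gw_rule: "(x, y) \<in> set h3_rules \<Longrightarrow> gw x = gw y"
proof -
  have c: "g 0 \<otimes> g 2 = g 2 \<otimes> g 0" by (rule g_commute) simp_all
  have b: "g 1 \<otimes> (g 2 \<otimes> g 1) = g 2 \<otimes> (g 1 \<otimes> g 2)"
    using g_braid[of 1] by (simp add: numeral_2_eq_2)
  have "m (idx 0) (idx 1) = 5" by (simp add: m_eq f_idx)
  then have "lm (concat (replicate 5 [g 0, g 1])) = \<one>" using g_order[of 0 1] by simp
  moreover have "replicate 5 x = [x, x, x, x, x]" for x :: "'g list" by (simp add: eval_nat_numeral)
  ultimately have 1: "g 0 \<otimes> (g 1 \<otimes> (g 0 \<otimes> (g 1 \<otimes> (g 0 \<otimes> (g 1 \<otimes> (g 0 \<otimes> (g 1 \<otimes> (g 0 \<otimes> g 1)))))))) = \<one>"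
    by simp
  have "g 0 \<otimes> (g 1 \<otimes> (g 0 \<otimes> (g 1 \<otimes> g 0)))
    = g 0 \<otimes> (g 1 \<otimes> (g 0 \<otimes> (g 1 \<otimes> (g 0 \<otimes> (g 1 \<otimes> (g 0 \<otimes> (g 1 \<otimes> (g 0 \<otimes> g 1))))))))
      \<otimes> (g 1 \<otimes> (g 0 \<otimes> (g 1 \<otimes> (g 0 \<otimes> g 1))))"
    by (simp add: m_assoc g_cancel g_invol)
  also have "\<dots> = g 1 \<otimes> (g 0 \<otimes> (g 1 \<otimes> (g 0 \<otimes> g 1)))" unfolding 1 by simp
  finally have d: "g 0 \<otimes> (g 1 \<otimes> (g 0 \<otimes> (g 1 \<otimes> g 0))) = g 1 \<otimes> (g 0 \<otimes> (g 1 \<otimes> (g 0 \<otimes> g 1)))" .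
  show "(x, y) \<in> set h3_rules \<Longrightarrow> gw x = gw y"
    unfolding h3_rules_def using b c d g_invol by auto
qed

lemma gw_rewrite_at: "gw (rewrite_at q w) = gw w"
proof (cases "find (\<lambda>(x, y). take (length x) (drop q w) = x) h3_rules")
  case None
  then show ?thesis by (simp add: rewrite_at_def)
next
  case (Some xy)
  obtain x y where xy: "xy = (x, y)" by (cases xy)
  have 1: "(x, y) \<in> set h3_rules" "take (length x) (drop q w) = x"
    using Some unfolding xy find_Some_iff by (auto simp: in_set_conv_nth)
  have "w = take q w @ x @ drop (q + length x) w"
    using append_take_drop_id[of q w] append_take_drop_id[of "length x" "drop q w"] 1(2)
    by (simp add: add.commute)
  then have "gw w = gw (take q w @ x @ drop (q + length x) w)" by (rule arg_cong)
  also have "\<dots> = gw (take q w @ y @ drop (q + length x) w)" using gw_rule[OF 1(1)] by (simp add: gw_append)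
  finally show ?thesis using Some by (simp add: rewrite_at_def xy)
qed

lemma gw_fold_rewrite_at: "gw (fold rewrite_at ps w) = gw w"
  by (induction ps arbitrary: w) (simp_all add: gw_rewrite_at)

lemma coset_decompose:
  assumes tab: "coset_table j R tab" and w: "w \<in> H (Suc j)"
  shows "\<exists>v\<in>H j. \<exists>r\<in>set R. w = v \<otimes> gw r"
proof -
  have "\<exists>v\<in>H j. \<exists>r\<in>gw ` set R. w = v \<otimes> r"
  proof (rule H_decompose[OF _ _ _ w])
    have "[] \<in> set R" using tab by (simp add: coset_table_def)
    then show "\<one> \<in> gw ` set R" by (metis gw_simps(1) image_eqI)
    show "gw ` set R \<subseteq> carrier W" by auto
    fix x i assume "x \<in> gw ` set R" "i \<le> j"
    then obtain r where r: "r \<in> set R" "x = gw r" by blast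
    obtain ps where ps: "coset_step j R r i ps" using coset_tableD[OF tab r(1) \<open>i \<le> j\<close>] by blast
    let ?w = "fold rewrite_at ps (r @ [i])"
    have x: "x \<otimes> g i = gw ?w" unfolding gw_fold_rewrite_at by (simp add: gw_append r(2))
    from ps consider "?w \<in> set R" | "?w \<noteq> []" "hd ?w < j" "tl ?w \<in> set R"
      unfolding coset_step_def Let_def by blast
    then show "\<exists>v\<in>H j. \<exists>r'\<in>gw ` set R. x \<otimes> g i = v \<otimes> r'"
    proof cases
      case 1
      then show ?thesis using H_one x by (intro bexI[of _ \<one>] bexI[of _ "gw ?w"]) simp_all
    next
      case 2
      then have "?w = hd ?w # tl ?w" by simp
      then have "x \<otimes> g i = g (hd ?w) \<otimes> gw (tl ?w)" unfolding x by (metis gw_simps(2))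
      then show ?thesis using H_gen[OF 2(2)] 2(3) by blast
    qed
  qed
  then show ?thesis by blast
qed

text \<open>Three coset decompositions in succession, down to the trivial subgroup.\<close>

lemma carrier_words: "carrier W = gw ` set all_words"
proof
  show "carrier W \<subseteq> gw ` set all_words"
  proof
    fix w assume "w \<in> carrier W"
    then have "w \<in> H (Suc 2)" using H_full by (simp add: numeral_3_eq_3 numeral_2_eq_2)
    then obtain v2 c where c: "v2 \<in> H 2" "c \<in> set reps2" "w = v2 \<otimes> gw c"
      using coset_decompose[OF coset_table2] by blast
    have "v2 \<in> H (Suc 1)" using c(1) by (simp add: numeral_2_eq_2)
    then obtain v1 b where b: "v1 \<in> H 1" "b \<in> set reps1" "v2 = v1 \<otimes> gw b"
      using coset_decompose[OF coset_table1] by blast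
    have "v1 \<in> H (Suc 0)" using b(1) by simp
    then obtain v0 a where a: "v0 \<in> H 0" "a \<in> set reps0" "v1 = v0 \<otimes> gw a"
      using coset_decompose[OF coset_table0] by blast
    have "v0 = \<one>" using a(1) by (auto simp: H_def)
    then have "w = gw (a @ b @ c)" using a b c by (simp add: gw_append m_assoc)
    moreover have "a @ b @ c \<in> set all_words" using a b c unfolding all_words_def by auto
    ultimately show "w \<in> gw ` set all_words" by blast
  qed
qed auto

end

section \<open>The absolute order in the model of \<open>H_3\<close>\<close>

lemma mul_cancel: "mul p (inv5 p) = id5 \<Longrightarrow> mul p (mul (inv5 p) q) = q"
  "mul (inv5 p) p = id5 \<Longrightarrow> mul (inv5 p) (mul p q) = q"
  by (simp_all add: mul_assoc[symmetric] mul_id del: mul.simps)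

lemma mulP_fst_snd: "fst (mulP x y) = mul (fst x) (fst y)" "snd (mulP x y) \<longleftrightarrow> snd x \<noteq> snd y"
  by (cases x; cases y; simp del: mul.simps)+

text \<open>Odd and even elements have the same permutation parts, so the list is a full product
  with the sign.\<close>

lemma elements_iff: "q \<in> set elements \<longleftrightarrow> fst q \<in> set rotations"
proof -
  have "p \<in> set rotations \<longleftrightarrow> (p, False) \<in> set elements" for p
    unfolding rotations_def by force
  moreover have "p \<in> set rotations \<longleftrightarrow> (p, True) \<in> set elements" for p
    using check_odd_elements unfolding sublist_of_def list_all_iff by force
  ultimately show ?thesis by (cases q; cases "snd q") auto
qed

text \<open>Type \<open>H\<^sub>3\<close> with a prescribed Coxeter element, identified with \<open>A\<^sub>5 \<times> \<int>/2\<close>; the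
  reflections are the pairs of a double transposition and the nontrivial sign.\<close>

locale h3_model = refl_group W s for W :: "('g, 'b) monoid_scheme" (structure) and s :: "'n::finite \<Rightarrow> 'g" +
  fixes rho :: "'g \<Rightarrow> h3" and c :: 'g
  assumes rho_mult: "x \<in> carrier W \<Longrightarrow> y \<in> carrier W \<Longrightarrow> rho (x \<otimes> y) = mulP (rho x) (rho y)"
    and rho_bij: "bij_betw rho (carrier W) (set elements)"
    and rho_T: "rho ` T = {(p, True) | p. p \<in> set involutions}"
    and c_closed: "c \<in> carrier W"
    and rho_c: "rho c = (cox5, True)"
begin

lemma rho_eq_iff: "x \<in> carrier W \<Longrightarrow> y \<in> carrier W \<Longrightarrow> rho x = rho y \<longleftrightarrow> x = y"
  using rho_bij by (auto simp: bij_betw_def inj_on_eq_iff)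

lemma rho_rotation: "x \<in> carrier W \<Longrightarrow> fst (rho x) \<in> set rotations"
  using bij_betwE[OF rho_bij] elements_iff by blast

lemma inv5: "p \<in> set rotations \<Longrightarrow> mul p (inv5 p) = id5"
  using check_rotations unfolding list_all_iff by blast

lemma rho_one: "rho \<one> = oneP"
proof -
  obtain p b where pb: "rho \<one> = (p, b)" by (cases "rho \<one>")
  have e: "mul p p = p" "\<not> b" using rho_mult[of \<one> \<one>] unfolding r_one[OF one_closed] pb by (auto split: if_splits)
  have "p \<in> set rotations" using rho_rotation[of \<one>] pb by simp
  from inv5[OF this] have "mul (mul p p) (inv5 p) = id5" unfolding e(1) .
  then show ?thesis unfolding mul_assoc inv5[OF \<open>p \<in> set rotations\<close>] mul_id using pb e(2) by simp
qed

lemma rho_inv: "x \<in> carrier W \<Longrightarrow> rho (inv x) = (inv5 (fst (rho x)), snd (rho x))"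
proof -
  assume x: "x \<in> carrier W"
  have "rho (inv x) = mulP (rho (inv x)) (mulP (rho x) (inv5 (fst (rho x)), snd (rho x)))"
    using inv5[OF rho_rotation[OF x]] by (cases "rho x") (simp add: mulP_one(2) del: mul.simps)
  also have "\<dots> = mulP (rho (inv x \<otimes> x)) (inv5 (fst (rho x)), snd (rho x))"
    using rho_mult[of "inv x" x] x by (simp add: mulP_assoc del: mulP.simps)
  also have "rho (inv x \<otimes> x) = oneP" using x rho_one by simp
  finally show ?thesis by (simp only: mulP_one(1))
qed

sublocale parity_group W s "\<lambda>w. snd (rho w)"
proof
  show "snd (rho (s i))" for i
  proof -
    have "rho (s i) \<in> rho ` T" using s_T by blast
    then show ?thesis unfolding rho_T by auto
  qed
qed (simp add: rho_mult mulP_fst_snd del: mulP.simps)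

abbreviation rot :: "'g \<Rightarrow> perm5" where "rot w \<equiv> fst (rho w)"
abbreviation par :: "'g \<Rightarrow> bool" where "par w \<equiv> snd (rho w)"

lemma involutions_iff: "p \<in> set involutions \<longleftrightarrow> p \<in> set rotations \<and> invol p"
  by (auto simp: involutions_def)

lemma T_iff: "x \<in> carrier W \<Longrightarrow> x \<in> T \<longleftrightarrow> par x \<and> invol (rot x)"
proof -
  assume x: "x \<in> carrier W"
  have "x \<in> T \<longleftrightarrow> rho x \<in> rho ` T"
    using x T_closed rho_eq_iff by blast
  also have "\<dots> \<longleftrightarrow> par x \<and> rot x \<in> set involutions" unfolding rho_T by (cases "rho x") auto
  finally show ?thesis using rho_rotation[OF x] involutions_iff by blast
qed

lemma one_iff: "x \<in> carrier W \<Longrightarrow> x = \<one> \<longleftrightarrow> \<not> par x \<and> rot x = id5"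
  using rho_eq_iff[of x \<one>] rho_one by (cases "rho x") auto

lemma lift_involution: "t \<in> set involutions \<Longrightarrow> \<exists>x\<in>T. rho x = (t, True)"
proof -
  assume "t \<in> set involutions"
  then have "(t, True) \<in> rho ` T" unfolding rho_T by simp
  then show ?thesis by force
qed

lemma rotation_facts:
  assumes "w \<in> carrier W" "rot w \<noteq> id5"
  shows "\<exists>t\<in>set involutions. invol (mul (rot w) t)" "\<exists>t\<in>set involutions. \<not> invol (mul (rot w) t)"
    "\<exists>t\<in>set (below (rot w)). \<exists>r\<in>set (below (rot w)). t \<noteq> r" "joins (rot w) = [] \<or> (\<exists>u. joins (rot w) = [u])"
proof -
  have "rot w \<in> set rotations" by (rule rho_rotation[OF assms(1)])
  then have *: "list_ex (\<lambda>t. invol (mul (rot w) t)) involutions" "list_ex (\<lambda>t. \<not> invol (mul (rot w) t)) involutions"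
    "case below (rot w) of t # r # ts \<Rightarrow> t \<noteq> r | _ \<Rightarrow> False"
    "case joins (rot w) of [] \<Rightarrow> True | u # us \<Rightarrow> us = []"
    using check_rotations assms(2) unfolding list_all_iff by blast+
  show "\<exists>t\<in>set involutions. invol (mul (rot w) t)" "\<exists>t\<in>set involutions. \<not> invol (mul (rot w) t)"
    using *(1,2) unfolding list_ex_iff by blast+
  show "\<exists>t\<in>set (below (rot w)). \<exists>r\<in>set (below (rot w)). t \<noteq> r"
    using *(3) by (auto split: list.splits)
  show "joins (rot w) = [] \<or> (\<exists>u. joins (rot w) = [u])"
    using *(4) by (auto split: list.splits)
qed

lemma length_even: "w \<in> carrier W \<Longrightarrow> \<not> par w \<Longrightarrow> w \<noteq> \<one> \<Longrightarrow> abs_length W s w = 2"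
proof -
  assume w: "w \<in> carrier W" "\<not> par w" "w \<noteq> \<one>"
  then have "rot w \<noteq> id5" using one_iff by blast
  from rotation_facts(1)[OF w(1) this] obtain t where t: "t \<in> set involutions" "invol (mul (rot w) t)" by blast
  then obtain x where x: "x \<in> T" "rho x = (t, True)" using lift_involution by blast
  have xc: "x \<in> carrier W" by (rule T_closed[OF x(1)])
  have "w \<otimes> x \<in> T" using T_iff[of "w \<otimes> x"] w xc x t by (simp add: rho_mult mulP_fst_snd del: mulP.simps mul.simps)
  moreover have "w \<otimes> x \<otimes> x = w" using w(1) xc T_invol[OF x(1)] by (simp add: m_assoc)
  ultimately show ?thesis using abs_length_two[of "w \<otimes> x" x] x(1) w(3) by simp
qed

text \<open>A further simple reflection turns \<open>w\<close> into a nontrivial rotation, of length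
  2, so the length is at most 3. Parity leaves 1 and 3, and length 1 would make \<open>w\<close> a
  reflection.\<close>

lemma length_odd: "w \<in> carrier W \<Longrightarrow> par w \<Longrightarrow> w \<notin> T \<Longrightarrow> abs_length W s w = 3"
proof -
  assume w: "w \<in> carrier W" "par w" "w \<notin> T"
  \<comment> \<open>Any simple reflection will do; types are nonempty.\<close>
  obtain i :: 'n where True by blast
  let ?v = "w \<otimes> s i"
  have v: "?v \<in> carrier W" using w by simp
  have "\<not> par ?v" using par_mult[OF w(1) s_closed] par_s w(2) by blast
  moreover have "?v \<noteq> \<one>"
  proof
    assume "?v = \<one>"
    then have "w = s i" using w(1) inv_equality[of w "s i"] inv_s by simp
    then show False using w(3) s_T by blast
  qed
  ultimately have "abs_length W s ?v = 2" using length_even v by blast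
  then obtain ts where ts: "length ts = 2" "set ts \<subseteq> T" "lm ts = ?v" using abs_length_ex[OF v] by metis
  have "lm (ts @ [s i]) = w"
    using lm_append[of ts "[s i]"] ts T_closed w(1) s_invol[of i] by (auto simp: m_assoc)
  then have le: "abs_length W s w \<le> 3" using abs_length_le[of "ts @ [s i]" w] ts s_T by simp
  have "abs_length W s w \<noteq> 1"
  proof
    assume "abs_length W s w = 1"
    then obtain us where us: "length us = 1" "set us \<subseteq> T" "lm us = w" using abs_length_ex[OF w(1)] by metis
    then obtain t where "us = [t]" by (auto simp: length_Suc_conv)
    then show False using us w(3) T_closed by auto
  qed
  moreover have "odd (abs_length W s w)" using par_abs_length[OF w(1)] w(2) by simp
  moreover have "l = 3" if "l \<le> 3" "odd l" "l \<noteq> 1" for l :: nat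
  proof -
    have "l = 0 \<or> l = 1 \<or> l = 2 \<or> l = 3" using that(1) by linarith
    then show ?thesis using that(2,3) by auto
  qed
  ultimately show ?thesis using le by blast
qed

lemma T_length_iff: "w \<in> carrier W \<Longrightarrow> w \<in> T \<longleftrightarrow> abs_length W s w = 1"
  using abs_length_T length_even length_odd abs_length_one by (cases "par w"; cases "w = \<one>") fastforce+

text \<open>Removing a reflection from an element of length 3 leaves a nontrivial rotation, and
  these all have length 2.\<close>

lemma T_le_odd: "t \<in> T \<Longrightarrow> w \<in> carrier W \<Longrightarrow> par w \<Longrightarrow> w \<notin> T \<Longrightarrow> abs_le W s t w"
proof -
  assume t: "t \<in> T" and w: "w \<in> carrier W" "par w" "w \<notin> T"
  have tc: "t \<in> carrier W" by (rule T_closed[OF t])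
  have "\<not> par (w \<otimes> inv t)" using par_mult[OF w(1) tc] par_T[OF t] w(2) inv_T[OF t] by simp
  moreover have "w \<otimes> inv t \<noteq> \<one>"
  proof
    assume "w \<otimes> inv t = \<one>"
    then have "w = t" using w(1) tc by (metis inv_equality inv_inv inv_closed)
    then show False using w(3) t by blast
  qed
  ultimately show ?thesis
    unfolding abs_le_def using length_even[of "w \<otimes> inv t"] length_odd[OF w] abs_length_T[OF t] w(1) tc by simp
qed

lemma T_le_even:
  assumes "t \<in> T" "w \<in> carrier W" "\<not> par w" "w \<noteq> \<one>"
  shows "abs_le W s t w \<longleftrightarrow> rot t \<in> set (below (rot w))"
proof -
  have tc: "t \<in> carrier W" by (rule T_closed[OF assms(1)])
  have "abs_le W s t w \<longleftrightarrow> abs_length W s (w \<otimes> t) = 1"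
    unfolding abs_le_def inv_T[OF assms(1)] using length_even[OF assms(2-4)] abs_length_T[OF assms(1)] by auto
  also have "\<dots> \<longleftrightarrow> w \<otimes> t \<in> T" using T_length_iff assms(2) tc by simp
  also have "\<dots> \<longleftrightarrow> invol (mul (rot w) (rot t))"
    using T_iff[of "w \<otimes> t"] assms(2,3) tc par_T[OF assms(1)] by (simp add: rho_mult mulP_fst_snd del: mulP.simps mul.simps)
  moreover have "rot t \<in> set involutions" using T_iff[OF tc] assms(1) rho_rotation[OF tc] involutions_iff by blast
  ultimately show ?thesis by (simp add: below_def)
qed

lemma c_par: "par c" "c \<notin> T"
proof -
  show "par c" by (simp add: rho_c)
  show "c \<notin> T" using T_iff[OF c_closed] by (simp add: rho_c invol_def)
qed

lemma T_le_c: "t \<in> T \<Longrightarrow> abs_le W s t c"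
  using T_le_odd c_closed c_par by blast

lemma le_c_odd: "v \<in> carrier W \<Longrightarrow> abs_le W s v c \<Longrightarrow> par v \<Longrightarrow> v \<notin> T \<Longrightarrow> v = c"
proof -
  assume v: "v \<in> carrier W" "abs_le W s v c" "par v" "v \<notin> T"
  have "abs_length W s (c \<otimes> inv v) = 0"
    using v(2) length_odd[OF v(1,3,4)] length_odd[OF c_closed c_par] unfolding abs_le_def by simp
  then have "c \<otimes> inv v = \<one>" using abs_length_zero c_closed v(1) by simp
  then show "v = c" using c_closed v(1) by (metis inv_equality inv_inv inv_closed)
qed

lemma le_c_even:
  assumes "v \<in> carrier W" "\<not> par v" "v \<noteq> \<one>"
  shows "abs_le W s v c \<longleftrightarrow> rot v \<in> set nc_rotations"
proof -
  have "abs_le W s v c \<longleftrightarrow> abs_length W s (c \<otimes> inv v) = 1"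
    unfolding abs_le_def length_even[OF assms] length_odd[OF c_closed c_par] by auto
  also have "\<dots> \<longleftrightarrow> c \<otimes> inv v \<in> T" using T_length_iff assms(1) c_closed by simp
  also have "\<dots> \<longleftrightarrow> (\<exists>t\<in>T. c = t \<otimes> v)"
  proof
    assume "c \<otimes> inv v \<in> T"
    moreover have "c = (c \<otimes> inv v) \<otimes> v" using c_closed assms(1) by (simp add: m_assoc)
    ultimately show "\<exists>t\<in>T. c = t \<otimes> v" by blast
  next
    assume "\<exists>t\<in>T. c = t \<otimes> v"
    then obtain t where t: "t \<in> T" "c = t \<otimes> v" by blast
    then have "c \<otimes> inv v = t" using assms(1) T_closed by (simp add: m_assoc)
    then show "c \<otimes> inv v \<in> T" using t(1) by simp
  qed
  also have "\<dots> \<longleftrightarrow> (\<exists>t\<in>T. v = t \<otimes> c)"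
  proof -
    have "c = t \<otimes> v \<longleftrightarrow> v = t \<otimes> c" if "t \<in> T" for t
      using T_invol[OF that] T_closed[OF that] c_closed assms(1)
      by (metis m_assoc l_one)
    then show ?thesis by blast
  qed
  also have "\<dots> \<longleftrightarrow> rot v \<in> set nc_rotations"
  proof
    assume "\<exists>t\<in>T. v = t \<otimes> c"
    then obtain t where t: "t \<in> T" "v = t \<otimes> c" by blast
    have "rot t \<in> set involutions" using T_iff[OF T_closed] t(1) rho_rotation[OF T_closed] involutions_iff by blast
    moreover have "rot v = mul (rot t) cox5"
      using t T_closed c_closed by (simp add: rho_mult mulP_fst_snd rho_c del: mulP.simps mul.simps)
    ultimately show "rot v \<in> set nc_rotations" by (simp add: nc_rotations_def del: mul.simps)
  next
    assume "rot v \<in> set nc_rotations"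
    then obtain p where p: "p \<in> set involutions" "rot v = mul p cox5" by (auto simp: nc_rotations_def simp del: mul.simps)
    obtain t where t: "t \<in> T" "rho t = (p, True)" using lift_involution[OF p(1)] by blast
    have "rho v = rho (t \<otimes> c)"
      using t p assms T_closed c_closed by (cases "rho v") (simp add: rho_mult rho_c del: mul.simps)
    then show "\<exists>t\<in>T. v = t \<otimes> c" using rho_eq_iff assms(1) t(1) T_closed c_closed by blast
  qed
  finally show ?thesis .
qed

text \<open>All reflections lie below \<open>w\<close>, and in the interval only \<open>c\<close> is
  above all of them: a reflection is above no other reflection, and a nontrivial rotation misses
  one.\<close>

lemma nc_proj_odd:
  assumes "w \<in> carrier W" "par w" "w \<notin> T"
  shows "nc_proj W s c w = c"
proof (rule nc_proj_eqI[OF assms(1)])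
  fix v assume v: "v \<in> carrier W" "abs_le W s v c" and up: "\<And>t. t \<in> T \<Longrightarrow> abs_le W s t w \<Longrightarrow> abs_le W s t v"
  have up: "abs_le W s t v" if "t \<in> T" for t using up[OF that T_le_odd[OF that assms]] .
  have s: "rot c \<noteq> id5" by (simp add: rho_c)
  have v1: "v \<noteq> \<one>" using up[OF s_T] abs_le_T_one[OF s_T] by blast
  moreover have "v \<notin> T"
  proof
    assume vT: "v \<in> T"
    obtain t r where "t \<in> set (below (rot c))" "r \<in> set (below (rot c))" "t \<noteq> r"
      using rotation_facts(3)[OF c_closed s] by blast
    moreover have "set (below (rot c)) \<subseteq> set involutions" by (auto simp: below_def)
    ultimately obtain x y where "x \<in> T" "y \<in> T" "rho x = (t, True)" "rho y = (r, True)" "t \<noteq> r"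
      using lift_involution by blast
    then show False using up[of x] up[of y] abs_le_T_T[OF _ vT] by auto
  qed
  moreover have "par v"
  proof (rule ccontr)
    assume np: "\<not> par v"
    then have "rot v \<noteq> id5" using one_iff v(1) v1 by blast
    from rotation_facts(2)[OF v(1) this] obtain t where t: "t \<in> set involutions" "\<not> invol (mul (rot v) t)" by blast
    obtain x where x: "x \<in> T" "rho x = (t, True)" using lift_involution[OF t(1)] by blast
    then have "t \<in> set (below (rot v))" using T_le_even[OF x(1) v(1) np v1] up by simp
    then show False using t(2) by (simp add: below_def)
  qed
  ultimately have "v = c" using le_c_odd v by blast
  then show "abs_le W s c v" using abs_le_refl c_closed by simp
qed (use T_le_c c_closed abs_le_refl in auto)

text \<open>Two different reflections lie below \<open>w\<close>. An upper bound in the interval is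
  therefore neither trivial nor a reflection, which leaves \<open>c\<close> and the rotations listed
  in \<open>joins\<close>.\<close>

lemma nc_proj_even:
  assumes w: "w \<in> carrier W" "\<not> par w" "w \<noteq> \<one>"
  shows "joins (rot w) = [] \<Longrightarrow> nc_proj W s c w = c"
    and "joins (rot w) = [p] \<Longrightarrow> u \<in> carrier W \<Longrightarrow> rho u = (p, False) \<Longrightarrow> nc_proj W s c w = u"
proof -
  have w1: "rot w \<noteq> id5" using one_iff w by blast
  have cases: "v = c \<or> \<not> par v \<and> v \<noteq> \<one> \<and> rot v \<in> set (joins (rot w))"
    if v: "v \<in> carrier W" "abs_le W s v c" and up: "\<And>t. t \<in> T \<Longrightarrow> abs_le W s t w \<Longrightarrow> abs_le W s t v" for v
  proof -
    have up: "abs_le W s t v" if "t \<in> T" "rot t \<in> set (below (rot w))" for t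
      using up[OF that(1)] T_le_even[OF that(1) w] that(2) by blast
    obtain t r where tr: "t \<in> set (below (rot w))" "r \<in> set (below (rot w))" "t \<noteq> r"
      using rotation_facts(3)[OF w(1) w1] by blast
    moreover have sub: "set (below (rot w)) \<subseteq> set involutions" by (auto simp: below_def)
    ultimately obtain x y where xy: "x \<in> T" "y \<in> T" "rho x = (t, True)" "rho y = (r, True)"
      using lift_involution by blast
    have le: "abs_le W s x v" "abs_le W s y v" using up xy tr by auto
    have v1: "v \<noteq> \<one>" using le(1) abs_le_T_one[OF xy(1)] by blast
    have vT: "v \<notin> T" using le abs_le_T_T xy tr(3) by auto
    show ?thesis
    proof (cases "par v")
      case True
      then show ?thesis using le_c_odd v vT by blast
    next
      case False
      have "invol (mul (rot v) q)" if q: "q \<in> set (below (rot w))" for q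
      proof -
        obtain z where z: "z \<in> T" "rho z = (q, True)" using lift_involution q sub by blast
        then have "q \<in> set (below (rot v))" using T_le_even[OF z(1) v(1) False v1] up[OF z(1)] q by simp
        then show ?thesis by (simp add: below_def)
      qed
      then have "rot v \<in> set (joins (rot w))"
        using le_c_even[OF v(1) False v1] v(2) by (simp add: joins_def list_all_iff)
      then show ?thesis using False v1 by blast
    qed
  qed
  show "nc_proj W s c w = c" if J: "joins (rot w) = []"
    proof (rule nc_proj_eqI[OF w(1)])
      show "abs_le W s c v" if "v \<in> carrier W" "abs_le W s v c"
        "\<And>t. t \<in> T \<Longrightarrow> abs_le W s t w \<Longrightarrow> abs_le W s t v" for v
        using cases[OF that] J abs_le_refl c_closed by auto
    qed (use T_le_c c_closed abs_le_refl in auto)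
  show "nc_proj W s c w = u" if J: "joins (rot w) = [p]" and u: "u \<in> carrier W" "rho u = (p, False)"
  proof -
    have p: "p \<in> set (joins (rot w))" using J by simp
    then have pn: "p \<in> set nc_rotations" by (simp add: joins_def)
    then have "p \<noteq> id5" using check_nc_rotations unfolding list_all_iff by blast
    then have u1: "u \<noteq> \<one>" "\<not> par u" using u one_iff by auto
    have uc: "abs_le W s u c" using le_c_even[OF u(1) u1(2,1)] pn u(2) by simp
    show ?thesis
    proof (rule nc_proj_eqI[OF w(1)])
      show "abs_le W s t u" if t: "t \<in> T" "abs_le W s t w" for t
      proof -
        have "rot t \<in> set (below (rot w))" using T_le_even[OF t(1) w] t(2) by blast
        then have "rot t \<in> set (below p)" using p by (auto simp: joins_def list_all_iff below_def)
        then show ?thesis using T_le_even[OF t(1) u(1) u1(2,1)] u(2) by simp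
      qed
      show "abs_le W s u v" if v: "v \<in> carrier W" "abs_le W s v c"
        "\<And>t. t \<in> T \<Longrightarrow> abs_le W s t w \<Longrightarrow> abs_le W s t v" for v
        using cases[OF v]
      proof
        assume "\<not> par v \<and> v \<noteq> \<one> \<and> rot v \<in> set (joins (rot w))"
        then have "rho v = rho u" using J u(2) by (cases "rho v") simp
        then have "v = u" using rho_eq_iff v(1) u(1) by blast
        then show ?thesis using abs_le_refl u(1) by simp
      next
        assume "v = c"
        then show ?thesis using uc by (simp only:)
      qed
    qed (use T_le_c u(1) uc in auto)
  qed
qed

lemma rho_mult_inv: "x \<in> carrier W \<Longrightarrow> y \<in> carrier W \<Longrightarrow>
    rho (x \<otimes> inv y) = (mul (rot x) (inv5 (rot y)), par x \<noteq> par y)"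
  by (cases "rho x"; cases "rho y") (auto simp: rho_mult rho_inv simp del: mul.simps)

lemma Pop_step: "w \<in> carrier W \<Longrightarrow> Pop W s c w \<in> carrier W \<and> rho (Pop W s c w) = pop5 (rho w)"
proof -
  assume w: "w \<in> carrier W"
  consider "w \<in> T" | "par w" "w \<notin> T" | "w = \<one>" | "\<not> par w" "w \<noteq> \<one>" by blast
  then show ?thesis
  proof cases
    case 1
    then have "pop5 (rho w) = oneP" using T_iff[OF w] by (simp add: pop5_def)
    then show ?thesis using Pop_T[OF 1 T_le_c[OF 1]] rho_one by simp
  next
    case 2
    then have "pop5 (rho w) = (mul (rot w) (inv5 cox5), False)" using T_iff[OF w] by (simp add: pop5_def)
    then show ?thesis
      unfolding Pop_def nc_proj_odd[OF w 2] using rho_mult_inv[OF w c_closed] w c_closed 2 by (simp add: rho_c)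
  next
    case 3
    then show ?thesis using Pop_one[OF c_closed] rho_one by (simp add: pop5_def)
  next
    case 4
    have w1: "rot w \<noteq> id5" using one_iff w 4 by blast
    from rotation_facts(4)[OF w w1] show ?thesis
    proof (elim disjE exE)
      assume J: "joins (rot w) = []"
      then have "pop5 (rho w) = (mul (rot w) (inv5 cox5), True)" using 4(1) w1 by (simp add: pop5_def)
      then show ?thesis
        unfolding Pop_def nc_proj_even(1)[OF w 4 J] using rho_mult_inv[OF w c_closed] w c_closed 4 by (simp add: rho_c)
    next
      fix p assume J: "joins (rot w) = [p]"
      then have "p \<in> set (joins (rot w))" by simp
      then obtain t where t: "t \<in> set involutions" "p = mul t cox5"
        by (auto simp: joins_def nc_rotations_def simp del: mul.simps)
      obtain x where x: "x \<in> T" "rho x = (t, True)" using lift_involution[OF t(1)] by blast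
      define u where "u = x \<otimes> c"
      have u: "u \<in> carrier W" "rho u = (p, False)"
        using T_closed[OF x(1)] c_closed t(2) x(2) by (simp_all add: u_def rho_mult rho_c del: mul.simps)
      have "pop5 (rho w) = (mul (rot w) (inv5 p), False)" using 4(1) w1 J by (simp add: pop5_def)
      then show ?thesis
        unfolding Pop_def nc_proj_even(2)[OF w 4 J u] using rho_mult_inv[OF w u(1)] w u 4 by simp
    qed
  qed
qed

lemma Pop_funpow: "w \<in> carrier W \<Longrightarrow> (Pop W s c ^^ j) w \<in> carrier W \<and> rho ((Pop W s c ^^ j) w) = (pop5 ^^ j) (rho w)"
  by (induction j) (simp_all add: Pop_step)

lemma Pop_funpow_one: "w \<in> carrier W \<Longrightarrow> (Pop W s c ^^ j) w = \<one> \<longleftrightarrow> (pop5 ^^ j) (rho w) = oneP"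
  using Pop_funpow[of w j] rho_eq_iff[of "(Pop W s c ^^ j) w" \<one>] rho_one by simp

lemma rho_inv_c: "rho (inv c) = (inv5 cox5, True)"
  using rho_inv[OF c_closed] by (simp add: rho_c)

lemma pop8: "(pop5 ^^ 8) q = pop8 q"
  by (simp add: eval_nat_numeral)

theorem Pop_conclusion_h3:
  assumes "finite (carrier W)"
  shows "(\<forall>w\<in>carrier W. (Pop W s c ^^ (10 - 1)) w = \<one>)
    \<and> Max {card (forward_orbit (Pop W s c) w) | w. w \<in> carrier W} = 10
    \<and> {forward_orbit (Pop W s c) w | w. w \<in> carrier W \<and> card (forward_orbit (Pop W s c) w) = 10}
        = {forward_orbit (Pop W s c) (inv c)}"
proof (rule forward_orbit_max[OF _ assms])
  have eight: "(10::nat) - 2 = 8" "(10::nat) - 1 = Suc 8" by simp_all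
  have el: "rho w \<in> set elements" if "w \<in> carrier W" for w using bij_betwE[OF rho_bij] that by blast
  have p1: "pop5 oneP = oneP" by (simp add: pop5_def)
  have fast: "(pop5 ^^ 8) (rho w) = oneP" if "w \<in> carrier W" "w \<noteq> inv c" for w
  proof -
    have "rho w \<noteq> (inv5 cox5, True)" using rho_eq_iff[of w "inv c"] that c_closed rho_inv_c by simp
    then show ?thesis using check_pop el[OF that(1)] unfolding list_all_iff pop8 by blast
  qed
  show "inv c \<in> carrier W" using c_closed by simp
  show "Pop W s c \<one> = \<one>" by (rule Pop_one[OF c_closed])
  show "(Pop W s c ^^ (10 - 1)) w = \<one>" if w: "w \<in> carrier W" for w
    proof -
      have "pop5 ((pop5 ^^ 8) (rho w)) = oneP"
      proof (cases "w = inv c")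
        case True
        then show ?thesis using check_pop_cox unfolding pop8 True rho_inv_c by blast
      next
        case False
        show ?thesis unfolding fast[OF w False] by (rule p1)
      qed
      then have "(pop5 ^^ Suc 8) (rho w) = oneP" by (simp only: funpow.simps(2) comp_apply)
      then show ?thesis unfolding eight Pop_funpow_one[OF w] .
    qed
  show "w = inv c" if w: "w \<in> carrier W" "(Pop W s c ^^ (10 - 2)) w \<noteq> \<one>" for w
    using w(2) fast[OF w(1)] unfolding Pop_funpow_one[OF w(1)] eight by blast
  show "(Pop W s c ^^ (10 - 2)) (inv c) \<noteq> \<one>"
    unfolding Pop_funpow_one[OF inv_closed[OF c_closed]] eight rho_inv_c pop8 using check_pop_cox by blast
qed simp

end

text \<open>From \<open>cos (3 * t) = - cos (2 * t)\<close> at \<open>t = pi / 5\<close>, after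
  cancelling the factor that belongs to the root -1.\<close>

lemma golden_cos: "4 * (cos (pi / 5))\<^sup>2 = 2 * cos (pi / 5) + (1::real)"
proof -
  define x where "x = cos (pi / 5)"
  have "cos (3 * (pi / 5)) = - cos (pi - 3 * (pi / 5))" by (simp only: cos_pi_minus minus_minus)
  also have "pi - 3 * (pi / 5) = 2 * (pi / 5)" by simp
  finally have "4 * x ^ 3 - 3 * x = - (2 * x\<^sup>2 - 1)"
    unfolding x_def cos_treble_cos cos_double_cos .
  then have "(x + 1) * (4 * x\<^sup>2 - 2 * x - 1) = 0" by (simp add: algebra_simps power2_eq_square power3_eq_cube)
  moreover have "x > 0" unfolding x_def by (rule cos_gt_zero_pi) (use pi_gt_zero in linarith)+
  ultimately have "4 * x\<^sup>2 - 2 * x - 1 = 0" by simp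
  then show ?thesis unfolding x_def by simp
qed

context h3_coxeter
begin

lemma letters: "f i = 0 \<or> f i = 1 \<or> f i = 2"
  using f_lt[of i] by linarith

lemma gen_relation: "foldr mulP (concat (replicate (m i j) [(gen (f i), True), (gen (f j), True)])) oneP = oneP"
proof -
  have "m i j = (if f i = f j then 1 else if f i + f j = 1 then 5 else if f i + f j = 3 then 3 else 2)"
    using letters[of i] letters[of j] by (elim disjE) (simp_all add: m_eq doubleton_eq_iff)
  moreover have "replicate 5 x = [x, x, x, x, x]" "replicate 3 x = [x, x, x]" "replicate 2 x = [x, x]" for x :: "h3 list"
    by (simp_all add: eval_nat_numeral)
  ultimately show ?thesis using letters[of i] letters[of j] by (elim disjE) (simp_all add: gen_def)
qed

lemma ex_psi:
  obtains psi :: "'g \<Rightarrow> h3" where "\<And>i. psi (s i) = (gen (f i), True)"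
    "\<And>ks. set ks \<subseteq> {..<3} \<Longrightarrow> psi (gw ks) = word_image ks"
    "\<And>x y. x \<in> carrier W \<Longrightarrow> y \<in> carrier W \<Longrightarrow> psi (x \<otimes> y) = mulP (psi x) (psi y)"
proof (rule coxeter_lift[OF sys, where mul = mulP and one = oneP and \<phi> = "\<lambda>i. (gen (f i), True)"])
  fix psi :: "'g \<Rightarrow> h3"
  assume w: "\<And>u. psi (lm (map s u)) = foldr mulP (map (\<lambda>i. (gen (f i), True)) u) oneP"
    and m: "\<And>x y. x \<in> carrier W \<Longrightarrow> y \<in> carrier W \<Longrightarrow> psi (x \<otimes> y) = mulP (psi x) (psi y)"
  have s: "psi (s i) = (gen (f i), True)" for i
    using w[of "[i]"] by (simp add: mulP_one(2) del: mulP.simps)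
  have "psi (gw ks) = word_image ks" if "set ks \<subseteq> {..<3}" for ks
    using that
  proof (induction ks)
    case Nil
    show ?case using w[of "[]"] by (simp add: word_image_def)
  next
    case (Cons k ks)
    then have "psi (g k) = (gen k, True)" by (simp add: g_def s f_idx)
    then show ?case using Cons by (simp add: m word_image_def del: mulP.simps)
  qed
  then show thesis using that s m by blast
qed (simp_all add: mulP_assoc mulP_one gen_relation del: mulP.simps)

text \<open>The permutation part of \<open>c\<close> may lie in either class of 5-cycles, so the
  standard model is conjugated by a permutation of the five points. This conjugation need not come
  from \<open>W\<close>; that it preserves the set of elements is checked on generators, and the
  reflections are identified again afterwards.\<close>

theorem Pop_conclusion_H3:
  assumes fin: "finite (carrier W)" and h: "is_coxeter_number W s m h" and c: "coxeter_element W s m h c"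
  shows "(\<forall>w\<in>carrier W. (Pop W s c ^^ (h - 1)) w = \<one>)
    \<and> Max {card (forward_orbit (Pop W s c) w) | w. w \<in> carrier W} = h
    \<and> {forward_orbit (Pop W s c) w | w. w \<in> carrier W \<and> card (forward_orbit (Pop W s c) w) = h}
        = {forward_orbit (Pop W s c) (inv c)}"
proof -
  have cW: "c \<in> carrier W" and ord: "ord c = h"
    using c by (simp_all add: coxeter_element_def regular_element_def)
  \<comment> \<open>The equations at the two end vertices determine the eigenvector up to scale; the
    one at the middle vertex is then the golden ratio identity for
    \<open>cos (pi / 5)\<close>.\<close>
  have h10: "h \<ge> 10"
  proof (rule coxeter_number_ge_eigen[OF fin h,
        where a = "\<lambda>j. if j = 0 then 2 * cos (pi / 5) else if j = 1 then 2 * cos (pi / 10) else 1"])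
    fix j :: nat assume j: "j < 3"
    have dbl: "2 * (cos (pi / 10))\<^sup>2 = 1 + cos (pi / 5)"
      using cos_double_cos[of "pi / 10"] by simp
    have "j = 0 \<or> j = 1 \<or> j = 2" using j by linarith
    then show "(if Suc j < 3 then edge j * (if Suc j = 0 then 2 * cos (pi / 5) else if Suc j = 1 then 2 * cos (pi / 10) else 1) else 0)
      + (if j > 0 then edge (j - 1) * (if j - 1 = 0 then 2 * cos (pi / 5) else if j - 1 = 1 then 2 * cos (pi / 10) else 1) else 0)
      = cos (pi / real 10) * (if j = 0 then 2 * cos (pi / 5) else if j = 1 then 2 * cos (pi / 10) else 1)"
    proof (elim disjE)
      assume "j = 1"
      then show ?thesis using golden_cos dbl by (simp add: edge_def power2_eq_square)
    qed (simp_all add: edge_def)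
  next
    have "cos (pi / 5) > 0" by (rule cos_gt_zero_pi) (use pi_gt_zero in linarith)+
    then show "(if (0::nat) = 0 then 2 * cos (pi / 5) else if (0::nat) = 1 then 2 * cos (pi / 10) else 1) \<noteq> 0" by simp
  qed simp
  obtain psi :: "'g \<Rightarrow> h3" where psi_s: "\<And>i. psi (s i) = (gen (f i), True)"
    and psi_gw: "\<And>ks. set ks \<subseteq> {..<3} \<Longrightarrow> psi (gw ks) = word_image ks"
    and psi_mult: "\<And>x y. x \<in> carrier W \<Longrightarrow> y \<in> carrier W \<Longrightarrow> psi (x \<otimes> y) = mulP (psi x) (psi y)"
    using ex_psi by blast
  have psi_one: "psi \<one> = oneP" using psi_gw[of "[]"] by (simp add: word_image_def)
  have "list_all (list_all (\<lambda>k. k < 3)) all_words" by code_simp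
  then have small: "set ks \<subseteq> {..<3}" if "ks \<in> set all_words" for ks
    using that by (auto simp: list_all_iff)
  have inj: "inj_on psi (carrier W)"
  proof (rule inj_onI)
    fix x y assume xy: "x \<in> carrier W" "y \<in> carrier W" "psi x = psi y"
    then obtain a b where ab: "a \<in> set all_words" "b \<in> set all_words" "x = gw a" "y = gw b"
      unfolding carrier_words by blast
    have "inj_on word_image (set all_words)" using distinct_elements unfolding elements_def distinct_map by blast
    moreover have "word_image a = word_image b" using xy(3) ab psi_gw small by simp
    ultimately show "x = y" using ab by (simp add: inj_on_eq_iff)
  qed
  have img: "psi ` carrier W = set elements"
    unfolding carrier_words elements_def image_image set_map using psi_gw small by (intro image_cong) auto
  have psi_pow: "psi (c [^] j) = foldr mulP (replicate j (psi c)) oneP" for j :: nat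
  proof (induction j)
    case (Suc j)
    have "psi (c [^] Suc j) = mulP (psi c) (psi (c [^] j))"
      unfolding nat_pow_Suc2[OF cW] using cW by (intro psi_mult) simp_all
    then show ?case using Suc by simp
  qed (simp add: psi_one)
  have no_pow: "foldr mulP (replicate j (psi c)) oneP \<noteq> oneP" if "0 < j" "j < 10" for j
  proof
    assume "foldr mulP (replicate j (psi c)) oneP = oneP"
    then have "psi (c [^] j) = psi \<one>" unfolding psi_pow psi_one .
    then have "c [^] j = \<one>" using inj_onD[OF inj] cW by simp
    then have "h dvd j" using pow_eq_id[OF cW] ord by simp
    then show False using that h10 by (auto dest: dvd_imp_le)
  qed
  have rep: "replicate 6 x = [x, x, x, x, x, x]" "replicate 5 x = [x, x, x, x, x]"
    "replicate 10 x = [x, x, x, x, x, x, x, x, x, x]" for x :: h3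
    by (simp_all add: eval_nat_numeral)
  define e where "e = relabel (fst (psi c))"
  have "psi c \<in> set elements" using img cW by blast
  then have "foldr mulP (replicate 10 (psi c)) oneP = oneP" "snd (psi c)" "good_relabel (fst (psi c)) e"
    using check_relabel no_pow[of 6] no_pow[of 5] unfolding list_all_iff rep e_def by auto
  then have "psi (c [^] (10::nat)) = psi \<one>" and sc: "snd (psi c)" and e: "mul e (inv5 e) = id5" "mul (inv5 e) e = id5"
    "mul (inv5 e) (mul (fst (psi c)) e) = cox5"
    and e_gen: "\<And>j. j < 3 \<Longrightarrow> mul (inv5 e) (mul (gen j) e) \<in> set rotations"
    unfolding psi_pow psi_one good_relabel_def by (auto simp: less_Suc_eq numeral_3_eq_3 numeral_2_eq_2 simp del: mul.simps)
  then have "c [^] (10::nat) = \<one>" using inj_onD[OF inj] cW by simp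
  then have "h dvd 10" using pow_eq_id[OF cW, of 10] ord by simp
  then have h_eq: "h = 10" using h10 by (auto dest: dvd_imp_le)
  note ec = mul_cancel(1)[OF e(1)] mul_cancel(2)[OF e(2)]
  define rho where "rho w = (mul (inv5 e) (mul (fst (psi w)) e), snd (psi w))" for w
  have rho_mult: "rho (x \<otimes> y) = mulP (rho x) (rho y)" if "x \<in> carrier W" "y \<in> carrier W" for x y
    using psi_mult[OF that] by (cases "psi x"; cases "psi y") (simp add: rho_def mul_assoc ec del: mul.simps)
  have unconj: "fst (psi w) = mul e (mul (fst (rho w)) (inv5 e))" for w
    by (simp add: rho_def mul_assoc e(1) ec mul_id del: mul.simps)
  have rho_inj: "inj_on rho (carrier W)"
  proof (rule inj_onI)
    fix x y assume xy: "x \<in> carrier W" "y \<in> carrier W" "rho x = rho y"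
    have "fst (psi x) = fst (psi y)" unfolding unconj[of x] unconj[of y] xy(3) ..
    moreover have "snd (psi x) = snd (psi y)" using xy(3) by (simp add: rho_def)
    ultimately have "psi x = psi y" by (rule prod_eqI)
    then show "x = y" using inj_onD[OF inj] xy by blast
  qed
  have rot_mul: "mul p q \<in> set rotations" if "p \<in> set rotations" "q \<in> set rotations" for p q
  proof -
    have "(p, False) \<in> psi ` carrier W" "(q, False) \<in> psi ` carrier W" unfolding img using that by (simp_all add: elements_iff)
    then obtain x y where "x \<in> carrier W" "y \<in> carrier W" "psi x = (p, False)" "psi y = (q, False)" by force
    then have "psi (x \<otimes> y) = (mul p q, False)" "x \<otimes> y \<in> carrier W" using psi_mult by simp_all
    then have "(mul p q, False) \<in> set elements" unfolding img[symmetric] by force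
    then show ?thesis by (simp add: elements_iff del: mul.simps)
  qed
  have rho_el: "rho w \<in> set elements" if wc: "w \<in> carrier W" for w
  proof -
    obtain u where u: "lm (map s u) = w" by (rule ex_word[OF wc])
    have "rho (lm (map s u)) \<in> set elements"
    proof (induction u)
      case Nil
      have "oneP \<in> set elements" using psi_one img one_closed by (metis image_eqI)
      moreover have "rho \<one> = oneP" by (simp add: rho_def psi_one mul_id e(2) del: mul.simps)
      ultimately show ?case by simp
    next
      case (Cons i u)
      have "fst (rho (s i)) \<in> set rotations" using e_gen[OF f_lt[of i]] by (simp add: rho_def psi_s)
      then show ?case using Cons rot_mul by (simp add: rho_mult elements_iff mulP_fst_snd del: mul.simps mulP.simps)
    qed
    then show ?thesis using u by simp
  qed
  have rho_bij: "bij_betw rho (carrier W) (set elements)"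
  proof -
    have "card (rho ` carrier W) = card (set elements)"
      unfolding card_image[OF rho_inj] img[symmetric] card_image[OF inj] ..
    then have "rho ` carrier W = set elements" using rho_el by (intro card_subset_eq) auto
    then show ?thesis using rho_inj by (simp add: bij_betw_def)
  qed
  have rho_one: "rho \<one> = oneP" by (simp add: rho_def psi_one mul_id e(2) del: mul.simps)
  have T_rho: "\<exists>p. rho t = (p, True) \<and> p \<in> set involutions" if t: "t \<in> T" for t
  proof -
    obtain v i where vi: "t = v \<otimes> s i \<otimes> inv v" "v \<in> carrier W" using t by (auto simp: reflections_def)
    have tc: "t \<in> carrier W" by (rule T_closed[OF t])
    have tv: "t \<otimes> v = v \<otimes> s i" using vi by (simp add: m_assoc)
    have si: "snd (rho (s i))" by (simp add: rho_def psi_s)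
    have "mulP (rho t) (rho v) = mulP (rho v) (rho (s i))" using tv rho_mult tc vi(2) by (metis s_closed)
    then have p1: "snd (rho t)" using si mulP_fst_snd(2)[of "rho t" "rho v"] mulP_fst_snd(2)[of "rho v" "rho (s i)"] by auto
    have "mulP (rho t) (rho t) = oneP" using rho_mult[OF tc tc] T_invol[OF t] rho_one by simp
    then have p2: "mul (fst (rho t)) (fst (rho t)) = id5" using mulP_fst_snd(1)[of "rho t" "rho t"] by simp
    \<comment> \<open>With trivial permutation part, \<open>t\<close> would commute with the
      conjugating element and hence equal the generator \<open>s i\<close>, whose permutation is not
      trivial.\<close>
    have "fst (rho t) \<noteq> id5"
    proof
      assume id: "fst (rho t) = id5"
      then have "rho (t \<otimes> v) = rho (v \<otimes> t)"
        using p1 vi(2) tc by (cases "rho t"; cases "rho v") (auto simp: rho_mult mul_id simp del: mul.simps)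
      then have "t \<otimes> v = v \<otimes> t" using inj_onD[OF rho_inj] tc vi(2) by simp
      then have "v \<otimes> t = v \<otimes> s i" using tv by simp
      then have "t = s i" using l_cancel[of v t "s i"] tc vi(2) by simp
      then have "fst (psi (s i)) = id5" using unconj[of "s i"] id by (simp add: mul_id e(1) del: mul.simps)
      then show False using letters[of i] by (auto simp: psi_s gen_def)
    qed
    then have "invol (fst (rho t))" using p2 by (simp add: invol_def)
    moreover have "fst (rho t) \<in> set rotations" using rho_el[OF tc] elements_iff by blast
    ultimately show ?thesis using p1 by (cases "rho t") (simp add: involutions_def)
  qed
  have "list_all (\<lambda>(u, i). list_all (\<lambda>k. k < 3) (u @ [i])) refl_words" by code_simp
  then have small2: "set (u @ [i]) \<subseteq> {..<3}" if "(u, i) \<in> set refl_words" for u i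
    using that by (fastforce simp: list_all_iff)
  have rho_T: "rho ` T = {(p, True) | p. p \<in> set involutions}"
  proof (intro equalityI subsetI)
    fix x assume "x \<in> {(p, True) | p. p \<in> set involutions}"
    then obtain p where p: "x = (p, True)" "p \<in> set rotations" "invol p" by (auto simp: involutions_def)
    have "x \<in> rho ` carrier W" using rho_bij p by (simp add: bij_betw_def elements_iff)
    then obtain w where w: "w \<in> carrier W" "rho w = x" by blast
    let ?q = "fst (psi w)"
    have pw: "p = fst (rho w)" using w(2) p(1) by simp
    have "?q \<noteq> id5"
    proof
      assume "?q = id5"
      then have "p = id5" unfolding pw rho_def by (simp add: mul_id e(2) del: mul.simps)
      then show False using p(3) by (simp add: invol_def)
    qed
    moreover have "mul ?q ?q = mul e (mul (mul p p) (inv5 e))"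
      unfolding unconj[of w] pw[symmetric] by (simp add: mul_assoc ec del: mul.simps)
    then have "mul ?q ?q = id5" using p(3) e(1) by (simp add: invol_def mul_id del: mul.simps)
    ultimately have "invol ?q" by (simp add: invol_def)
    moreover have "snd (psi w)" using w(2) p(1) by (simp add: rho_def)
    moreover have "psi w \<in> set elements" using img w(1) by blast
    ultimately have "psi w \<in> set (map (\<lambda>(u, i). word_image (u @ i # rev u)) refl_words)"
      using check_refl_words unfolding list_all_iff by blast
    then obtain u i where ui: "(u, i) \<in> set refl_words" "psi w = word_image (u @ i # rev u)" by auto
    have "psi w = psi (gw (u @ i # rev u))" using psi_gw[of "u @ i # rev u"] small2[OF ui(1)] ui(2) by simp
    then have "w = gw (u @ i # rev u)" using inj_onD[OF inj] w(1) by simp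
    also have "\<dots> = gw u \<otimes> g i \<otimes> inv (gw u)"
    proof -
      have "inv (gw u) = gw (rev u)" unfolding gw_word word_inv rev_map ..
      then show ?thesis by (simp add: gw_append m_assoc)
    qed
    finally have "w \<in> T" using T_conj[OF s_T[of "idx i"] gw_closed[of u]] by (simp add: g_def)
    then show "x \<in> rho ` T" using w(2) by blast
  qed (use T_rho in force)
  interpret M: h3_model W s rho c
    by unfold_locales (use rho_mult rho_bij rho_T cW e(3) sc in \<open>simp_all add: rho_def del: mul.simps\<close>)
  show ?thesis unfolding h_eq by (rule M.Pop_conclusion_h3[OF fin])
qed

end

section \<open>The coincidental types\<close>

lemma linear_type_coxeter:
  fixes s :: "'n::finite \<Rightarrow> 'g"
  assumes "coxeter_system W s m" "linear_type k m" "k \<ge> 3"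
  obtains f where "linear_coxeter W s m f k CARD('n)"
proof -
  obtain f where f: "bij_betw f UNIV {0..<CARD('n)}"
    "\<forall>i j. m i j = (if f i = f j then 1 else if {f i, f j} = {0, 1} then k
       else if f i = Suc (f j) \<or> f j = Suc (f i) then 3 else 2)"
    using assms(2) unfolding linear_type_def by blast
  have "linear_coxeter W s m f k CARD('n)"
    by (intro linear_coxeter.intro assms HOL.refl f(1) spec[OF spec[OF f(2)]])
  then show thesis by (rule that)
qed

theorem theorem5p1:
  fixes W :: "('g, 'b) monoid_scheme"
    and s :: "'n::finite \<Rightarrow> 'g"
    and m :: "'n \<Rightarrow> 'n \<Rightarrow> nat"
    and c :: 'g
    and h :: nat
  assumes "coxeter_system W s m"
    and "finite (carrier W)"
    and "irreducible_coxeter_matrix m"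
    and "coincidental_type m"
    and "is_coxeter_number W s m h"
    and "coxeter_element W s m h c"
  shows "(\<forall>w\<in>carrier W. (Pop W s c ^^ (h - 1)) w = \<one>\<^bsub>W\<^esub>)
    \<and> Max {card (forward_orbit (Pop W s c) w) | w. w \<in> carrier W} = h
    \<and> {forward_orbit (Pop W s c) w | w.
          w \<in> carrier W \<and> card (forward_orbit (Pop W s c) w) = h}
        = {forward_orbit (Pop W s c) (inv\<^bsub>W\<^esub> c)}"
proof -
  note facts = assms(2,5,6)
  let ?n = "CARD('n)"
  have perms: "bij_betw (\<lambda>x. if x < N then N - 1 - x else x) {..<N} {..<N}" for N :: nat
    by (rule bij_betwI[where g = "\<lambda>x. N - 1 - x"]) auto
  consider "linear_type 3 m" | "?n \<ge> 2" "linear_type 4 m" | "?n = 3" "linear_type 5 m"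
    | k where "k \<ge> 3" "?n = 2" "linear_type k m"
    using assms(4) unfolding coincidental_type_def type_A_def type_B_def type_H3_def type_I2_def by blast
  then show ?thesis
  proof cases
    case 1
    obtain f where "linear_coxeter W s m f 3 ?n" using linear_type_coxeter[OF assms(1) 1] by auto
    moreover have "sym_perms (Suc ?n) id 0" by unfold_locales (simp_all add: permutes_id)
    ultimately have "lin_perm W s m f 3 ?n (Suc ?n) id 0 0"
      by (intro lin_perm.intro lin_perm_axioms.intro) simp_all
    then show ?thesis using facts by (rule lin_perm.Pop_conclusion_linear)
  next
    case 2
    \<comment> \<open>Negation of the signed numbers, listed in increasing order.\<close>
    define sg :: "nat \<Rightarrow> nat" where "sg x = (if x < 2 * ?n then 2 * ?n - 1 - x else x)" for x
    obtain f where "linear_coxeter W s m f 4 ?n" using linear_type_coxeter[OF assms(1) 2(2)] by auto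
    moreover have "sym_perms (2 * ?n) sg 1"
    proof
      show "sg permutes {..<2 * ?n}"
        unfolding sg_def by (rule bij_imp_permutes[OF perms]) simp
      show "sg x \<noteq> x" if "x < 2 * ?n" for x
      proof
        assume "sg x = x"
        then have "2 * ?n = Suc (2 * x)" using that by (simp add: sg_def)
        then show False by presburger
      qed
    qed (auto simp: sg_def)
    ultimately have "lin_perm W s m f 4 ?n (2 * ?n) sg 1 (?n - 1)"
      using 2(1) by (intro lin_perm.intro lin_perm_axioms.intro) (simp_all add: sg_def)
    then show ?thesis using facts by (rule lin_perm.Pop_conclusion_linear)
  next
    case 3
    obtain f where "linear_coxeter W s m f 5 ?n" using linear_type_coxeter[OF assms(1) 3(2)] by auto
    then have "h3_coxeter W s m f" unfolding 3(1) by (rule h3_coxeter.intro)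
    then show ?thesis using facts by (rule h3_coxeter.Pop_conclusion_H3)
  next
    case 4
    obtain f where "linear_coxeter W s m f k ?n" using linear_type_coxeter[OF assms(1) 4(3,1)] by blast
    then show ?thesis using 4(2) facts by (rule linear_coxeter.Pop_conclusion_dihedral)
  qed
qed

end
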